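(* Let $Q$ be an $n\times n$ symmetric integer matrix, $p$ an odd prime, $k$ a positive integer and $t$ an element of $\mathbb{Z}/p^k\mathbb{Z}$. Then there is a polynomial time Las Vegas algorithm that performs $O(n^{1+\omega}\log k+nk^3+n\log p)$ ring operations over $\mathbb{Z}/p^k\mathbb{Z}$ and fails with probability at most $1/3$; otherwise it outputs a uniform (respectively: uniform primitive; uniform non-primitive) $p^k$-representation of $t$ by $Q$, if such a representation exists.
   Context: A $p^k$-representation of $t$ by $Q$ is a vector $x\in(\mathbb{Z}/p^k\mathbb{Z})^n$ with $x^{T}Qx\equiv t \pmod{p^k}$. A vector $v\in(\mathbb{Z}/p^k\mathbb{Z})^n$ is primitive if some coordinate $v_i$ satisfies $\gcd(v_i,p)=1$, and non-primitive otherwise. A Las Vegas algorithm either fails and outputs nothing, or outputs a correct answer. Complexity is measured in ring operations: additions, multiplications, inversions in $\mathbb{Z}/p^k\mathbb{Z}$, operations on integers, and sampling a uniformly random element of $\mathbb{Z}/p^k\mathbb{Z}$ each count as $O(1)$. $\omega$ is a constant such that multiplying two $n\times n$ matrices over $\mathbb{Z}/p^k\mathbb{Z}$ takes $O(n^\omega)$ ring operations. *)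

theory Defs
  imports
    "HOL-Probability.SPMF"
    "HOL-Number_Theory.Modular_Inverse"
    "HOL-Computational_Algebra.Primes"
    "HOL-Computational_Algebra.Polynomial"
    "HOL-Library.Log_Nat"
    "Jordan_Normal_Form.Matrix"
begin

section \<open>Representations of a residue by a quadratic form\<close>

text \<open>An element of \<open>\<int>/p\<^sup>k\<int>\<close> is given by its residue in \<open>{0..<p^k}\<close>.\<close>

definition representations :: "nat \<Rightarrow> int mat \<Rightarrow> nat \<Rightarrow> nat \<Rightarrow> int \<Rightarrow> int Matrix.vec set" where
  "representations n Q p k t =
    {x \<in> carrier_vec n. (\<forall>i<n. vec_index x i \<in> {0..<int p ^ k}) \<and>
       [scalar_prod x (mult_mat_vec Q x) = t] (mod (int p ^ k))}"

definition primitive :: "nat \<Rightarrow> int Matrix.vec \<Rightarrow> bool" where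
  "primitive p x \<longleftrightarrow> (\<exists>i<dim_vec x. gcd (vec_index x i) (int p) = 1)"

definition primitive_representations ::
    "nat \<Rightarrow> int mat \<Rightarrow> nat \<Rightarrow> nat \<Rightarrow> int \<Rightarrow> int Matrix.vec set" where
  "primitive_representations n Q p k t = {x \<in> representations n Q p k t. primitive p x}"

definition nonprimitive_representations ::
    "nat \<Rightarrow> int mat \<Rightarrow> nat \<Rightarrow> nat \<Rightarrow> int \<Rightarrow> int Matrix.vec set" where
  "nonprimitive_representations n Q p k t = {x \<in> representations n Q p k t. \<not> primitive p x}"


section \<open>Randomized algorithms over \<open>\<int>/m\<int>\<close>\<close>

text \<open>
  An algorithm is one program, the same for all inputs, for a random access machine whose memory
  consists of integer arrays. The modulus \<open>m\<close> enters only through the ring operations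
  \<open>RAdd\<close>, \<open>RMul\<close>, \<open>RInv\<close> and through \<open>Sample\<close>. A scalar variable is cell 0 of an array.
\<close>

type_synonym vname = string
type_synonym store = "vname \<Rightarrow> int \<Rightarrow> int"

datatype binop = Add | Sub | Mul | Div | Mod | Less | RAdd | RMul

datatype expr =
    Lit int
  | Cell vname expr
  | Op binop expr expr
  | RInv expr

datatype com =
    Skip
  | Assign vname expr expr
  | Sample vname expr
  | Seq com com
  | Cond expr com com
  | While expr com

fun apply_op :: "int \<Rightarrow> binop \<Rightarrow> int \<Rightarrow> int \<Rightarrow> int" where
  "apply_op m Add a b = a + b"
| "apply_op m Sub a b = a - b"
| "apply_op m Mul a b = a * b"
| "apply_op m Div a b = a div b"
| "apply_op m Mod a b = a mod b"
| "apply_op m Less a b = (if a < b then 1 else 0)"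
| "apply_op m RAdd a b = (a + b) mod m"
| "apply_op m RMul a b = (a * b) mod m"

primrec eval :: "int \<Rightarrow> store \<Rightarrow> expr \<Rightarrow> int" where
  "eval m s (Lit c) = c"
| "eval m s (Cell a e) = s a (eval m s e)"
| "eval m s (Op f e1 e2) = apply_op m f (eval m s e1) (eval m s e2)"
| "eval m s (RInv e) = modular_inverse m (eval m s e)"

text \<open>
  Two costs are recorded: the number of operations (unit cost), and the total bit length of all
  integers, addresses included, on which the operations act (logarithmic cost). No operation
  increases the bit length more than linearly and each is computable in time polynomial in the bit
  length of its operands and of \<open>m\<close>, so polynomial logarithmic cost is polynomial running time.
\<close>

definition bit_size :: "int \<Rightarrow> nat" where
  "bit_size a = 1 + nat (bitlen \<bar>a\<bar>)"

primrec ops :: "expr \<Rightarrow> nat" where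
  "ops (Lit c) = 1"
| "ops (Cell a e) = ops e + 1"
| "ops (Op f e1 e2) = ops e1 + ops e2 + 1"
| "ops (RInv e) = ops e + 1"

primrec bit_cost :: "int \<Rightarrow> store \<Rightarrow> expr \<Rightarrow> nat" where
  "bit_cost m s (Lit c) = bit_size c"
| "bit_cost m s (Cell a e) = bit_cost m s e + bit_size (eval m s (Cell a e))"
| "bit_cost m s (Op f e1 e2) =
    bit_cost m s e1 + bit_cost m s e2 + bit_size (eval m s (Op f e1 e2)) +
    (if f = RAdd \<or> f = RMul then bit_size m else 0)"
| "bit_cost m s (RInv e) = bit_cost m s e + bit_size (eval m s (RInv e)) + bit_size m"

record state =
  mem :: store
  time :: nat
  bits :: nat

definition charge :: "nat \<Rightarrow> nat \<Rightarrow> state \<Rightarrow> state" where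
  "charge u b \<sigma> = \<sigma>\<lparr>time := time \<sigma> + u, bits := bits \<sigma> + b\<rparr>"

definition set_cell :: "vname \<Rightarrow> int \<Rightarrow> int \<Rightarrow> state \<Rightarrow> state" where
  "set_cell a i v \<sigma> = \<sigma>\<lparr>mem := (mem \<sigma>)(a := (mem \<sigma> a)(i := v))\<rparr>"

definition charge_test :: "int \<Rightarrow> expr \<Rightarrow> state \<Rightarrow> state" where
  "charge_test m e \<sigma> = charge (ops e + 1) (bit_cost m (mem \<sigma>) e + 1) \<sigma>"

text \<open>Divergence shows up as missing probability mass.\<close>

partial_function (spmf) while_loop ::
    "int \<Rightarrow> expr \<Rightarrow> (state \<Rightarrow> state spmf) \<Rightarrow> state \<Rightarrow> state spmf" where
  "while_loop m e body \<sigma> =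
    (if eval m (mem \<sigma>) e \<noteq> 0
     then bind_spmf (body (charge_test m e \<sigma>)) (while_loop m e body)
     else return_spmf (charge_test m e \<sigma>))"

primrec exec :: "int \<Rightarrow> com \<Rightarrow> state \<Rightarrow> state spmf" where
  "exec m Skip \<sigma> = return_spmf (charge 1 1 \<sigma>)"
| "exec m (Assign a i e) \<sigma> =
    return_spmf
      (charge (ops i + ops e + 1) (bit_cost m (mem \<sigma>) i + bit_cost m (mem \<sigma>) e + 1)
        (set_cell a (eval m (mem \<sigma>) i) (eval m (mem \<sigma>) e) \<sigma>))"
| "exec m (Sample a i) \<sigma> =
    map_spmf
      (\<lambda>v. charge (ops i + 1) (bit_cost m (mem \<sigma>) i + bit_size m)
        (set_cell a (eval m (mem \<sigma>) i) v \<sigma>))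
      (spmf_of_set {0..<m})"
| "exec m (Seq c1 c2) \<sigma> = bind_spmf (exec m c1 \<sigma>) (exec m c2)"
| "exec m (Cond e c1 c2) \<sigma> =
    (if eval m (mem \<sigma>) e \<noteq> 0 then exec m c1 (charge_test m e \<sigma>)
     else exec m c2 (charge_test m e \<sigma>))"
| "exec m (While e c) \<sigma> = while_loop m e (exec m c) \<sigma>"

definition start :: "store \<Rightarrow> state" where
  "start s = \<lparr>mem = s, time = 0, bits = 0\<rparr>"

definition scalar_cells :: "int \<Rightarrow> int \<Rightarrow> int" where
  "scalar_cells v = (\<lambda>i. if i = 0 then v else 0)"

definition matrix_cells :: "nat \<Rightarrow> int mat \<Rightarrow> int \<Rightarrow> int" where
  "matrix_cells n A =
    (\<lambda>l. if 0 \<le> l \<and> l < int (n * n) then index_mat A (nat l div n, nat l mod n) else 0)"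


section \<open>The exponent of matrix multiplication\<close>

definition matmul_input :: "nat \<Rightarrow> nat \<Rightarrow> nat \<Rightarrow> int mat \<Rightarrow> int mat \<Rightarrow> store" where
  "matmul_input n p k A B = (\<lambda>_ _. 0)
    (''n'' := scalar_cells (int n), ''p'' := scalar_cells (int p), ''k'' := scalar_cells (int k),
     ''A'' := matrix_cells n A, ''B'' := matrix_cells n B)"

definition matmul_exponent :: "real \<Rightarrow> bool" where
  "matmul_exponent \<omega> \<longleftrightarrow> (\<exists>c. \<exists>C::real. \<forall>n p k A B.
     n \<ge> 1 \<longrightarrow> prime p \<longrightarrow> odd p \<longrightarrow> k \<ge> 1 \<longrightarrow>
     A \<in> carrier_mat n n \<longrightarrow> elements_mat A \<subseteq> {0..<int p ^ k} \<longrightarrow>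
     B \<in> carrier_mat n n \<longrightarrow> elements_mat B \<subseteq> {0..<int p ^ k} \<longrightarrow>
     (let D = exec (int p ^ k) c (start (matmul_input n p k A B)) in
       lossless_spmf D \<and>
       (\<forall>\<sigma>\<in>set_spmf D.
          real (time \<sigma>) \<le> C * real n powr \<omega> \<and>
          (\<forall>i<n. \<forall>j<n.
             mem \<sigma> ''C'' (int (i * n + j)) = index_mat (A * B) (i, j) mod (int p ^ k)))))"


section \<open>Las Vegas sampling\<close>

datatype outcome = Failure | No_Representation | Representation "int Matrix.vec"

definition outcome :: "nat \<Rightarrow> state \<Rightarrow> outcome" where
  "outcome n \<sigma> =
    (if mem \<sigma> ''status'' 0 = 1 then Representation (Matrix.vec n (\<lambda>i. mem \<sigma> ''x'' (int i)))
     else if mem \<sigma> ''status'' 0 = 2 then No_Representation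
     else Failure)"

definition sampler_input :: "nat \<Rightarrow> int mat \<Rightarrow> nat \<Rightarrow> nat \<Rightarrow> int \<Rightarrow> store" where
  "sampler_input n Q p k t = (\<lambda>_ _. 0)
    (''n'' := scalar_cells (int n), ''p'' := scalar_cells (int p), ''k'' := scalar_cells (int k),
     ''t'' := scalar_cells t, ''Q'' := matrix_cells n Q)"

text \<open>The modulus is an input of bit length of order \<open>k log p\<close>.\<close>

definition input_size :: "nat \<Rightarrow> int mat \<Rightarrow> nat \<Rightarrow> nat \<Rightarrow> int \<Rightarrow> nat" where
  "input_size n Q p k t =
    (\<Sum>i<n. \<Sum>j<n. bit_size (index_mat Q (i, j))) + k * bit_size (int p) + bit_size t"

text \<open>Since \<open>log k\<close> vanishes for \<open>k = 1\<close>, the asymptotic factor is read as \<open>log (k + 1)\<close>.\<close>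

definition ring_op_bound :: "real \<Rightarrow> nat \<Rightarrow> nat \<Rightarrow> nat \<Rightarrow> real" where
  "ring_op_bound \<omega> n p k =
    real n powr (1 + \<omega>) * log 2 (real k + 1) + real n * real k ^ 3 + real n * log 2 (real p)"

text \<open>
  \<open>D\<close> is conditioned on not failing; it is then uniform on \<open>R\<close>, or reports correctly that \<open>R\<close> is
  empty. In particular a vector outside \<open>R\<close> is never output.
\<close>

definition las_vegas_uniform :: "int Matrix.vec set \<Rightarrow> outcome spmf \<Rightarrow> bool" where
  "las_vegas_uniform R D \<longleftrightarrow>
     lossless_spmf D \<and> spmf D Failure \<le> 1 / 3 \<and>
     cond_spmf D (- {Failure}) =
       (if R = {} then return_spmf No_Representation else map_spmf Representation (spmf_of_set R))"

definition sampling_algorithm ::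
    "real \<Rightarrow> (nat \<Rightarrow> int mat \<Rightarrow> nat \<Rightarrow> nat \<Rightarrow> int \<Rightarrow> int Matrix.vec set) \<Rightarrow> com \<Rightarrow> bool" where
  "sampling_algorithm \<omega> reps c \<longleftrightarrow> (\<exists>C::real. \<exists>P::nat poly. \<forall>n Q p k t.
     n \<ge> 1 \<longrightarrow> Q \<in> carrier_mat n n \<longrightarrow> transpose_mat Q = Q \<longrightarrow>
     prime p \<longrightarrow> odd p \<longrightarrow> k \<ge> 1 \<longrightarrow> t \<in> {0..<int p ^ k} \<longrightarrow>
     (let D = exec (int p ^ k) c (start (sampler_input n Q p k t)) in
       (\<forall>\<sigma>\<in>set_spmf D.
          real (time \<sigma>) \<le> C * ring_op_bound \<omega> n p k \<and>
          bits \<sigma> \<le> poly P (input_size n Q p k t)) \<and>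
       las_vegas_uniform (reps n Q p k t) (map_spmf (outcome n) D)))"

end

(* Only matrices over Z/p^k of bounded size are manipulated, and matmul_exponent w forces w >= 2, since
   all n^2 entries of a product have to be written; so O(n^3 + n k^3 + n log p) operations are affordable.
   Over Z/p^k an odd form is diagonalised by column operations to sum_i p^(e_i) u_i y_i^2 with units u_i.
   A solution y is classified by the last index J whose term has least valuation d, and by v = val(y_J).
   In a class the other coordinates are free multiples of known powers of p, and y_J solves
   z^2 = r (mod p^(k-d)), two roots or none according to the quadratic character of r. A class that is
   not empty has a positive proportion of free coordinates with r a nonzero square; so choosing the class
   with weight (number of choices), the free coordinates and the root at random and rejecting when r is
   not a square gives the uniform distribution. Square roots come from (a + X)^((p-1)/2) mod X^2 - r with
   random a, which succeeds for a number of a that does not depend on r, and Newton iteration. All the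
   randomness is sampled first into one integer Z, uniform on [0, m^K) with m = p^k; each of 200 attempts
   reads one digit of Z in base m^(2n+4). *)
theory Submission
  imports Defs "HOL-Number_Theory.Number_Theory" "HOL-Library.FuncSet"
begin

text \<open>The budget n log p pays for only O(n) exponentiations modulo p, while there are about nk
  classes. Whether a class is nonempty must therefore be decided from a constant number of quadratic
  characters per index J. Taking J as the last index of least valuation makes this possible: the
  exponents increase with the index, so the coordinates that influence r modulo p are those below J
  whose exponent has the parity of that of J, a set independent of v. The number t enters only
  through whether p^(d+1) divides it and, if not, through t / p^d, for which only one d comes into
  question. Uniformity has to be exact, so probabilities are treated as cardinalities: after the
  draw everything is a function of Z, and all solutions have equally many preimages. In a nonempty
  class at least 2/27 of the digit vectors are good, at least 1/5 of the a yield a root, and cutting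
  the range of an attempt down to a multiple of the total weight loses at most half. This leaves a
  share of 1/135 for success, and (134/135)^200 < 1/3.\<close>

section \<open>Lower bound for the exponent of matrix multiplication\<close>

definition write_bound :: "vname => state => state => bool" where
 "write_bound a sg sg' \<longleftrightarrow>
   finite {i. mem sg' a i ~= mem sg a i} &
   card {i. mem sg' a i ~= mem sg a i} + time sg <= time sg'"

lemma write_bound_trans:
 assumes "write_bound a sg sg'" "write_bound a sg' sg''"
 shows "write_bound a sg sg''"
proof -
 let ?D = "%rh rh'. {i. mem rh' a i ~= mem rh a i}"
 have sub: "?D sg sg'' \<subseteq> ?D sg sg' \<union> ?D sg' sg''" by auto
 have fin: "finite (?D sg sg' \<union> ?D sg' sg'')"
  using assms by (auto simp: write_bound_def)
 have "card (?D sg sg'') <= card (?D sg sg') + card (?D sg' sg'')"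
  using card_mono[OF fin sub] card_Un_le order_trans by blast
 with assms finite_subset[OF sub fin] show ?thesis
  unfolding write_bound_def by linarith
qed

lemma write_bound_charge [simp]: "write_bound a sg (charge u b sg)"
 by (simp add: write_bound_def charge_def)

lemma write_bound_charge_test [simp]: "write_bound a sg (charge_test m e sg)"
 by (simp add: charge_test_def)

lemma write_bound_testD: "write_bound a (charge_test m e sg) rh ==> write_bound a sg rh"
 by (rule write_bound_trans[OF write_bound_charge_test])

lemma write_bound_set_cell:
 assumes "u \<ge> 1"
 shows "write_bound a sg (charge u b (set_cell x i v sg))"
proof -
 let ?D = "{j. mem (charge u b (set_cell x i v sg)) a j ~= mem sg a j}"
 have sub: "?D \<subseteq> {i}"
  by (auto simp: charge_def set_cell_def)
 then have "finite ?D" by (rule finite_subset) simp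
 moreover have "card ?D <= 1" using card_mono[OF _ sub] by simp
 ultimately show ?thesis using assms
  by (auto simp: write_bound_def charge_def set_cell_def)
qed

lemma while_loop_write_bound:
 assumes "!!sg sg'. sg' \<in> set_spmf (body sg) ==> write_bound a sg sg'"
 shows "\<forall>sg'\<in>set_spmf (while_loop m e body sg). write_bound a sg sg'"
 using assms
proof -
 have "ALL sg. \<forall>sg'\<in>set_spmf (while_loop m e body sg). write_bound a sg sg'"
  using assms
 proof (induction rule: while_loop.fixp_induct)
  case (3 f)
  show ?case
  proof (intro allI ballI)
   fix sg sg'
   assume *: "sg' \<in> set_spmf (if Defs.eval m (mem sg) e ~= 0
    then bind_spmf (body (charge_test m e sg)) (f m e body)
    else return_spmf (charge_test m e sg))"
   show "write_bound a sg sg'"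
   proof (cases "Defs.eval m (mem sg) e = 0")
    case False
    with * obtain rh where "rh \<in> set_spmf (body (charge_test m e sg))" "sg' \<in> set_spmf (f m e body rh)"
     by (auto simp: set_bind_spmf)
    then have "write_bound a (charge_test m e sg) rh" "write_bound a rh sg'"
     using "3.prems" "3.IH" by simp_all
    then show ?thesis
     by (blast intro: write_bound_testD write_bound_trans)
   qed (use * in simp)
  qed
 qed simp_all
 then show ?thesis by blast
qed

text \<open>A step changes at most one cell and is charged at least one unit, and both quantities
  add up along an execution.\<close>

lemma exec_write_bound:
 "sg' \<in> set_spmf (exec m c sg) ==> write_bound a sg sg'"
proof (induction c arbitrary: sg sg')
 case (Seq c1 c2)
 then show ?case by (auto simp: set_bind_spmf intro: write_bound_trans[OF Seq.IH(1) Seq.IH(2)])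
next
 case (Cond e c1 c2)
 then show ?case
  by (auto split: if_splits dest!: Cond.IH intro!: write_bound_testD[of a m e sg])
next
 case (While e c)
 then show ?case using while_loop_write_bound[of "exec m c" a m e sg] by auto
qed (auto simp: write_bound_set_cell)

lemma set_spmf_empty_lossless: "lossless_spmf p ==> EX x. x \<in> set_spmf p"
 by (metis ex_in_conv lossless_spmf_def measure_spmf_zero_iff inf_bot_left weight_spmf_def zero_neq_one)

lemma matmul_exponent_ge_2:
 assumes "matmul_exponent \<omega>"
 shows "\<omega> \<ge> 2"
proof (rule ccontr)
 assume "~ \<omega> \<ge> 2"
 obtain c C where cC: "!!n p k A B.
   n \<ge> 1 ==> prime p ==> odd p ==> k \<ge> 1 ==>
   A \<in> carrier_mat n n ==> elements_mat A \<subseteq> {0..<int p ^ k} ==>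
   B \<in> carrier_mat n n ==> elements_mat B \<subseteq> {0..<int p ^ k} ==>
   (let D = exec (int p ^ k) c (start (matmul_input n p k A B)) in
    lossless_spmf D &
    (\<forall>sg\<in>set_spmf D.
     real (time sg) <= C * real n powr \<omega> &
     (ALL i<n. ALL j<n.
       mem sg ''C'' (int (i * n + j)) = index_mat (A * B) (i, j) mod (int p ^ k))))"
  using assms unfolding matmul_exponent_def by blast
 \<comment> \<open>The all-ones matrix squared has all entries n. With p = 3 and k = n the modulus
   3^n exceeds n, so these entries stay nonzero, whereas the array \<open>C\<close> starts as zero:
   all n^2 cells must be changed.\<close>
 have quad: "real n ^ 2 <= C * real n powr \<omega>" if n: "n \<ge> 1" for n
 proof -
  define A where "A = Matrix.mat n n (%_. 1::int)"
  define m where "m = int 3 ^ n"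
  have "(n::nat) < 2 ^ n" by (rule less_exp)
  also have "(2::nat) ^ n <= 3 ^ n" by (rule power_mono) auto
  finally have nm: "int n < m" unfolding m_def by (metis of_nat_less_iff of_nat_power)
  then have m1: "m > 1" using n by linarith
  have el: "elements_mat A \<subseteq> {0..<m}" using m1
   by (auto simp: A_def elements_mat_def)
  let ?D = "exec m c (start (matmul_input n 3 n A A))"
  have *: "lossless_spmf ?D &
    (\<forall>sg\<in>set_spmf ?D.
     real (time sg) <= C * real n powr \<omega> &
     (ALL i<n. ALL j<n. mem sg ''C'' (int (i * n + j)) = index_mat (A * A) (i, j) mod m))"
   using cC[of n 3 n A A] n el unfolding m_def Let_def by (simp add: A_def)
  then obtain sg where sg: "sg \<in> set_spmf ?D"
   using set_spmf_empty_lossless by blast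
  have entry: "mem sg ''C'' (int (i * n + j)) = int n" if "i < n" "j < n" for i j
  proof -
   have "index_mat (A * A) (i, j) = int n"
    using that by (simp add: A_def scalar_prod_def)
   then show ?thesis using * sg that nm by simp
  qed
  have "write_bound ''C'' (start (matmul_input n 3 n A A)) sg"
   using exec_write_bound[OF sg] .
  moreover have "mem (start (matmul_input n 3 n A A)) ''C'' i = 0" for i
   by (simp add: start_def matmul_input_def)
  ultimately have wb: "finite {i. mem sg ''C'' i ~= 0}" "card {i. mem sg ''C'' i ~= 0} <= time sg"
   by (auto simp: write_bound_def start_def)
  have "int ` {..<n * n} \<subseteq> {i. mem sg ''C'' i ~= 0}"
  proof clarsimp
   fix l assume l: "l < n * n" and z: "mem sg ''C'' (int l) = 0"
   have "l div n < n" "l mod n < n" "l = l div n * n + l mod n"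
    using l n by (auto simp: less_mult_imp_div_less)
   then show False using entry[of "l div n" "l mod n"] z n by simp
  qed
  then have "card (int ` {..<n * n}) <= time sg"
   using wb card_mono by (meson order_trans)
  then have "n * n <= time sg" by (simp add: card_image)
  then have "real n ^ 2 <= real (time sg)"
   by (metis of_nat_le_iff of_nat_mult power2_eq_square)
  moreover have "real (time sg) <= C * real n powr \<omega>" using * sg by blast
  ultimately show ?thesis by linarith
 qed
 define d where "d = 2 - \<omega>"
 have d: "d > 0" using \<open>~ \<omega> \<ge> 2\<close> by (simp add: d_def)
 \<comment> \<open>Chosen so large that n^(2 - \<omega>) is at least |C| + 1.\<close>
 define n where "n = Suc (nat \<lceil>(\<bar>C\<bar> + 1) powr (1 / d)\<rceil>)"
 have "(\<bar>C\<bar> + 1) powr (1 / d) <= real n" unfolding n_def by linarith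
 then have "((\<bar>C\<bar> + 1) powr (1 / d)) powr d <= real n powr d"
  using d by (intro powr_mono2) auto
 moreover have "((\<bar>C\<bar> + 1) powr (1 / d)) powr d = \<bar>C\<bar> + 1"
  using d by (simp add: powr_powr)
 ultimately have n: "n \<ge> 1" "real n powr (2 - \<omega>) > C"
  by (auto simp: n_def d_def)
 have "C * real n powr \<omega> < real n powr (2 - \<omega>) * real n powr \<omega>"
  using n by (intro mult_strict_right_mono) auto
 also have "... = real n ^ 2" using n by (simp flip: powr_add)
 finally have lt: "C * real n powr \<omega> < real n ^ 2" .
 show False by (rule notE[OF leD[OF quad[OF n(1)]] lt])
qed

section \<open>A deterministic loop language, its compilation and its two costs\<close>

datatype pcom =
  PSkip
 | PAsg vname expr expr
 | PSeq pcom pcom (infixr ";;" 60)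
 | PIf expr pcom pcom
 | PFor vname vname pcom

definition upd :: "vname => int => int => store => store" where
 "upd a i v s = s(a := (s a)(i := v))"

lemma upd_apply: "upd a i v s b j = (if b = a & j = i then v else s b j)"
 by (simp add: upd_def)

lemma upd_other: "b ~= a ==> upd a i v s b = s b"
 by (simp add: upd_def)

abbreviation V :: "vname => expr" where
 "V a == Cell a (Lit 0)"

text \<open>The bound \<open>N\<close> is read once on entry, while the compiled
  \<open>While\<close> reads it at every test. The two agree for well-formed programs, whose loop
  bodies change neither the bound nor the counter. In return every program is a total function on
  stores.\<close>

primrec run :: "int => pcom => store => store" where
 "run m PSkip s = s"
| "run m (PAsg a i e) s = upd a (Defs.eval m s i) (Defs.eval m s e) s"
| "run m (c1 ;; c2) s = run m c2 (run m c1 s)"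
| "run m (PIf e c1 c2) s = (if Defs.eval m s e ~= 0 then run m c1 s else run m c2 s)"
| "run m (PFor i N b) s =
  ((%s. upd i 0 (s i 0 + 1) (run m b s)) ^^ nat (s N 0)) (upd i 0 0 s)"

primrec compile :: "pcom => com" where
 "compile PSkip = Skip"
| "compile (PAsg a i e) = Assign a i e"
| "compile (c1 ;; c2) = Seq (compile c1) (compile c2)"
| "compile (PIf e c1 c2) = Cond e (compile c1) (compile c2)"
| "compile (PFor i N b) =
  Seq (Assign i (Lit 0) (Lit 0))
   (While (Op Less (V i) (V N)) (Seq (compile b) (Assign i (Lit 0) (Op Add (V i) (Lit 1)))))"

primrec mods :: "pcom => vname set" where
 "mods PSkip = {}"
| "mods (PAsg a i e) = {a}"
| "mods (c1 ;; c2) = mods c1 \<union> mods c2"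
| "mods (PIf e c1 c2) = mods c1 \<union> mods c2"
| "mods (PFor i N b) = insert i (mods b)"

lemmas upd_simps = upd_apply upd_other

lemma run_frame: "a ~: mods c ==> run m c s a = s a"
proof (induction c arbitrary: s)
 case (PFor i N b)
 have "((%s. upd i 0 (s i 0 + 1) (run m b s)) ^^ r) t a = t a" for r t
  using PFor by (induction r) (auto simp: upd_simps)
 with PFor.prems show ?case by (simp add: upd_simps)
qed (auto simp: upd_simps)

lemma run_For_induct:
 assumes "i ~: mods b"
  and "I 0 (upd i 0 0 s)"
  and step: "!!j t. j < nat (s N 0) ==> I j t ==> t i 0 = int j ==> I (Suc j) (upd i 0 (int j + 1) (run m b t))"
 shows "I (nat (s N 0)) (run m (PFor i N b) s)"
proof -
 define f where "f = (%s. upd i 0 (s i 0 + 1) (run m b s))"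
 have "I r ((f ^^ r) (upd i 0 0 s)) & ((f ^^ r) (upd i 0 0 s)) i 0 = int r" if "r <= nat (s N 0)" for r
  using that
 proof (induction r)
  case 0
  show ?case unfolding funpow_0 using assms(2) by (intro conjI) (assumption | simp add: upd_apply)+
 next
  case (Suc r)
  have "I r ((f ^^ r) (upd i 0 0 s))" "((f ^^ r) (upd i 0 0 s)) i 0 = int r" "r < nat (s N 0)"
   using Suc by simp_all
  with step[OF this(3,1,2)] show ?case
   by (simp add: f_def) (simp add: upd_apply)
 qed
 then show ?thesis by (simp add: f_def)
qed

text \<open>The names in \<open>read_only\<close> hold loop bounds and the cap \<open>BIG\<close>; reducing modulo \<open>BIG\<close> is how an
 assignment keeps its value short.\<close>

definition read_only :: "vname set" where
 "read_only = {''n'', ''k'', ''p'', ''t'', ''lg'', ''nk'', ''cl'', ''l1'', ''T'', ''m'', ''BIG''}"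

text \<open>Accepts expressions whose value respects every bound \<open>2 ^ bt\<close>, bt at least
  4, that holds for the cells and the modulus: literals below 2^4, ring results, truth values,
  quotients and remainders of short values, anything reduced modulo \<open>BIG\<close>. Plain sums,
  differences and products may break the bound and have to be reduced first.\<close>

fun short :: "expr => bool" where
 "short (Lit c) = (\<bar>c\<bar> <= 9)"
| "short (Cell a e) = True"
| "short (RInv e) = True"
| "short (Op Less a b) = True"
| "short (Op RAdd a b) = True"
| "short (Op RMul a b) = True"
| "short (Op Div a b) = short a"
| "short (Op binop.Mod a b) = (short a & short b | b = V ''BIG'')"
| "short (Op f a b) = False"

primrec small_lits :: "expr => bool" where
 "small_lits (Lit c) = (\<bar>c\<bar> <= 9)"
| "small_lits (Cell a e) = small_lits e"
| "small_lits (Op f a b) = (small_lits a & small_lits b)"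
| "small_lits (RInv e) = small_lits e"

primrec wf :: "pcom => bool" where
 "wf PSkip = True"
| "wf (PAsg a i e) = (a ~: read_only & short e & small_lits i & small_lits e & ops i + ops e <= 150)"
| "wf (c1 ;; c2) = (wf c1 & wf c2)"
| "wf (PIf e c1 c2) = (small_lits e & ops e <= 150 & wf c1 & wf c2)"
| "wf (PFor i N b) = (i ~: read_only & N \<in> read_only & i ~: mods b & wf b)"

text \<open>In a loop, 9 pays for the initial assignment (3) and the last, failing test (6); 12 pays
  for one test (6) and one increment (6). Adding both branches of a conditional keeps the cost
  independent of the store.\<close>

primrec cost :: "(vname => nat) => pcom => nat" where
 "cost nu PSkip = 1"
| "cost nu (PAsg a i e) = ops i + ops e + 1"
| "cost nu (c1 ;; c2) = cost nu c1 + cost nu c2"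
| "cost nu (PIf e c1 c2) = ops e + 1 + cost nu c1 + cost nu c2"
| "cost nu (PFor i N b) = 9 + nu N * (cost nu b + 12)"

lemma wf_mods: "wf c ==> mods c \<inter> read_only = {}"
 by (induction c) auto

definition bounded :: "nat => store => bool" where
 "bounded bt s \<longleftrightarrow> (ALL a i. \<bar>s a i\<bar> <= 2 ^ bt) & s ''BIG'' 0 > 0"

lemma bit_size_le:
 assumes "\<bar>x\<bar> <= 2 ^ q"
 shows "bit_size x <= q + 2"
proof -
 have "\<bar>x\<bar> < 2 ^ nat (int q + 1)" using assms
  by (simp add: nat_add_distrib) (metis le_less_trans mult_2 less_add_same_cancel1 zero_less_numeral zero_less_power)
 then have "bitlen \<bar>x\<bar> <= int q + 1"
  by (subst bitlen_le_iff_power) auto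
 then show ?thesis unfolding bit_size_def by linarith
qed

lemma abs_div_le: "\<bar>a div b\<bar> <= \<bar>a\<bar>" for a b :: int
proof -
 have pos: "\<bar>a div b\<bar> <= \<bar>a\<bar>" if b: "b > 0" for a b :: int
 proof (cases "a \<ge> 0")
  case True
  then have "a div b <= a div 1" using b by (intro zdiv_mono2) auto
  with True show ?thesis using b by (simp add: pos_imp_zdiv_nonneg_iff)
 next
  case False
  then have "a div 1 <= a div b" using b by (intro zdiv_mono2_neg) auto
  moreover have "a div b < 0" using False b by (meson div_neg_pos_less0 not_le)
  ultimately show ?thesis using False by simp
 qed
 consider "b > 0" | "b = 0" | "b < 0" by linarith
 then show ?thesis
 proof cases
  case 3
  then show ?thesis using pos[of "-b" "-a"] by simp
 qed (use pos in auto)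
qed

lemma abs_mod_le: "\<bar>a mod b\<bar> <= max \<bar>a\<bar> \<bar>b\<bar>" for a b :: int
 by (cases "b = 0") (auto simp: abs_mod_less less_imp_le le_max_iff_disj)

text \<open>Exponents add under a product, and a sum needs one bit more; the \<open>bt\<close>
  contributed by the node of the operator itself pays for it. The assumption on \<open>bt\<close>
  also covers the literals.\<close>

lemma abs_eval_le:
 assumes s: "!!a i. \<bar>s a i\<bar> <= 2 ^ bt" and m: "0 < m" "m <= 2 ^ bt" and bt: "bt \<ge> 4"
  and e: "small_lits e"
 shows "\<bar>Defs.eval m s e\<bar> <= 2 ^ (bt * ops e)"
 using e
proof (induction e)
 case (Lit c)
 have "(2::int) ^ 4 <= 2 ^ bt" using bt by (intro power_increasing) auto
 with Lit show ?case by simp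
next
 case (Cell a e)
 have "\<bar>s a (Defs.eval m s e)\<bar> <= 2 ^ bt" by (rule s)
 also have "... <= 2 ^ (bt * ops (Cell a e))" by (intro power_increasing) auto
 finally show ?case by simp
next
 case (RInv e)
 have "\<bar>modular_inverse m (Defs.eval m s e)\<bar> <= m"
  using m modular_inverse_int_nonneg[of m "Defs.eval m s e"] modular_inverse_int_less[of m "Defs.eval m s e"] by linarith
 also have "... <= 2 ^ bt" by (rule m)
 also have "... <= 2 ^ (bt * ops (RInv e))" by (intro power_increasing) auto
 finally show ?case by simp
next
 case (Op f a b)
 let ?x = "Defs.eval m s a" and ?y = "Defs.eval m s b" and ?p = "bt * ops a" and ?q = "bt * ops b"
 have x: "\<bar>?x\<bar> <= 2 ^ ?p" and y: "\<bar>?y\<bar> <= 2 ^ ?q" using Op by auto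
 have le: "?p <= ?p + ?q" "?q <= ?p + ?q" "bt <= bt + ?p + ?q" by auto
 have xy: "\<bar>?x\<bar> <= 2 ^ (?p + ?q)" "\<bar>?y\<bar> <= 2 ^ (?p + ?q)"
  using order_trans[OF x power_increasing[OF le(1), of 2]]
   order_trans[OF y power_increasing[OF le(2), of 2]] by auto
 have two: "2 * 2 ^ (?p + ?q) <= (2::int) ^ (bt * ops (Op f a b))"
  unfolding power_Suc[symmetric] using bt by (intro power_increasing) (auto simp: algebra_simps)
 have mb: "m <= (2::int) ^ (bt * ops (Op f a b))"
  by (rule order_trans[OF m(2)]) (auto intro!: power_increasing simp: algebra_simps)
 have mul: "\<bar>?x * ?y\<bar> <= 2 ^ (?p + ?q)"
  unfolding abs_mult power_add using x y by (intro mult_mono) auto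
 have one: "(1::int) <= 2 ^ (?p + ?q)" by simp
 show ?case
 proof (cases f)
  case Div
  then show ?thesis using abs_div_le[of ?x ?y] xy two one by simp
 next
  case Mod
  then show ?thesis using abs_mod_le[of ?x ?y] xy two one by simp
 next
  case RAdd
  then show ?thesis using mb pos_mod_bound[OF m(1), of "?x + ?y"] pos_mod_sign[OF m(1), of "?x + ?y"]
   by (simp del: ops.simps)
 next
  case RMul
  then show ?thesis using mb pos_mod_bound[OF m(1), of "?x * ?y"] pos_mod_sign[OF m(1), of "?x * ?y"]
   by (simp del: ops.simps)
 qed (use xy two mul one in auto)
qed

lemma bit_cost_le:
 assumes s: "!!a i. \<bar>s a i\<bar> <= 2 ^ bt" and m: "0 < m" "m <= 2 ^ bt" and bt: "bt \<ge> 4"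
  and e: "small_lits e" "ops e <= N"
 shows "bit_cost m s e <= ops e * (bt * N + bt + 4)"
 using e
proof (induction e)
 case (Lit c)
 have "bit_size c <= bt * 1 + 2"
  using bit_size_le[OF abs_eval_le[OF s m bt Lit(1)]] by simp
 then show ?case by (simp add: algebra_simps)
next
 case (Cell a e)
 have "bit_size (s a (Defs.eval m s e)) <= bt + 2" by (rule bit_size_le[OF s])
 with Cell show ?case by simp
next
 case (RInv e)
 have "bit_size (Defs.eval m s (RInv e)) <= bt * N + 2"
  using bit_size_le[OF abs_eval_le[OF s m bt RInv(2)]] RInv(3)
  by (meson add_le_mono1 mult_le_mono2 order_trans)
 moreover have "bit_size m <= bt + 2" using m by (intro bit_size_le) auto
 ultimately show ?case using RInv by simp
next
 case (Op f a b)
 have "bit_size (Defs.eval m s (Op f a b)) <= bt * N + 2"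
  using bit_size_le[OF abs_eval_le[OF s m bt Op(3)]] Op(4)
  by (meson add_le_mono1 mult_le_mono2 order_trans)
 moreover have "bit_size m <= bt + 2" using m by (intro bit_size_le) auto
 moreover have "ops (Op f a b) * (bt * N + bt + 4) = ops a * (bt * N + bt + 4) + ops b * (bt * N + bt + 4) + (bt * N + bt + 4)"
  by (simp add: algebra_simps)
 ultimately show ?case using Op by simp
qed

lemma short_eval_le:
 assumes s: "bounded bt s" and m: "0 < m" "m <= 2 ^ bt" and bt: "bt \<ge> 4" and e: "short e"
 shows "\<bar>Defs.eval m s e\<bar> <= 2 ^ bt"
proof -
 have p16: "(2::int) ^ 4 <= 2 ^ bt" using bt by (intro power_increasing) auto
 have S: "\<bar>s a i\<bar> <= 2 ^ bt" for a i using s by (simp add: bounded_def)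
 have inv: "\<bar>modular_inverse m x\<bar> <= 2 ^ bt" for x
  using m modular_inverse_int_nonneg[of m x] modular_inverse_int_less[of m x] by linarith
 have md: "\<bar>x mod m\<bar> <= 2 ^ bt" for x
  using m pos_mod_bound[of m x] pos_mod_sign[of m x] by linarith
 show ?thesis using e
 proof (induction e rule: short.induct)
  case (7 a b)
  then show ?case using abs_div_le[of "Defs.eval m s a" "Defs.eval m s b"] by simp
 next
  case (8 a b)
  show ?case
  proof (cases "b = V ''BIG''")
   case True
   have "s ''BIG'' 0 > 0" using s by (simp add: bounded_def)
   then have "\<bar>Defs.eval m s a mod s ''BIG'' 0\<bar> <= \<bar>s ''BIG'' 0\<bar>"
    by (simp add: pos_mod_bound less_imp_le)
   then show ?thesis using True S[of "''BIG''" 0] by simp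
  next
   case False
   then show ?thesis using 8 abs_mod_le[of "Defs.eval m s a" "Defs.eval m s b"] by auto
  qed
 qed (use p16 S inv md in auto)
qed

lemma while_loop_unfold:
 "while_loop m e body sg =
  (if Defs.eval m (mem sg) e ~= 0
   then bind_spmf (body (charge_test m e sg)) (while_loop m e body)
   else return_spmf (charge_test m e sg))"
 by (rule while_loop.simps)

lemma mem_charge [simp]: "mem (charge u b sg) = mem sg"
 and time_charge [simp]: "time (charge u b sg) = time sg + u"
 and bits_charge [simp]: "bits (charge u b sg) = bits sg + b"
 by (simp_all add: charge_def)

lemma mem_charge_test [simp]: "mem (charge_test m e sg) = mem sg"
 and time_charge_test [simp]: "time (charge_test m e sg) = time sg + (ops e + 1)"
 and bits_charge_test [simp]: "bits (charge_test m e sg) = bits sg + (bit_cost m (mem sg) e + 1)"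
 by (simp_all add: charge_test_def)

lemma mem_set_cell [simp]: "mem (set_cell a i v sg) = upd a i v (mem sg)"
 unfolding set_cell_def upd_def by simp

lemma time_set_cell [simp]: "time (set_cell a i v sg) = time sg"
 and bits_set_cell [simp]: "bits (set_cell a i v sg) = bits sg"
 by (simp_all add: set_cell_def)

text \<open>One number \<open>T\<close> controls both costs, a unit of time standing for
  \<open>200 * bt\<close> bits: with at most 150 operations per expression, intermediate values have
  about \<open>150 * bt\<close> bits, and \<open>150 * bt + bt + 4 <= 200 * bt\<close>.\<close>

definition exec_to :: "int => nat => com => nat => state => store => bool" where
 "exec_to m bt c T sg s \<longleftrightarrow> (EX sg'. exec m c sg = return_spmf sg' & mem sg' = s & bounded bt s &
   time sg' <= time sg + T & bits sg' <= bits sg + T * (200 * bt))"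

lemma exec_to_mono:
 assumes "exec_to m bt c T sg s" "T <= T'"
 shows "exec_to m bt c T' sg s"
proof -
 have "T * (200 * bt) <= T' * (200 * bt)" using assms(2) by (rule mult_le_mono1)
 moreover obtain sg' where "exec m c sg = return_spmf sg'" "mem sg' = s" "bounded bt s"
   "time sg' <= time sg + T" "bits sg' <= bits sg + T * (200 * bt)"
  using assms(1) by (auto simp: exec_to_def)
 ultimately show ?thesis using assms(2) unfolding exec_to_def
  by - (intro exI[of _ sg'] conjI, (assumption | linarith)+)
qed

lemma exec_to_Seq:
 assumes "exec_to m bt c1 T1 sg s" "!!sg. mem sg = s ==> exec_to m bt c2 T2 sg s'"
 shows "exec_to m bt (Seq c1 c2) (T1 + T2) sg s'"
proof -
 obtain sg1 where 1: "exec m c1 sg = return_spmf sg1" "mem sg1 = s"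
   "time sg1 <= time sg + T1" "bits sg1 <= bits sg + T1 * (200 * bt)"
  using assms(1) by (auto simp: exec_to_def)
 obtain sg2 where 2: "exec m c2 sg1 = return_spmf sg2" "mem sg2 = s'" "bounded bt s'"
   "time sg2 <= time sg1 + T2" "bits sg2 <= bits sg1 + T2 * (200 * bt)"
  using assms(2)[OF 1(2)] by (auto simp: exec_to_def)
 show ?thesis using 1 2 unfolding exec_to_def
  by (intro exI[of _ sg2]) (simp add: algebra_simps)
qed

context
 fixes m :: int and bt :: nat
 assumes m: "0 < m" "m <= 2 ^ bt" and bt: "bt \<ge> 4"
begin

lemma bit_cost_150:
 assumes "bounded bt s" "small_lits e" "ops e <= 150"
 shows "bit_cost m s e <= ops e * (200 * bt)"
proof -
 have "bit_cost m s e <= ops e * (bt * 150 + bt + 4)"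
  using assms m bt by (intro bit_cost_le) (auto simp: bounded_def)
 also have "... <= ops e * (200 * bt)" using bt by (intro mult_left_mono) auto
 finally show ?thesis .
qed

lemma exec_to_Assign:
 assumes s: "bounded bt (mem sg)" and v: "\<bar>Defs.eval m (mem sg) e\<bar> <= 2 ^ bt" and a: "a ~= ''BIG''"
  and e: "small_lits i" "small_lits e" "ops i + ops e <= 150"
 shows "exec_to m bt (Assign a i e) (ops i + ops e + 1) sg (upd a (Defs.eval m (mem sg) i) (Defs.eval m (mem sg) e) (mem sg))"
 using bit_cost_150[OF s e(1)] bit_cost_150[OF s e(2)] e(3) s v a bt
 by (auto simp: exec_to_def algebra_simps bounded_def upd_simps)

text \<open>Result, size bound and costs are proved in one induction, because the cost of a step
  depends on the size of the store left by the steps before it. The limits \<open>nu\<close> concern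
  read-only cells only, so they survive from the start to every inner loop.\<close>

lemma exec_compile:
 assumes "wf c" "bounded bt (mem sg)" "!!N. N \<in> read_only ==> nat (mem sg N 0) <= nu N"
 shows "exec_to m bt (compile c) (cost nu c) sg (run m c (mem sg))"
 using assms
proof (induction c arbitrary: sg)
 case PSkip
 then show ?case using bt by (simp add: exec_to_def)
next
 case (PAsg a i e)
 then have "a ~= ''BIG''" by (auto simp: read_only_def)
 then show ?case using exec_to_Assign[of sg e a i] short_eval_le[OF PAsg.prems(2) m bt] PAsg
  by simp
next
 case (PSeq c1 c2)
 have "mods c1 \<inter> read_only = {}" using PSeq.prems(1) wf_mods by simp
 then have ro: "run m c1 (mem sg) N = mem sg N" if "N \<in> read_only" for N
  using that by (intro run_frame) auto
 have 1: "exec_to m bt (compile c1) (cost nu c1) sg (run m c1 (mem sg))" using PSeq by auto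
 moreover from 1 have "bounded bt (run m c1 (mem sg))" by (auto simp: exec_to_def)
 then have "exec_to m bt (compile c2) (cost nu c2) sg' (run m c2 (run m c1 (mem sg)))"
  if "mem sg' = run m c1 (mem sg)" for sg'
  using PSeq.IH(2)[of sg'] PSeq.prems that ro by simp
 ultimately show ?case by (simp add: exec_to_Seq)
next
 case (PIf e c1 c2)
 let ?sg = "charge_test m e sg"
 define c where "c = (if Defs.eval m (mem sg) e ~= 0 then c1 else c2)"
 have c: "exec_to m bt (compile c) (cost nu c) ?sg (run m c (mem sg))"
  using PIf.IH(1)[of ?sg] PIf.IH(2)[of ?sg] PIf.prems by (auto simp: c_def)
 have ex: "exec m (compile (PIf e c1 c2)) sg = exec m (compile c) ?sg"
  "run m (PIf e c1 c2) (mem sg) = run m c (mem sg)" "cost nu c <= cost nu c1 + cost nu c2"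
  by (auto simp: c_def)
 have "bit_cost m (mem sg) e <= ops e * (200 * bt)"
  using bit_cost_150 PIf.prems by auto
 moreover have "cost nu c * (200 * bt) <= (cost nu c1 + cost nu c2) * (200 * bt)"
  using ex(3) by (rule mult_le_mono1)
 ultimately show ?case using c ex(3) bt unfolding exec_to_def ex
  by (force simp: algebra_simps)
next
 case (PFor i N b)
 define f where "f = (%s. upd i 0 (s i 0 + 1) (run m b s))"
 let ?e = "Op Less (V i) (V N)" and ?b = "Seq (compile b) (Assign i (Lit 0) (Op Add (V i) (Lit 1)))"
 have i: "i ~= ''BIG''" "i ~= N" "i ~: mods b" "i ~: read_only" "N \<in> read_only" and b: "wf b"
  using PFor.prems(1) by (auto simp: read_only_def)
 have ro: "run m b s x = s x" if "x \<in> read_only" for x s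
  using that wf_mods[OF b] by (intro run_frame) auto
 have body: "exec_to m bt ?b (cost nu b + 6) rh (f (mem rh))"
  if "bounded bt (mem rh)" "!!x. x \<in> read_only ==> mem rh x = mem sg x" "mem rh i 0 < mem rh N 0" "mem rh i 0 \<ge> 0" for rh
 proof -
  have 1: "exec_to m bt (compile b) (cost nu b) rh (run m b (mem rh))"
   using PFor.IH[OF b that(1)] that(2) PFor.prems(3) by auto
  then have bd: "bounded bt (run m b (mem rh))" by (auto simp: exec_to_def)
  have ri: "run m b (mem rh) i = mem rh i" using i by (intro run_frame) auto
  have "mem rh N 0 <= 2 ^ bt" using that(1) unfolding bounded_def by (meson abs_le_D1)
  then have v: "\<bar>mem rh i 0 + 1\<bar> <= 2 ^ bt" using that(3,4) by linarith
  have 2: "exec_to m bt (Assign i (Lit 0) (Op Add (V i) (Lit 1))) 6 rh' (f (mem rh))"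
   if rh': "mem rh' = run m b (mem rh)" for rh'
   using exec_to_Assign[of rh' "Op Add (V i) (Lit 1)" i "Lit 0"] bd ri v i(1)
   by (simp add: rh' f_def eval_nat_numeral)
  show ?thesis by (rule exec_to_Seq[OF 1 2])
 qed
 have loop: "exec_to m bt (While ?e ?b) (6 + r * (cost nu b + 12)) rh ((f ^^ r) (mem rh))"
  if "bounded bt (mem rh)" "!!x. x \<in> read_only ==> mem rh x = mem sg x" "mem rh i 0 \<ge> 0"
   "r = nat (mem sg N 0 - mem rh i 0)" for rh r
  using that
 proof (induction r arbitrary: rh)
  case 0
  then have "Defs.eval m (mem rh) ?e = 0" using i by auto
  moreover have "bit_cost m (mem rh) ?e <= 5 * (200 * bt)"
   using bit_cost_150[OF 0(1), of ?e] by simp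
  ultimately show ?case using 0 bt
   by (auto simp: exec_to_def while_loop_unfold[of m ?e])
 next
  case (Suc r)
  let ?rh = "charge_test m ?e rh"
  from Suc.prems have lt: "mem rh i 0 < mem rh N 0" using i by simp
  then have "Defs.eval m (mem rh) ?e ~= 0" by auto
  then have ex: "exec m (While ?e ?b) rh = exec m (Seq ?b (While ?e ?b)) ?rh"
   by (simp add: while_loop_unfold[of m ?e _ rh])
  have bdy: "exec_to m bt ?b (cost nu b + 6) ?rh (f (mem rh))"
   using body[of ?rh] Suc.prems lt by simp
  have fi: "f (mem rh) i 0 = mem rh i 0 + 1" "x \<in> read_only ==> f (mem rh) x = mem rh x" for x
   using i ro by (auto simp: f_def upd_simps)
  have bd: "bounded bt (f (mem rh))" using bdy by (auto simp: exec_to_def)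
  have "exec_to m bt (Seq ?b (While ?e ?b)) (cost nu b + 6 + (6 + r * (cost nu b + 12))) ?rh ((f ^^ r) (f (mem rh)))"
  proof (rule exec_to_Seq[OF bdy])
   fix ta :: state assume ta: "mem ta = f (mem rh)"
   show "exec_to m bt (While ?e ?b) (6 + r * (cost nu b + 12)) ta ((f ^^ r) (f (mem rh)))"
   proof -
    have r: "r = nat (mem sg N 0 - mem ta i 0)" using Suc.prems(4) fi(1) by (simp add: ta)
    show ?thesis using Suc.IH[OF _ _ _ r] Suc.prems fi bd unfolding ta by simp
   qed
  qed
  moreover have "bit_cost m (mem rh) ?e <= 5 * (200 * bt)"
   using bit_cost_150[OF Suc.prems(1), of ?e] by simp
  ultimately show ?case using bt unfolding exec_to_def ex funpow_Suc_right o_def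
   by (force simp: algebra_simps)
 qed
 have i0: "exec_to m bt (Assign i (Lit 0) (Lit 0)) 3 sg (upd i 0 0 (mem sg))"
  using exec_to_Assign[of sg "Lit 0" i "Lit 0"] PFor.prems i by (simp add: eval_nat_numeral)
 then have bd: "bounded bt (upd i 0 0 (mem sg))" by (auto simp: exec_to_def)
 let ?r = "nat (mem sg N 0)"
 have "exec_to m bt (compile (PFor i N b)) (3 + (6 + ?r * (cost nu b + 12))) sg (run m (PFor i N b) (mem sg))"
  unfolding compile.simps run.simps f_def[symmetric]
 proof (rule exec_to_Seq[OF i0])
  fix rh :: state assume rh: "mem rh = upd i 0 0 (mem sg)"
  show "exec_to m bt (While ?e ?b) (6 + ?r * (cost nu b + 12)) rh ((f ^^ ?r) (upd i 0 0 (mem sg)))"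
  proof -
   have "upd i 0 0 (mem sg) x = mem sg x" if "x \<in> read_only" for x
    using that i by (intro upd_other) auto
   then show ?thesis using loop[of rh ?r] bd i unfolding rh by (simp add: upd_apply)
  qed
 qed
 moreover have "?r * (cost nu b + 12) <= nu N * (cost nu b + 12)"
  using PFor.prems(3) i by (intro mult_le_mono1) auto
 then have le: "3 + (6 + ?r * (cost nu b + 12)) <= cost nu (PFor i N b)" by simp
 ultimately show ?case using exec_to_mono by blast
qed

end

section \<open>Squares and nonsquares modulo an odd prime\<close>

locale odd_prime =
 fixes p :: nat
 assumes prime_p: "prime p" and odd_p: "odd p"
begin

abbreviation P :: int where "P == int p"

lemma p_ge_3: "p \<ge> 3"
proof -
 have "p \<ge> 2" by (rule prime_ge_2_nat[OF prime_p])
 moreover have "p ~= 2" using odd_p by auto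
 ultimately show ?thesis by linarith
qed

lemma prime_P: "prime P" using prime_p by simp

lemma P_dvd_mult_iff: "P dvd a * b \<longleftrightarrow> P dvd a | P dvd b"
 using prime_dvd_mult_iff[OF prime_P] .

lemma P_dvd_2_iff [simp]: "~ P dvd 2"
 using p_ge_3 zdvd_imp_le[of P 2] by auto

lemma p_neq_1 [simp]: "p ~= Suc 0" "P ~= 1"
 using p_ge_3 by auto

lemma P_dvd_square [simp]: "P dvd a\<^sup>2 \<longleftrightarrow> P dvd a"
 by (simp add: power2_eq_square P_dvd_mult_iff)

lemma P_dvd_small: "P dvd z ==> \<bar>z\<bar> < P ==> z = 0"
 by (rule ccontr) (use dvd_imp_le_int[of z P] in simp)

lemma unit_inverse: "~ P dvd a ==> EX b. [a * b = 1] (mod P) & ~ P dvd b"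
proof -
 assume "~ P dvd a"
 then have "coprime a P" using prime_imp_coprime[OF prime_P] coprime_commute by blast
 then obtain b where b: "[a * b = 1] (mod P)" using cong_solve_coprime_int by blast
 then have "~ P dvd b" using cong_dvd_iff[OF b] by auto
 with b show ?thesis by blast
qed

lemma cong_square_iff: "[x\<^sup>2 = y\<^sup>2] (mod P) \<longleftrightarrow> [x = y] (mod P) | [x = - y] (mod P)"
proof -
 have "x\<^sup>2 - y\<^sup>2 = (x - y) * (x + y)" by (simp add: power2_eq_square algebra_simps)
 then show ?thesis by (simp add: cong_iff_dvd_diff P_dvd_mult_iff)
qed

definition nzsq :: "int => bool" where
 "nzsq a \<longleftrightarrow> ~ P dvd a & QuadRes P a"

definition nonsq :: "int => bool" where
 "nonsq a \<longleftrightarrow> ~ P dvd a & ~ QuadRes P a"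

abbreviation h :: nat where "h == (p - 1) div 2"

lemma QuadRes_cong: "[a = b] (mod P) ==> QuadRes P a \<longleftrightarrow> QuadRes P b"
 unfolding QuadRes_def by (meson cong_sym cong_trans)

lemma nzsq_cong: "[a = b] (mod P) ==> nzsq a \<longleftrightarrow> nzsq b"
 using QuadRes_cong cong_dvd_iff unfolding nzsq_def by blast

lemma nonsq_cong: "[a = b] (mod P) ==> nonsq a \<longleftrightarrow> nonsq b"
 using QuadRes_cong cong_dvd_iff unfolding nonsq_def by blast

lemma Legendre_eq: "Legendre a P = (if nzsq a then 1 else if nonsq a then -1 else 0)"
 by (auto simp: Legendre_def nzsq_def nonsq_def cong_0_iff)

lemma euler: "[Legendre a P = a ^ h] (mod P)"
 using euler_criterion[OF prime_p] p_ge_3 by simp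

lemma distinct_mod_P: "~ [0 = 1] (mod P)" "~ [0 = - 1] (mod P)" "~ [1 = - 1] (mod P)" "~ [- 1 = 1] (mod P)"
 by (simp_all add: cong_iff_dvd_diff)

lemma nzsq_iff: "nzsq a \<longleftrightarrow> [a ^ h = 1] (mod P)"
 using euler[of a] distinct_mod_P unfolding Legendre_eq cong_def
 by (auto split: if_splits)

lemma nonsq_iff: "nonsq a \<longleftrightarrow> [a ^ h = - 1] (mod P)"
 using euler[of a] distinct_mod_P unfolding Legendre_eq cong_def
 by (auto split: if_splits simp: nzsq_def nonsq_def)

lemma nzsq_square: "~ P dvd a ==> nzsq (a\<^sup>2)"
 by (auto simp: nzsq_def QuadRes_def intro: exI[of _ a])

lemma nzsq_mult: "nzsq a ==> nzsq (a * b) \<longleftrightarrow> nzsq b"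
 unfolding nzsq_iff power_mult_distrib
 unfolding cong_def by (metis mod_mult_left_eq mult_1)

lemma nonsq_mult_nzsq: "nzsq a ==> nonsq (a * b) \<longleftrightarrow> nonsq b"
 unfolding nzsq_iff nonsq_iff power_mult_distrib
 unfolding cong_def by (metis mod_mult_left_eq mult_1)

lemma nonsq_mult: "nonsq a ==> nzsq (a * b) \<longleftrightarrow> nonsq b"
proof -
 assume "nonsq a"
 then have "[a ^ h * b ^ h = (-1) * b ^ h] (mod P)"
  unfolding nonsq_iff by (rule cong_scalar_right)
 then have "[(a * b) ^ h = - (b ^ h)] (mod P)"
  unfolding power_mult_distrib by simp
 then have "nzsq (a * b) \<longleftrightarrow> [- (b ^ h) = 1] (mod P)"
  unfolding nzsq_iff cong_def by simp
 also have "... \<longleftrightarrow> P dvd - (b ^ h - - 1)"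
  by (simp add: cong_iff_dvd_diff)
 also have "... \<longleftrightarrow> nonsq b"
  unfolding nonsq_iff cong_iff_dvd_diff dvd_minus_iff ..
 finally show ?thesis .
qed

abbreviation F :: "int set" where "F == {0..<P}"

lemma mod_in_F [simp]: "x mod P \<in> F"
 using p_ge_3 by auto

lemma finite_F [simp]: "finite {x. 0 <= x & x < P & Q x}"
 by (rule finite_subset[of _ F]) auto

lemma F_cong_eq: "x \<in> F ==> y \<in> F ==> [x = y] (mod P) \<longleftrightarrow> x = y"
 by (auto simp: cong_def)

lemma card_roots_le_2: "card {x \<in> F. [x\<^sup>2 = a] (mod P)} <= 2"
proof (cases "{x \<in> F. [x\<^sup>2 = a] (mod P)} = {}")
 case True
 show ?thesis unfolding True by simp
next
 case False
 then obtain s where s: "s \<in> F" "[s\<^sup>2 = a] (mod P)" by blast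
 have "{x \<in> F. [x\<^sup>2 = a] (mod P)} \<subseteq> {s, (- s) mod P}"
 proof
  fix x assume x: "x \<in> {x \<in> F. [x\<^sup>2 = a] (mod P)}"
  then have "[x\<^sup>2 = s\<^sup>2] (mod P)" using s by (auto intro: cong_trans cong_sym)
  then have "[x = s] (mod P) | [x = - s] (mod P)" by (simp add: cong_square_iff)
  moreover have "x mod P = x" "s mod P = s" using x s by auto
  ultimately show "x \<in> {s, (- s) mod P}" unfolding cong_def by auto
 qed
 then have "card {x \<in> F. [x\<^sup>2 = a] (mod P)} <= card {s, (- s) mod P}"
  by (rule card_mono[rotated]) simp
 also have "... <= 2" by (simp add: card_insert_if)
 finally show ?thesis .
qed

lemma card_roots_le:
 "card {x \<in> F. [x\<^sup>2 = a] (mod P)} <= (if nzsq a then 2 else if P dvd a then 1 else 0)"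
proof -
 have none: "{x \<in> F. [x\<^sup>2 = a] (mod P)} = {}" if "~ nzsq a" "~ P dvd a"
  using that by (auto simp: nzsq_def QuadRes_def)
 have zero: "{x \<in> F. [x\<^sup>2 = a] (mod P)} \<subseteq> {0}" if "P dvd a"
 proof
  fix x assume x: "x \<in> {x \<in> F. [x\<^sup>2 = a] (mod P)}"
  then have "P dvd x\<^sup>2" using that cong_dvd_iff by blast
  with x show "x \<in> {0}" using F_cong_eq[of x 0] p_ge_3 by (auto simp: cong_0_iff)
 qed
 consider "nzsq a" | "P dvd a" | "~ nzsq a" "~ P dvd a" by blast
 then show ?thesis
 proof cases
  case 1
  then show ?thesis using card_roots_le_2[of a] by simp
 next
  case 2
  then have "~ nzsq a" by (simp add: nzsq_def)
  then show ?thesis using card_mono[OF _ zero[OF 2]] 2 by simp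
 next
  case 3
  show ?thesis unfolding none[OF 3] by simp
 qed
qed

text \<open>Pigeonhole: for arguments from 0 to (p-1)/2, both x^2 and c - d w^2 take (p+1)/2
  different residues, so the two sets of values meet.\<close>

lemma sum_of_squares_mod:
 assumes d: "~ P dvd d"
 shows "\<exists>x\<in>F. \<exists>w\<in>F. [x\<^sup>2 + d * w\<^sup>2 = c] (mod P)"
proof -
 let ?H = "{0..int h}"
 have sz: "2 * h + 1 = p" using odd_p by (auto elim!: oddE)
 then have szi: "2 * int h + 1 = P" by linarith
 define f where "f = (%x::int. x\<^sup>2 mod P)"
 define g where "g = (%w::int. (c - d * w\<^sup>2) mod P)"
 have inj: "x = y" if "x \<in> ?H" "y \<in> ?H" "[x\<^sup>2 = y\<^sup>2] (mod P)" for x y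
 proof -
  have "P dvd x - y | P dvd x + y"
   using that(3) unfolding cong_square_iff unfolding cong_iff_dvd_diff by simp
  then show ?thesis
  proof
   assume "P dvd x - y"
   moreover have "\<bar>x - y\<bar> < P" using that szi by auto
   ultimately have "x - y = 0" by (rule P_dvd_small)
   then show ?thesis by simp
  next
   assume "P dvd x + y"
   moreover have "\<bar>x + y\<bar> < P" using that szi by auto
   ultimately have "x + y = 0" by (rule P_dvd_small)
   with that show ?thesis by auto
  qed
 qed
 have "inj_on f ?H" by (rule inj_onI) (auto simp: f_def cong_def intro!: inj)
 then have cf: "card (f ` ?H) = h + 1" by (simp add: card_image)
 have "inj_on g ?H"
 proof (rule inj_onI)
  fix x y assume xy: "x \<in> ?H" "y \<in> ?H" "g x = g y"
  then have "[c - d * x\<^sup>2 = c - d * y\<^sup>2] (mod P)" by (simp add: g_def cong_def)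
  then have "P dvd d * (x\<^sup>2 - y\<^sup>2)"
   by (simp add: cong_iff_dvd_diff algebra_simps dvd_diff_commute)
  then have "[x\<^sup>2 = y\<^sup>2] (mod P)" using d by (simp add: P_dvd_mult_iff cong_iff_dvd_diff)
  then show "x = y" using xy inj by blast
 qed
 then have cg: "card (g ` ?H) = h + 1" by (simp add: card_image)
 have sub: "f ` ?H \<union> g ` ?H \<subseteq> F" by (auto simp: f_def g_def) (use p_ge_3 in auto)
 have "card (f ` ?H \<union> g ` ?H) <= card F" by (rule card_mono[OF _ sub]) simp
 then have "card (f ` ?H \<union> g ` ?H) <= p" by simp
 then have "f ` ?H \<inter> g ` ?H ~= {}"
  using cf cg sz card_Un_disjoint[of "f ` ?H" "g ` ?H"] by auto
 then obtain z where "z \<in> f ` ?H" "z \<in> g ` ?H" by blast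
 then obtain x w where xw: "x \<in> ?H" "w \<in> ?H" "f x = g w"
  by (metis (no_types, lifting) imageE)
 have "[x\<^sup>2 = c - d * w\<^sup>2] (mod P)" using xw(3) by (simp add: f_def g_def cong_def)
 then have "[x\<^sup>2 + d * w\<^sup>2 = c] (mod P)" by (simp add: cong_iff_dvd_diff algebra_simps)
 moreover have "x \<in> F" "w \<in> F" using xw szi by auto
 ultimately show ?thesis by blast
qed

definition rep_pairs :: "int => int => (int \<times> int) set" where
 "rep_pairs d c = {(x, w) \<in> F \<times> F. [x\<^sup>2 + d * w\<^sup>2 = c] (mod P)}"

lemma finite_rep_pairs [simp]: "finite (rep_pairs d c)"
 by (rule finite_subset[of _ "F \<times> F"]) (auto simp: rep_pairs_def)

text \<open>Multiplicativity of the norm form \<open>x\<^sup>2 + d w\<^sup>2\<close>, all of whose unit values are attained, makes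
 all unit values equally frequent.\<close>

lemma card_rep_pairs_le:
 assumes d: "~ P dvd d" and c: "~ P dvd c" "~ P dvd c'"
 shows "card (rep_pairs d c) <= card (rep_pairs d c')"
proof -
 obtain b where b: "[c * b = 1] (mod P)" using unit_inverse[OF c(1)] by blast
 \<comment> \<open>An element g1 + g2 sqrt(-d) whose norm is c'/c.\<close>
 obtain g1 g2 where g: "[g1\<^sup>2 + d * g2\<^sup>2 = c' * b] (mod P)"
  using sum_of_squares_mod[OF d] by blast
 define nu where "nu = g1\<^sup>2 + d * g2\<^sup>2"
 have "[nu * c = c' * b * c] (mod P)" unfolding nu_def by (rule cong_scalar_right[OF g])
 also have "c' * b * c = c' * (c * b)" by simp
 also have "[... = c' * 1] (mod P)" by (rule cong_scalar_left[OF b])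
 finally have nuc: "[nu * c = c'] (mod P)" by simp
 then have nu: "~ P dvd nu" using c(2) cong_dvd_iff[OF nuc] by auto
 \<comment> \<open>Multiplication by g1 + g2 sqrt(-d). It is injective because multiplying further
   by the conjugate multiplies by the unit \<open>nu\<close>.\<close>
 define ph where "ph = (%(x, w). ((g1 * x - d * g2 * w) mod P, (g1 * w + g2 * x) mod P))"
 have "inj_on ph (rep_pairs d c)"
 proof (rule inj_onI, clarify)
  fix x w x' w' assume xw: "(x, w) \<in> rep_pairs d c" "(x', w') \<in> rep_pairs d c" "ph (x, w) = ph (x', w')"
  have 1: "P dvd g1 * x - d * g2 * w - (g1 * x' - d * g2 * w')"
   and 2: "P dvd g1 * w + g2 * x - (g1 * w' + g2 * x')"
   using xw(3) by (auto simp: ph_def mod_eq_dvd_iff)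
  have "P dvd g1 * (g1 * x - d * g2 * w - (g1 * x' - d * g2 * w')) + d * g2 * (g1 * w + g2 * x - (g1 * w' + g2 * x'))"
   by (intro dvd_add[OF dvd_mult[OF 1] dvd_mult[OF 2]])
  also have "... = nu * (x - x')" by (simp add: nu_def power2_eq_square algebra_simps)
  finally have x: "P dvd x - x'" using nu by (simp add: P_dvd_mult_iff)
  have "P dvd g1 * (g1 * w + g2 * x - (g1 * w' + g2 * x')) - g2 * (g1 * x - d * g2 * w - (g1 * x' - d * g2 * w'))"
   by (intro dvd_diff[OF dvd_mult[OF 2] dvd_mult[OF 1]])
  also have "... = nu * (w - w')" by (simp add: nu_def power2_eq_square algebra_simps)
  finally have w: "P dvd w - w'" using nu by (simp add: P_dvd_mult_iff)
  show "x = x' & w = w'"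
   using x w xw(1,2) F_cong_eq by (auto simp: rep_pairs_def cong_iff_dvd_diff)
 qed
 moreover have "ph ` rep_pairs d c \<subseteq> rep_pairs d c'"
 proof (rule image_subsetI)
  fix z assume "z \<in> rep_pairs d c"
  moreover obtain x w where z: "z = (x, w)" by fastforce
  ultimately have xw: "(x, w) \<in> rep_pairs d c" by simp
  have "[((g1 * x - d * g2 * w) mod P)\<^sup>2 + d * ((g1 * w + g2 * x) mod P)\<^sup>2
    = (g1 * x - d * g2 * w)\<^sup>2 + d * (g1 * w + g2 * x)\<^sup>2] (mod P)"
   by (intro cong_add cong_mult cong_pow) (simp_all add: cong_def)
  also have "(g1 * x - d * g2 * w)\<^sup>2 + d * (g1 * w + g2 * x)\<^sup>2 = nu * (x\<^sup>2 + d * w\<^sup>2)"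
   by (simp add: nu_def power2_eq_square algebra_simps)
  also have "[... = nu * c] (mod P)" using xw by (intro cong_scalar_left) (auto simp: rep_pairs_def)
  also note nuc
  finally show "ph z \<in> rep_pairs d c'"
   using mod_in_F by (simp add: rep_pairs_def ph_def z)
 qed
 ultimately show ?thesis by (metis card_image card_mono finite_rep_pairs)
qed

lemma card_rep_pairs_0:
 assumes d: "~ P dvd d"
 shows "card (rep_pairs d 0) <= 2 * p - 1"
proof -
 have eq: "rep_pairs d 0 = (%(w, x). (x, w)) ` (SIGMA w:F. {x \<in> F. [x\<^sup>2 = - d * w\<^sup>2] (mod P)})"
  by (force simp: rep_pairs_def cong_iff_dvd_diff)
 have "card (rep_pairs d 0) <= card (SIGMA w:F. {x \<in> F. [x\<^sup>2 = - d * w\<^sup>2] (mod P)})"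
  unfolding eq by (intro card_image_le finite_SigmaI) auto
 also have "... = (\<Sum>w\<in>F. card {x \<in> F. [x\<^sup>2 = - d * w\<^sup>2] (mod P)})" by (subst card_SigmaI) auto
 also have "... <= (\<Sum>w\<in>F. if w = 0 then 1 else 2)"
 proof (rule sum_mono)
  fix w assume "w \<in> F"
  show "card {x \<in> F. [x\<^sup>2 = - d * w\<^sup>2] (mod P)} <= (if w = 0 then 1 else 2)"
   using card_roots_le[of "- d * w\<^sup>2"] card_roots_le_2[of "- d * w\<^sup>2"]
   by (auto simp: nzsq_def)
 qed
 also have "... = (\<Sum>w\<in>insert 0 (F - {0}). if w = 0 then 1 else 2)"
  using p_ge_3 by (intro sum.cong) auto
 also have "... = 1 + 2 * (p - 1)" using p_ge_3 by (subst sum.insert) (auto simp: card_Diff_singleton)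
 finally show ?thesis using p_ge_3 by linarith
qed

text \<open>The p^2 pairs are distributed over p values. Zero takes at most 2p - 1 of them, and the
  p - 1 unit values share the remaining (p - 1)^2 or more equally.\<close>

lemma card_rep_pairs_ge:
 assumes d: "~ P dvd d" and c: "~ P dvd c"
 shows "card (rep_pairs d c) \<ge> p - 1"
proof -
 have "F \<times> F = (\<Union>e\<in>F. rep_pairs d e)"
 proof (intro equalityI subsetI)
  fix z assume z: "z \<in> F \<times> F"
  obtain x w where xw: "z = (x, w)" by fastforce
  with z have "z \<in> rep_pairs d ((x\<^sup>2 + d * w\<^sup>2) mod P)" by (simp add: rep_pairs_def cong_def)
  then show "z \<in> (\<Union>e\<in>F. rep_pairs d e)" using mod_in_F by blast
 qed (auto simp: rep_pairs_def)
 then have "card (F \<times> F) = card (\<Union>e\<in>F. rep_pairs d e)" by simp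
 also have "... = (\<Sum>e\<in>F. card (rep_pairs d e))"
 proof (rule card_UN_disjoint)
  show "\<forall>i\<in>F. \<forall>j\<in>F. i ~= j --> rep_pairs d i \<inter> rep_pairs d j = {}"
   using F_cong_eq by (auto simp: rep_pairs_def dest: cong_trans[OF cong_sym])
 qed auto
 also have "... <= (\<Sum>e\<in>F. if e = 0 then 2 * p - 1 else card (rep_pairs d c))"
 proof (rule sum_mono)
  fix e assume e: "e \<in> F"
  show "card (rep_pairs d e) <= (if e = 0 then 2 * p - 1 else card (rep_pairs d c))"
  proof (cases "e = 0")
   case False
   then have "~ P dvd e" using e zdvd_imp_le[of P e] by auto
   then show ?thesis using False card_rep_pairs_le[OF d _ c] by simp
  qed (use card_rep_pairs_0[OF d] in simp)
 qed
 also have "... = (\<Sum>e\<in>insert 0 (F - {0}). if e = 0 then 2 * p - 1 else card (rep_pairs d c))"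
  using p_ge_3 by (intro sum.cong) auto
 also have "... = 2 * p - 1 + (p - 1) * card (rep_pairs d c)"
  using p_ge_3 by (subst sum.insert) (auto simp: card_Diff_singleton)
 finally have "p * p <= 2 * p - 1 + (p - 1) * card (rep_pairs d c)"
  by (simp add: card_cartesian_product)
 moreover obtain q where q: "p = Suc q" using p_ge_3 by (cases p) auto
 ultimately have "q * q <= q * card (rep_pairs d c)" by (simp add: algebra_simps)
 then show ?thesis using q p_ge_3 by simp
qed

text \<open>Pairs (x, w) with x^2 = c (ta - u w^2) are the representations of the unit c ta by x^2 +
  cu w^2, so there are at least p - 1. A good w accounts for at most two of them, and the at most
  two w with value zero for one each. Hence there are at least (p - 3)/2 good w, which is at least
  p/5 for p at least 5.\<close>

lemma card_nzsq_values:
 assumes "p \<ge> 5" and c: "~ P dvd c" and u: "~ P dvd u" and ta: "~ P dvd ta"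
 shows "p <= 5 * card {w \<in> F. nzsq (c * (ta - u * w\<^sup>2))}"
proof -
 let ?M = "{w \<in> F. nzsq (c * (ta - u * w\<^sup>2))}" and ?Z = "{w \<in> F. P dvd c * (ta - u * w\<^sup>2)}"
 obtain v where v: "[u * v = 1] (mod P)" "~ P dvd v" using unit_inverse[OF u] by blast
 have "?Z \<subseteq> {w \<in> F. [w\<^sup>2 = v * ta] (mod P)}"
 proof
  fix w assume w: "w \<in> ?Z"
  then have "[u * w\<^sup>2 = ta] (mod P)" using c by (auto simp: P_dvd_mult_iff cong_iff_dvd_diff dvd_diff_commute)
  then have "[v * (u * w\<^sup>2) = v * ta] (mod P)" by (rule cong_scalar_left)
  moreover have "[u * v * w\<^sup>2 = 1 * w\<^sup>2] (mod P)" by (rule cong_scalar_right[OF v(1)])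
  ultimately have "[w\<^sup>2 = v * ta] (mod P)" by (metis cong_sym cong_trans mult.assoc mult.commute mult_1)
  with w show "w \<in> {w \<in> F. [w\<^sup>2 = v * ta] (mod P)}" by simp
 qed
 then have "card ?Z <= card {w \<in> F. [w\<^sup>2 = v * ta] (mod P)}" by (rule card_mono[rotated]) simp
 then have Z: "card ?Z <= 2" using card_roots_le_2[of "v * ta"] by simp
 have cu: "~ P dvd c * u" "~ P dvd c * ta" using c u ta by (auto simp: P_dvd_mult_iff)
 have eq: "rep_pairs (c * u) (c * ta) =
   (%(w, x). (x, w)) ` (SIGMA w:F. {x \<in> F. [x\<^sup>2 = c * (ta - u * w\<^sup>2)] (mod P)})"
  by (force simp: rep_pairs_def cong_iff_dvd_diff algebra_simps)
 have "p - 1 <= card (rep_pairs (c * u) (c * ta))" by (rule card_rep_pairs_ge[OF cu])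
 also have "... <= card (SIGMA w:F. {x \<in> F. [x\<^sup>2 = c * (ta - u * w\<^sup>2)] (mod P)})"
  unfolding eq by (intro card_image_le finite_SigmaI) auto
 also have "... = (\<Sum>w\<in>F. card {x \<in> F. [x\<^sup>2 = c * (ta - u * w\<^sup>2)] (mod P)})" by (subst card_SigmaI) auto
 also have "... <= (\<Sum>w\<in>F. 2 * (if w \<in> ?M then 1 else 0) + (if w \<in> ?Z then 1 else 0))"
 proof (rule sum_mono)
  fix w assume "w \<in> F"
  then show "card {x \<in> F. [x\<^sup>2 = c * (ta - u * w\<^sup>2)] (mod P)} <= 2 * (if w \<in> ?M then 1 else 0) + (if w \<in> ?Z then 1 else 0)"
   using card_roots_le[of "c * (ta - u * w\<^sup>2)"] by auto
 qed
 also have "... = 2 * card ?M + card ?Z"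
  by (simp add: sum.distrib flip: sum_distrib_left) (simp add: sum.If_cases Int_def)
 finally show ?thesis using Z assms(1) by linarith
qed

text \<open>For p at least 5, fix w2 outside the at most two values where A - u2 w2^2 vanishes and
  count w1: this gives at least (p - 2) p / 5 pairs. For p = 3 the claim only asks for one pair,
  which comes from solving u1 w1^2 + u2 w2^2 = A - 1/c, so that the value is 1.\<close>

lemma card_nzsq_values2:
 assumes c: "~ P dvd c" and u: "~ P dvd u1" "~ P dvd u2"
 shows "p ^ 2 <= 9 * card {(w1, w2) \<in> F \<times> F. nzsq (c * (A - u1 * w1\<^sup>2 - u2 * w2\<^sup>2))}"
proof -
 let ?S = "{(w1, w2) \<in> F \<times> F. nzsq (c * (A - u1 * w1\<^sup>2 - u2 * w2\<^sup>2))}"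
 have fin: "finite ?S" by (rule finite_subset[of _ "F \<times> F"]) auto
 show ?thesis
 proof (cases "p \<ge> 5")
  case True
  let ?Z = "{w \<in> F. P dvd A - u2 * w\<^sup>2}"
  obtain v where v: "[u2 * v = 1] (mod P)" "~ P dvd v" using unit_inverse[OF u(2)] by blast
  have "?Z \<subseteq> {w \<in> F. [w\<^sup>2 = v * A] (mod P)}"
  proof
   fix w assume w: "w \<in> ?Z"
   then have "[u2 * w\<^sup>2 = A] (mod P)" by (auto simp: cong_iff_dvd_diff dvd_diff_commute)
   then have "[v * (u2 * w\<^sup>2) = v * A] (mod P)" by (rule cong_scalar_left)
   moreover have "[u2 * v * w\<^sup>2 = 1 * w\<^sup>2] (mod P)" by (rule cong_scalar_right[OF v(1)])
   ultimately have "[w\<^sup>2 = v * A] (mod P)" by (metis cong_sym cong_trans mult.assoc mult.commute mult_1)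
   with w show "w \<in> {w \<in> F. [w\<^sup>2 = v * A] (mod P)}" by simp
  qed
  then have "card ?Z <= card {w \<in> F. [w\<^sup>2 = v * A] (mod P)}" by (rule card_mono[rotated]) simp
  then have Z: "card ?Z <= 2" using card_roots_le_2[of "v * A"] by simp
  have "card (F - ?Z) \<ge> p - 2"
  proof -
   have "card (F - ?Z) = card F - card ?Z" by (rule card_Diff_subset) auto
   then show ?thesis using Z by simp
  qed
  then have "(p - 2) * p <= card (F - ?Z) * p" by (rule mult_le_mono1)
  also have "... = (\<Sum>w\<in>F - ?Z. p)" by simp
  also have "... <= (\<Sum>w\<in>F - ?Z. 5 * card {w1 \<in> F. nzsq (c * ((A - u2 * w\<^sup>2) - u1 * w1\<^sup>2))})"
   by (intro sum_mono card_nzsq_values) (use True c u in auto)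
  also have "... = 5 * (\<Sum>w\<in>F - ?Z. card {w1 \<in> F. nzsq (c * ((A - u2 * w\<^sup>2) - u1 * w1\<^sup>2))})"
   by (simp add: sum_distrib_left)
  also have "(\<Sum>w\<in>F - ?Z. card {w1 \<in> F. nzsq (c * ((A - u2 * w\<^sup>2) - u1 * w1\<^sup>2))}) =
    card (SIGMA w:F - ?Z. {w1 \<in> F. nzsq (c * ((A - u2 * w\<^sup>2) - u1 * w1\<^sup>2))})" by (subst card_SigmaI) auto
  also have "... = card ((%(w, w1). (w1, w)) ` (SIGMA w:F - ?Z. {w1 \<in> F. nzsq (c * ((A - u2 * w\<^sup>2) - u1 * w1\<^sup>2))}))"
   by (intro card_image[symmetric] inj_onI) auto
  also have "... <= card ?S" by (intro card_mono fin) (auto simp: algebra_simps)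
  finally have le: "(p - 2) * p <= 5 * card ?S" by simp
  obtain q where q: "p = q + 5" using True le_Suc_ex by (metis add.commute)
  then have "p - 2 = q + 3" by simp
  with le q have "(q + 3) * (q + 5) <= 5 * card ?S" by metis
  moreover have "5 * (q + 5)\<^sup>2 <= 9 * ((q + 3) * (q + 5))"
   by (simp add: power2_eq_square algebra_simps)
  ultimately have "5 * (q + 5)\<^sup>2 <= 5 * (9 * card ?S)" by linarith
  then show ?thesis unfolding q[symmetric] by simp
 next
  case False
  then have p: "p = 3" using p_ge_3 odd_p by (cases "p = 4") auto
  obtain c' where c': "[c * c' = 1] (mod P)" using unit_inverse[OF c] by blast
  obtain v where v: "[u1 * v = 1] (mod P)" "~ P dvd v" using unit_inverse[OF u(1)] by blast
  obtain w1 w2 where w: "w1 \<in> F" "w2 \<in> F" "[w1\<^sup>2 + (v * u2) * w2\<^sup>2 = v * (A - c')] (mod P)"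
   using sum_of_squares_mod[of "v * u2" "v * (A - c')"] v u by (auto simp: P_dvd_mult_iff)
  have "[u1 * (w1\<^sup>2 + (v * u2) * w2\<^sup>2) = u1 * (v * (A - c'))] (mod P)" using w(3) by (rule cong_scalar_left)
  moreover have "[u1 * w1\<^sup>2 + (u1 * v) * (u2 * w2\<^sup>2) = u1 * w1\<^sup>2 + 1 * (u2 * w2\<^sup>2)] (mod P)"
   "[(u1 * v) * (A - c') = 1 * (A - c')] (mod P)"
   by (intro cong_add cong_refl cong_scalar_right[OF v(1)])+
  ultimately have "[u1 * w1\<^sup>2 + u2 * w2\<^sup>2 = A - c'] (mod P)"
   unfolding cong_def by (simp add: algebra_simps)
  then have "[c * (A - u1 * w1\<^sup>2 - u2 * w2\<^sup>2) = c * c'] (mod P)"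
   by (intro cong_scalar_left) (simp add: cong_iff_dvd_diff algebra_simps dvd_diff_commute)
  then have "[c * (A - u1 * w1\<^sup>2 - u2 * w2\<^sup>2) = 1\<^sup>2] (mod P)" using c' cong_trans by simp
  then have "nzsq (c * (A - u1 * w1\<^sup>2 - u2 * w2\<^sup>2))" using nzsq_square[of 1] nzsq_cong by simp
  then have "(w1, w2) \<in> ?S" using w by simp
  then have "card ?S > 0" using fin card_gt_0_iff by blast
  then show ?thesis using p by simp
 qed
qed

text \<open>Squaring identifies 1 and -1, so it cannot be onto the p residues.\<close>

lemma ex_nonsq: "EX nu. nonsq nu"
proof (rule ccontr)
 assume "~ (EX nu. nonsq nu)"
 then have sq: "QuadRes P a" if "~ P dvd a" for a using that by (auto simp: nonsq_def)
 have "F \<subseteq> (%x. x\<^sup>2 mod P) ` (F - {P - 1})"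
 proof
  fix a assume a: "a \<in> F"
  obtain y where y: "[y\<^sup>2 = a] (mod P)"
  proof (cases "P dvd a")
   case True
   then have "[0\<^sup>2 = a] (mod P)" by (simp add: cong_0_iff cong_sym)
   then show ?thesis by (rule that)
  next
   case False
   then show ?thesis using sq[OF False] that by (auto simp: QuadRes_def)
  qed
  define z where "z = (if y mod P = P - 1 then 1 else y mod P)"
  have "z \<in> F - {P - 1}" using mod_in_F[of y] p_ge_3 by (auto simp: z_def)
  moreover have "[z\<^sup>2 = y\<^sup>2] (mod P)"
  proof (cases "y mod P = P - 1")
   case True
   then have "[y = - 1] (mod P)" using p_ge_3 by (simp add: cong_def zmod_minus1)
   then have "[y\<^sup>2 = (- 1)\<^sup>2] (mod P)" by (rule cong_pow)
   then show ?thesis using True by (simp add: z_def cong_sym)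
  next
   case False
   then show ?thesis by (simp add: z_def cong_def power_mod)
  qed
  then have "[z\<^sup>2 = a] (mod P)" using y cong_trans by blast
  then have "z\<^sup>2 mod P = a" using a by (simp add: cong_def)
  ultimately show "a \<in> (%x. x\<^sup>2 mod P) ` (F - {P - 1})" by blast
 qed
 then have "card F <= card ((%x. x\<^sup>2 mod P) ` (F - {P - 1}))" by (intro card_mono) auto
 also have "... <= card (F - {P - 1})" by (rule card_image_le) simp
 also have "... < card F" by (rule card_Diff1_less) (use p_ge_3 in auto)
 finally show False by simp
qed

definition gm :: nat where "gm = card {a \<in> F. nonsq (a\<^sup>2 - 1)}"

text \<open>A factor that is a nonsquare exchanges squares and nonsquares, which reduces the count
  to \<open>card_nzsq_values\<close>. For p = 3 the residue a = 0 serves, -1 being a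
  nonsquare.\<close>

lemma gm_ge: "p <= 5 * gm"
proof (cases "p \<ge> 5")
 case True
 obtain nu where nu: "nonsq nu" using ex_nonsq by blast
 have "nonsq (a\<^sup>2 - 1) \<longleftrightarrow> nzsq ((- nu) * (1 - 1 * a\<^sup>2))" for a
  using nonsq_mult[OF nu, of "a\<^sup>2 - 1"] by (simp add: algebra_simps)
 moreover have "~ P dvd - nu" using nu by (simp add: nonsq_def)
 ultimately show ?thesis using card_nzsq_values[OF True, of "- nu" 1 1] by (simp add: gm_def)
next
 case False
 then have p: "p = 3" using p_ge_3 odd_p by (cases "p = 4") auto
 have "nonsq (0\<^sup>2 - 1)" unfolding nonsq_iff by (simp add: p)
 then have "0 \<in> {a \<in> F. nonsq (a\<^sup>2 - 1)}" using p by simp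
 then have "gm \<ge> 1" unfolding gm_def
  using card_gt_0_iff[of "{a \<in> F. nonsq (a\<^sup>2 - 1)}"] by force
 then show ?thesis using p by simp
qed

text \<open>If s^2 = r, then a -> s a permutes the residues and (s a)^2 - r = s^2 (a^2 - 1) has the
  character of a^2 - 1. That the count does not depend on r is what later gives all solutions
  equally many preimages.\<close>

lemma card_nonsq_shift:
 assumes "nzsq r"
 shows "card {a \<in> F. nonsq (a\<^sup>2 - r)} = gm"
proof -
 obtain s where s: "[s\<^sup>2 = r] (mod P)" "~ P dvd r" using assms by (auto simp: nzsq_def QuadRes_def)
 then have ns: "~ P dvd s" using cong_dvd_iff[OF s(1)] by auto
 obtain b where b: "[s * b = 1] (mod P)" using unit_inverse[OF ns] by blast
 have key: "nonsq ((s * a)\<^sup>2 - r) \<longleftrightarrow> nonsq (a\<^sup>2 - 1)" for a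
 proof -
  have "[(s * a)\<^sup>2 - r = (s * a)\<^sup>2 - s\<^sup>2] (mod P)" by (intro cong_diff cong_refl cong_sym[OF s(1)])
  then have "nonsq ((s * a)\<^sup>2 - r) \<longleftrightarrow> nonsq ((s * a)\<^sup>2 - s\<^sup>2)" by (rule nonsq_cong)
  also have "(s * a)\<^sup>2 - s\<^sup>2 = s\<^sup>2 * (a\<^sup>2 - 1)" by (simp add: power2_eq_square algebra_simps)
  finally show ?thesis using nonsq_mult_nzsq[OF nzsq_square[OF ns]] by simp
 qed
 have "bij_betw (%a. s * a mod P) {a \<in> F. nonsq (a\<^sup>2 - 1)} {a \<in> F. nonsq (a\<^sup>2 - r)}"
 proof (rule bij_betwI[where g = "%a. b * a mod P"])
  have sq: "nonsq ((x mod P)\<^sup>2 - c) \<longleftrightarrow> nonsq (x\<^sup>2 - c)" for x c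
   by (rule nonsq_cong) (intro cong_diff cong_pow cong_refl; simp add: cong_def)
  have inv: "s * (b * a mod P) mod P = a mod P" "b * (s * a mod P) mod P = a mod P" for a
  proof -
   have "[s * b * a = 1 * a] (mod P)" by (rule cong_scalar_right[OF b])
   then show "s * (b * a mod P) mod P = a mod P" "b * (s * a mod P) mod P = a mod P"
    by (simp_all add: cong_def mod_mult_right_eq ac_simps)
  qed
  show "(%a. s * a mod P) \<in> {a \<in> F. nonsq (a\<^sup>2 - 1)} \<rightarrow> {a \<in> F. nonsq (a\<^sup>2 - r)}"
   using sq key mod_in_F by auto
  show "(%a. b * a mod P) \<in> {a \<in> F. nonsq (a\<^sup>2 - r)} \<rightarrow> {a \<in> F. nonsq (a\<^sup>2 - 1)}"
  proof
   fix a assume a: "a \<in> {a \<in> F. nonsq (a\<^sup>2 - r)}"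
   have "nonsq ((b * a mod P)\<^sup>2 - 1) \<longleftrightarrow> nonsq ((s * (b * a mod P) mod P)\<^sup>2 - r)"
    unfolding sq key ..
   also have "... \<longleftrightarrow> nonsq (a\<^sup>2 - r)" unfolding inv using a by simp
   finally show "b * a mod P \<in> {a \<in> F. nonsq (a\<^sup>2 - 1)}" using a mod_in_F by simp
  qed
  show "b * (s * x mod P) mod P = x" if "x \<in> {a \<in> F. nonsq (a\<^sup>2 - 1)}" for x
   using that inv(2)[of x] by simp
  show "s * (b * y mod P) mod P = y" if "y \<in> {a \<in> F. nonsq (a\<^sup>2 - r)}" for y
   using that inv(1)[of y] by simp
 qed
 then show ?thesis unfolding gm_def by (simp add: bij_betw_same_card)
qed

end

section \<open>Square roots modulo p and their lifting to p^k\<close>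

definition qstep :: "int => int => int \<times> int \<times> int \<times> int \<times> int => int \<times> int \<times> int \<times> int \<times> int" where
 "qstep m r = (%(u, v, b, c, e).
   (if e mod 2 = 1 then (u * b + r * (v * c)) mod m else u,
   if e mod 2 = 1 then (u * c + v * b) mod m else v,
   (b * b + r * (c * c)) mod m, (2 * (b * c)) mod m, e div 2))"

text \<open>Binary powering in \<open>\<int>[X]/(m, X\<^sup>2 - r)\<close>.\<close>

definition qpow :: "int => int => nat => int => int => int => int \<times> int" where
 "qpow m r l b c e = (case (qstep m r ^^ l) (1, 0, b, c, e) of (u, v, _) => (u, v))"

definition newton :: "int => int => int => int" where
 "newton m r z = (z + (r - z * z) * modular_inverse m (2 * z)) mod m"

context odd_prime
begin

text \<open>Sending X to a root s of X^2 - r modulo p is a ring homomorphism, so powering can be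
  followed on values: accumulator times base to the remaining exponent is invariant.\<close>

lemma qpow_hom:
 assumes m: "P dvd m" and s: "[s\<^sup>2 = r] (mod P)" and e: "0 <= e" "e < 2 ^ l"
  and uv: "qpow m r l b c e = (u, v)"
 shows "[u + v * s = (b + c * s) ^ nat e] (mod P)"
proof -
 have mm: "[x mod m = x] (mod P)" for x using m by (simp add: cong_def mod_mod_cancel)
 have sr: "[r * x = s * s * x] (mod P)" for x
  using cong_scalar_right[OF cong_sym[OF s], of x] by (simp add: power2_eq_square)
 have inv: "case (qstep m r ^^ j) (1, 0, b, c, e) of (u, v, b', c', e') =>
   e' = e div 2 ^ j & [(u + v * s) * (b' + c' * s) ^ nat e' = (b + c * s) ^ nat e] (mod P)" for j
 proof (induction j)
  case 0
  then show ?case by simp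
 next
  case (Suc j)
  obtain u v b' c' e' where st: "(qstep m r ^^ j) (1, 0, b, c, e) = (u, v, b', c', e')"
   by (metis prod_cases5)
  have IH: "e' = e div 2 ^ j" "[(u + v * s) * (b' + c' * s) ^ nat e' = (b + c * s) ^ nat e] (mod P)"
   using Suc unfolding st by auto
  define B where "B = (b' * b' + r * (c' * c')) mod m + (2 * (b' * c')) mod m * s"
  have "[B = (b' * b' + s * s * (c' * c')) + 2 * (b' * c') * s] (mod P)"
   unfolding B_def
   by (intro cong_add[OF cong_trans[OF mm cong_add[OF cong_refl sr]] cong_scalar_right[OF mm]])
  also have "(b' * b' + s * s * (c' * c')) + 2 * (b' * c') * s = (b' + c' * s)\<^sup>2"
   by (simp add: power2_eq_square algebra_simps)
  finally have "[B ^ nat (e' div 2) = ((b' + c' * s)\<^sup>2) ^ nat (e' div 2)] (mod P)" by (rule cong_pow)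
  then have B: "[B ^ nat (e' div 2) = (b' + c' * s) ^ (2 * nat (e' div 2))] (mod P)"
   by (simp add: power_mult)
  have e0: "e' \<ge> 0" using IH(1) e by (simp add: pos_imp_zdiv_nonneg_iff)
  have e2: "e' div 2 = e div 2 ^ Suc j"
   unfolding power_Suc2 using IH(1) zdiv_zmult2_eq[of 2 e "2 ^ j"] by simp
  have "[(if e' mod 2 = 1 then (u * b' + r * (v * c')) mod m else u) * 1 +
    (if e' mod 2 = 1 then (u * c' + v * b') mod m else v) * s =
    (u + v * s) * (b' + c' * s) ^ nat (e' mod 2)] (mod P)" (is "[?U = _] (mod P)")
  proof (cases "e' mod 2 = 1")
   case True
   have "[(u * b' + r * (v * c')) mod m + (u * c' + v * b') mod m * s =
     (u * b' + s * s * (v * c')) + (u * c' + v * b') * s] (mod P)"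
    by (intro cong_add[OF cong_trans[OF mm cong_add[OF cong_refl sr]] cong_scalar_right[OF mm]])
   also have "(u * b' + s * s * (v * c')) + (u * c' + v * b') * s = (u + v * s) * (b' + c' * s)"
    by (simp add: algebra_simps)
   finally show ?thesis using True by simp
  next
   case False
   then have "e' mod 2 = 0" by presburger
   then show ?thesis by simp
  qed
  then have "[?U * B ^ nat (e' div 2) =
    ((u + v * s) * (b' + c' * s) ^ nat (e' mod 2)) * (b' + c' * s) ^ (2 * nat (e' div 2))] (mod P)"
   by (rule cong_mult[OF _ B])
  also have "((u + v * s) * (b' + c' * s) ^ nat (e' mod 2)) * (b' + c' * s) ^ (2 * nat (e' div 2)) =
    (u + v * s) * (b' + c' * s) ^ (nat (e' mod 2) + 2 * nat (e' div 2))"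
   by (simp add: power_add)
  also have "nat (e' mod 2) + 2 * nat (e' div 2) = nat (e' mod 2 + 2 * (e' div 2))"
  proof -
   have "nat (x + 2 * y) = nat x + 2 * nat y" if "x \<ge> 0" "y \<ge> 0" for x y :: int
    using that by (simp add: nat_add_distrib nat_mult_distrib)
   then show ?thesis using e0 by (simp only: pos_mod_sign pos_imp_zdiv_nonneg_iff zero_less_numeral)
  qed
  also have "e' mod 2 + 2 * (e' div 2) = e'" by simp
  also note IH(2)
  finally show ?case using st e2 by (simp add: qstep_def B_def)
 qed
 obtain u' v' b' c' e' where st: "(qstep m r ^^ l) (1, 0, b, c, e) = (u', v', b', c', e')"
  by (metis prod_cases5)
 have "e div 2 ^ l = 0" using e by simp
 then show ?thesis using inv[of l] uv unfolding st by (auto simp: qpow_def st)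
qed

lemma h_bounds: "0 <= int h" "P < 2 ^ l ==> int h < 2 ^ l"
 by auto

text \<open>With r = 0 and no X-part the recursion is ordinary modular powering, so the same code
  evaluates Euler's criterion.\<close>

lemma qpow_nzsq:
 assumes m: "P dvd m" and l: "P < 2 ^ l" and uv: "qpow m 0 l x 0 (int h) = (u, v)"
 shows "u mod P = 1 \<longleftrightarrow> nzsq x"
proof -
 have "[u + v * 0 = (x + 0 * 0) ^ nat (int h)] (mod P)"
  by (rule qpow_hom[OF m _ _ _ uv]) (use h_bounds l in auto)
 then have "[u = x ^ h] (mod P)" by simp
 moreover have "1 mod P = 1" using p_ge_3 by simp
 ultimately show ?thesis unfolding nzsq_iff cong_def by simp
qed

text \<open>At a root \<open>s\<close> of \<open>X\<^sup>2 - r\<close>, the power \<open>(a + X)\<^sup>h\<close> evaluates to the quadratic character of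
 \<open>a + s\<close>; it is a multiple of \<open>X\<close> exactly if the two roots give opposite characters.\<close>

lemma qpow_root:
 assumes m: "P dvd m" and l: "P < 2 ^ l" and uv: "qpow m r l a 1 (int h) = (u, v)"
 shows "P dvd u & [v * v * r = 1] (mod P) \<longleftrightarrow> nzsq r & nonsq (a\<^sup>2 - r)"
proof (cases "nzsq r")
 case False
 \<comment> \<open>The test certifies r by itself: v^2 r = 1 makes r the inverse of a square, and
   1/v one of its roots.\<close>
 have "~ [v * v * r = 1] (mod P)"
 proof
  assume 1: "[v * v * r = 1] (mod P)"
  then have "~ P dvd v" using cong_dvd_iff[OF 1] by (auto simp: P_dvd_mult_iff)
  then have "nzsq (v\<^sup>2)" by (rule nzsq_square)
  moreover have "nzsq (v\<^sup>2 * r)"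
   using nzsq_cong[OF 1] nzsq_square[of 1] by (simp add: power2_eq_square)
  ultimately show False using nzsq_mult False by blast
 qed
 then show ?thesis using False by simp
next
 case True
 then obtain s where s: "[s\<^sup>2 = r] (mod P)" "~ P dvd r" by (auto simp: nzsq_def QuadRes_def)
 have s': "[(- s)\<^sup>2 = r] (mod P)" using s by simp
 have ns: "~ P dvd s" using s cong_dvd_iff[OF s(1)] by auto
 have 1: "[u + v * s = (a + s) ^ h] (mod P)"
  using qpow_hom[OF m s(1) h_bounds(1) h_bounds(2)[OF l] uv] by simp
 have 2: "[u - v * s = (a - s) ^ h] (mod P)"
  using qpow_hom[OF m s' h_bounds(1) h_bounds(2)[OF l] uv] by simp
 have "[(a + s) * (a - s) = a\<^sup>2 - r] (mod P)"
  using s(1) by (simp add: cong_iff_dvd_diff power2_eq_square algebra_simps dvd_diff_commute)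
 then have prod: "nonsq (a\<^sup>2 - r) \<longleftrightarrow> nonsq ((a + s) * (a - s))" using nonsq_cong by blast
 have prod': "nonsq ((a + s) * (a - s)) \<longleftrightarrow> [(u + v * s) * (u - v * s) = - 1] (mod P)"
  unfolding nonsq_iff power_mult_distrib using cong_mult[OF 1 2] by (simp add: cong_def)
 have vr: "[v * v * r = (v * s)\<^sup>2] (mod P)"
  using cong_scalar_left[OF s(1), of "v * v"] by (simp add: power2_eq_square ac_simps cong_sym)
 show ?thesis
 proof
  assume L: "P dvd u & [v * v * r = 1] (mod P)"
  then have "[(u + v * s) * (u - v * s) = (0 + v * s) * (0 - v * s)] (mod P)"
   by (intro cong_mult cong_add cong_diff) (auto simp: cong_0_iff)
  also have "(0 + v * s) * (0 - v * s) = - ((v * s)\<^sup>2)" by (simp add: power2_eq_square)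
  also have "[... = - (v * v * r)] (mod P)" using vr by (simp add: cong_minus_minus_iff cong_sym)
  also have "[- (v * v * r) = - 1] (mod P)" using L by (simp add: cong_minus_minus_iff)
  finally show "nzsq r & nonsq (a\<^sup>2 - r)" using True prod prod' by simp
 next
  assume R: "nzsq r & nonsq (a\<^sup>2 - r)"
  then have n: "nonsq ((a + s) * (a - s))" using prod by simp
  then have nd: "~ P dvd a + s" "~ P dvd a - s" by (auto simp: nonsq_def P_dvd_mult_iff)
  have ns': "nonsq (a + s) & nzsq (a - s) | nzsq (a + s) & nonsq (a - s)"
   using n nd nzsq_mult[of "a + s" "a - s"] nonsq_mult[of "a + s" "a - s"]
   unfolding nonsq_def nzsq_def by blast
  have opp: "[u + v * s = - 1] (mod P) & [u - v * s = 1] (mod P) | [u + v * s = 1] (mod P) & [u - v * s = - 1] (mod P)"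
   using ns' 1 2 unfolding nzsq_iff nonsq_iff cong_def by metis
  then have "[(u + v * s) + (u - v * s) = 0] (mod P)"
   using cong_add[of "u + v * s" "- 1" P "u - v * s" 1] cong_add[of "u + v * s" 1 P "u - v * s" "- 1"] by auto
  then have "P dvd 2 * u" by (simp add: cong_0_iff)
  then have u: "P dvd u" by (simp add: P_dvd_mult_iff)
  then have "[u = 0] (mod P)" by (simp add: cong_0_iff)
  then have "[(u + v * s)\<^sup>2 = (0 + v * s)\<^sup>2] (mod P)" by (intro cong_pow cong_add cong_refl)
  moreover have "[(u + v * s)\<^sup>2 = 1] (mod P)"
   using opp cong_pow[of "u + v * s" "- 1" P 2] cong_pow[of "u + v * s" 1 P 2] by auto
  ultimately have "[(v * s)\<^sup>2 = 1] (mod P)" by (metis add_0 cong_sym cong_trans)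
  with vr have "[v * v * r = 1] (mod P)" by (rule cong_trans)
  with u show "P dvd u & [v * v * r = 1] (mod P)" by simp
 qed
qed

lemma coprime_P_power: "~ P dvd z ==> coprime z (P ^ k)"
 by (metis coprime_commute coprime_power_right_iff prime_P prime_imp_coprime)

text \<open>With error e = r - z^2 and w the inverse of 2z, the square of z + e w is r + e (2zw - 1)
  + e^2 w^2, where the middle term vanishes modulo p^k. Precision in fact doubles; one more digit
  per step is enough, as k steps fit into the budget.\<close>

lemma newton_step:
 assumes k: "k \<ge> 1" and z: "~ P dvd z" and j: "1 <= j" "[z\<^sup>2 = r] (mod P ^ min k j)"
 shows "[newton (P ^ k) r z = z] (mod P)" "[(newton (P ^ k) r z)\<^sup>2 = r] (mod P ^ min k (Suc j))"
proof -
 let ?m = "P ^ k"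
 define w where "w = modular_inverse ?m (2 * z)"
 define dl where "dl = r - z * z"
 have "~ P dvd 2 * z" using z by (simp add: P_dvd_mult_iff)
 then have w: "[2 * z * w = 1] (mod ?m)"
  unfolding w_def by (intro cong_modular_inverse1 coprime_P_power)
 have nw: "[newton ?m r z = z + dl * w] (mod ?m)"
  unfolding newton_def dl_def w_def by (simp add: cong_def)
 have dl: "P ^ min k j dvd dl"
  using j(2) by (simp add: dl_def cong_iff_dvd_diff power2_eq_square dvd_diff_commute)
 have "P ^ 1 dvd P ^ min k j" using k j(1) by (intro le_imp_power_dvd) auto
 then have Pdl: "P dvd dl" using dl dvd_trans by simp
 have Pm: "P dvd ?m" using k by (simp add: dvd_power)
 show "[newton ?m r z = z] (mod P)"
  using cong_dvd_modulus[OF nw Pm] Pdl by (metis cong_add_lcancel_0 cong_trans cong_0_iff dvd_mult2)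
 have mm: "P ^ min k (Suc j) dvd ?m" by (intro le_imp_power_dvd) auto
 have "[(newton ?m r z)\<^sup>2 = (z + dl * w)\<^sup>2] (mod P ^ min k (Suc j))"
  using cong_dvd_modulus[OF nw mm] by (rule cong_pow)
 also have "(z + dl * w)\<^sup>2 = r + dl * (2 * z * w - 1) + (dl * dl) * w\<^sup>2"
  by (simp add: dl_def power2_eq_square algebra_simps)
 also have "[... = r + 0 + 0] (mod P ^ min k (Suc j))"
 proof (intro cong_add cong_refl)
  have "?m dvd 2 * z * w - 1" using w by (simp add: cong_iff_dvd_diff)
  then show "[dl * (2 * z * w - 1) = 0] (mod P ^ min k (Suc j))"
   using mm by (meson cong_0_iff dvd_mult dvd_trans)
  have "P ^ min k j * P ^ min k j dvd dl * dl" using dl by (rule mult_dvd_mono) (rule dl)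
  moreover have "P ^ min k (Suc j) dvd P ^ min k j * P ^ min k j"
   unfolding power_add[symmetric] using k j(1) by (intro le_imp_power_dvd) auto
  ultimately show "[dl * dl * w\<^sup>2 = 0] (mod P ^ min k (Suc j))"
   by (meson cong_0_iff dvd_mult2 dvd_trans)
 qed
 finally show "[(newton ?m r z)\<^sup>2 = r] (mod P ^ min k (Suc j))" by simp
qed

lemma newton_iterate:
 assumes k: "k \<ge> 1" and z: "~ P dvd z" and r: "[z\<^sup>2 = r] (mod P)"
 shows "[(newton (P ^ k) r ^^ k) z = z] (mod P)" "[((newton (P ^ k) r ^^ k) z)\<^sup>2 = r] (mod P ^ k)"
proof -
 have "[(newton (P ^ k) r ^^ j) z = z] (mod P) & [((newton (P ^ k) r ^^ j) z)\<^sup>2 = r] (mod P ^ min k (Suc j))" for j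
 proof (induction j)
  case 0
  have "min k (Suc 0) = 1" using k by simp
  then show ?case using r by simp
 next
  case (Suc j)
  then have "~ P dvd (newton (P ^ k) r ^^ j) z" using z cong_dvd_iff by blast
  from newton_step[OF k this, of "Suc j" r] Suc show ?case
   by (auto intro: cong_trans)
 qed
 from this[of k] show "[(newton (P ^ k) r ^^ k) z = z] (mod P)" "[((newton (P ^ k) r ^^ k) z)\<^sup>2 = r] (mod P ^ k)"
  by (simp_all add: min_def)
qed

text \<open>p^j divides (z - w)(z + w), and p cannot divide both factors, since their sum 2z is a
  unit.\<close>

lemma sqrt_unique:
 assumes "~ P dvd z" "[z\<^sup>2 = w\<^sup>2] (mod P ^ j)"
 shows "[z = w] (mod P ^ j) | [z = - w] (mod P ^ j)"
proof -
 have d: "P ^ j dvd (z - w) * (z + w)"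
  using assms(2) by (simp add: cong_iff_dvd_diff power2_eq_square algebra_simps)
 show ?thesis
 proof (cases "P dvd z - w")
  case True
  have "~ P dvd z + w"
  proof
   assume "P dvd z + w"
   then have "P dvd (z - w) + (z + w)" using True by (rule dvd_add[rotated])
   then have "P dvd 2 * z" by simp
   then show False using assms(1) by (simp add: P_dvd_mult_iff)
  qed
  then have "coprime (P ^ j) (z + w)" using coprime_P_power coprime_commute by blast
  then show ?thesis using d by (simp add: coprime_dvd_mult_left_iff cong_iff_dvd_diff)
 next
  case False
  then have "coprime (P ^ j) (z - w)" using coprime_P_power coprime_commute by blast
  then show ?thesis using d by (simp add: coprime_dvd_mult_right_iff cong_iff_dvd_diff)
 qed
qed

lemma card_residue_pred:
 assumes "k \<ge> 1"
 shows "card {a \<in> {0..<P ^ k}. Q (a mod P)} = p ^ (k - 1) * card {a \<in> F. Q a}"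
proof -
 have m: "P ^ k = P ^ (k - 1) * P" using power_minus_mult[of k P] assms by simp
 have "bij_betw (%a. (a div P, a mod P)) {a \<in> {0..<P ^ k}. Q (a mod P)} ({0..<P ^ (k - 1)} \<times> {a \<in> F. Q a})"
 proof (rule bij_betwI[where g = "%(q, a). q * P + a"])
  have P0: "P > 0" using p_ge_3 by simp
  show "(%a. (a div P, a mod P)) \<in> {a \<in> {0..<P ^ k}. Q (a mod P)} \<rightarrow> {0..<P ^ (k - 1)} \<times> {a \<in> F. Q a}"
  proof
   fix a assume a: "a \<in> {a \<in> {0..<P ^ k}. Q (a mod P)}"
   then have "a < P ^ (k - 1) * P" unfolding m by simp
   moreover have "a div P * P <= a"
    using div_mult_mod_eq[of a P] pos_mod_sign[OF P0, of a] by linarith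
   ultimately have "a div P * P < P ^ (k - 1) * P" by linarith
   then have "a div P < P ^ (k - 1)" using P0 by simp
   then show "(a div P, a mod P) \<in> {0..<P ^ (k - 1)} \<times> {a \<in> F. Q a}"
    using a P0 by (auto simp: pos_imp_zdiv_nonneg_iff)
  qed
  show "(%(q, a). q * P + a) \<in> {0..<P ^ (k - 1)} \<times> {a \<in> F. Q a} \<rightarrow> {a \<in> {0..<P ^ k}. Q (a mod P)}"
  proof (rule funcsetI)
   fix z assume "z \<in> {0..<P ^ (k - 1)} \<times> {a \<in> F. Q a}"
   then obtain q a where z: "z = (q, a)" and qa: "0 <= q" "q < P ^ (k - 1)" "0 <= a" "a < P" "Q a" by auto
   have "q * P + a < (q + 1) * P" using qa by (simp add: algebra_simps)
   also have "... <= P ^ (k - 1) * P" using qa by (intro mult_right_mono) auto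
   finally show "(%(q, a). q * P + a) z \<in> {a \<in> {0..<P ^ k}. Q (a mod P)}" using qa m by (simp add: z)
  qed
 qed (auto simp: div_mult_self1)
 then show ?thesis by (simp add: bij_betw_same_card card_cartesian_product nat_power_eq)
qed

lemma card_nonsq_shift_power:
 assumes "k \<ge> 1" "nzsq r"
 shows "card {a \<in> {0..<P ^ k}. nonsq (a\<^sup>2 - r)} = p ^ (k - 1) * gm"
proof -
 have "nonsq ((a mod P)\<^sup>2 - r) \<longleftrightarrow> nonsq (a\<^sup>2 - r)" for a
  by (rule nonsq_cong) (intro cong_diff cong_pow cong_refl; simp add: cong_def)
 then show ?thesis
  using card_residue_pred[OF assms(1), of "%a. nonsq (a\<^sup>2 - r)"] card_nonsq_shift[OF assms(2)] by simp
qed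

end

section \<open>Quadratic forms modulo m under elementary operations\<close>

definition app :: "nat => (nat => nat => int) => (nat => int) => nat => int" where
 "app n A y i = (\<Sum>j<n. A i j * y j)"

definition bf :: "nat => (nat => nat => int) => (nat => int) => (nat => int) => int" where
 "bf n A x y = (\<Sum>i<n. x i * app n A y i)"

definition shear :: "nat => nat => int => (nat => int) => nat => int" where
 "shear a b c y = y(b := y b + c * y a)"

definition add_col :: "int => nat => nat => int => (nat => nat => int) => nat => nat => int" where
 "add_col m a b c M i j = (if j = a then (M i a + c * M i b) mod m else M i j)"

definition add_row :: "int => nat => nat => int => (nat => nat => int) => nat => nat => int" where
 "add_row m a b c M i j = (if i = a then (M a j + c * M b j) mod m else M i j)"

definition add_both :: "int => nat => nat => int => (nat => nat => int) => nat => nat => int" where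
 "add_both m a b c M = add_row m a b c (add_col m a b c M)"

lemma app_cong: "(!!j. j < n ==> [y j = z j] (mod m)) ==> [app n A y i = app n A z i] (mod m)"
 unfolding app_def by (intro cong_sum cong_scalar_left) simp

lemma bf_cong:
 assumes "!!j. j < n ==> [x j = x' j] (mod m)" "!!j. j < n ==> [y j = y' j] (mod m)"
 shows "[bf n A x y = bf n A x' y'] (mod m)"
 unfolding bf_def using assms by (intro cong_sum cong_mult app_cong) auto

lemma app_add_col:
 assumes "a < n" "b < n"
 shows "[app n (add_col m a b c M) y i = app n M (shear a b c y) i] (mod m)"
proof -
 have "[app n (add_col m a b c M) y i = (\<Sum>j<n. (M i j + (if j = a then c * M i b else 0)) * y j)] (mod m)"
  unfolding app_def by (intro cong_sum cong_scalar_right) (auto simp: add_col_def cong_def)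
 also have "(\<Sum>j<n. (M i j + (if j = a then c * M i b else 0)) * y j) =
   (\<Sum>j<n. M i j * y j) + (\<Sum>j<n. if j = a then c * M i b * y j else 0)"
  unfolding sum.distrib[symmetric] by (intro sum.cong) (auto simp: algebra_simps)
 also have "... = (\<Sum>j<n. M i j * y j) + (\<Sum>j<n. if j = b then M i j * c * y a else 0)"
  using assms by (simp add: sum.delta)
 also have "... = app n M (shear a b c y) i"
  unfolding sum.distrib[symmetric] app_def by (intro sum.cong) (auto simp: shear_def algebra_simps)
 finally show ?thesis .
qed

lemma bf_add_row:
 assumes "a < n" "b < n"
 shows "[bf n (add_row m a b c M) x y = bf n M (shear a b c x) y] (mod m)"
proof -
 have swap: "bf n N x y = (\<Sum>j<n. y j * app n (%i j. N j i) x j)" for N x y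
  unfolding bf_def app_def sum_distrib_left
  by (subst sum.swap) (intro sum.cong refl, simp add: ac_simps)
 have eq: "(%i j. add_row m a b c M j i) = add_col m a b c (%i j. M j i)"
  by (intro ext) (simp add: add_row_def add_col_def)
 show ?thesis unfolding swap eq
  by (intro cong_sum cong_scalar_left app_add_col assms)
qed

lemma bf_add_both:
 assumes "a < n" "b < n"
 shows "[bf n (add_both m a b c M) y y = bf n M (shear a b c y) (shear a b c y)] (mod m)"
proof -
 have "[bf n (add_both m a b c M) y y = bf n (add_col m a b c M) (shear a b c y) y] (mod m)"
  unfolding add_both_def by (rule bf_add_row[OF assms])
 also have "[bf n (add_col m a b c M) (shear a b c y) y = bf n M (shear a b c y) (shear a b c y)] (mod m)"
  unfolding bf_def by (intro cong_sum cong_scalar_left app_add_col assms)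
 finally show ?thesis .
qed

definition inverse_mod :: "int => nat => (nat => nat => int) => (nat => nat => int) => bool" where
 "inverse_mod m n U W \<longleftrightarrow> (ALL y. ALL i<n. [app n U (app n W y) i = y i] (mod m) & [app n W (app n U y) i = y i] (mod m))"

text \<open>Expresses U^T Q0 U = Q modulo m through the values of the quadratic forms, the shape on
  which a shear acts directly. Symmetry serves the pivot search, and the range of the entries lets
  divisibility by m mean equality with 0 at the end.\<close>

definition equiv_form :: "int => nat => (nat => nat => int) => (nat => nat => int) => (nat => nat => int) => bool" where
 "equiv_form m n Q0 Q U \<longleftrightarrow>
   (ALL i<n. ALL j<n. Q i j = Q j i & 0 <= Q i j & Q i j < m) &
   (ALL y. [bf n Q0 (app n U y) (app n U y) = bf n Q y y] (mod m)) &
   (EX W. inverse_mod m n U W)"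

lemma app_eqI: "(!!j. j < n ==> A i j = B i j) ==> app n A y i = app n B y i"
 unfolding app_def by (intro sum.cong) auto

lemma app_eqI': "(!!j. j < n ==> y j = z j) ==> app n A y i = app n A z i"
 unfolding app_def by (intro sum.cong) auto

lemma bf_eqI: "(!!i j. i < n ==> j < n ==> A i j = B i j) ==> bf n A x y = bf n B x y"
 unfolding bf_def by (intro sum.cong refl arg_cong2[where f = "(*)"] app_eqI) auto

lemma bf_eqI': "(!!j. j < n ==> x j = x' j) ==> (!!j. j < n ==> y j = y' j) ==> bf n A x y = bf n A x' y'"
 unfolding bf_def by (intro sum.cong refl arg_cong2[where f = "(*)"] app_eqI') auto

lemma inverse_mod_congI:
 assumes "inverse_mod m n U W" "!!i j. i < n ==> j < n ==> U' i j = U i j"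
 shows "inverse_mod m n U' W"
proof -
 have "app n U' y i = app n U y i" if "i < n" for y i
  using assms(2) that by (intro app_eqI) auto
 moreover from this have "app n W (app n U' y) i = app n W (app n U y) i" for y i
  by (intro app_eqI') auto
 ultimately show ?thesis using assms(1) by (simp add: inverse_mod_def)
qed

lemma equiv_form_congI:
 assumes "equiv_form m n Q0 Q U"
  "!!i j. i < n ==> j < n ==> Q' i j = Q i j" "!!i j. i < n ==> j < n ==> U' i j = U i j"
 shows "equiv_form m n Q0 Q' U'"
proof -
 have U: "app n U' y i = app n U y i" if "i < n" for y i
  using assms(3) that by (intro app_eqI) auto
 have "bf n Q0 (app n U' y) (app n U' y) = bf n Q0 (app n U y) (app n U y)" for y
  using U by (intro bf_eqI') auto
 moreover have "bf n Q' y y = bf n Q y y" for y using assms(2) by (intro bf_eqI) auto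
 moreover obtain W where "inverse_mod m n U W" using assms(1) by (auto simp: equiv_form_def)
 then have "inverse_mod m n U' W" by (rule inverse_mod_congI[OF _ assms(3)])
 then have "EX W. inverse_mod m n U' W" by blast
 ultimately show ?thesis using assms(1,2) unfolding equiv_form_def by simp
qed

lemma equiv_form_init:
 assumes "m > 0" "!!i j. i < n ==> j < n ==> Q0 i j = Q0 j i"
 shows "equiv_form m n Q0 (%i j. Q0 i j mod m) (%i j. if i = j then 1 else 0)"
proof -
 have id: "app n (%i j. if i = j then 1 else 0) y i = y i" if "i < n" for y i
  using that by (simp add: app_def if_distrib[of "%x. x * _"] cong: if_cong)
 have "[bf n Q0 y y = bf n (%i j. Q0 i j mod m) y y] (mod m)" for y
  unfolding bf_def app_def by (intro cong_sum cong_scalar_left cong_scalar_right) (simp add: cong_def)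
 moreover have "bf n Q0 (app n (%i j. if i = j then 1 else 0) y) (app n (%i j. if i = j then 1 else 0) y) = bf n Q0 y y" for y
  by (intro bf_eqI') (auto simp: id)
 moreover have "inverse_mod m n (%i j. if i = j then 1 else 0) (%i j. if i = j then 1 else 0)"
  by (simp add: inverse_mod_def id)
 ultimately show ?thesis using assms by (auto simp: equiv_form_def)
qed

lemma add_both_simps:
 "add_both m a b c Q a a = ((Q a a + c * Q a b) mod m + c * (if b = a then (Q a a + c * Q a b) mod m else (Q b a + c * Q b b) mod m)) mod m"
 "i ~= a ==> add_both m a b c Q i a = (Q i a + c * Q i b) mod m"
 "j ~= a ==> add_both m a b c Q a j = (Q a j + c * Q b j) mod m"
 "i ~= a ==> j ~= a ==> add_both m a b c Q i j = Q i j"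
 by (auto simp: add_both_def add_row_def add_col_def)

lemma inverse_mod_add_col:
 assumes ab: "a < n" "b < n" "a ~= b" and W: "inverse_mod m n U W"
 shows "EX W'. inverse_mod m n (add_col m a b c U) W'"
proof -
 \<comment> \<open>The row operation on \<open>W\<close> that undoes the shear: applying
   \<open>shear a b c\<close> after \<open>W'\<close> gives back \<open>W\<close>.\<close>
 define W' where "W' = (%i j. if i = b then W b j - c * W a j else W i j)"
 have W': "app n W' x i = (if i = b then app n W x b - c * app n W x a else app n W x i)" for x i
  by (auto simp: app_def W'_def sum_subtractf sum_distrib_left algebra_simps)
 have sh: "shear a b c (app n W' x) = app n W x" for x
  using ab by (auto simp: shear_def W' fun_eq_iff)
 show ?thesis unfolding inverse_mod_def
 proof (intro exI[of _ W'] allI impI conjI)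
  fix y i assume i: "i < n"
  have "[app n (add_col m a b c U) (app n W' y) i = app n U (app n W y) i] (mod m)"
   using app_add_col[OF ab(1,2), of m c U "app n W' y" i] unfolding sh .
  also have "[app n U (app n W y) i = y i] (mod m)" using W i by (simp add: inverse_mod_def)
  finally show "[app n (add_col m a b c U) (app n W' y) i = y i] (mod m)" .
  have *: "[app n W (app n (add_col m a b c U) y) j = shear a b c y j] (mod m)" if "j < n" for j
  proof -
   have "[app n W (app n (add_col m a b c U) y) j = app n W (app n U (shear a b c y)) j] (mod m)"
    by (intro app_cong app_add_col ab)
   also have "[app n W (app n U (shear a b c y)) j = shear a b c y j] (mod m)" using W that by (simp add: inverse_mod_def)
   finally show ?thesis .
  qed
  have "[app n W' (app n (add_col m a b c U) y) i =
    (if i = b then shear a b c y b - c * shear a b c y a else shear a b c y i)] (mod m)"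
   unfolding W' using * ab i by (auto intro!: cong_diff cong_scalar_left)
  also have "(if i = b then shear a b c y b - c * shear a b c y a else shear a b c y i) = y i"
   using ab by (auto simp: shear_def)
  finally show "[app n W' (app n (add_col m a b c U) y) i = y i] (mod m)" .
 qed
qed

lemma equiv_form_add:
 assumes "equiv_form m n Q0 Q U" and ab: "a < n" "b < n" "a ~= b" and m: "m > 0"
 shows "equiv_form m n Q0 (add_both m a b c Q) (add_col m a b c U)"
 unfolding equiv_form_def
proof (intro conjI allI impI)
 have Q: "!!i j. i < n ==> j < n ==> Q i j = Q j i & 0 <= Q i j & Q i j < m"
  and F: "!!y. [bf n Q0 (app n U y) (app n U y) = bf n Q y y] (mod m)"
  and W: "EX W. inverse_mod m n U W"
  using assms(1) by (auto simp: equiv_form_def)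
 fix i j assume ij: "i < n" "j < n"
 have sym: "Q a j = Q j a" "Q b j = Q j b" "Q i a = Q a i" "Q i b = Q b i" "Q i j = Q j i" using Q ij ab by auto
 show "add_both m a b c Q i j = add_both m a b c Q j i"
  by (cases "i = a"; cases "j = a") (simp_all add: add_both_simps sym)
 show "0 <= add_both m a b c Q i j" "add_both m a b c Q i j < m"
  using m Q ij by (auto simp: add_both_def add_row_def add_col_def)
next
 have F: "!!y. [bf n Q0 (app n U y) (app n U y) = bf n Q y y] (mod m)"
  using assms(1) by (auto simp: equiv_form_def)
 fix y
 have "[bf n Q0 (app n (add_col m a b c U) y) (app n (add_col m a b c U) y) =
   bf n Q0 (app n U (shear a b c y)) (app n U (shear a b c y))] (mod m)"
  by (intro bf_cong app_add_col ab)
 also have "[bf n Q0 (app n U (shear a b c y)) (app n U (shear a b c y)) = bf n Q (shear a b c y) (shear a b c y)] (mod m)" by (rule F)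
 also have "[bf n Q (shear a b c y) (shear a b c y) = bf n (add_both m a b c Q) y y] (mod m)" by (rule cong_sym[OF bf_add_both[OF ab(1,2)]])
 finally show "[bf n Q0 (app n (add_col m a b c U) y) (app n (add_col m a b c U) y) = bf n (add_both m a b c Q) y y] (mod m)" .
next
 show "EX W. inverse_mod m n (add_col m a b c U) W"
  using assms(1) inverse_mod_add_col[OF ab] by (auto simp: equiv_form_def)
qed

section \<open>Diagonalization of a form over an odd prime power: invariants\<close>

context odd_prime
begin

text \<open>State of the diagonalization: the first \<open>s\<close> basis vectors are split off, and the remaining
 block is divisible by \<open>p\<^sup>e\<close>.\<close>

definition diag_state :: "nat => nat => (nat => nat => int) => nat => nat => (nat => nat => int) => (nat => nat => int) => bool" where
 "diag_state n k Q0 s e Q U \<longleftrightarrow>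
   equiv_form (P ^ k) n Q0 Q U & s <= n & e <= k &
   (ALL i<s. ALL j<n. j ~= i --> Q i j = 0) &
   (ALL i<n. ALL j<n. s <= i --> s <= j --> P ^ e dvd Q i j)"

text \<open>The default exponent k with unit 1 denotes a diagonal entry that is zero modulo p^k. So
  when the remaining block has vanished, the arrays already describe a complete diagonal
  form.\<close>

definition diag_vals :: "nat => nat => nat => nat => (nat => nat => int) => (nat => nat) => (nat => int) => bool" where
 "diag_vals n k s e Q ex un \<longleftrightarrow>
   (ALL i<s. ex i < k & ex i <= e & ~ P dvd un i & Q i i = P ^ ex i * un i) &
   (ALL i<s. ALL j<s. i <= j --> ex i <= ex j) &
   (ALL i<n. s <= i --> ex i = k & un i = 1)"

lemma diag_state_add:
 assumes st: "diag_state n k Q0 s e Q U" and ab: "a < n" "b < n" "a ~= b" "s <= a" "s <= b"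
 shows "diag_state n k Q0 s e (add_both (P ^ k) a b c Q) (add_col (P ^ k) a b c U)"
  "i < s ==> add_both (P ^ k) a b c Q i i = Q i i"
proof -
 have eq: "equiv_form (P ^ k) n Q0 Q U" and s: "s <= n" "e <= k"
  and Z: "!!i j. i < s ==> j < n ==> j ~= i ==> Q i j = 0"
  and D: "!!i j. i < n ==> j < n ==> s <= i ==> s <= j ==> P ^ e dvd Q i j"
  using st by (auto simp: diag_state_def)
 have m: "P ^ k > 0" using p_ge_3 by simp
 have em: "P ^ e dvd P ^ k" using s by (intro le_imp_power_dvd)
 have "add_both (P ^ k) a b c Q i j = 0" if "i < s" "j < n" "j ~= i" for i j
  using that ab Z by (cases "j = a") (auto simp: add_both_simps)
 moreover have "P ^ e dvd add_both (P ^ k) a b c Q i j" if "i < n" "j < n" "s <= i" "s <= j" for i j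
  using that ab D unfolding add_both_def add_row_def add_col_def
  by (auto intro!: dvd_mod em dvd_add dvd_mult)
 ultimately show "diag_state n k Q0 s e (add_both (P ^ k) a b c Q) (add_col (P ^ k) a b c U)"
  using equiv_form_add[OF eq ab(1-3) m] s by (simp add: diag_state_def)
 show "add_both (P ^ k) a b c Q i i = Q i i" if "i < s"
  using that ab by (simp add: add_both_simps)
qed

lemma dvd_mod_power: "j <= k ==> P ^ j dvd x mod P ^ k \<longleftrightarrow> P ^ j dvd x"
 by (simp add: dvd_mod_iff le_imp_power_dvd)

lemma add_both_diag_dvd:
 assumes "j <= k" "a ~= b"
 shows "P ^ j dvd add_both (P ^ k) a b 1 Q a a \<longleftrightarrow> P ^ j dvd Q a a + Q a b + (Q b a + Q b b)"
proof -
 have "add_both (P ^ k) a b 1 Q a a = (Q a a + Q a b + (Q b a + Q b b)) mod P ^ k"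
  using assms by (simp add: add_both_simps mod_simps)
 then show ?thesis using assms by (simp add: dvd_mod_power)
qed

lemma P_power_dvd_2: "P ^ j dvd 2 * x \<longleftrightarrow> P ^ j dvd x"
 using coprime_P_power[of 2 j] by (simp add: coprime_commute coprime_dvd_mult_right_iff)

text \<open>A quadratic polynomial in \<open>c\<close> that vanishes at \<open>c = 0, 1, 2\<close> vanishes identically.\<close>

lemma two_shears:
 assumes ab: "a < n" "b < n" "a ~= b" and sym: "Q a b = Q b a" and j: "j <= k"
  and 0: "P ^ j dvd Q a a"
  and 1: "P ^ j dvd add_both (P ^ k) a b 1 Q a a"
  and 2: "P ^ j dvd add_both (P ^ k) a b 1 (add_both (P ^ k) a b 1 Q) a a"
 shows "P ^ j dvd Q a b" "P ^ j dvd Q b b"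
proof -
 let ?Q = "add_both (P ^ k) a b 1 Q"
 have A: "P ^ j dvd Q a a + Q a b + (Q b a + Q b b)" using 1 add_both_diag_dvd[OF j ab(3)] by blast
 have B: "P ^ j dvd ?Q a a + ?Q a b + (?Q b a + ?Q b b)" using 2 add_both_diag_dvd[OF j ab(3)] by blast
 have r: "?Q a b = (Q a b + Q b b) mod P ^ k" "?Q b a = (Q b a + Q b b) mod P ^ k" "?Q b b = Q b b"
  using ab by (auto simp: add_both_simps)
 have "P ^ j dvd (Q a a + Q a b + (Q b a + Q b b)) - Q a a" by (rule dvd_diff[OF A 0])
 also have "(Q a a + Q a b + (Q b a + Q b b)) - Q a a = 2 * Q a b + Q b b" unfolding sym by simp
 finally have 3: "P ^ j dvd 2 * Q a b + Q b b" .
 have "P ^ j dvd ?Q a a + ?Q a b + (?Q b a + ?Q b b) - ?Q a a" by (rule dvd_diff[OF B 1])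
 also have "?Q a a + ?Q a b + (?Q b a + ?Q b b) - ?Q a a = 2 * ((Q a b + Q b b) mod P ^ k) + Q b b"
  unfolding r unfolding sym by simp
 finally have "P ^ j dvd 2 * ((Q a b + Q b b) mod P ^ k) + Q b b" .
 moreover have "[(Q a b + Q b b) mod P ^ k = Q a b + Q b b] (mod P ^ j)"
  by (rule cong_dvd_modulus[of _ _ "P ^ k"]) (use j in \<open>auto simp: cong_def le_imp_power_dvd\<close>)
 then have "[2 * ((Q a b + Q b b) mod P ^ k) + Q b b = 2 * (Q a b + Q b b) + Q b b] (mod P ^ j)"
  by (rule cong_add[OF cong_scalar_left cong_refl])
 ultimately have 4: "P ^ j dvd 2 * (Q a b + Q b b) + Q b b" using cong_dvd_iff by blast
 have "P ^ j dvd (2 * (Q a b + Q b b) + Q b b) - (2 * Q a b + Q b b)" by (rule dvd_diff[OF 4 3])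
 then show bb: "P ^ j dvd Q b b" by (simp add: P_power_dvd_2)
 have "P ^ j dvd 2 * Q a b + Q b b - Q b b" by (rule dvd_diff[OF 3 bb])
 then show "P ^ j dvd Q a b" by (simp add: P_power_dvd_2)
qed

lemma eliminate_entry:
 assumes e: "e < k" and d: "P ^ e dvd x" "P ^ e dvd q" "~ P ^ Suc e dvd q"
 shows "(x + (- (x div P ^ e) * modular_inverse (P ^ k) (q div P ^ e)) mod P ^ k * q) mod P ^ k = 0"
  "~ P dvd q div P ^ e"
proof -
 obtain u where u: "q = P ^ e * u" using d(2) by blast
 obtain v where v: "x = P ^ e * v" using d(1) by blast
 have P0: "P ^ e ~= 0" using p_ge_3 by simp
 have qu: "q div P ^ e = u" "x div P ^ e = v" using u v P0 by auto
 have nu: "~ P dvd u" using d(3) u by (auto simp: dvd_def mult.assoc power_Suc2 simp del: power_Suc)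
 then show "~ P dvd q div P ^ e" by (simp add: qu)
 have i: "[u * modular_inverse (P ^ k) u = 1] (mod P ^ k)"
  using nu by (intro cong_modular_inverse1 coprime_P_power)
 have "[x + (- v * modular_inverse (P ^ k) u) mod P ^ k * q = x + (- v * modular_inverse (P ^ k) u) * q] (mod P ^ k)"
  by (intro cong_add cong_refl cong_scalar_right) (simp add: cong_def)
 also have "x + (- v * modular_inverse (P ^ k) u) * q = P ^ e * v - P ^ e * v * (u * modular_inverse (P ^ k) u)"
  by (simp add: u v algebra_simps)
 also have "[... = P ^ e * v - P ^ e * v * 1] (mod P ^ k)"
  by (intro cong_diff cong_refl cong_scalar_left i)
 finally show "(x + (- (x div P ^ e) * modular_inverse (P ^ k) (q div P ^ e)) mod P ^ k * q) mod P ^ k = 0"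
  by (simp add: qu cong_def)
qed

definition diagonal_form :: "nat => nat => (nat => nat => int) => (nat => nat => int) => (nat => nat) => (nat => int) => bool" where
 "diagonal_form n k Q0 U ex un \<longleftrightarrow>
   (ALL i<n. ex i <= k & ~ P dvd un i) & (ALL i j. i <= j --> j < n --> ex i <= ex j) &
   (ALL y. [bf n Q0 (app n U y) (app n U y) = (\<Sum>i<n. P ^ ex i * un i * (y i)\<^sup>2)] (mod P ^ k)) &
   (EX W. inverse_mod (P ^ k) n U W)"

lemma diagonal_form_final:
 assumes st: "diag_state n k Q0 s e Q U" and v: "diag_vals n k s e Q ex un" and fin: "s = n | e = k"
 shows "diagonal_form n k Q0 U ex un"
proof -
 have sn: "s <= n" and eq: "equiv_form (P ^ k) n Q0 Q U" using st by (auto simp: diag_state_def)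
 have Q: "!!i j. i < n ==> j < n ==> Q i j = Q j i & 0 <= Q i j & Q i j < P ^ k"
  and F: "!!y. [bf n Q0 (app n U y) (app n U y) = bf n Q y y] (mod P ^ k)"
  using eq by (auto simp: equiv_form_def)
 \<comment> \<open>Either no index is left, or the entry lies in [0, p^k) and is divisible by
   p^k.\<close>
 have big: "Q i j = 0" if "i < n" "j < n" "s <= i" "s <= j" for i j
 proof -
  have "P ^ k dvd Q i j" using st fin that by (auto simp: diag_state_def)
  then show ?thesis using Q[OF that(1,2)] zdvd_not_zless[of "Q i j" "P ^ k"] by (cases "Q i j = 0") auto
 qed
 have off: "Q i j = 0" if ij: "i < n" "j < n" "i ~= j" for i j
 proof -
  consider "i < s" | "j < s" | "s <= i" "s <= j" by linarith
  then show ?thesis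
  proof cases
   case 1
   then show ?thesis using st ij by (auto simp: diag_state_def)
  next
   case 2
   then have "Q j i = 0" using st ij by (auto simp: diag_state_def)
   then show ?thesis using Q ij by auto
  qed (use big ij in auto)
 qed
 have dg: "[Q i i = P ^ ex i * un i] (mod P ^ k)" if "i < n" for i
 proof (cases "i < s")
  case True
  then show ?thesis using v by (auto simp: diag_vals_def)
 next
  case False
  then have "Q i i = 0" "ex i = k" using big that v by (auto simp: diag_vals_def)
  then show ?thesis by (simp add: cong_def)
 qed
 have diag: "[bf n Q y y = (\<Sum>i<n. P ^ ex i * un i * (y i)\<^sup>2)] (mod P ^ k)" for y
 proof -
  have "bf n Q y y = (\<Sum>i<n. Q i i * (y i)\<^sup>2)"
   unfolding bf_def
  proof (rule sum.cong[OF refl])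
   fix i assume i: "i \<in> {..<n}"
   have "app n Q y i = (\<Sum>j<n. if j = i then Q i i * y i else 0)"
    unfolding app_def using off i by (intro sum.cong) auto
   then show "y i * app n Q y i = Q i i * (y i)\<^sup>2" using i by (simp add: power2_eq_square)
  qed
  also have "[... = (\<Sum>i<n. P ^ ex i * un i * (y i)\<^sup>2)] (mod P ^ k)"
   by (intro cong_sum cong_scalar_right dg) auto
  finally show ?thesis .
 qed
 moreover have "ex i <= k & ~ P dvd un i" if "i < n" for i
 proof (cases "i < s")
  case True
  then show ?thesis using v by (auto simp: diag_vals_def less_imp_le)
 next
  case False
  then show ?thesis using v that by (auto simp: diag_vals_def)
 qed
 moreover have "ex i <= ex j" if "i <= j" "j < n" for i j
 proof (cases "j < s")
  case True
  then show ?thesis using v that by (auto simp: diag_vals_def)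
 next
  case False
  then have "ex j = k" using v that by (auto simp: diag_vals_def)
  then show ?thesis using calculation(2)[of i] that by simp
 qed
 moreover have "EX W. inverse_mod (P ^ k) n U W" using eq by (auto simp: equiv_form_def)
 ultimately show ?thesis unfolding diagonal_form_def
  using cong_trans[OF F diag] by simp
qed

end

section \<open>Programs for the diagonalization\<close>

abbreviation (input) plus_e (infixl "+." 65) where "a +. b == Op Add a b"
abbreviation (input) minus_e (infixl "-." 65) where "a -. b == Op Sub a b"
abbreviation (input) times_e (infixl "*." 70) where "a *. b == Op Mul a b"
abbreviation (input) radd_e (infixl "+:" 65) where "a +: b == Op RAdd a b"
abbreviation (input) rmul_e (infixl "*:" 70) where "a *: b == Op RMul a b"
abbreviation (input) div_e (infixl "div." 70) where "a div. b == Op Div a b"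
abbreviation (input) mod_e (infixl "mod." 70) where "a mod. b == Op binop.Mod a b"
abbreviation (input) less_e (infix "<." 50) where "a <. b == Op Less a b"
abbreviation (input) assign_s (infix "<--" 61) where "x <-- e == PAsg x (Lit 0) e"

definition big_e :: "expr => expr" where "big_e e = e mod. V ''BIG''"
definition not_e :: "expr => expr" where "not_e a = (Lit 1 -. a)"
text \<open>Here and in \<open>or_e\<close>, the comparison at the top returns 0 or 1 and makes the
  expression \<open>short\<close>; a bare sum of truth values would not be accepted in an
  assignment.\<close>

definition eq_e :: "expr => expr => expr" where "eq_e a b = ((a <. b) +. (b <. a) <. Lit 1)"
definition or_e :: "expr => expr => expr" where "or_e a b = (Lit 0 <. a +. b)"
definition entry :: "expr => expr => expr" where "entry i j = (i *. V ''n'' +. j)"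
definition elem :: "vname => vname => expr" where "elem x i = Cell x (V i)"

lemma eval_e [simp]:
 "Defs.eval m s (big_e a) = Defs.eval m s a mod s ''BIG'' 0"
 "Defs.eval m s (not_e a) = 1 - Defs.eval m s a"
 "Defs.eval m s (eq_e a b) = (if Defs.eval m s a = Defs.eval m s b then 1 else 0)"
 "Defs.eval m s (entry a b) = Defs.eval m s a * s ''n'' 0 + Defs.eval m s b"
 "Defs.eval m s (elem x i) = s x (s i 0)"
 by (simp_all add: big_e_def not_e_def eq_e_def entry_def elem_def)

lemma eval_or [simp]:
 "Defs.eval m s (or_e a b) = (if Defs.eval m s a + Defs.eval m s b > 0 then 1 else 0)"
 by (simp add: or_e_def)

lemmas expr_defs = big_e_def not_e_def eq_e_def or_e_def entry_def elem_def

definition powers_c :: pcom where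
 "powers_c = (PAsg ''pw'' (Lit 0) (Lit 1) ;;
   PFor ''i'' ''k'' (PAsg ''pw'' (V ''i'' +. Lit 1) (big_e (elem ''pw'' ''i'' *. V ''p''))))"

definition init_c :: pcom where
 "init_c =
   (PFor ''i'' ''n'' (PFor ''j'' ''n''
    (PAsg ''Q'' (entry (V ''i'') (V ''j'')) (Cell ''Q'' (entry (V ''i'') (V ''j'')) +: Lit 0) ;;
    PAsg ''U'' (entry (V ''i'') (V ''j'')) (eq_e (V ''i'') (V ''j'')))) ;;
   PFor ''i'' ''n'' (PAsg ''ex'' (V ''i'') (V ''k'') ;; PAsg ''un'' (V ''i'') (Lit 1)))"

definition add_col_c :: "vname => pcom" where
 "add_col_c x = PFor ''h'' ''n''
   (PAsg x (entry (V ''h'') (V ''a''))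
    (Cell x (entry (V ''h'') (V ''a'')) +: V ''c'' *. Cell x (entry (V ''h'') (V ''b''))))"

definition add_row_c :: "vname => pcom" where
 "add_row_c x = PFor ''h'' ''n''
   (PAsg x (entry (V ''a'') (V ''h''))
    (Cell x (entry (V ''a'') (V ''h'')) +: V ''c'' *. Cell x (entry (V ''b'') (V ''h''))))"

definition add_c :: pcom where
 "add_c = (add_col_c ''Q'' ;; add_row_c ''Q'' ;; add_col_c ''U'')"

definition residual :: "expr => expr" where
 "residual q = q mod. Cell ''pw'' (V ''e'' +. Lit 1)"

definition pivot_e :: expr where
 "pivot_e = Cell ''Q'' (entry (V ''s'') (V ''s''))"

definition scan_c :: pcom where
 "scan_c = (''fnd'' <-- Lit 0 ;;
   PFor ''i'' ''n'' (PFor ''j'' ''n''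
    (PIf ((V ''s'' <. V ''i'' +. Lit 1) *. (V ''i'' <. V ''j'' +. Lit 1) *.
       residual (Cell ''Q'' (entry (V ''i'') (V ''j''))))
     (''y'' <-- V ''i'' ;; ''z'' <-- V ''j'' ;; ''fnd'' <-- Lit 1) PSkip)))"

definition shear_c :: "vname => pcom" where
 "shear_c x = PIf (eq_e (residual pivot_e) (Lit 0) *. not_e (eq_e (V x) (V ''s'')))
   (''a'' <-- V ''s'' ;; ''b'' <-- V x ;; ''c'' <-- Lit 1 ;; add_c) PSkip"

text \<open>The scan has stored in y and z the position of an entry not divisible by p^(e+1). Each
  shear acts only while the pivot is still divisible by p^(e+1); the order of the five is explained
  by \<open>pivot_found\<close>.\<close>

definition pivot_c :: pcom where
 "pivot_c = (shear_c ''z'' ;; shear_c ''z'' ;; shear_c ''y'' ;; shear_c ''z'' ;; shear_c ''z'')"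

definition eliminate_c :: pcom where
 "eliminate_c =
   (PAsg ''un'' (V ''s'') (pivot_e div. elem ''pw'' ''e'') ;;
   PAsg ''ex'' (V ''s'') (V ''e'') ;;
   PFor ''j'' ''n'' (PIf (V ''s'' <. V ''j'')
    (''c'' <-- (Lit 0 -. Cell ''Q'' (entry (V ''s'') (V ''j'')) div. elem ''pw'' ''e'') *: RInv (elem ''un'' ''s'') ;;
     ''a'' <-- V ''j'' ;; ''b'' <-- V ''s'' ;; add_c) PSkip) ;;
   ''s'' <-- big_e (V ''s'' +. Lit 1))"

text \<open>An iteration that does something either splits off a basis vector or raises e, so n + k
  iterations suffice. Each costs O(n^2), including the elimination of up to n columns at O(n) each,
  and (n + k) n^2 stays within a constant times n^3 + n k^3.\<close>

definition diag_c :: pcom where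
 "diag_c = (''s'' <-- Lit 0 ;; ''e'' <-- Lit 0 ;;
   PFor ''it'' ''nk'' (PIf ((V ''s'' <. V ''n'') *. (V ''e'' <. V ''k''))
    (scan_c ;; PIf (V ''fnd'') (pivot_c ;; eliminate_c) (''e'' <-- big_e (V ''e'' +. Lit 1))) PSkip))"

lemmas diag_defs = powers_c_def init_c_def add_col_c_def add_row_c_def add_c_def residual_def pivot_e_def
 scan_c_def shear_c_def pivot_c_def eliminate_c_def diag_c_def

lemma mods_diag [simp]:
 "mods powers_c = {''pw'', ''i''}"
 "mods init_c = {''Q'', ''U'', ''i'', ''j'', ''ex'', ''un''}"
 "mods (add_col_c x) = {x, ''h''}" "mods (add_row_c x) = {x, ''h''}"
 "mods add_c = {''Q'', ''U'', ''h''}"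
 "mods scan_c = {''fnd'', ''i'', ''j'', ''y'', ''z''}"
 "mods (shear_c x) = {''a'', ''b'', ''c'', ''Q'', ''U'', ''h''}"
 "mods pivot_c = {''a'', ''b'', ''c'', ''Q'', ''U'', ''h''}"
 "mods eliminate_c = {''un'', ''ex'', ''j'', ''c'', ''a'', ''b'', ''Q'', ''U'', ''h'', ''s''}"
 "mods diag_c = {''s'', ''e'', ''it'', ''fnd'', ''i'', ''j'', ''y'', ''z'', ''a'', ''b'', ''c'', ''Q'', ''U'', ''h'', ''un'', ''ex''}"
 by (auto simp: diag_defs)

lemma wf_diag [simp]:
 "wf powers_c" "wf init_c" "wf add_c" "wf scan_c" "wf (shear_c ''z'')" "wf (shear_c ''y'')" "wf pivot_c" "wf eliminate_c" "wf diag_c"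
 by (simp_all add: diag_defs expr_defs read_only_def)

lemma wf_add_col [simp]: "x ~: read_only ==> ''h'' ~= x ==> wf (add_col_c x)" "x ~: read_only ==> ''h'' ~= x ==> wf (add_row_c x)"
 by (simp_all add: diag_defs expr_defs read_only_def)

section \<open>Correctness of the diagonalization program\<close>

locale machine = odd_prime p for p +
 fixes n k lg l1 :: nat and t B :: int
 assumes k_pos: "k \<ge> 1" and n_pos: "n \<ge> 1" and lg: "P < 2 ^ lg"
  and t: "0 <= t" "t < P ^ k"
  and B_large: "P ^ k < B" "int n + int k + 5 < B"
begin

abbreviation m :: int where "m == P ^ k"

definition base :: "store => bool" where
 "base s \<longleftrightarrow> s ''n'' 0 = int n & s ''k'' 0 = int k & s ''p'' 0 = P & s ''t'' 0 = t & s ''lg'' 0 = int lg &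
   s ''nk'' 0 = int (n + k) & s ''cl'' 0 = int ((n + 1) * k) & s ''l1'' 0 = int l1 & s ''T'' 0 = 200 &
   s ''m'' 0 = m & s ''BIG'' 0 = B"

lemma base_cong: "(!!x. x \<in> read_only ==> s' x = s x) ==> base s' \<longleftrightarrow> base s"
 by (simp add: base_def read_only_def)

lemma base_upd [simp]: "x ~: read_only ==> base (upd x i v s) \<longleftrightarrow> base s"
 by (intro base_cong upd_other) auto

lemma base_run [simp]: "wf c ==> base (run m' c s) \<longleftrightarrow> base s"
 using wf_mods by (intro base_cong run_frame) blast

lemma baseD:
 assumes "base s"
 shows "s ''n'' 0 = int n" "s ''k'' 0 = int k" "s ''p'' 0 = P" "s ''t'' 0 = t" "s ''lg'' 0 = int lg"
  "s ''nk'' 0 = int (n + k)" "s ''cl'' 0 = int ((n + 1) * k)" "s ''l1'' 0 = int l1" "s ''T'' 0 = 200"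
  "s ''m'' 0 = m" "s ''BIG'' 0 = B"
 using assms by (simp_all add: base_def)

lemma m_pos: "m > 0" using p_ge_3 by simp

lemma P_power_le: "i <= k ==> P ^ i <= m"
 using p_ge_3 by (intro power_increasing) auto

lemma read_only_mem [simp]: "''n'' \<in> read_only" "''k'' \<in> read_only" "''p'' \<in> read_only" "''t'' \<in> read_only" "''lg'' \<in> read_only"
  "''nk'' \<in> read_only" "''cl'' \<in> read_only" "''l1'' \<in> read_only" "''T'' \<in> read_only" "''m'' \<in> read_only" "''BIG'' \<in> read_only"
 by (simp_all add: read_only_def)

definition pows :: "store => bool" where
 "pows s \<longleftrightarrow> base s & (\<forall>i\<le>k. s ''pw'' (int i) = P ^ i)"

lemma pows_upd [simp]: "x ~: read_only ==> x ~= ''pw'' ==> pows (upd x i v s) \<longleftrightarrow> pows s"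
 by (simp add: pows_def upd_simps)

lemma pows_run [simp]: "wf c ==> ''pw'' ~: mods c ==> pows (run m' c s) \<longleftrightarrow> pows s"
 by (simp add: pows_def run_frame)

lemma run_powers:
 assumes "base s"
 shows "pows (run m powers_c s)"
proof -
 let ?b = "PAsg ''pw'' (V ''i'' +. Lit 1) (big_e (elem ''pw'' ''i'' *. V ''p''))"
 let ?s = "upd ''pw'' 0 1 s"
 define I where "I = (%j u. base u & (\<forall>i\<le>j. u ''pw'' (int i) = P ^ i))"
 have N: "nat (?s ''k'' 0) = k" using assms by (simp add: upd_simps baseD)
 have "I (nat (?s ''k'' 0)) (run m (PFor ''i'' ''k'' ?b) ?s)"
 proof (rule run_For_induct[where I = I])
  show "I 0 (upd ''i'' 0 0 ?s)" using assms by (simp add: I_def upd_simps read_only_def)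
 next
  fix j u assume j: "j < nat (?s ''k'' 0)" and I: "I j u" and i: "u ''i'' 0 = int j"
  have b: "base u" and p: "!!i. i <= j ==> u ''pw'' (int i) = P ^ i" using I by (auto simp: I_def)
  \<comment> \<open>No power that is stored exceeds m < B, so the reduction modulo
    \<open>BIG\<close> leaves it unchanged.\<close>
  have "P ^ Suc j <= m" using j N by (intro P_power_le) simp
  then have "P ^ j * P mod B = P ^ Suc j" using B_large p_ge_3 by (simp add: mult.commute)
  then show "I (Suc j) (upd ''i'' 0 (int j + 1) (run m ?b u))"
   using b p i by (auto simp: I_def upd_simps baseD read_only_def le_Suc_eq)
 qed simp
 then show ?thesis by (simp add: N powers_c_def pows_def I_def)
qed

definition mt :: "store => vname => nat => nat => int" where
 "mt s x i j = s x (int i * int n + int j)"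

lemma entry_eq_iff:
 assumes "j < n" "j' < n"
 shows "int i * int n + int j = int i' * int n + int j' \<longleftrightarrow> i = i' & j = j'"
proof
 assume "int i * int n + int j = int i' * int n + int j'"
 then have eq: "i * n + j = i' * n + j'" by (metis of_nat_add of_nat_eq_iff of_nat_mult)
 have "(i * n + j) div n = i" "(i * n + j) mod n = j" "(i' * n + j') div n = i'" "(i' * n + j') mod n = j'"
  using assms by auto
 then show "i = i' & j = j'" using eq by metis
qed auto

lemma mt_upd:
 "j < n ==> j' < n ==> mt (upd x (int i * int n + int j) v s) x i' j' = (if i' = i & j' = j then v else mt s x i' j')"
 by (simp add: mt_def upd_simps entry_eq_iff)

lemma mt_upd_other [simp]: "x ~= y ==> mt (upd y i v s) x = mt s x"
 by (simp add: mt_def upd_simps fun_eq_iff)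

lemma mt_run [simp]: "x ~: mods c ==> mt (run m' c s) x = mt s x"
 by (simp add: mt_def run_frame fun_eq_iff)

lemma run_add_col:
 assumes s: "base s" "s ''a'' 0 = int a" "s ''b'' 0 = int b" "s ''c'' 0 = c" "a < n" "b < n" "a ~= b"
  and x: "x ~: read_only" "x ~: {''a'', ''b'', ''c'', ''h''}" and ij: "i < n" "j < n"
 shows "mt (run m (add_col_c x) s) x i j = add_col m a b c (mt s x) i j"
proof -
 let ?b = "PAsg x (entry (V ''h'') (V ''a''))
    (Cell x (entry (V ''h'') (V ''a'')) +: V ''c'' *. Cell x (entry (V ''h'') (V ''b'')))"
 define I where "I = (%h u. base u & u ''a'' = s ''a'' & u ''b'' = s ''b'' & u ''c'' = s ''c'' &
   (ALL i<n. ALL j<n. mt u x i j = (if i < h then add_col m a b c (mt s x) i j else mt s x i j)))"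
 have x': "''a'' ~= x" "''b'' ~= x" "''c'' ~= x" "''h'' ~= x" using x by auto
 have N: "nat (s ''n'' 0) = n" using s by (simp add: baseD)
 have "I (nat (s ''n'' 0)) (run m (PFor ''h'' ''n'' ?b) s)"
 proof (rule run_For_induct[where I = I])
  show "I 0 (upd ''h'' 0 0 s)" using s x x' by (simp add: I_def upd_other read_only_def)
 next
  fix h u assume h: "h < nat (s ''n'' 0)" and I: "I h u" and i: "u ''h'' 0 = int h"
  have b: "base u" and e: "u ''a'' 0 = int a" "u ''b'' 0 = int b" "u ''c'' 0 = c" "u ''a'' = s ''a''" "u ''b'' = s ''b''" "u ''c'' = s ''c''"
   and M: "!!i j. i < n ==> j < n ==> mt u x i j = (if i < h then add_col m a b c (mt s x) i j else mt s x i j)"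
   using I s by (auto simp: I_def)
  have hn: "h < n" using h N by simp
  have u: "u x (int h * int n + int a) = mt s x h a" "u x (int h * int n + int b) = mt s x h b"
   using M[OF hn s(5)] M[OF hn s(6)] by (simp_all add: mt_def)
  have r: "run m ?b u = upd x (int h * int n + int a) ((mt s x h a + c * mt s x h b) mod m) u"
   using e b i by (simp add: baseD u)
  have "mt (run m ?b u) x i j = (if i < Suc h then add_col m a b c (mt s x) i j else mt s x i j)" if "i < n" "j < n" for i j
   unfolding r using M[OF that] that s(5) hn by (auto simp: mt_upd add_col_def less_Suc_eq)
  then show "I (Suc h) (upd ''h'' 0 (int h + 1) (run m ?b u))"
   using b e x x' unfolding I_def by (simp add: upd_other read_only_def)
 qed (use x' in simp)
 then show ?thesis using ij by (simp add: N add_col_c_def I_def)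
qed

lemma run_add_row:
 assumes s: "base s" "s ''a'' 0 = int a" "s ''b'' 0 = int b" "s ''c'' 0 = c" "a < n" "b < n" "a ~= b"
  and x: "x ~: read_only" "x ~: {''a'', ''b'', ''c'', ''h''}" and ij: "i < n" "j < n"
 shows "mt (run m (add_row_c x) s) x i j = add_row m a b c (mt s x) i j"
proof -
 let ?b = "PAsg x (entry (V ''a'') (V ''h''))
    (Cell x (entry (V ''a'') (V ''h'')) +: V ''c'' *. Cell x (entry (V ''b'') (V ''h'')))"
 define I where "I = (%h u. base u & u ''a'' = s ''a'' & u ''b'' = s ''b'' & u ''c'' = s ''c'' &
   (ALL i<n. ALL j<n. mt u x i j = (if j < h then add_row m a b c (mt s x) i j else mt s x i j)))"
 have x': "''a'' ~= x" "''b'' ~= x" "''c'' ~= x" "''h'' ~= x" using x by auto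
 have N: "nat (s ''n'' 0) = n" using s by (simp add: baseD)
 have "I (nat (s ''n'' 0)) (run m (PFor ''h'' ''n'' ?b) s)"
 proof (rule run_For_induct[where I = I])
  show "I 0 (upd ''h'' 0 0 s)" using s x x' by (simp add: I_def upd_other read_only_def)
 next
  fix h u assume h: "h < nat (s ''n'' 0)" and I: "I h u" and i: "u ''h'' 0 = int h"
  have b: "base u" and e: "u ''a'' 0 = int a" "u ''b'' 0 = int b" "u ''c'' 0 = c" "u ''a'' = s ''a''" "u ''b'' = s ''b''" "u ''c'' = s ''c''"
   and M: "!!i j. i < n ==> j < n ==> mt u x i j = (if j < h then add_row m a b c (mt s x) i j else mt s x i j)"
   using I s by (auto simp: I_def)
  have hn: "h < n" using h N by simp
  have u: "u x (int a * int n + int h) = mt s x a h" "u x (int b * int n + int h) = mt s x b h"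
   using M[OF s(5) hn] M[OF s(6) hn] by (simp_all add: mt_def)
  have r: "run m ?b u = upd x (int a * int n + int h) ((mt s x a h + c * mt s x b h) mod m) u"
   using e b i by (simp add: baseD u)
  have "mt (run m ?b u) x i j = (if j < Suc h then add_row m a b c (mt s x) i j else mt s x i j)" if "i < n" "j < n" for i j
   unfolding r using M[OF that] that s(5) hn by (auto simp: mt_upd add_row_def less_Suc_eq)
  then show "I (Suc h) (upd ''h'' 0 (int h + 1) (run m ?b u))"
   using b e x x' unfolding I_def by (simp add: upd_other read_only_def)
 qed (use x' in simp)
 then show ?thesis using ij by (simp add: N add_row_c_def I_def)
qed

lemma run_add:
 assumes s: "base s" "s ''a'' 0 = int a" "s ''b'' 0 = int b" "s ''c'' 0 = c" "a < n" "b < n" "a ~= b"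
  and ij: "i < n" "j < n"
 shows "mt (run m add_c s) ''Q'' i j = add_both m a b c (mt s ''Q'') i j"
  "mt (run m add_c s) ''U'' i j = add_col m a b c (mt s ''U'') i j"
proof -
 let ?s1 = "run m (add_col_c ''Q'') s" let ?s2 = "run m (add_row_c ''Q'') ?s1"
 have ro: "''Q'' ~: read_only" "''U'' ~: read_only" by (auto simp: read_only_def)
 have 1: "mt ?s1 ''Q'' i j = add_col m a b c (mt s ''Q'') i j" if "i < n" "j < n" for i j
  using run_add_col[OF s ro(1) _ that] by simp
 have b1: "base ?s1" "?s1 ''a'' 0 = int a" "?s1 ''b'' 0 = int b" "?s1 ''c'' 0 = c"
  using s ro by (simp_all add: run_frame)
 have "mt ?s2 ''Q'' i j = add_row m a b c (mt ?s1 ''Q'') i j"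
  using run_add_row[OF b1 s(5-7) ro(1) _ ij] by simp
 also have "... = add_both m a b c (mt s ''Q'') i j"
  unfolding add_both_def using 1 ij s(5-7) by (simp add: add_row_def)
 finally have 2: "mt ?s2 ''Q'' i j = add_both m a b c (mt s ''Q'') i j" .
 have b2: "base ?s2" "?s2 ''a'' 0 = int a" "?s2 ''b'' 0 = int b" "?s2 ''c'' 0 = c"
  using b1 ro by (simp_all add: run_frame)
 show "mt (run m add_c s) ''Q'' i j = add_both m a b c (mt s ''Q'') i j"
  by (simp add: add_c_def 2)
 show "mt (run m add_c s) ''U'' i j = add_col m a b c (mt s ''U'') i j"
  using run_add_col[OF b2 s(5-7) ro(2) _ ij] by (simp add: add_c_def)
qed

end

lemma For_inv:
 assumes N: "s N 0 = int M" and i: "i ~: mods b" and 0: "I 0 (upd i 0 0 s)"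
  and step: "!!j u. j < M ==> I j u ==> u i 0 = int j ==> (!!x. x ~: mods b ==> x ~= i ==> u x = s x) ==>
   I (Suc j) (upd i 0 (int j + 1) (run m b u))"
 shows "I M (run m (PFor i N b) s)"
proof -
 define I' where "I' = (%j u. I j u & (ALL x. x ~: mods b --> x ~= i --> u x = s x))"
 have "I' (nat (s N 0)) (run m (PFor i N b) s)"
 proof (rule run_For_induct[where I = I'])
  show "I' 0 (upd i 0 0 s)" using 0 by (simp add: I'_def upd_other)
 next
  fix j u assume "j < nat (s N 0)" "I' j u" "u i 0 = int j"
  then show "I' (Suc j) (upd i 0 (int j + 1) (run m b u))"
   using step[of j u] N by (auto simp: I'_def upd_other run_frame)
 qed (rule i)
 then show ?thesis using N by (simp add: I'_def)
qed

context odd_prime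
begin

definition shear_mat :: "nat => nat => nat => nat => (nat => nat => int) => nat => nat => int" where
 "shear_mat k j s x Q = (if P ^ j dvd Q s s & x ~= s then add_both (P ^ k) s x 1 Q else Q)"

lemma shear_mat_stable:
 "~ P ^ j dvd Q s s ==> shear_mat k j s x Q = Q"
 by (simp add: shear_mat_def)

text \<open>Suppose the pivot stays divisible throughout. Then the first two shears with z force, by
  \<open>two_shears\<close>, the entries (s,z) and (z,z) to be divisible. Adding y to s brings the
  entry (y,z) to position (s,z), up to a divisible term, and the last two shears with z force this
  entry to be divisible as well, a contradiction.\<close>

lemma pivot_found:
 assumes sym: "!!i i'. i < n ==> i' < n ==> Q i i' = Q i' i"
  and sn: "s <= y" "y <= z" "z < n" and j: "j <= k" and nd: "~ P ^ j dvd Q y z"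
 shows "~ P ^ j dvd shear_mat k j s z (shear_mat k j s z (shear_mat k j s y (shear_mat k j s z (shear_mat k j s z Q)))) s s"
  (is "~ P ^ j dvd ?E s s")
proof
 let ?A = "%x. add_both (P ^ k) s x 1"
 assume d: "P ^ j dvd ?E s s"
 have dA: "P ^ j dvd Q s s"
  using d shear_mat_stable[of j Q s k] by metis
 have zs: "z ~= s" using nd dA sn by (metis le_antisym)
 define A1 where "A1 = ?A z Q"
 have 1: "shear_mat k j s z Q = A1" using dA zs by (simp add: shear_mat_def A1_def)
 have d1: "P ^ j dvd A1 s s" using d shear_mat_stable[of j A1 s k] unfolding 1 by metis
 define A2 where "A2 = ?A z A1"
 have 2: "shear_mat k j s z A1 = A2" using d1 zs by (simp add: shear_mat_def A2_def)
 have d2: "P ^ j dvd A2 s s" using d shear_mat_stable[of j A2 s k] unfolding 1 2 by metis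
 have sn': "s < n" using sn by simp
 have T: "P ^ j dvd Q s z" "P ^ j dvd Q z z"
  using two_shears[OF sn' sn(3) _ sym[OF sn' sn(3)] j dA] d1 d2 zs unfolding A1_def A2_def by auto
 have yz: "y ~= z" "y ~= s" using T nd by auto
 define A3 where "A3 = ?A y A2"
 have 3: "shear_mat k j s y A2 = A3" using d2 yz by (simp add: shear_mat_def A3_def)
 have d3: "P ^ j dvd A3 s s" using d shear_mat_stable[of j A3 s k] unfolding 1 2 3 by metis
 define A4 where "A4 = ?A z A3"
 have 4: "shear_mat k j s z A3 = A4" using d3 zs by (simp add: shear_mat_def A4_def)
 have d4: "P ^ j dvd A4 s s" using d shear_mat_stable[of j A4 s k] unfolding 1 2 3 4 by metis
 have 5: "shear_mat k j s z A4 = ?A z A4" using d4 zs by (simp add: shear_mat_def)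
 have d5: "P ^ j dvd ?A z A4 s s" using d unfolding 1 2 3 4 5 .
 have c1: "A1 s z = (Q s z + Q z z) mod P ^ k" "A1 z s = (Q z s + Q z z) mod P ^ k" "A1 z z = Q z z" "A1 y z = Q y z" "A1 z y = Q z y"
  using zs yz by (auto simp: A1_def add_both_simps)
 have c2: "A2 s z = (A1 s z + A1 z z) mod P ^ k" "A2 z s = (A1 z s + A1 z z) mod P ^ k" "A2 z z = Q z z" "A2 y z = Q y z" "A2 z y = Q z y"
  using zs yz by (auto simp: A2_def add_both_simps c1)
 have c3: "A3 s z = (A2 s z + A2 y z) mod P ^ k" "A3 z s = (A2 z s + A2 z y) mod P ^ k"
  using zs yz by (auto simp: A3_def add_both_simps)
 have yn: "y < n" using sn by simp
 have s3: "A3 s z = A3 z s"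
  unfolding c3 c2 c1 using sym[OF sn' sn(3)] sym[OF yn sn(3)] by simp
 have "P ^ j dvd A3 s z"
  using two_shears(1)[OF sn' sn(3) _ s3 j d3] d4 d5 zs unfolding A4_def by auto
 then have 6: "P ^ j dvd A2 s z + A2 y z" unfolding c3 using j by (simp add: dvd_mod_power)
 have "P ^ j dvd A1 s z + A1 z z" unfolding c1 using T j by (intro dvd_add) (auto simp: dvd_mod_power)
 then have "P ^ j dvd A2 s z" unfolding c2 using j by (simp add: dvd_mod_power)
 with 6 have "P ^ j dvd A2 y z" by (simp add: dvd_add_right_iff)
 then show False using nd by (simp add: c2)
qed

lemma diag_state_congI:
 assumes "diag_state n k Q0 s e Q U"
  "!!i j. i < n ==> j < n ==> Q' i j = Q i j" "!!i j. i < n ==> j < n ==> U' i j = U i j"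
 shows "diag_state n k Q0 s e Q' U'"
proof -
 have "equiv_form (P ^ k) n Q0 Q' U'"
  by (rule equiv_form_congI[OF _ assms(2,3)]) (use assms(1) in \<open>auto simp: diag_state_def\<close>)
 then show ?thesis using assms(1,2) by (auto simp: diag_state_def)
qed

end

context machine
begin

lemma loop:
 assumes s: "base s" and N: "s N 0 = int M" and w: "wf (PFor i N b)" and 0: "I 0 (upd i 0 0 s)"
  and step: "!!j u. j < M ==> I j u ==> u i 0 = int j ==> base u ==> (!!x. x ~: mods b ==> x ~= i ==> u x = s x) ==>
   I (Suc j) (upd i 0 (int j + 1) (run m b u))"
 shows "I M (run m (PFor i N b) s)"
proof (rule For_inv[where I = I and b = b and i = i and N = N and s = s, OF N _ 0])
 show "i ~: mods b" using w by simp
 fix j u assume *: "j < M" "I j u" "u i 0 = int j" "!!x. x ~: mods b ==> x ~= i ==> u x = s x"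
 have "base u \<longleftrightarrow> base s"
  by (intro base_cong *(4)) (use w wf_mods[of b] in auto)
 then show "I (Suc j) (upd i 0 (int j + 1) (run m b u))" using step[OF *(1-3)] * s by blast
qed

lemma wf_simps: "x ~: read_only \<longleftrightarrow> x ~= ''n'' & x ~= ''k'' & x ~= ''p'' & x ~= ''t'' & x ~= ''lg'' &
  x ~= ''nk'' & x ~= ''cl'' & x ~= ''l1'' & x ~= ''T'' & x ~= ''m'' & x ~= ''BIG''"
 by (simp add: read_only_def)

lemma run_init:
 assumes s: "base s"
 shows "!!i j. i < n ==> j < n ==> mt (run m init_c s) ''Q'' i j = mt s ''Q'' i j mod m"
  "!!i j. i < n ==> j < n ==> mt (run m init_c s) ''U'' i j = (if i = j then 1 else 0)"
  "!!i. i < n ==> run m init_c s ''ex'' (int i) = int k & run m init_c s ''un'' (int i) = 1"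
proof -
 let ?b = "PAsg ''Q'' (entry (V ''i'') (V ''j'')) (Cell ''Q'' (entry (V ''i'') (V ''j'')) +: Lit 0) ;;
    PAsg ''U'' (entry (V ''i'') (V ''j'')) (eq_e (V ''i'') (V ''j''))"
 let ?in = "PFor ''j'' ''n'' ?b"
 let ?l1 = "PFor ''i'' ''n'' ?in"
 let ?l2 = "PFor ''i'' ''n'' (PAsg ''ex'' (V ''i'') (V ''k'') ;; PAsg ''un'' (V ''i'') (Lit 1))"
 \<comment> \<open>\<open>R\<close> marks the entries already treated, so one invariant serves both
   the outer and the inner loop.\<close>
 define K where "K = (%R u. (ALL i<n. ALL j<n. mt u ''Q'' i j = (if R i j then mt s ''Q'' i j mod m else mt s ''Q'' i j)) &
   (ALL i<n. ALL j<n. R i j --> mt u ''U'' i j = (if i = j then 1 else 0)))"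
 have "K (%i' j'. i' < n) (run m ?l1 s)"
 proof (rule loop[where I = "%i. K (%i' j'. i' < i)", OF s])
  show "s ''n'' 0 = int n" using s by (simp add: baseD)
  show "K (%i' j'. i' < 0) (upd ''i'' 0 0 s)" by (simp add: K_def)
  show "wf ?l1" by (simp add: expr_defs read_only_def)
  fix i u assume i: "i < n" "K (%i' j'. i' < i) u" "u ''i'' 0 = int i" and bu: "base u"
  have "K (%i' j'. i' < i | i' = i & j' < n) (run m ?in u)"
  proof (rule loop[where I = "%j. K (%i' j'. i' < i | i' = i & j' < j)", OF bu])
   show "u ''n'' 0 = int n" using bu by (simp add: baseD)
   show "K (%i' j'. i' < i | i' = i & j' < 0) (upd ''j'' 0 0 u)" using i by (simp add: K_def)
   show "wf ?in" by (simp add: expr_defs read_only_def)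
   fix j w assume j: "j < n" and K: "K (%i' j'. i' < i | i' = i & j' < j) w" and wj: "w ''j'' 0 = int j" and bw: "base w"
    and fr: "!!x. x ~: mods ?b ==> x ~= ''j'' ==> w x = u x"
   have wi: "w ''i'' 0 = int i" using fr[of "''i''"] i by simp
   have q: "w ''Q'' (int i * int n + int j) = mt s ''Q'' i j"
    using K i j by (auto simp: K_def mt_def)
   have r: "run m ?b w = upd ''U'' (int i * int n + int j) (if i = j then 1 else 0)
     (upd ''Q'' (int i * int n + int j) (mt s ''Q'' i j mod m) w)"
    using wi wj bw q by (simp add: baseD upd_simps)
   show "K (%i' j'. i' < i | i' = i & j' < Suc j) (upd ''j'' 0 (int j + 1) (run m ?b w))"
    unfolding r K_def using K i(1) j unfolding K_def by (auto simp: mt_upd less_Suc_eq)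
  qed
  then show "K (%i' j'. i' < Suc i) (upd ''i'' 0 (int i + 1) (run m ?in u))"
   unfolding K_def by (auto simp: less_Suc_eq simp del: run.simps)
 qed
 then have 1: "i < n ==> j < n ==> mt (run m ?l1 s) ''Q'' i j = mt s ''Q'' i j mod m"
  "i < n ==> j < n ==> mt (run m ?l1 s) ''U'' i j = (if i = j then 1 else 0)" for i j
  by (auto simp: K_def)
 have b1: "base (run m ?l1 s)" using s by (subst base_run) (simp_all add: expr_defs read_only_def)
 have 2: "ALL i<n. run m ?l2 (run m ?l1 s) ''ex'' (int i) = int k & run m ?l2 (run m ?l1 s) ''un'' (int i) = 1"
 proof (rule loop[where I = "%j u. ALL i<j. u ''ex'' (int i) = int k & u ''un'' (int i) = 1", OF b1])
  show "run m ?l1 s ''n'' 0 = int n" using b1 by (simp only: baseD)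
  show "wf ?l2" by (simp add: expr_defs read_only_def)
  fix j u assume I: "ALL i<j. u ''ex'' (int i) = int k & u ''un'' (int i) = 1" and u: "u ''i'' 0 = int j" "base u"
  have r: "run m (PAsg ''ex'' (V ''i'') (V ''k'') ;; PAsg ''un'' (V ''i'') (Lit 1)) u = upd ''un'' (int j) 1 (upd ''ex'' (int j) (int k) u)"
   using u by (simp add: baseD upd_simps)
  show "ALL i<Suc j. upd ''i'' 0 (int j + 1) (run m (PAsg ''ex'' (V ''i'') (V ''k'') ;; PAsg ''un'' (V ''i'') (Lit 1)) u) ''ex'' (int i) = int k &
    upd ''i'' 0 (int j + 1) (run m (PAsg ''ex'' (V ''i'') (V ''k'') ;; PAsg ''un'' (V ''i'') (Lit 1)) u) ''un'' (int i) = 1"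
   unfolding r using I by (simp add: upd_simps less_Suc_eq)
 qed simp
 have ne: "mt (run m ?l2 w) ''Q'' = mt w ''Q''" "mt (run m ?l2 w) ''U'' = mt w ''U''" for w
  by (intro mt_run; simp)+
 have rc: "run m init_c s = run m ?l2 (run m ?l1 s)" by (simp only: init_c_def run.simps(3))
 show "!!i j. i < n ==> j < n ==> mt (run m init_c s) ''Q'' i j = mt s ''Q'' i j mod m"
  "!!i j. i < n ==> j < n ==> mt (run m init_c s) ''U'' i j = (if i = j then 1 else 0)"
  unfolding rc ne using 1 by auto
 show "!!i. i < n ==> run m init_c s ''ex'' (int i) = int k & run m init_c s ''un'' (int i) = 1"
  unfolding rc using 2 by blast
qed

lemma powsD: "pows s ==> base s" "pows s ==> i <= k ==> s ''pw'' (int i) = P ^ i"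
 by (auto simp: pows_def)

lemma pows_Suc: "pows s ==> e < k ==> s ''pw'' (int e + 1) = P ^ Suc e"
 using powsD(2)[of s "Suc e"] by (simp add: add.commute)

lemma run_scan:
 assumes s: "pows s" "s ''s'' 0 = int s0" "s ''e'' 0 = int e0" "e0 < k"
 defines "u == run m scan_c s" and "Q == mt s ''Q''"
 shows "(u ''fnd'' 0 = 0 & (ALL i<n. ALL j<n. s0 <= i --> i <= j --> P ^ Suc e0 dvd Q i j)) |
  (u ''fnd'' 0 = 1 & (EX i j. s0 <= i & i <= j & j < n & u ''y'' 0 = int i & u ''z'' 0 = int j & ~ P ^ Suc e0 dvd Q i j))"
proof -
 let ?c = "(V ''s'' <. V ''i'' +. Lit 1) *. (V ''i'' <. V ''j'' +. Lit 1) *.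
       residual (Cell ''Q'' (entry (V ''i'') (V ''j'')))"
 let ?b = "PIf ?c (''y'' <-- V ''i'' ;; ''z'' <-- V ''j'' ;; ''fnd'' <-- Lit 1) PSkip"
 let ?in = "PFor ''j'' ''n'' ?b"
 let ?l1 = "PFor ''i'' ''n'' ?in"
 define K where "K = (%R (u :: store). (u ''fnd'' 0 = (0::int) & (ALL i<n. ALL j<n. R i j --> s0 <= i --> i <= j --> P ^ Suc e0 dvd Q i j)) |
  (u ''fnd'' 0 = 1 & (EX i j. s0 <= i & i <= j & j < n & u ''y'' 0 = int i & u ''z'' 0 = int j & ~ P ^ Suc e0 dvd Q i j)))"
 have b: "base s" using s by (simp add: powsD)
 let ?s = "upd ''fnd'' 0 0 s"
 have b': "base ?s" using b by (simp add: read_only_def)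
 have "K (%i' j'. i' < n) (run m ?l1 ?s)"
 proof (rule loop[where I = "%i. K (%i' j'. i' < i)", OF b'])
  show "?s ''n'' 0 = int n" using b' by (simp only: baseD)
  show "K (%i' j'. i' < 0) (upd ''i'' 0 0 ?s)" by (simp add: K_def upd_simps)
  show "wf ?l1" by (simp add: expr_defs read_only_def residual_def)
  fix i u assume i: "i < n" "K (%i' j'. i' < i) u" "u ''i'' 0 = int i" and bu: "base u"
   and fr: "!!x. x ~: mods ?in ==> x ~= ''i'' ==> u x = ?s x"
  have "K (%i' j'. i' < i | i' = i & j' < n) (run m ?in u)"
  proof (rule loop[where I = "%j. K (%i' j'. i' < i | i' = i & j' < j)", OF bu])
   show "u ''n'' 0 = int n" using bu by (simp add: baseD)
   show "K (%i' j'. i' < i | i' = i & j' < 0) (upd ''j'' 0 0 u)" using i(2) by (simp add: K_def upd_simps)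
   show "wf ?in" by (simp add: expr_defs read_only_def residual_def)
   fix j w assume j: "j < n" and K: "K (%i' j'. i' < i | i' = i & j' < j) w" and wj: "w ''j'' 0 = int j" and bw: "base w"
    and fr': "!!x. x ~: mods ?b ==> x ~= ''j'' ==> w x = u x"
   have wi: "w ''i'' 0 = int i" using fr'[of "''i''"] i by simp
   have "w ''Q'' = s ''Q''" "w ''s'' = s ''s''" "w ''e'' = s ''e''" "w ''pw'' = s ''pw''"
    using fr fr' by (simp_all add: upd_simps)
   then have e: "Defs.eval m w ?c = (if s0 <= i then 1 else 0) * (if i <= j then 1 else 0) * (Q i j mod P ^ Suc e0)"
    using wi wj s pows_Suc[OF s(1,4)] bw by (simp add: residual_def baseD Q_def mt_def)
   show "K (%i' j'. i' < i | i' = i & j' < Suc j) (upd ''j'' 0 (int j + 1) (run m ?b w))"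
   proof (cases "s0 <= i & i <= j & ~ P ^ Suc e0 dvd Q i j")
    case True
    then have "Defs.eval m w ?c ~= 0" unfolding e by (simp add: mod_eq_0_iff_dvd)
    then have r: "run m ?b w = upd ''fnd'' 0 1 (upd ''z'' 0 (int j) (upd ''y'' 0 (int i) w))"
     using wi wj by (simp add: upd_simps)
    show ?thesis unfolding r K_def using True j by (simp add: upd_simps)
   next
    case False
    then have "Defs.eval m w ?c = 0" unfolding e by (auto simp: mod_eq_0_iff_dvd)
    then have r: "run m ?b w = w" by simp
    show ?thesis unfolding r using K False unfolding K_def by (auto simp: upd_simps less_Suc_eq)
   qed
  qed
  then show "K (%i' j'. i' < Suc i) (upd ''i'' 0 (int i + 1) (run m ?in u))"
   unfolding K_def by (auto simp: upd_simps less_Suc_eq simp del: run.simps)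
 qed
 moreover have "u = run m ?l1 ?s" by (simp only: u_def scan_c_def run.simps Defs.eval.simps)
 ultimately show ?thesis by (simp add: K_def)
qed

lemma run_shear:
 assumes s: "pows s" "s ''s'' 0 = int s0" "s ''e'' 0 = int e0" "e0 < k" "s x 0 = int x0" "x ~= ''a''"
  and st: "diag_state n k Q0 s0 e0 Q U" and x: "s0 <= x0" "x0 < n"
  and Q: "!!i j. i < n ==> j < n ==> mt s ''Q'' i j = Q i j" and U: "!!i j. i < n ==> j < n ==> mt s ''U'' i j = U i j"
 defines "u == run m (shear_c x) s" and "Q' == shear_mat k (Suc e0) s0 x0 Q"
 shows "EX U'. diag_state n k Q0 s0 e0 Q' U' & (ALL i<n. ALL j<n. mt u ''Q'' i j = Q' i j & mt u ''U'' i j = U' i j)"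
  "!!i. i < s0 ==> Q' i i = Q i i"
proof -
 have b: "base s" and s0: "s0 < n" using s x by (auto simp: powsD)
 have e: "Defs.eval m s (eq_e (residual pivot_e) (Lit 0) *. not_e (eq_e (V x) (V ''s''))) ~= 0 \<longleftrightarrow>
   P ^ Suc e0 dvd Q s0 s0 & x0 ~= s0"
  using s pows_Suc[OF s(1,4)] Q[OF s0 s0] b by (auto simp: residual_def pivot_e_def baseD mt_def mod_eq_0_iff_dvd)
 have "(EX U'. diag_state n k Q0 s0 e0 Q' U' & (ALL i<n. ALL j<n. mt u ''Q'' i j = Q' i j & mt u ''U'' i j = U' i j)) &
  (ALL i<s0. Q' i i = Q i i)"
 proof (cases "P ^ Suc e0 dvd Q s0 s0 & x0 ~= s0")
  case True
  let ?s = "upd ''c'' 0 1 (upd ''b'' 0 (int x0) (upd ''a'' 0 (int s0) s))"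
  have r: "u = run m add_c ?s"
   using e True s by (simp add: u_def shear_c_def upd_simps)
  show ?thesis
  proof -
   have b': "base ?s" "?s ''a'' 0 = int s0" "?s ''b'' 0 = int x0" "?s ''c'' 0 = 1" "s0 ~= x0"
    using b True by (auto simp: upd_simps read_only_def)
   have Q': "Q' = add_both m s0 x0 1 Q" using True by (simp add: Q'_def shear_mat_def)
   have "mt u ''Q'' i j = Q' i j & mt u ''U'' i j = add_col m s0 x0 1 U i j" if "i < n" "j < n" for i j
    using run_add[OF b'(1-4) s0 x(2) b'(5) that] Q U that s0 x
    by (auto simp: r Q' add_both_def add_row_def add_col_def)
   then show ?thesis
    using diag_state_add[OF st s0 x(2) b'(5) le_refl x(1)] Q' by blast
  qed
 next
  case False
  then have "u = s" "Q' = Q" using e by (auto simp: u_def shear_c_def Q'_def shear_mat_def)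
  then show ?thesis using st Q U by blast
 qed
 then show "EX U'. diag_state n k Q0 s0 e0 Q' U' & (ALL i<n. ALL j<n. mt u ''Q'' i j = Q' i j & mt u ''U'' i j = U' i j)"
  "!!i. i < s0 ==> Q' i i = Q i i" by auto
qed

lemma run_pivot:
 assumes s: "pows s" "s ''s'' 0 = int s0" "s ''e'' 0 = int e0" "e0 < k" "s ''y'' 0 = int y0" "s ''z'' 0 = int z0"
  and st: "diag_state n k Q0 s0 e0 (mt s ''Q'') (mt s ''U'')" and x: "s0 <= y0" "y0 <= z0" "z0 < n"
  and nd: "~ P ^ Suc e0 dvd mt s ''Q'' y0 z0"
 defines "u == run m pivot_c s"
 shows "diag_state n k Q0 s0 e0 (mt u ''Q'') (mt u ''U'')" "~ P ^ Suc e0 dvd mt u ''Q'' s0 s0"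
  "!!i. i < s0 ==> mt u ''Q'' i i = mt s ''Q'' i i"
proof -
 have fr: "pows (run m (shear_c x) w) = pows w" "run m (shear_c x) w ''s'' = w ''s''" "run m (shear_c x) w ''e'' = w ''e''"
  "run m (shear_c x) w ''y'' = w ''y''" "run m (shear_c x) w ''z'' = w ''z''" if "x = ''y'' | x = ''z''" for x w
  using that by (auto simp: run_frame)
 have sn: "s0 < n" "y0 < n" using x by auto
 let ?w1 = "run m (shear_c ''z'') s" let ?w2 = "run m (shear_c ''z'') ?w1"
 let ?w3 = "run m (shear_c ''y'') ?w2" let ?w4 = "run m (shear_c ''z'') ?w3" let ?w5 = "run m (shear_c ''z'') ?w4"
 let ?S = "shear_mat k (Suc e0) s0" let ?Q = "mt s ''Q''"
 obtain U1 where U1: "diag_state n k Q0 s0 e0 (?S z0 ?Q) U1" "!!i j. i < n ==> j < n ==> mt ?w1 ''Q'' i j = ?S z0 ?Q i j"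
   "!!i j. i < n ==> j < n ==> mt ?w1 ''U'' i j = U1 i j" and d1: "!!i. i < s0 ==> ?S z0 ?Q i i = ?Q i i"
  using run_shear[of s s0 e0 "''z''" z0 Q0 ?Q "mt s ''U''"] s st x by auto
 obtain U2 where U2: "diag_state n k Q0 s0 e0 (?S z0 (?S z0 ?Q)) U2" "!!i j. i < n ==> j < n ==> mt ?w2 ''Q'' i j = ?S z0 (?S z0 ?Q) i j"
   "!!i j. i < n ==> j < n ==> mt ?w2 ''U'' i j = U2 i j" and d2: "!!i. i < s0 ==> ?S z0 (?S z0 ?Q) i i = ?S z0 ?Q i i"
  using run_shear[of ?w1 s0 e0 "''z''" z0 Q0 "?S z0 ?Q" U1] s U1 x fr by auto
 obtain U3 where U3: "diag_state n k Q0 s0 e0 (?S y0 (?S z0 (?S z0 ?Q))) U3" "!!i j. i < n ==> j < n ==> mt ?w3 ''Q'' i j = ?S y0 (?S z0 (?S z0 ?Q)) i j"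
   "!!i j. i < n ==> j < n ==> mt ?w3 ''U'' i j = U3 i j" and d3: "!!i. i < s0 ==> ?S y0 (?S z0 (?S z0 ?Q)) i i = ?S z0 (?S z0 ?Q) i i"
  using run_shear[of ?w2 s0 e0 "''y''" y0 Q0 "?S z0 (?S z0 ?Q)" U2] s U2 x sn fr by auto
 obtain U4 where U4: "diag_state n k Q0 s0 e0 (?S z0 (?S y0 (?S z0 (?S z0 ?Q)))) U4" "!!i j. i < n ==> j < n ==> mt ?w4 ''Q'' i j = ?S z0 (?S y0 (?S z0 (?S z0 ?Q))) i j"
   "!!i j. i < n ==> j < n ==> mt ?w4 ''U'' i j = U4 i j" and d4: "!!i. i < s0 ==> ?S z0 (?S y0 (?S z0 (?S z0 ?Q))) i i = ?S y0 (?S z0 (?S z0 ?Q)) i i"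
  using run_shear[of ?w3 s0 e0 "''z''" z0 Q0 "?S y0 (?S z0 (?S z0 ?Q))" U3] s U3 x fr by auto
 obtain U5 where U5: "diag_state n k Q0 s0 e0 (?S z0 (?S z0 (?S y0 (?S z0 (?S z0 ?Q))))) U5" "!!i j. i < n ==> j < n ==> mt ?w5 ''Q'' i j = ?S z0 (?S z0 (?S y0 (?S z0 (?S z0 ?Q)))) i j"
   "!!i j. i < n ==> j < n ==> mt ?w5 ''U'' i j = U5 i j" and d5: "!!i. i < s0 ==> ?S z0 (?S z0 (?S y0 (?S z0 (?S z0 ?Q)))) i i = ?S z0 (?S y0 (?S z0 (?S z0 ?Q))) i i"
  using run_shear[of ?w4 s0 e0 "''z''" z0 Q0 "?S z0 (?S y0 (?S z0 (?S z0 ?Q)))" U4] s U4 x fr by auto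
 have u: "u = ?w5" by (simp only: u_def pivot_c_def run.simps(3))
 show "diag_state n k Q0 s0 e0 (mt u ''Q'') (mt u ''U'')"
  unfolding u by (rule diag_state_congI[OF U5(1)]) (use U5 in auto)
 have sym: "?Q i i' = ?Q i' i" if "i < n" "i' < n" for i i'
  using st that by (auto simp: diag_state_def equiv_form_def)
 show "~ P ^ Suc e0 dvd mt u ''Q'' s0 s0"
  unfolding u U5(2)[OF sn(1) sn(1)] by (rule pivot_found[where n = n]) (use sym x nd s in auto)
 show "mt u ''Q'' i i = mt s ''Q'' i i" if "i < s0" for i
  unfolding u using U5(2)[of i i] d1 d2 d3 d4 d5 that sn by simp
qed

lemma run_eliminate:
 assumes s: "pows s" "s ''s'' 0 = int s0" "s ''e'' 0 = int e0" "e0 < k" "s0 < n"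
  and st: "diag_state n k Q0 s0 e0 (mt s ''Q'') (mt s ''U'')" and nd: "~ P ^ Suc e0 dvd mt s ''Q'' s0 s0"
  and ex: "!!i. i < n ==> s ''ex'' (int i) = int (ex i)" and v: "diag_vals n k s0 e0 (mt s ''Q'') ex (%i. s ''un'' (int i))"
 defines "u == run m eliminate_c s"
 shows "u ''s'' 0 = int (Suc s0)" "diag_state n k Q0 (Suc s0) e0 (mt u ''Q'') (mt u ''U'')"
  "!!i. i < n ==> u ''ex'' (int i) = int ((ex(s0 := e0)) i)"
  "diag_vals n k (Suc s0) e0 (mt u ''Q'') (ex(s0 := e0)) (%i. u ''un'' (int i))"
proof -
 let ?Q = "mt s ''Q''"
 let ?in = "''c'' <-- (Lit 0 -. Cell ''Q'' (entry (V ''s'') (V ''j'')) div. elem ''pw'' ''e'') *: RInv (elem ''un'' ''s'') ;;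
     ''a'' <-- V ''j'' ;; ''b'' <-- V ''s'' ;; add_c"
 let ?b = "PIf (V ''s'' <. V ''j'') ?in PSkip"
 let ?l = "PFor ''j'' ''n'' ?b"
 let ?s = "upd ''ex'' (int s0) (int e0) (upd ''un'' (int s0) (?Q s0 s0 div P ^ e0) s)"
 have b: "base s" and b': "base ?s" using s by (auto simp: powsD read_only_def)
 have un0: "~ P dvd ?Q s0 s0 div P ^ e0" "?Q s0 s0 = P ^ e0 * (?Q s0 s0 div P ^ e0)"
  using eliminate_entry(2)[OF s(4) _ _ nd] st s(5) by (auto simp: diag_state_def)
 \<comment> \<open>Clearing entry (s, j) changes row and column j only. The pivot therefore keeps
   its value, its unit part can be computed once before the loop, and the zeros already produced
   remain.\<close>
 define I where "I = (%j w. diag_state n k Q0 s0 e0 (mt w ''Q'') (mt w ''U'') &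
   (\<forall>i\<le>s0. mt w ''Q'' i i = ?Q i i) & (ALL j'<j. s0 < j' --> mt w ''Q'' s0 j' = 0))"
 have I: "I n (run m ?l ?s)"
 proof (rule loop[where I = I, OF b'])
  show "?s ''n'' 0 = int n" using b' by (simp only: baseD)
  show "wf ?l" by (simp add: expr_defs wf_simps)
  show "I 0 (upd ''j'' 0 0 ?s)" using st by (simp add: I_def)
  fix j w assume j: "j < n" and I: "I j w" and wj: "w ''j'' 0 = int j" and bw: "base w"
   and fr: "!!x. x ~: mods ?b ==> x ~= ''j'' ==> w x = ?s x"
  have ws: "w ''s'' 0 = int s0" "w ''e'' 0 = int e0" "w ''pw'' = s ''pw''" "w ''un'' (int s0) = ?Q s0 s0 div P ^ e0"
   using fr s by (simp_all add: upd_simps)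
  show "I (Suc j) (upd ''j'' 0 (int j + 1) (run m ?b w))"
  proof (cases "s0 < j")
   case True
   define c where "c = (- (mt w ''Q'' s0 j div P ^ e0) * modular_inverse m (?Q s0 s0 div P ^ e0)) mod m"
   let ?w = "upd ''b'' 0 (int s0) (upd ''a'' 0 (int j) (upd ''c'' 0 c w))"
   have r: "run m ?b w = run m add_c ?w"
    using True ws wj bw powsD(2)[OF s(1), of e0] s(4)
    by (simp add: upd_simps baseD c_def mt_def)
   have W: "base ?w" "?w ''a'' 0 = int j" "?w ''b'' 0 = int s0" "?w ''c'' 0 = c"
    using bw by (auto simp: upd_simps read_only_def)
   have js: "j ~= s0" using True by simp
   have ds: "diag_state n k Q0 s0 e0 (mt w ''Q'') (mt w ''U'')" "mt w ''Q'' s0 s0 = ?Q s0 s0"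
    using I by (auto simp: I_def)
   note A = run_add[OF W j s(5) js]
   have ds': "diag_state n k Q0 s0 e0 (add_both m j s0 c (mt w ''Q'')) (add_col m j s0 c (mt w ''U''))"
    using diag_state_add(1)[OF ds(1) j s(5) js] True by simp
   have "diag_state n k Q0 s0 e0 (mt (run m add_c ?w) ''Q'') (mt (run m add_c ?w) ''U'')"
    by (rule diag_state_congI[OF ds']) (use A in auto)
   moreover have "mt (run m add_c ?w) ''Q'' i i = ?Q i i" if "i <= s0" for i
    using A(1)[of i i] that True s(5) I by (simp add: add_both_simps I_def)
   moreover have "mt (run m add_c ?w) ''Q'' s0 j' = 0" if "j' < Suc j" "s0 < j'" for j'
   proof (cases "j' = j")
    case True
    have "P ^ e0 dvd mt w ''Q'' s0 j" "P ^ e0 dvd ?Q s0 s0"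
     using ds j s(5) st \<open>s0 < j\<close> by (auto simp: diag_state_def)
    then show ?thesis
     using A(1)[OF s(5) j] eliminate_entry(1)[OF s(4) _ _ nd, of "mt w ''Q'' s0 j"] True js ds(2)
     by (simp add: add_both_simps c_def)
   next
    case False
    then show ?thesis using that j I js A(1)[OF s(5), of j'] by (simp add: add_both_simps I_def)
   qed
   ultimately show ?thesis unfolding r I_def by simp
  next
   case False
   then have r: "run m ?b w = w" using ws wj by simp
   show ?thesis unfolding r using I False by (auto simp: I_def less_Suc_eq)
  qed
 qed
 have r: "u = upd ''s'' 0 (int (Suc s0)) (run m ?l ?s)"
 proof -
  have "int s0 + 1 < B" using s(5) B_large by linarith
  moreover have "run m ?l ?s ''s'' = ?s ''s''" by (rule run_frame) simp
  moreover have "base (run m ?l ?s)" using b' by (subst base_run) (simp_all add: expr_defs wf_simps)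
  ultimately show ?thesis
   using s b powsD(2)[OF s(1), of e0]
   by (simp add: u_def eliminate_c_def pivot_e_def upd_simps baseD mt_def del: run.simps(5)) (simp add: add.commute)
 qed
 have arr: "u ''ex'' = ?s ''ex''" "u ''un'' = ?s ''un''"
  unfolding r by (simp_all add: upd_other run_frame del: run.simps(5))
 show "u ''s'' 0 = int (Suc s0)" unfolding r by (simp add: upd_simps)
 have mq: "mt u ''Q'' = mt (run m ?l ?s) ''Q''" "mt u ''U'' = mt (run m ?l ?s) ''U''" unfolding r by simp_all
 have ds: "diag_state n k Q0 s0 e0 (mt u ''Q'') (mt u ''U'')" and dd: "!!i. i <= s0 ==> mt u ''Q'' i i = ?Q i i"
  and z: "!!j. j < n ==> s0 < j ==> mt u ''Q'' s0 j = 0"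
  using I unfolding I_def mq by auto
 have z': "mt u ''Q'' s0 j = 0" if "j < n" "j ~= s0" for j
 proof (cases "s0 < j")
  case False
  then have "mt u ''Q'' j s0 = 0" using ds that s(5) by (auto simp: diag_state_def)
  moreover have "mt u ''Q'' s0 j = mt u ''Q'' j s0" using ds that s(5) by (auto simp: diag_state_def equiv_form_def)
  ultimately show ?thesis by simp
 qed (use z that in auto)
 show "diag_state n k Q0 (Suc s0) e0 (mt u ''Q'') (mt u ''U'')"
  using ds z' s(5) by (auto simp: diag_state_def less_Suc_eq)
 show ex': "u ''ex'' (int i) = int ((ex(s0 := e0)) i)" if "i < n" for i
  unfolding arr using ex[OF that] by (simp add: upd_simps)
 show "diag_vals n k (Suc s0) e0 (mt u ''Q'') (ex(s0 := e0)) (%i. u ''un'' (int i))"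
  unfolding arr using v un0 dd s(4) by (auto simp: diag_vals_def upd_simps less_Suc_eq)
qed

lemma run_diag:
 assumes s: "pows s" and Q: "!!i j. i < n ==> j < n ==> mt s ''Q'' i j = Q0 i j mod m"
  and U: "!!i j. i < n ==> j < n ==> mt s ''U'' i j = (if i = j then 1 else 0)"
  and ex: "!!i. i < n ==> s ''ex'' (int i) = int k & s ''un'' (int i) = 1"
  and sym: "!!i j. i < n ==> j < n ==> Q0 i j = Q0 j i"
 defines "u == run m diag_c s"
 shows "EX ex. (ALL i<n. u ''ex'' (int i) = int (ex i)) & diagonal_form n k Q0 (mt u ''U'') ex (%i. u ''un'' (int i))"
proof -
 let ?b = "PIf ((V ''s'' <. V ''n'') *. (V ''e'' <. V ''k''))
    (scan_c ;; PIf (V ''fnd'') (pivot_c ;; eliminate_c) (''e'' <-- big_e (V ''e'' +. Lit 1))) PSkip"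
 let ?l = "PFor ''it'' ''nk'' ?b"
 let ?s = "upd ''e'' 0 0 (upd ''s'' 0 0 s)"
 have b: "base ?s" "pows ?s" using s by (auto simp: powsD read_only_def)
 define J where "J = (%s0 e0 ex w. pows w & w ''s'' 0 = int s0 & w ''e'' 0 = int e0 &
   diag_state n k Q0 s0 e0 (mt w ''Q'') (mt w ''U'') &
   (ALL i<n. w ''ex'' (int i) = int (ex i)) & diag_vals n k s0 e0 (mt w ''Q'') ex (%i. w ''un'' (int i)))"
 \<comment> \<open>The measure s + e gains one per iteration until s = n or e = k; after n + k
   iterations one of these must hold.\<close>
 define I where "I = (%it w. EX s0 e0 ex. J s0 e0 ex w & (s0 + e0 \<ge> it | s0 = n | e0 = k))"
 have "I (n + k) (run m ?l ?s)"
 proof (rule loop[where I = I, OF b(1)])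
  show "?s ''nk'' 0 = int (n + k)" using b by (simp only: baseD)
  show "wf ?l" by (simp add: big_e_def wf_simps)
  have "equiv_form m n Q0 (mt s ''Q'') (mt s ''U'')"
   by (rule equiv_form_congI[OF equiv_form_init[OF m_pos, of n Q0]]) (use sym Q U in auto)
  then have "J 0 0 (%_. k) (upd ''it'' 0 0 ?s)"
   using b ex by (auto simp: J_def diag_state_def diag_vals_def upd_simps wf_simps)
  then show "I 0 (upd ''it'' 0 0 ?s)" unfolding I_def by blast
  fix it w assume "I it w" and bw: "base w"
  then obtain s0 e0 ex where J: "J s0 e0 ex w" and pr: "s0 + e0 \<ge> it | s0 = n | e0 = k" by (auto simp: I_def)
  have w: "pows w" "w ''s'' 0 = int s0" "w ''e'' 0 = int e0" and ds: "diag_state n k Q0 s0 e0 (mt w ''Q'') (mt w ''U'')"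
   and ex: "!!i. i < n ==> w ''ex'' (int i) = int (ex i)" and dv: "diag_vals n k s0 e0 (mt w ''Q'') ex (%i. w ''un'' (int i))"
   using J by (auto simp: J_def)
  have le: "s0 <= n" "e0 <= k" using ds by (auto simp: diag_state_def)
  have up: "J s1 e1 ex1 (upd ''it'' 0 v w1) = J s1 e1 ex1 w1" for s1 e1 ex1 v w1
   by (simp add: J_def upd_simps wf_simps)
  show "I (Suc it) (upd ''it'' 0 (int it + 1) (run m ?b w))"
  proof (cases "s0 < n & e0 < k")
   case False
   then have r: "run m ?b w = w" using w bw by (auto simp: baseD)
   show ?thesis unfolding r I_def up using J False le by (intro exI[of _ s0] exI[of _ e0] exI[of _ ex]) auto
  next
   case True
   let ?w = "run m scan_c w"
   have r: "run m ?b w = run m (PIf (V ''fnd'') (pivot_c ;; eliminate_c) (''e'' <-- big_e (V ''e'' +. Lit 1))) ?w"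
    using True w bw by (simp add: baseD)
   have w': "pows ?w" "?w ''s'' 0 = int s0" "?w ''e'' 0 = int e0" "mt ?w ''Q'' = mt w ''Q''" "mt ?w ''U'' = mt w ''U''"
    "?w ''ex'' = w ''ex''" "?w ''un'' = w ''un''" using w by (simp_all add: run_frame)
   consider (none) "?w ''fnd'' 0 = 0" "!!i j. i < n ==> j < n ==> s0 <= i ==> i <= j ==> P ^ Suc e0 dvd mt w ''Q'' i j"
    | (found) y0 z0 where "?w ''fnd'' 0 = 1" "s0 <= y0" "y0 <= z0" "z0 < n" "?w ''y'' 0 = int y0" "?w ''z'' 0 = int z0"
     "~ P ^ Suc e0 dvd mt w ''Q'' y0 z0"
    using run_scan[OF w(1-3)] True by blast
   then show ?thesis
   proof cases
    case none
    have "(int e0 + 1) mod B = int (Suc e0)" using True B_large by simp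
    then have r': "run m ?b w = upd ''e'' 0 (int (Suc e0)) ?w"
     unfolding r using none w' powsD(1)[OF w'(1)] by (simp add: baseD)
    have "P ^ Suc e0 dvd mt w ''Q'' i j" if "i < n" "j < n" "s0 <= i" "s0 <= j" for i j
    proof (cases "i <= j")
     case False
     have "mt w ''Q'' i j = mt w ''Q'' j i" using ds that by (auto simp: diag_state_def equiv_form_def)
     then show ?thesis using none(2)[of j i] that False by simp
    qed (use none(2) that in auto)
    then have "diag_state n k Q0 s0 (Suc e0) (mt w ''Q'') (mt w ''U'')"
     using ds True by (auto simp: diag_state_def)
    moreover have "diag_vals n k s0 (Suc e0) (mt w ''Q'') ex (%i. w ''un'' (int i))"
     using dv by (auto simp: diag_vals_def)
    ultimately have "J s0 (Suc e0) ex (upd ''e'' 0 (int (Suc e0)) ?w)"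
     using w' ex by (simp add: J_def upd_simps wf_simps)
    then show ?thesis unfolding r' I_def up using pr True by (intro exI[of _ s0] exI[of _ "Suc e0"] exI[of _ ex]) auto
   next
    case found
    have r': "run m ?b w = run m eliminate_c (run m pivot_c ?w)" unfolding r using found by simp
    have dsw: "diag_state n k Q0 s0 e0 (mt ?w ''Q'') (mt ?w ''U'')" using ds w' by simp
    have ek: "e0 < k" and sn: "s0 < n" using True by auto
    have nd: "~ P ^ Suc e0 dvd mt ?w ''Q'' y0 z0" using found w' by simp
    let ?v = "run m pivot_c ?w"
    note pv = run_pivot[OF w'(1-3) ek found(5,6) dsw found(2-4) nd]
    have v: "pows ?v" "?v ''s'' 0 = int s0" "?v ''e'' 0 = int e0" "?v ''ex'' = w ''ex''" "?v ''un'' = w ''un''"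
     using w' by (simp_all add: run_frame)
    have exv: "?v ''ex'' (int i) = int (ex i)" if "i < n" for i using ex[OF that] v by simp
    have dvv: "diag_vals n k s0 e0 (mt ?v ''Q'') ex (%i. ?v ''un'' (int i))"
     using dv pv(3) w' v by (auto simp: diag_vals_def)
    note el = run_eliminate[OF v(1-3) ek sn pv(1,2) exv dvv]
    let ?x = "run m eliminate_c ?v"
    have "pows ?x" "?x ''e'' 0 = int e0" using v by (simp_all add: run_frame)
    then have "J (Suc s0) e0 (ex(s0 := e0)) ?x" using el by (simp add: J_def)
    then show ?thesis unfolding r' I_def up using pr True by (intro exI[of _ "Suc s0"] exI[of _ e0] exI[of _ "ex(s0 := e0)"]) auto
   qed
  qed
 qed
 moreover have "u = run m ?l ?s" by (simp only: u_def diag_c_def run.simps Defs.eval.simps)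
 ultimately obtain s0 e0 ex where J: "J s0 e0 ex u" and pr: "s0 + e0 \<ge> n + k | s0 = n | e0 = k"
  unfolding I_def by blast
 have ds: "diag_state n k Q0 s0 e0 (mt u ''Q'') (mt u ''U'')" using J by (simp add: J_def)
 then have "s0 <= n" "e0 <= k" by (auto simp: diag_state_def)
 then have "s0 = n | e0 = k" using pr by linarith
 then have "diagonal_form n k Q0 (mt u ''U'') ex (%i. u ''un'' (int i))"
  using diagonal_form_final[OF ds] J by (auto simp: J_def)
 then show ?thesis using J by (auto simp: J_def)
qed

end

section \<open>Mixed radix digits, and averaging over permutations\<close>

primrec rest :: "(nat => int) => nat => int => int" where
 "rest N 0 x = x"
| "rest N (Suc j) x = rest N j x div N j"

definition digit :: "(nat => int) => nat => int => int" where
 "digit N j x = rest N j x mod N j"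

lemma rest_bounds:
 assumes "!!j. j < n ==> N j > 0" "0 <= x" "x < (\<Prod>j<n. N j) * M"
 shows "0 <= rest N n x & rest N n x < M"
 using assms
proof (induction n arbitrary: M)
 case (Suc n)
 have "0 <= rest N n x & rest N n x < N n * M"
  using Suc.prems by (intro Suc.IH) (auto simp: mult.assoc)
 moreover have "N n > 0" using Suc.prems by simp
 moreover have "rest N n x div N n * N n <= rest N n x"
  using div_mult_mod_eq[of "rest N n x" "N n"] pos_mod_sign[OF \<open>N n > 0\<close>, of "rest N n x"] by linarith
 ultimately have "rest N n x div N n * N n < N n * M" by linarith
 then have "rest N n x div N n * N n < M * N n" by (simp only: mult.commute)
 then have "rest N n x div N n < M" using \<open>N n > 0\<close> by (simp only: mult_less_cancel_right_pos)
 then show ?case using \<open>0 <= rest N n x & _\<close> \<open>N n > 0\<close> by (simp add: pos_imp_zdiv_nonneg_iff)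
qed simp

lemma rest_inj:
 assumes "!!j. j < n ==> digit N j x = digit N j y" "rest N n x = rest N n y"
 shows "x = y"
proof -
 have "rest N j x = rest N j y" if "j <= n" for j
  using that
 proof (induction j rule: inc_induct)
  case (step j)
  then have "rest N j x div N j = rest N j y div N j" "rest N j x mod N j = rest N j y mod N j"
   using assms(1)[of j] by (auto simp: digit_def)
  then show ?case by (metis div_mult_mod_eq)
 qed (rule assms(2))
 from this[of 0] show ?thesis by simp
qed

lemma mixed_radix_bij:
 assumes N: "!!j. j < n ==> N j > 0" and M: "M \<ge> 0"
 shows "bij_betw (%x. (\<lambda>j\<in>{..<n}. digit N j x, rest N n x)) {0..<(\<Prod>j<n. N j) * M}
   ((\<Pi>\<^sub>E j\<in>{..<n}. {0..<N j}) \<times> {0..<M})"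
proof -
 let ?f = "%x. (\<lambda>j\<in>{..<n}. digit N j x, rest N n x)"
 let ?X = "{0..<(\<Prod>j<n. N j) * M}" let ?Y = "(\<Pi>\<^sub>E j\<in>{..<n}. {0..<N j}) \<times> {0..<M}"
 have inj: "inj_on ?f ?X"
 proof (rule inj_onI)
  fix x y assume "?f x = ?f y"
  then have "!!j. j < n ==> digit N j x = digit N j y" "rest N n x = rest N n y"
   by (auto simp: fun_eq_iff restrict_def) metis
  then show "x = y" by (rule rest_inj)
 qed
 have sub: "?f ` ?X \<subseteq> ?Y"
 proof (rule image_subsetI)
  fix x assume "x \<in> ?X"
  then have "0 <= rest N n x & rest N n x < M" using rest_bounds[of n N x M] N by simp
  then show "?f x \<in> ?Y" using N by (simp add: digit_def restrict_PiE_iff)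
 qed
 have fin: "finite ?Y" by (intro finite_cartesian_product finite_PiE) auto
 have "card (?f ` ?X) = card ?X" by (rule card_image[OF inj])
 also have "... = nat ((\<Prod>j<n. N j) * M)" by simp
 also have "... = nat (\<Prod>j<n. N j) * nat M"
  using M N by (intro nat_mult_distrib prod_nonneg) (auto intro: less_imp_le)
 also have "nat (\<Prod>j<n. N j) = (\<Prod>j<n. nat (N j))"
 proof -
  have "int (\<Prod>j<n. nat (N j)) = (\<Prod>j<n. N j)"
   unfolding of_nat_prod using N by (intro prod.cong) (auto simp: less_imp_le)
  then show ?thesis by linarith
 qed
 also have "(\<Prod>j<n. nat (N j)) * nat M = card ?Y" by (simp add: card_cartesian_product card_PiE)
 finally have "?f ` ?X = ?Y" by (rule card_subset_eq[OF fin sub])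
 then show ?thesis using inj by (simp add: bij_betw_def)
qed

text \<open>Double counting of pairs (ta, g): as each \<open>ph ta\<close> permutes X, the share of
  good elements is the average, over g, of the share of ta that move g to a good element. A lower
  bound for every single orbit is therefore enough, and only a few coordinates need to be
  moved.\<close>

lemma card_pred_averaging:
 fixes c :: nat
 assumes X: "finite X" and T: "finite T" "T ~= {}" and bij: "!!ta. ta \<in> T ==> bij_betw (ph ta) X X"
  and lower: "!!g. g \<in> X ==> a * card T <= b * card {ta \<in> T. Q (ph ta g)}"
 shows "a * card X <= b * card {g \<in> X. Q g}"
proof -
 have eq: "card {g \<in> X. Q (ph ta g)} = card {g \<in> X. Q g}" if "ta \<in> T" for ta
 proof -
  have "bij_betw (ph ta) {g \<in> X. Q (ph ta g)} {g \<in> X. Q g}"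
   using bij[OF that] by (auto simp: bij_betw_def inj_on_def)
  then show ?thesis by (rule bij_betw_same_card)
 qed
 have ind: "card {x \<in> S. R x} = (\<Sum>x\<in>S. if R x then 1 else (0::nat))" if "finite S" for S :: "'z set" and R
  using that by (simp add: sum.If_cases Int_def)
 have ind': "card {x \<in> S. R x} = (\<Sum>x\<in>S. if R x then 1 else (0::nat))" if "finite S" for S :: "'y set" and R
  using that by (simp add: sum.If_cases Int_def)
 have "a * card T * card X = (\<Sum>g\<in>X. a * card T)" by simp
 also have "... <= (\<Sum>g\<in>X. b * card {ta \<in> T. Q (ph ta g)})" by (intro sum_mono lower)
 also have "... = b * (\<Sum>g\<in>X. \<Sum>ta\<in>T. if Q (ph ta g) then 1 else 0)"
  using T by (simp add: sum_distrib_left sum.If_cases Int_def)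
 also have "(\<Sum>g\<in>X. \<Sum>ta\<in>T. if Q (ph ta g) then 1 else 0) = (\<Sum>ta\<in>T. \<Sum>g\<in>X. if Q (ph ta g) then 1 else (0::nat))"
  by (rule sum.swap)
 also have "... = (\<Sum>ta\<in>T. card {g \<in> X. Q g})"
  using X eq by (intro sum.cong refl) (simp add: sum.If_cases Int_def)
 also have "... = card T * card {g \<in> X. Q g}" by simp
 finally have "card T * (a * card X) <= card T * (b * card {g \<in> X. Q g})" by (simp add: ac_simps)
 then show ?thesis using T by (simp add: card_gt_0_iff)
qed

section \<open>Classification of the solutions of a diagonal equation\<close>

locale sampling = odd_prime p for p +
 fixes n k l lg :: nat and prim :: bool and t :: int and ex :: "nat => nat" and un :: "nat => int"
 assumes k_pos: "k \<ge> 1" and l_le: "l <= 1" and lg: "P < 2 ^ lg" and t: "0 <= t" "t < P ^ k"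
  and ex_le: "!!i. i < n ==> ex i <= k" and un: "!!i. i < n ==> ~ P dvd un i"
  and ex_mono: "!!i j. i <= j ==> j < n ==> ex i <= ex j"
begin

abbreviation m :: int where "m == P ^ k"

lemma P_pos [simp]: "P > 0" using p_ge_3 by simp

lemma p_pos [simp]: "p > 0" "p ~= 0" using p_ge_3 by auto

lemma m_pos [simp]: "m > 0" by simp

lemma P_dvd_m: "P dvd m" using k_pos by (simp add: dvd_power)

lemma P_power_dvd_m: "i <= k ==> P ^ i dvd m" by (rule le_imp_power_dvd)

text \<open>The p-adic valuation capped at k: modulo p^k nothing beyond is visible, and 0 receives
  the value k.\<close>

definition val :: "int => nat" where
 "val x = Max {a. a <= k & P ^ a dvd x}"

lemma le_val_iff: "a <= k ==> a <= val x \<longleftrightarrow> P ^ a dvd x"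
proof -
 assume a: "a <= k"
 let ?S = "{a. a <= k & P ^ a dvd x}"
 have fin: "finite ?S" by (rule finite_subset[of _ "{..k}"]) auto
 have "0 \<in> ?S" by simp
 then have "Max ?S \<in> ?S" using fin by (intro Max_in) auto
 then have mx: "P ^ val x dvd x" by (simp add: val_def)
 show ?thesis
 proof
  assume "a <= val x"
  then show "P ^ a dvd x" using mx by (meson dvd_trans le_imp_power_dvd)
 next
  assume "P ^ a dvd x"
  then show "a <= val x" unfolding val_def using fin a by (intro Max_ge) auto
 qed
qed

definition q :: "(nat => int) => int" where
 "q y = (\<Sum>i<n. P ^ ex i * un i * (y i)\<^sup>2)"

definition vecs :: "(nat => int) set" where
 "vecs = {y. (ALL i<n. 0 <= y i & y i < m) & (\<forall>i\<ge>n. y i = 0)}"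

text \<open>One definition covers the three sampling problems: l = 0 without \<open>prim\<close> for
  all solutions, l = 0 with \<open>prim\<close> for primitive ones, l = 1 without
  \<open>prim\<close> for nonprimitive ones.\<close>

definition sols :: "(nat => int) set" where
 "sols = {y \<in> vecs. [q y = t] (mod m) & (ALL i<n. P ^ l dvd y i) & (prim --> (EX i<n. ~ P dvd y i))}"

text \<open>The least valuation of a coordinate that keeps its term from undercutting d. Terms after
  J must stay strictly above d, because J is the last one at d; hence the extra 1. The other 1
  rounds the half up, and truncated subtraction gives 0 where there is no constraint.\<close>

definition lbd :: "nat => nat => nat => nat" where
 "lbd d J j = max l ((d + (if J < j then 1 else 0) + 1 - ex j) div 2)"

lemma lbd_le_iff: "lbd d J j <= w \<longleftrightarrow> l <= w & d + (if J < j then 1 else 0) <= ex j + 2 * w"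
 unfolding lbd_def by auto

text \<open>The pair \<open>(J, v)\<close> with \<open>J < n\<close> stands for the vectors whose last term of least valuation \<open>d\<close> has
 index \<open>J\<close> and a coordinate of valuation \<open>v\<close>; \<open>(n, 0)\<close> for those all of whose terms vanish mod \<open>p\<^sup>k\<close>.\<close>

definition lev :: "nat => nat => nat" where
 "lev J v = (if J < n then ex J + 2 * v else k)"

definition in_class :: "nat => nat => (nat => int) => bool" where
 "in_class J v y \<longleftrightarrow> (ALL j<n. j ~= J --> lbd (lev J v) J j <= val (y j)) &
   (if J < n then l <= v & lev J v < k & val (y J) = v else v = 0)"

text \<open>Let J < J'. Membership in the second class bounds its level by that of the first, while
  membership in the first class keeps all terms after J strictly above its level. For J' = n the
  level is k, which the first level does not reach.\<close>

lemma in_class_unique: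
 assumes "in_class J v y" "in_class J' v' y" "J <= n" "J' <= n"
 shows "J = J' & v = v'"
proof -
 have aux: False if c: "in_class J v y" "in_class J' v' y" and lt: "J < J'" "J' <= n" for J v J' v'
 proof -
  have J: "J < n" using lt by simp
  have 1: "lev J v < k" "lev J v = ex J + 2 * val (y J)" using c(1) J by (auto simp: in_class_def lev_def)
  have "lbd (lev J' v') J' J <= val (y J)" using c(2) J lt by (auto simp: in_class_def)
  then have 2: "lev J' v' <= lev J v" using lt 1(2) by (simp add: lbd_le_iff)
  show False
  proof (cases "J' < n")
   case True
   have "lbd (lev J v) J J' <= val (y J')" using c(1) True lt by (auto simp: in_class_def)
   then have "lev J v + 1 <= ex J' + 2 * val (y J')" using lt by (simp add: lbd_le_iff)
   moreover have "lev J' v' = ex J' + 2 * val (y J')" using c(2) True by (auto simp: in_class_def lev_def)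
   ultimately show False using 2 by simp
  next
   case False
   then have "lev J' v' = k" by (simp add: lev_def)
   then show False using 1 2 by simp
  qed
 qed
 have "J = J'" using aux[OF assms(1,2)] aux[OF assms(2,1)] assms(3,4) by (meson linorder_neqE_nat)
 moreover have "v = v'" using assms \<open>J = J'\<close> by (auto simp: in_class_def split: if_splits)
 ultimately show ?thesis by simp
qed

lemma in_class_exists:
 assumes l: "!!i. i < n ==> P ^ l dvd y i"
 shows "EX J v. J <= n & in_class J v y"
proof -
 have lv: "l <= val (y i)" if "i < n" for i using l[OF that] l_le k_pos by (subst le_val_iff) auto
 let ?f = "%j. ex j + 2 * val (y j)"
 show ?thesis
 proof (cases "EX j<n. ?f j < k")
  case False
  then have "k <= ?f j" if "j < n" for j using that by (meson not_le)
  then have "in_class n 0 y" using lv by (auto simp: in_class_def lbd_le_iff lev_def not_less)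
  then show ?thesis by blast
 next
  case True
  then obtain j0 where j0: "j0 < n" "?f j0 < k" by blast
  define d where "d = Min (?f ` {..<n})"
  have fin: "finite (?f ` {..<n})" "?f ` {..<n} ~= {}" using j0 by auto
  have d_le: "d <= ?f j" if "j < n" for j unfolding d_def using fin that by (intro Min_le) auto
  have "d \<in> ?f ` {..<n}" unfolding d_def using fin by (rule Min_in)
  then obtain j1 where j1: "j1 < n" "?f j1 = d" by auto
  define J where "J = Max {j. j < n & ?f j = d}"
  have fin': "finite {j. j < n & ?f j = d}" by (rule finite_subset[of _ "{..<n}"]) auto
  have "J \<in> {j. j < n & ?f j = d}" unfolding J_def using fin' j1 by (intro Max_in) auto
  then have J: "J < n" "?f J = d" by auto
  have Jmax: "j <= J" if "j < n" "?f j = d" for j unfolding J_def using fin' that by (intro Max_ge) auto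
  have dk: "d < k" using d_le[OF j0(1)] j0(2) by simp
  have "in_class J (val (y J)) y"
   unfolding in_class_def
  proof (intro conjI allI impI)
   fix j assume j: "j < n" "j ~= J"
   have "d + (if J < j then 1 else 0) <= ?f j"
    using d_le[OF j(1)] Jmax[OF j(1)] by (cases "?f j = d") auto
   then show "lbd (lev J (val (y J))) J j <= val (y j)" using lv[OF j(1)] J by (simp add: lbd_le_iff lev_def)
  qed (use J lv dk in \<open>auto simp: lev_def\<close>)
  then show ?thesis using J by (meson less_imp_le)
 qed
qed

definition y0 :: "nat => nat => (nat => int) => nat => int" where
 "y0 d J g j = (if j < n & j ~= J then P ^ lbd d J j * g j else 0)"

text \<open>Radix 1 at J forces that digit to be 0, so that all n positions can be decoded
  alike.\<close>

definition radix :: "nat => nat => nat => int" where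
 "radix d J j = (if j = J then 1 else P ^ (k - lbd d J j))"

definition acc :: "nat => nat => (nat => int) => int" where
 "acc d J g = (t - q (y0 d J g)) mod m"

text \<open>The equation for the unit part z of the pivot coordinate, divided by p^d and by the unit
  of J, reads z^2 = r modulo p^(k-d). For J = n nothing has to be solved; the dummy value 1 is a
  nonzero square, so the root test accepts as many a as in every other class.\<close>

definition rad :: "nat => nat => (nat => int) => int" where
 "rad d J g = (if J < n then (acc d J g div P ^ d * modular_inverse m (un J)) mod m else 1)"

text \<open>The indices besides J whose terms can have valuation exactly d, hence the only ones that
  matter for r modulo p.\<close>

definition blk :: "nat => nat set" where
 "blk J = {j. j < J & (ex j + ex J) mod 2 = 0}"

definition root_ok :: "int => int => bool" where
 "root_ok r a \<longleftrightarrow> (case qpow m r lg a 1 (int h) of (u, w) => P dvd u & [w * w * r = 1] (mod P))"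

text \<open>When the test succeeds, w^2 r = 1 modulo p, so 1/w is a root to start from; the bit
  chooses its sign.\<close>

definition root :: "int => int => bool => int" where
 "root r a b = (newton m r ^^ k) ((if b then -1 else 1) * modular_inverse m (snd (qpow m r lg a 1 (int h))) mod m)"

text \<open>The parity of R selects one of the two roots. The equation fixes the unit part of y_J
  only modulo p^(k-d), whereas y_J = p^v z needs z modulo p^(k-v); the half R div 2, below p^(d-v),
  supplies the free upper digits.\<close>

definition out :: "nat => nat => (nat => int) => int => int => nat => int" where
 "out J v g R a = (let d = lev J v; r = rad d J g in
   if J < n then (y0 d J g)(J := P ^ v * (root r a (R mod 2 = 1) mod P ^ (k - d) + R div 2 * P ^ (k - d)))
   else y0 d J g)"

definition success :: "nat => nat => (nat => int) => int => int => bool" where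
 "success J v g R a \<longleftrightarrow> root_ok (rad (lev J v) J g) a & (prim --> (EX i<n. ~ P dvd out J v g R a i))"

lemma root_ok_iff: "root_ok r a \<longleftrightarrow> nzsq r & nonsq (a\<^sup>2 - r)"
 unfolding root_ok_def using qpow_root[OF P_dvd_m lg, of r a] by (auto split: prod.split)

lemma root_props:
 assumes "root_ok r a"
 shows "[(root r a b)\<^sup>2 = r] (mod m)" "~ P dvd root r a b" "[root r a True = - root r a False] (mod m)"
proof -
 obtain u w where uw: "qpow m r lg a 1 (int h) = (u, w)" by fastforce
 have w1: "[w * w * r = 1] (mod P)" using assms uw by (auto simp: root_ok_def)
 then have nw: "~ P dvd w" using cong_dvd_iff[OF w1] by (auto simp: P_dvd_mult_iff)
 define i where "i = modular_inverse m w"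
 have "[w * i = 1] (mod m)" unfolding i_def using nw by (intro cong_modular_inverse1 coprime_P_power)
 then have wi: "[w * i = 1] (mod P)" by (rule cong_dvd_modulus[OF _ P_dvd_m])
 then have ni: "~ P dvd i" using cong_dvd_iff[OF wi] by (auto simp: P_dvd_mult_iff)
 have "[(w * i)\<^sup>2 * r = 1\<^sup>2 * r] (mod P)" by (intro cong_scalar_right cong_pow wi)
 moreover have "[(w * w * r) * i\<^sup>2 = 1 * i\<^sup>2] (mod P)" by (intro cong_scalar_right w1)
 ultimately have ir: "[i\<^sup>2 = r] (mod P)" by (simp add: cong_def power2_eq_square ac_simps)
 define s where "s = (%b. (if b then -1 else 1) * i mod m)"
 have s: "[s b = (if b then - i else i)] (mod P)" for b
  using cong_dvd_modulus[OF _ P_dvd_m, of "s b" "if b then - i else i"] by (auto simp: s_def cong_def)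
 have ns: "~ P dvd s b" for b using cong_dvd_iff[OF s[of b]] ni by auto
 have s2: "[(s b)\<^sup>2 = r] (mod P)" for b
 proof -
  have "[(s b)\<^sup>2 = (if b then - i else i)\<^sup>2] (mod P)" by (rule cong_pow[OF s])
  also have "(if b then - i else i)\<^sup>2 = i\<^sup>2" by simp
  also note ir
  finally show ?thesis .
 qed
 have rt: "root r a b = (newton m r ^^ k) (s b)" for b by (simp only: root_def uw snd_conv s_def i_def)
 have near: "[root r a b = s b] (mod P)" for b unfolding rt by (rule newton_iterate(1)[OF k_pos ns s2])
 show sq: "[(root r a b)\<^sup>2 = r] (mod m)" for b unfolding rt by (rule newton_iterate(2)[OF k_pos ns s2])
 show nr: "~ P dvd root r a b" for b using cong_dvd_iff[OF near[of b]] ns by simp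
 \<comment> \<open>Both iterates are roots of r, so they agree up to sign. They are not congruent to
   each other, since they reduce to -i and i modulo p.\<close>
 have "[(root r a True)\<^sup>2 = (root r a False)\<^sup>2] (mod m)" using sq cong_trans cong_sym by blast
 then consider "[root r a True = root r a False] (mod m)" | "[root r a True = - root r a False] (mod m)"
  using sqrt_unique[OF nr] by blast
 then show "[root r a True = - root r a False] (mod m)"
 proof cases
  case 1
  then have "[root r a True = root r a False] (mod P)" by (rule cong_dvd_modulus[OF _ P_dvd_m])
  then have "[- i = i] (mod P)" using near[of True] near[of False] s[of True] s[of False]
   by (simp add: cong_def)
  then have "P dvd 2 * i" by (simp add: cong_iff_dvd_diff dvd_diff_commute)
  then show ?thesis using ni by (simp add: P_dvd_mult_iff)
 qed
qed

text \<open>The two roots differ modulo p^j for every positive j because twice a root is a unit, and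
  there are no others.\<close>

lemma root_choice:
 assumes ok: "root_ok r a" and j: "1 <= j" "j <= k" and z: "[z\<^sup>2 = r] (mod P ^ j)"
 shows "\<exists>!b. [root r a b = z] (mod P ^ j)"
proof -
 note R = root_props[OF ok]
 have mj: "P ^ j dvd m" using j by (intro P_power_dvd_m)
 have "[(root r a False)\<^sup>2 = z\<^sup>2] (mod P ^ j)"
  using cong_dvd_modulus[OF R(1) mj] z cong_trans cong_sym by blast
 then have "[root r a False = z] (mod P ^ j) | [root r a False = - z] (mod P ^ j)"
  by (rule sqrt_unique[OF R(2)])
 moreover have TF: "[root r a True = - root r a False] (mod P ^ j)" by (rule cong_dvd_modulus[OF R(3) mj])
 moreover have "~ ([root r a True = z] (mod P ^ j) & [root r a False = z] (mod P ^ j))"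
 proof
  assume a: "[root r a True = z] (mod P ^ j) & [root r a False = z] (mod P ^ j)"
  then have "[root r a False = - root r a False] (mod P ^ j)" using TF by (meson cong_sym cong_trans)
  then have "P ^ j dvd 2 * root r a False" by (simp add: cong_iff_dvd_diff)
  moreover have "P dvd P ^ j" using j by (simp add: dvd_power)
  ultimately have "P dvd 2 * root r a False" by (rule dvd_trans[rotated])
  then show False using R(2) by (simp add: P_dvd_mult_iff)
 qed
 moreover have "[root r a True = z] (mod P ^ j)" if "[root r a False = - z] (mod P ^ j)"
 proof -
  have "[- root r a False = - (- z)] (mod P ^ j)" using that by (simp only: cong_minus_minus_iff)
  then show ?thesis using TF cong_trans by fastforce
 qed
 ultimately show ?thesis by (metis (full_types))
qed

end

lemma card_pairs_fst: "card {(x, y) \<in> A \<times> B. R x} = card {x \<in> A. R x} * card B"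
proof -
 have "{(x, y) \<in> A \<times> B. R x} = {x \<in> A. R x} \<times> B" by auto
 then show ?thesis by (simp only: card_cartesian_product)
qed

context sampling
begin

lemma finite_blk [simp]: "finite (blk J)"
 by (rule finite_subset[of _ "{..<J}"]) (auto simp: blk_def)

lemma lbd_ge: "l <= lbd d J j" "d + (if J < j then 1 else 0) <= ex j + 2 * lbd d J j"
 using lbd_le_iff[of d J j "lbd d J j"] by auto

text \<open>The exponents of j and J have equal parity and \<open>ex j <= ex J\<close>, so the half
  is exact. It is at least v, hence at least l, and the maximum in \<open>lbd\<close> has no
  effect.\<close>

lemma lbd_blk:
 assumes "J < n" "l <= v" "j \<in> blk J"
 shows "ex j + 2 * lbd (lev J v) J j = lev J v"
proof -
 have j: "j < J" "(ex j + ex J) mod 2 = 0" using assms by (auto simp: blk_def)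
 then have "ex j <= ex J" using ex_mono[of j J] assms by simp
 moreover have "ex J mod 2 = ex j mod 2" using j(2) by presburger
 ultimately obtain c where c: "ex J = ex j + 2 * c" by (metis le_iff_add mod_eq_dvd_iff_nat add_diff_cancel_left' dvd_def)
 then show ?thesis using assms j by (auto simp: lbd_def lev_def)
qed

lemma lbd_not_blk:
 assumes "J < n" "j ~= J" "j ~: blk J"
 shows "Suc (lev J v) <= ex j + 2 * lbd (lev J v) J j"
proof (cases "J < j")
 case True
 then show ?thesis using lbd_ge(2)[of "lev J v" J j] by simp
next
 case False
 then have "(ex j + ex J) mod 2 ~= 0" using assms by (auto simp: blk_def)
 then have "ex j + 2 * lbd (lev J v) J j ~= ex J + 2 * v" by presburger
 moreover have "ex J + 2 * v <= ex j + 2 * lbd (lev J v) J j"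
  using lbd_ge(2)[of "lev J v" J j] assms by (simp add: lev_def split: if_splits)
 ultimately show ?thesis using assms by (simp add: lev_def)
qed

lemma lbd_le_k:
 assumes "J <= n" "J < n ==> lev J v < k" "j < n"
 shows "lbd (lev J v) J j <= k"
proof (cases "J < n")
 case True
 then show ?thesis using assms l_le k_pos by (auto simp: lbd_le_iff)
next
 case False
 then show ?thesis using assms l_le k_pos by (auto simp: lbd_le_iff lev_def)
qed

lemma term_y0: "j < n ==> j ~= J ==>
  P ^ ex j * un j * (y0 d J g j)\<^sup>2 = P ^ (ex j + 2 * lbd d J j) * (un j * (g j)\<^sup>2)"
 by (simp add: y0_def power_add power_mult power_mult_distrib power2_eq_square ac_simps)

text \<open>All terms have valuation at least d, and modulo p^(d+1) only those of the block
  survive.\<close>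

lemma q_y0:
 assumes J: "J < n" "l <= v"
 shows "EX X. q (y0 (lev J v) J g) = P ^ lev J v * X & [X = (\<Sum>j\<in>blk J. un j * (g j)\<^sup>2)] (mod P)"
proof -
 let ?d = "lev J v"
 define X where "X = (\<Sum>j<n. if j = J then 0 else P ^ (ex j + 2 * lbd ?d J j - ?d) * (un j * (g j)\<^sup>2))"
 have ge: "?d <= ex j + 2 * lbd ?d J j" if "j ~= J" for j
  using lbd_ge(2)[of ?d J j] by (auto split: if_splits)
 have "q (y0 ?d J g) = P ^ ?d * X"
  unfolding q_def X_def sum_distrib_left
 proof (rule sum.cong[OF refl])
  fix j assume j: "j \<in> {..<n}"
  show "P ^ ex j * un j * (y0 ?d J g j)\<^sup>2 = P ^ ?d * (if j = J then 0 else P ^ (ex j + 2 * lbd ?d J j - ?d) * (un j * (g j)\<^sup>2))"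
  proof (cases "j = J")
   case False
   have "P ^ (ex j + 2 * lbd ?d J j) = P ^ ?d * P ^ (ex j + 2 * lbd ?d J j - ?d)"
    using ge[OF False] by (simp add: power_add[symmetric])
   then show ?thesis using term_y0[of j J ?d g] j False by simp
  qed (simp add: y0_def)
 qed
 moreover have "[X = (\<Sum>j<n. if j \<in> blk J then un j * (g j)\<^sup>2 else 0)] (mod P)"
  unfolding X_def
 proof (rule cong_sum)
  fix j assume j: "j \<in> {..<n}"
  show "[(if j = J then 0 else P ^ (ex j + 2 * lbd ?d J j - ?d) * (un j * (g j)\<^sup>2)) = (if j \<in> blk J then un j * (g j)\<^sup>2 else 0)] (mod P)"
  proof (cases "j \<in> blk J")
   case True
   then have "j ~= J" by (auto simp: blk_def)
   then show ?thesis using lbd_blk[OF J True] True by simp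
  next
   case False
   have "P dvd P ^ (ex j + 2 * lbd ?d J j - ?d)" if "j ~= J"
    using lbd_not_blk[OF J(1) that False, of v] by (intro dvd_power) auto
   then show ?thesis using False by (auto simp: cong_0_iff)
  qed
 qed
 moreover have "(\<Sum>j<n. if j \<in> blk J then un j * (g j)\<^sup>2 else 0) = (\<Sum>j\<in>blk J. un j * (g j)\<^sup>2)"
  using J(1) by (intro sum.mono_neutral_cong_right) (auto simp: blk_def)
 ultimately show ?thesis by auto
qed

lemma q_update:
 assumes "J < n"
 shows "q ((y0 d J g)(J := z)) = q (y0 d J g) + P ^ ex J * un J * z\<^sup>2"
proof -
 have "q ((y0 d J g)(J := z)) = (\<Sum>i<n. P ^ ex i * un i * (y0 d J g i)\<^sup>2 + (if i = J then P ^ ex J * un J * z\<^sup>2 else 0))"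
  unfolding q_def by (intro sum.cong refl) (auto simp: y0_def)
 then show ?thesis using assms by (simp add: sum.distrib q_def)
qed

definition tau :: "nat => int" where "tau d = t div P ^ d"

lemma rad_facts:
 assumes J: "J < n" "l <= v" "lev J v < k" and td: "P ^ lev J v dvd t"
 shows "P ^ lev J v dvd acc (lev J v) J g"
  "[un J * rad (lev J v) J g = acc (lev J v) J g div P ^ lev J v] (mod m)"
  "[un J * rad (lev J v) J g = tau (lev J v) - (\<Sum>j\<in>blk J. un j * (g j)\<^sup>2)] (mod P)"
proof -
 let ?d = "lev J v"
 obtain X where X: "q (y0 ?d J g) = P ^ ?d * X" "[X = (\<Sum>j\<in>blk J. un j * (g j)\<^sup>2)] (mod P)"
  using q_y0[OF J(1,2)] by blast
 have tt: "t = P ^ ?d * tau ?d" using td by (simp add: tau_def)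
 have mk: "m = P ^ ?d * P ^ (k - ?d)" using J(3) by (simp add: power_add[symmetric])
 have "acc ?d J g = (P ^ ?d * (tau ?d - X)) mod m"
  by (subst tt) (simp add: acc_def X(1) right_diff_distrib flip: tt)
 also have "... = P ^ ?d * ((tau ?d - X) mod P ^ (k - ?d))" unfolding mk by (rule mod_mult_mult1)
 finally have a: "acc ?d J g = P ^ ?d * ((tau ?d - X) mod P ^ (k - ?d))" .
 then show "P ^ ?d dvd acc ?d J g" by simp
 have ad: "acc ?d J g div P ^ ?d = (tau ?d - X) mod P ^ (k - ?d)" unfolding a by simp
 have inv: "[un J * modular_inverse m (un J) = 1] (mod m)"
  by (intro cong_modular_inverse1 coprime_P_power un J)
 have "[un J * rad ?d J g = un J * (acc ?d J g div P ^ ?d * modular_inverse m (un J))] (mod m)"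
  using J(1) unfolding rad_def by (intro cong_scalar_left) (simp add: cong_def)
 also have "un J * (acc ?d J g div P ^ ?d * modular_inverse m (un J)) = acc ?d J g div P ^ ?d * (un J * modular_inverse m (un J))"
  by simp
 also have "[acc ?d J g div P ^ ?d * (un J * modular_inverse m (un J)) = acc ?d J g div P ^ ?d * 1] (mod m)"
  by (intro cong_scalar_left inv)
 finally show ur: "[un J * rad ?d J g = acc ?d J g div P ^ ?d] (mod m)" by simp
 have "P dvd P ^ (k - ?d)" using J(3) by (intro dvd_power) auto
 then have 1: "[(tau ?d - X) mod P ^ (k - ?d) = tau ?d - X] (mod P)" by (simp add: cong_def mod_mod_cancel)
 have 2: "[tau ?d - X = tau ?d - (\<Sum>j\<in>blk J. un j * (g j)\<^sup>2)] (mod P)" by (intro cong_diff cong_refl X(2))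
 have "[un J * rad ?d J g = (tau ?d - X) mod P ^ (k - ?d)] (mod P)"
  using cong_dvd_modulus[OF ur P_dvd_m] unfolding ad .
 then show "[un J * rad ?d J g = tau ?d - (\<Sum>j\<in>blk J. un j * (g j)\<^sup>2)] (mod P)"
  by (rule cong_trans[OF _ cong_trans[OF 1 2]])
qed

text \<open>By \<open>rad_facts\<close> the product u_J r is known modulo p; one more factor u_J
  turns it into u_J^2 r, which has the character of r.\<close>

lemma nzsq_rad:
 assumes J: "J < n" "l <= v" "lev J v < k" and td: "P ^ lev J v dvd t"
 shows "nzsq (rad (lev J v) J g) \<longleftrightarrow> nzsq (un J * (tau (lev J v) - (\<Sum>j\<in>blk J. un j * (g j)\<^sup>2)))"
proof -
 have "[un J * (un J * rad (lev J v) J g) = un J * (tau (lev J v) - (\<Sum>j\<in>blk J. un j * (g j)\<^sup>2))] (mod P)"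
  by (intro cong_scalar_left rad_facts(3) assms)
 from nzsq_cong[OF this] have "nzsq ((un J)\<^sup>2 * rad (lev J v) J g) \<longleftrightarrow> nzsq (un J * (tau (lev J v) - (\<Sum>j\<in>blk J. un j * (g j)\<^sup>2)))"
  unfolding power2_eq_square[of "un J"] mult.assoc .
 then show ?thesis unfolding nzsq_mult[OF nzsq_square[OF un[OF J(1)]]] .
qed

lemma solution_iff:
 assumes J: "J < n" "l <= v" "lev J v < k" and td: "P ^ lev J v dvd t"
 shows "[q ((y0 (lev J v) J g)(J := P ^ v * z)) = t] (mod m) \<longleftrightarrow> [z\<^sup>2 = rad (lev J v) J g] (mod P ^ (k - lev J v))"
proof -
 let ?d = "lev J v" let ?A = "acc ?d J g div P ^ ?d"
 have mk: "m = P ^ ?d * P ^ (k - ?d)" using J(3) by (simp add: power_add[symmetric])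
 have Pd: "P ^ ?d ~= 0" by simp
 have sq: "P ^ ex J * un J * (P ^ v * z)\<^sup>2 = P ^ ?d * (un J * z\<^sup>2)"
  using J(1) by (simp add: lev_def power_add power_mult power_mult_distrib power2_eq_square ac_simps)
 have "[q ((y0 ?d J g)(J := P ^ v * z)) = t] (mod m) \<longleftrightarrow> [P ^ ?d * (un J * z\<^sup>2) = t - q (y0 ?d J g)] (mod m)"
  unfolding q_update[OF J(1)] sq cong_iff_dvd_diff by (simp add: algebra_simps)
 also have "... \<longleftrightarrow> [P ^ ?d * (un J * z\<^sup>2) = acc ?d J g] (mod m)" by (simp add: acc_def cong_def)
 also have "acc ?d J g = P ^ ?d * ?A" using rad_facts(1)[OF assms] by simp
 also have "[P ^ ?d * (un J * z\<^sup>2) = P ^ ?d * ?A] (mod m) \<longleftrightarrow> [un J * z\<^sup>2 = ?A] (mod P ^ (k - ?d))"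
  unfolding cong_iff_dvd_diff mk right_diff_distrib[symmetric] using Pd by simp
 also have "... \<longleftrightarrow> [un J * z\<^sup>2 = un J * rad ?d J g] (mod P ^ (k - ?d))"
  using cong_dvd_modulus[OF rad_facts(2)[OF assms, of g], of "P ^ (k - ?d)"] P_power_dvd_m[of "k - ?d"]
  by (auto simp: cong_def)
 also have "... \<longleftrightarrow> [z\<^sup>2 = rad ?d J g] (mod P ^ (k - ?d))"
  by (intro cong_mult_lcancel coprime_P_power un J)
 finally show ?thesis .
qed

lemma q_y0_zero: "[q (y0 (lev n 0) n g) = 0] (mod m)"
proof -
 have "m dvd P ^ ex j * un j * (y0 k n g j)\<^sup>2" if "j < n" for j
 proof -
  have "k <= ex j + 2 * lbd k n j" using lbd_ge(2)[of k n j] that by simp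
  then have "m dvd P ^ (ex j + 2 * lbd k n j)" by (rule le_imp_power_dvd)
  then show ?thesis using that by (subst term_y0) auto
 qed
 then have "m dvd q (y0 k n g)" unfolding q_def by (intro dvd_sum) auto
 then show ?thesis by (simp add: lev_def cong_0_iff)
qed

definition two_blk :: "nat => bool" where
 "two_blk J \<longleftrightarrow> (\<exists>i\<in>blk J. \<exists>j\<in>blk J. i ~= j)"

text \<open>Decides whether the block can make r a nonzero square. Two block variables always can.
  If t / p^d vanishes modulo p, a single variable contributes only the class of -u_i u_J. If it is a
  unit, a single variable suffices for p > 3, while for p = 3 squares are 0 or 1 and both cases are
  tested. The level d enters only through the divisibility of t and the unit t / p^d.\<close>

definition feas_sq :: "nat => nat => bool" where
 "feas_sq J d \<longleftrightarrow> (if P ^ Suc d dvd t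
   then two_blk J | (EX i. blk J = {i} & nzsq (- un i * un J))
   else two_blk J | nzsq (tau d * un J) | (EX i. blk J = {i} & (nzsq ((tau d - un i) * un J) | p > 3)))"

definition feas :: "nat => nat => bool" where
 "feas J v \<longleftrightarrow> (prim --> (EX j<n. lbd (lev J v) J j = 0)) &
   (if J < n then l <= v & lev J v < k & P ^ lev J v dvd t & feas_sq J (lev J v) else v = 0 & t = 0)"

lemma P_dvd_tau: "P ^ d dvd t ==> P dvd tau d \<longleftrightarrow> P ^ Suc d dvd t"
 by (auto simp: tau_def dvd_def power_Suc2 mult.assoc simp del: power_Suc)

lemma square_mod_3: "p = 3 ==> ~ P dvd x ==> [x\<^sup>2 = 1] (mod P)"
proof -
 assume p: "p = 3" and x: "~ P dvd x"
 then have "x mod 3 ~= 0" by (simp add: mod_eq_0_iff_dvd)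
 moreover have "0 <= x mod 3" "x mod 3 < 3" by simp_all
 ultimately have "x mod 3 = 1 | x mod 3 = 2" by linarith
 moreover have "x\<^sup>2 mod 3 = (x mod 3)\<^sup>2 mod 3" by (simp add: power_mod)
 ultimately show ?thesis using p by (auto simp: cong_def)
qed

lemma p_le_3: "~ p > 3 ==> p = 3"
 using p_ge_3 by simp

lemma blk_cases: "blk J = {} | (EX i. blk J = {i}) | two_blk J"
 unfolding two_blk_def by blast

lemma feas_sq_necessary:
 assumes J: "J < n" and td: "P ^ d dvd t" and sq: "nzsq (un J * (tau d - (\<Sum>j\<in>blk J. un j * (g j)\<^sup>2)))"
 shows "feas_sq J d"
proof -
 consider "blk J = {}" | i where "blk J = {i}" | "two_blk J" using blk_cases by blast
 then show ?thesis
 proof cases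
  case 1
  then have s: "nzsq (tau d * un J)" using sq by (simp add: mult.commute)
  then have "~ P ^ Suc d dvd t" using P_dvd_tau[OF td] by (auto simp: nzsq_def)
  then show ?thesis using s by (simp add: feas_sq_def)
 next
  case 2
  then have s: "nzsq (un J * (tau d - un i * (g i)\<^sup>2))" using sq by simp
  show ?thesis
  proof (cases "P ^ Suc d dvd t")
   case True
   then have "P dvd tau d" using P_dvd_tau[OF td] by simp
   then have "[un J * (tau d - un i * (g i)\<^sup>2) = un J * (0 - un i * (g i)\<^sup>2)] (mod P)"
    by (intro cong_scalar_left cong_diff cong_refl) (simp add: cong_0_iff)
   then have s2: "nzsq ((g i)\<^sup>2 * (- un i * un J))" using s nzsq_cong by (simp add: ac_simps)
   then have "~ P dvd g i" by (auto simp: nzsq_def P_dvd_mult_iff)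
   then have "nzsq (- un i * un J)" using s2 nzsq_mult[OF nzsq_square] by blast
   then show ?thesis using True 2 by (simp add: feas_sq_def)
  next
   case False
   show ?thesis
   proof (cases "p > 3")
    case True
    then show ?thesis using False 2 by (simp add: feas_sq_def)
   next
    case p: False
    show ?thesis
    proof (cases "P dvd g i")
     case True
     then have "[un J * (tau d - un i * (g i)\<^sup>2) = un J * (tau d - un i * 0)] (mod P)"
      by (intro cong_scalar_left cong_diff cong_refl) (simp add: cong_0_iff)
     then have "nzsq (tau d * un J)" using s nzsq_cong by (simp add: mult.commute)
     then show ?thesis using False by (simp add: feas_sq_def)
    next
     case g: False
     have "[un J * (tau d - un i * (g i)\<^sup>2) = un J * (tau d - un i * 1)] (mod P)"
      by (intro cong_scalar_left cong_diff cong_refl square_mod_3 p_le_3 p g)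
     then have "nzsq ((tau d - un i) * un J)" using s nzsq_cong by (simp add: mult.commute)
     then show ?thesis using False 2 by (simp add: feas_sq_def)
    qed
   qed
  qed
 next
  case 3
  then show ?thesis by (simp add: feas_sq_def)
 qed
qed

lemma card_translate:
 "card {(x, y) \<in> F \<times> F. R ((c + x) mod P) ((d + y) mod P)} = card {(x, y) \<in> F \<times> F. R x y}"
proof -
 let ?f = "%(x, y). ((c + x) mod P, (d + y) mod P)"
 have inj1: "x = x'" if "x \<in> F" "x' \<in> F" "(e + x) mod P = (e + x') mod P" for e x x'
 proof -
  have "[e + x = e + x'] (mod P)" using that by (simp add: cong_def)
  then have "[x = x'] (mod P)" by (simp add: cong_add_lcancel)
  then show ?thesis using F_cong_eq that by blast
 qed
 have inj: "inj_on ?f (F \<times> F)"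
 proof (rule inj_onI)
  fix z z' assume z: "z \<in> F \<times> F" "z' \<in> F \<times> F" "?f z = ?f z'"
  obtain x y x' y' where zz: "z = (x, y)" "z' = (x', y')" by (cases z; cases z')
  have "x = x'" "y = y'" by (rule inj1[of x x' c], use z zz in simp_all)
    (rule inj1[of y y' d], use z zz in simp_all)
  then show "z = z'" using zz by simp
 qed
 have sub: "?f ` (F \<times> F) \<subseteq> F \<times> F" using mod_in_F by auto
 have im: "?f ` (F \<times> F) = F \<times> F" by (rule endo_inj_surj[OF _ sub inj]) simp
 let ?A = "{z \<in> F \<times> F. case ?f z of (x, y) => R x y}" and ?B = "{z \<in> F \<times> F. case z of (x, y) => R x y}"
 have "?f ` ?A = ?B"
 proof
  show "?f ` ?A \<subseteq> ?B"
  proof (rule image_subsetI)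
   fix z assume z: "z \<in> ?A"
   then have "?f z \<in> ?f ` (F \<times> F)" by (intro imageI) simp
   then have "?f z \<in> F \<times> F" unfolding im .
   moreover have "case ?f z of (x, y) => R x y" using z by (simp only: mem_Collect_eq)
   ultimately show "?f z \<in> ?B" unfolding mem_Collect_eq by (rule conjI)
  qed
  show "?B \<subseteq> ?f ` ?A"
  proof
   fix z assume z: "z \<in> ?B"
   then have "z \<in> ?f ` (F \<times> F)" unfolding im by simp
   then obtain w where w: "z = ?f w" "w \<in> F \<times> F" by (rule imageE)
   have "case ?f w of (x, y) => R x y" unfolding w(1)[symmetric] using z by (simp only: mem_Collect_eq)
   with w(2) have "w \<in> ?A" unfolding mem_Collect_eq by (rule conjI)
   with w(1) show "z \<in> ?f ` ?A" by (rule image_eqI)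
  qed
 qed
 moreover have "card (?f ` ?A) = card ?A" by (rule card_image[OF inj_on_subset[OF inj]]) blast
 ultimately have "card ?A = card ?B" by simp
 moreover have "{(x, y) \<in> F \<times> F. R ((c + x) mod P) ((d + y) mod P)} = ?A"
  by (intro Collect_cong) (simp split: prod.split)
 moreover have "{(x, y) \<in> F \<times> F. R x y} = ?B" by (intro Collect_cong) (simp split: prod.split)
 ultimately show ?thesis by (simp only:)
qed

lemma cong_square_shift: "[un i * (((c + x) mod P))\<^sup>2 = un i * (c + x)\<^sup>2] (mod P)"
 by (intro cong_scalar_left cong_pow) (simp add: cong_def)

lemma card_F2 [simp]: "card (F \<times> F) = p\<^sup>2"
 by (simp add: card_cartesian_product power2_eq_square)

text \<open>At most two block coordinates are shifted; n, which lies outside the block, stands for a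
  missing one. The share 1/9 is that of two variables. An empty block gives everything; a single
  variable gives at least 2/3 when t / p^d vanishes modulo p, otherwise 1/5 for p > 3 and 1/3 for p
  = 3.\<close>

lemma feas_sq_count:
 assumes J: "J < n" and td: "P ^ d dvd t" and f: "feas_sq J d"
 shows "EX j1 j2. (j1 \<in> blk J | j1 = n) & (j2 \<in> blk J | j2 = n) & (ALL g. p\<^sup>2 <= 9 *
   card {(x, y) \<in> F \<times> F. nzsq (un J * (tau d - (\<Sum>j\<in>blk J. un j * (g j + (if j = j1 then x else if j = j2 then y else 0))\<^sup>2)))})"
proof -
 define C where "C = (%j1 j2. ALL g. p\<^sup>2 <= 9 *
   card {(x, y) \<in> F \<times> F. nzsq (un J * (tau d - (\<Sum>j\<in>blk J. un j * (g j + (if j = j1 then x else if j = j2 then y else 0))\<^sup>2)))})"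
 have nJ: "n ~: blk J" using J by (auto simp: blk_def)
 have goal: ?thesis if "C j1 j2" "j1 \<in> blk J | j1 = n" "j2 \<in> blk J | j2 = n" for j1 j2
  using that unfolding C_def by blast
 consider "blk J = {}" | i where "blk J = {i}" | "two_blk J" using blk_cases by blast
 then show ?thesis
 proof cases
  case 1
  have s: "nzsq (tau d * un J)" using f 1 by (auto simp: feas_sq_def two_blk_def split: if_splits)
  have "{(x, y) \<in> F \<times> F. nzsq (un J * (tau d - (\<Sum>j\<in>blk J. un j * (g j + (if j = n then x else if j = n then y else 0))\<^sup>2)))} = F \<times> F" for g
   using s 1 by (auto simp: mult.commute)
  then have "C n n" unfolding C_def by (simp only: card_F2) simp
  then show ?thesis by (rule goal) simp_all
 next
  case 2
  have i1: "i \<in> blk J" using 2 by simp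
  then have i: "i \<in> blk J" "i < n" using J by (simp_all add: blk_def)
  have no2: "~ two_blk J" using 2 by (simp add: two_blk_def)
  let ?R = "%x. nzsq (un J * (tau d - un i * x\<^sup>2))"
  have nu: "~ P dvd un i" "~ P dvd un J" using un i J by auto
  have one: "p <= 9 * card {x \<in> F. ?R x}"
  proof (cases "P ^ Suc d dvd t")
   case True
   then have Pt: "P dvd tau d" using P_dvd_tau[OF td] by simp
   have s: "nzsq (- un i * un J)" using f 2 no2 True by (auto simp: feas_sq_def)
   have "F - {0} \<subseteq> {x \<in> F. ?R x}"
   proof
    fix x assume x: "x \<in> F - {0}"
    then have "~ P dvd x" using zdvd_imp_le[of P x] by auto
    then have "nzsq (x\<^sup>2 * (- un i * un J))" using s nzsq_mult[OF nzsq_square] by blast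
    moreover have "[un J * (tau d - un i * x\<^sup>2) = un J * (0 - un i * x\<^sup>2)] (mod P)"
     using Pt by (intro cong_scalar_left cong_diff cong_refl) (simp add: cong_0_iff)
    ultimately have "?R x" using nzsq_cong by (simp add: ac_simps)
    then show "x \<in> {x \<in> F. ?R x}" using x by simp
   qed
   then have "card (F - {0}) <= card {x \<in> F. ?R x}" by (intro card_mono) auto
   then show ?thesis using p_ge_3 by (simp add: card_Diff_singleton)
  next
   case False
   then have Pt: "~ P dvd tau d" using P_dvd_tau[OF td] by simp
   show ?thesis
   proof (cases "p > 3")
    case True
    then have "p \<ge> 5" using odd_p by (cases "p = 4") auto
    then show ?thesis using card_nzsq_values[OF _ nu(2,1) Pt] by simp
   next
    case p3: False
    then consider "nzsq (tau d * un J)" | "nzsq ((tau d - un i) * un J)"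
     using f 2 no2 False by (auto simp: feas_sq_def)
    then have "\<exists>x\<in>F. ?R x"
    proof cases
     case 1
     then have "?R 0" by (simp add: mult.commute)
     then show ?thesis by (intro bexI[of _ 0]) auto
    next
     case 2
     then have "?R 1" by (simp add: mult.commute)
     then show ?thesis using p_ge_3 by (intro bexI[of _ 1]) auto
    qed
    then have "card {x \<in> F. ?R x} > 0" by (auto simp: card_gt_0_iff)
    then show ?thesis using p_le_3[OF p3] by simp
   qed
  qed
  have "p\<^sup>2 <= 9 * card {(x, y) \<in> F \<times> F. nzsq (un J * (tau d - (\<Sum>j\<in>blk J. un j * (g j + (if j = i then x else if j = n then y else 0))\<^sup>2)))}" for g
  proof -
   have "nzsq (un J * (tau d - un i * (g i + x)\<^sup>2)) \<longleftrightarrow> ?R ((g i + x) mod P)" for x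
    by (intro nzsq_cong cong_scalar_left cong_diff cong_refl cong_sym[OF cong_square_shift])
   then have "card {(x, y) \<in> F \<times> F. nzsq (un J * (tau d - (\<Sum>j\<in>blk J. un j * (g j + (if j = i then x else if j = n then y else 0))\<^sup>2)))} =
     card {(x, y) \<in> F \<times> F. ?R ((g i + x) mod P)}" using 2 by simp
   also have "... = card {(x, y) \<in> F \<times> F. ?R x}" by (rule card_translate[of "%x y. ?R x" "g i" 0])
   also have "card {(x, y) \<in> F \<times> F. ?R x} = card {x \<in> F. ?R x} * card F" by (rule card_pairs_fst)
   also have "card F = p" by simp
   finally show ?thesis using mult_le_mono1[OF one, of p] by (simp add: power2_eq_square)
  qed
  then have "C i n" unfolding C_def by blast
  then show ?thesis by (rule goal) (use i in simp_all)
 next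
  case 3
  then obtain i1 i2 where i: "i1 \<in> blk J" "i2 \<in> blk J" "i1 ~= i2" by (auto simp: two_blk_def)
  then have lt: "i1 < n" "i2 < n" using J by (auto simp: blk_def)
  have "p\<^sup>2 <= 9 * card {(x, y) \<in> F \<times> F. nzsq (un J * (tau d - (\<Sum>j\<in>blk J. un j * (g j + (if j = i1 then x else if j = i2 then y else 0))\<^sup>2)))}" for g
  proof -
   define A where "A = tau d - (\<Sum>j\<in>blk J - {i1} - {i2}. un j * (g j)\<^sup>2)"
   have split: "(\<Sum>j\<in>blk J. un j * (g j + (if j = i1 then x else if j = i2 then y else 0))\<^sup>2) =
     un i1 * (g i1 + x)\<^sup>2 + (un i2 * (g i2 + y)\<^sup>2 + (\<Sum>j\<in>blk J - {i1} - {i2}. un j * (g j)\<^sup>2))" for x y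
   proof -
    let ?f = "%j. un j * (g j + (if j = i1 then x else if j = i2 then y else 0))\<^sup>2"
    have "sum ?f (blk J) = ?f i1 + sum ?f (blk J - {i1})" using i by (intro sum.remove) auto
    also have "sum ?f (blk J - {i1}) = ?f i2 + sum ?f (blk J - {i1} - {i2})" using i by (intro sum.remove) auto
    also have "sum ?f (blk J - {i1} - {i2}) = (\<Sum>j\<in>blk J - {i1} - {i2}. un j * (g j)\<^sup>2)" by (intro sum.cong) auto
    finally show ?thesis using i by simp
   qed
   let ?R = "%x y. nzsq (un J * (A - un i1 * x\<^sup>2 - un i2 * y\<^sup>2))"
   have "nzsq (un J * (tau d - (\<Sum>j\<in>blk J. un j * (g j + (if j = i1 then x else if j = i2 then y else 0))\<^sup>2))) \<longleftrightarrow>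
     ?R ((g i1 + x) mod P) ((g i2 + y) mod P)" for x y
   proof -
    have "tau d - (\<Sum>j\<in>blk J. un j * (g j + (if j = i1 then x else if j = i2 then y else 0))\<^sup>2) =
     A - un i1 * (g i1 + x)\<^sup>2 - un i2 * (g i2 + y)\<^sup>2" unfolding split A_def by simp
    then show ?thesis
     by (simp only:) (intro nzsq_cong cong_scalar_left cong_diff cong_refl cong_sym[OF cong_square_shift])
   qed
   then have "card {(x, y) \<in> F \<times> F. nzsq (un J * (tau d - (\<Sum>j\<in>blk J. un j * (g j + (if j = i1 then x else if j = i2 then y else 0))\<^sup>2)))} =
    card {(x, y) \<in> F \<times> F. ?R ((g i1 + x) mod P) ((g i2 + y) mod P)}" by simp
   also have "... = card {(x, y) \<in> F \<times> F. ?R x y}" by (rule card_translate)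
   finally show ?thesis using card_nzsq_values2[of "un J" "un i1" "un i2" A] un J lt by simp
  qed
  then have "C i1 i2" unfolding C_def by blast
  then show ?thesis by (rule goal) (use i in simp_all)
 qed
qed

end

section \<open>Decoding digits into solutions, and counting the preimages\<close>

context sampling
begin

definition digits :: "nat => nat => (nat => int) set" where
 "digits J v = (\<Pi>\<^sub>E j\<in>{..<n}. {0..<radix (lev J v) J j})"

definition mult :: "nat => nat => int" where
 "mult J v = (if J < n then 2 * P ^ (lev J v - v) else 1)"

definition valid :: "nat => nat => bool" where
 "valid J v \<longleftrightarrow> J <= n & (if J < n then l <= v & lev J v < k else v = 0)"

lemma feas_valid: "feas J v ==> J <= n ==> valid J v"
 by (auto simp: feas_def valid_def split: if_splits)

lemma in_class_valid: "in_class J v y ==> J <= n ==> valid J v"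
 by (auto simp: in_class_def valid_def split: if_splits)

lemma v_le_lev: "J < n ==> v <= lev J v"
 by (simp add: lev_def)

lemma out_other: "i ~= J ==> out J v g R a i = y0 (lev J v) J g i"
 by (simp add: out_def Let_def)

lemma out_J: "J < n ==> out J v g R a = (y0 (lev J v) J g)(J := P ^ v *
  (root (rad (lev J v) J g) a (R mod 2 = 1) mod P ^ (k - lev J v) + R div 2 * P ^ (k - lev J v)))"
 by (simp add: out_def Let_def)

lemma out_n: "~ J < n ==> out J v g R a = y0 (lev J v) J g"
 by (simp add: out_def Let_def)

lemma unit_part:
 assumes "valid J v" "J < n" "~ P dvd z"
 shows "~ P dvd z mod P ^ (k - lev J v) + w * P ^ (k - lev J v)"
proof -
 have d: "P dvd P ^ (k - lev J v)" using assms by (intro dvd_power) (auto simp: valid_def)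
 then have "P dvd z mod P ^ (k - lev J v) \<longleftrightarrow> P dvd z" by (rule dvd_mod_iff)
 then show ?thesis using assms(3) d by (simp add: dvd_add_left_iff)
qed

text \<open>Success does not depend on R: the pivot coordinate is p^v times a unit whichever root
  and upper digits are chosen.\<close>

lemma success_iff:
 assumes "valid J v"
 shows "success J v g R a \<longleftrightarrow> nzsq (rad (lev J v) J g) & nonsq (a\<^sup>2 - rad (lev J v) J g) &
   (prim --> J < n & v = 0 | (EX i<n. i ~= J & ~ P dvd y0 (lev J v) J g i))"
proof (cases "root_ok (rad (lev J v) J g) a")
 case True
 have "P dvd out J v g R a J \<longleftrightarrow> v ~= 0" if J: "J < n"
 proof -
  have "P dvd P ^ v \<longleftrightarrow> v ~= 0"
  proof (cases v)
   case 0
   have "~ P dvd 1" using p_ge_3 zdvd_imp_le[of P 1] by auto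
   then show ?thesis unfolding 0 by simp
  qed simp
  then show ?thesis using unit_part[OF assms J root_props(2)[OF True]] unfolding out_J[OF J]
   by (simp only: fun_upd_same P_dvd_mult_iff) simp
 qed
 then have "(EX i<n. ~ P dvd out J v g R a i) \<longleftrightarrow> J < n & v = 0 | (EX i<n. i ~= J & ~ P dvd y0 (lev J v) J g i)"
  using out_other by metis
 then show ?thesis using True unfolding success_def root_ok_iff by blast
next
 case False
 then show ?thesis unfolding success_def root_ok_iff by blast
qed

lemma lbd_valid: "valid J v ==> j < n ==> lbd (lev J v) J j <= k"
 by (rule lbd_le_k) (auto simp: valid_def)

lemma radix_pos [simp]: "radix d J j > 0"
 by (simp add: radix_def)

lemma digits_D:
 assumes "g \<in> digits J v" "j < n" "j ~= J" "valid J v"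
 shows "0 <= g j" "g j < P ^ (k - lbd (lev J v) J j)"
  "0 <= y0 (lev J v) J g j" "y0 (lev J v) J g j < m" "P ^ lbd (lev J v) J j dvd y0 (lev J v) J g j"
proof -
 show g: "0 <= g j" "g j < P ^ (k - lbd (lev J v) J j)"
  using PiE_mem[OF assms(1)[unfolded digits_def], of j] assms(2,3) by (simp_all add: radix_def)
 have y: "y0 (lev J v) J g j = P ^ lbd (lev J v) J j * g j" using assms by (simp add: y0_def)
 show "0 <= y0 (lev J v) J g j" "P ^ lbd (lev J v) J j dvd y0 (lev J v) J g j" unfolding y using g by auto
 have "P ^ lbd (lev J v) J j * g j < P ^ lbd (lev J v) J j * P ^ (k - lbd (lev J v) J j)"
  using g by (intro mult_strict_left_mono) auto
 also have "... = m" using lbd_valid[OF assms(4,2)] by (simp add: power_add[symmetric])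
 finally show "y0 (lev J v) J g j < m" unfolding y .
qed

lemma root_part_bounds:
 assumes v: "valid J v" and J: "J < n" and R: "0 <= R" "R < mult J v"
 shows "0 <= z mod P ^ (k - lev J v) + R div 2 * P ^ (k - lev J v)"
  "P ^ v * (z mod P ^ (k - lev J v) + R div 2 * P ^ (k - lev J v)) < m"
proof -
 let ?K = "P ^ (k - lev J v)"
 have K: "?K > 0" by simp
 have z: "0 <= z mod ?K" "z mod ?K < ?K" using K by auto
 have h: "0 <= R div 2" "R div 2 < P ^ (lev J v - v)" using R J by (auto simp: mult_def)
 show "0 <= z mod ?K + R div 2 * ?K" using z h by simp
 have "z mod ?K + R div 2 * ?K < (R div 2 + 1) * ?K" using z by (simp add: algebra_simps)
 also have "... <= P ^ (lev J v - v) * ?K" using h by (intro mult_right_mono) auto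
 finally have "P ^ v * (z mod ?K + R div 2 * ?K) < P ^ v * (P ^ (lev J v - v) * ?K)"
  by (intro mult_strict_left_mono) auto
 also have "... = m"
  using v J v_le_lev[OF J, of v] by (simp add: power_add[symmetric] valid_def)
 finally show "P ^ v * (z mod ?K + R div 2 * ?K) < m" .
qed

lemma val_scaled_unit:
 assumes "~ P dvd z" "v < k"
 shows "val (P ^ v * z) = v"
proof -
 have "v <= val (P ^ v * z)" using assms by (subst le_val_iff) auto
 moreover have "~ Suc v <= val (P ^ v * z)"
  using assms by (subst le_val_iff) (auto simp: power_Suc2 simp del: power_Suc)
 ultimately show ?thesis by simp
qed

lemma out_sound:
 assumes f: "feas J v" "J <= n" and g: "g \<in> digits J v" and R: "0 <= R" "R < mult J v" and s: "success J v g R a"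
 shows "out J v g R a \<in> sols" "in_class J v (out J v g R a)"
proof -
 let ?y = "out J v g R a" let ?d = "lev J v"
 have v: "valid J v" using f by (rule feas_valid)
 have ok: "root_ok (rad ?d J g) a" and pr: "prim --> (EX i<n. ~ P dvd ?y i)" using s by (auto simp: success_def)
 let ?z = "root (rad ?d J g) a (R mod 2 = 1)"
 have other: "0 <= ?y i & ?y i < m & lbd ?d J i <= val (?y i)" if "i < n" "i ~= J" for i
  using digits_D[OF g that v] lbd_valid[OF v that(1)] by (simp add: out_other[OF that(2)] le_val_iff)
 have piv: "0 <= ?y J & ?y J < m & val (?y J) = v" if J: "J < n"
 proof -
  have vk: "v < k" using v J v_le_lev[OF J, of v] by (auto simp: valid_def)
  show ?thesis
   unfolding out_J[OF J] using root_part_bounds[OF v J R, of ?z]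
    val_scaled_unit[OF unit_part[OF v J root_props(2)[OF ok]] vk] by simp
 qed
 have vecs: "?y \<in> vecs"
 proof -
  have "?y i = 0" if "i \<ge> n" for i
   using that by (cases "J < n") (auto simp: out_J out_n y0_def)
  moreover have "0 <= ?y i & ?y i < m" if "i < n" for i
   using other[OF that] piv that by (cases "i = J") auto
  ultimately show ?thesis by (simp add: vecs_def)
 qed
 show cl: "in_class J v ?y"
  using other piv v f by (auto simp: in_class_def valid_def)
 have "P ^ l dvd ?y i" if "i < n" for i
 proof -
  have "l <= val (?y i)"
  proof (cases "i = J")
   case True
   then show ?thesis using piv that v by (auto simp: valid_def)
  next
   case False
   then show ?thesis using other[OF that False] lbd_ge(1)[of ?d J i] by simp
  qed
  moreover have "l <= k" using l_le k_pos by simp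
  ultimately show ?thesis using le_val_iff by blast
 qed
 moreover have "[q ?y = t] (mod m)"
 proof (cases "J < n")
  case True
  have c: "l <= v" "?d < k" "P ^ ?d dvd t" using f True by (auto simp: feas_def)
  let ?w = "?z mod P ^ (k - ?d) + R div 2 * P ^ (k - ?d)"
  have "[?w = ?z] (mod P ^ (k - ?d))" by (simp add: cong_def)
  then have "[?w\<^sup>2 = ?z\<^sup>2] (mod P ^ (k - ?d))" by (rule cong_pow)
  moreover have "[?z\<^sup>2 = rad ?d J g] (mod P ^ (k - ?d))"
   using root_props(1)[OF ok] by (rule cong_dvd_modulus) (intro P_power_dvd_m diff_le_self)
  ultimately have "[?w\<^sup>2 = rad ?d J g] (mod P ^ (k - ?d))" by (rule cong_trans)
  then show ?thesis unfolding out_J[OF True] solution_iff[OF True c] .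
 next
  case False
  have J: "J = n" using False f(2) by linarith
  have "lev J v = lev n 0" by (simp only: lev_def J less_irrefl if_False)
  then have "y0 (lev J v) J g = y0 (lev n 0) n g" by (simp only: J)
  then have y: "?y = y0 (lev n 0) n g" by (rule out_n[OF False, THEN trans])
  have t0: "t = 0" using f(1) False unfolding feas_def by (simp only: if_False)
  have "[q ?y = z] (mod m)" if "z = 0" for z unfolding that y by (rule q_y0_zero)
  then show ?thesis using t0 by blast
 qed
 ultimately show "?y \<in> sols" using vecs pr by (simp add: sols_def)
qed

text \<open>The inverse of decoding. That p^d divides t holds because p^d divides every term of the
  form and d < k.\<close>

lemma sol_decompose:
 assumes y: "y \<in> sols" and c: "in_class J v y" and Jn: "J <= n"
 defines "g == (%j. if j < n then (if j = J then 0 else y j div P ^ lbd (lev J v) J j) else undefined)"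
 shows "g \<in> digits J v" "!!j. j ~= J ==> y0 (lev J v) J g j = y j"
  "J < n ==> P ^ lev J v dvd t"
  "J < n ==> EX z. y J = P ^ v * z & ~ P dvd z & 0 <= z & z < P ^ (k - v) & [z\<^sup>2 = rad (lev J v) J g] (mod P ^ (k - lev J v))"
proof -
 let ?d = "lev J v"
 have v: "valid J v" using c Jn by (rule in_class_valid)
 have vec: "0 <= y i" "y i < m" if "i < n" for i using y that by (auto simp: sols_def vecs_def)
 have dv: "P ^ lbd ?d J j dvd y j" if "j < n" "j ~= J" for j
  using c that lbd_valid[OF v that(1)] le_val_iff by (auto simp: in_class_def)
 have "0 <= g j & g j < radix ?d J j" if "j < n" for j
 proof (cases "j = J")
  case True
  then show ?thesis using that by (simp add: g_def radix_def)
 next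
  case False
  have "y j div P ^ lbd ?d J j * P ^ lbd ?d J j = y j" using dv[OF that False] by simp
  also have "... < P ^ (k - lbd ?d J j) * P ^ lbd ?d J j"
   using vec[OF that] lbd_valid[OF v that] by (simp add: power_add[symmetric])
  finally have "y j div P ^ lbd ?d J j < P ^ (k - lbd ?d J j)" by (simp only: mult_less_cancel_right_pos zero_less_power P_pos)
  moreover have "0 <= y j div P ^ lbd ?d J j" using vec[OF that] by (simp add: pos_imp_zdiv_nonneg_iff)
  ultimately show ?thesis using that False by (simp add: g_def radix_def)
 qed
 then show g: "g \<in> digits J v" by (auto simp: digits_def PiE_iff extensional_def g_def)
 show eq: "y0 ?d J g j = y j" if "j ~= J" for j
 proof (cases "j < n")
  case True
  then show ?thesis using dv[OF True that] that by (simp add: y0_def g_def)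
 next
  case False
  then show ?thesis using y by (simp add: y0_def sols_def vecs_def)
 qed
 assume J: "J < n"
 have c': "l <= v" "?d < k" "val (y J) = v" using c J by (auto simp: in_class_def)
 have vd: "v <= ?d" by (rule v_le_lev[OF J])
 have "P ^ v dvd y J" using c' vd le_val_iff[of v "y J"] by simp
 then obtain z where z: "y J = P ^ v * z" by blast
 have nz: "~ P dvd z"
 proof
  assume "P dvd z"
  then have "P ^ Suc v dvd y J" unfolding z power_Suc2 by (rule mult_dvd_mono[OF dvd_refl])
  then show False using le_val_iff[of "Suc v" "y J"] c' vd by simp
 qed
 have z0: "0 <= z"
 proof -
  have "P ^ v * 0 <= P ^ v * z" using vec(1)[OF J] unfolding z by simp
  then show ?thesis by (simp only: mult_le_cancel_left_pos zero_less_power P_pos)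
 qed
 have zk: "z < P ^ (k - v)"
 proof -
  have "P ^ v * z < P ^ v * P ^ (k - v)" using vec(2)[OF J] c' vd unfolding z by (simp add: power_add[symmetric])
  then show ?thesis by (simp only: mult_less_cancel_left_pos zero_less_power P_pos)
 qed
 have yy: "y = (y0 ?d J g)(J := P ^ v * z)" using eq z by (auto simp: fun_eq_iff)
 obtain X where X: "q (y0 ?d J g) = P ^ ?d * X" using q_y0[OF J c'(1)] by blast
 have "q y = P ^ ?d * X + P ^ ex J * un J * (P ^ v * z)\<^sup>2" by (subst yy) (simp only: q_update[OF J] X)
 also have "P ^ ex J * un J * (P ^ v * z)\<^sup>2 = P ^ ?d * (un J * z\<^sup>2)"
  using J by (simp add: lev_def power_add power_mult power_mult_distrib power2_eq_square ac_simps)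
 finally have "P ^ ?d dvd q y" by simp
 moreover have "[q y = t] (mod P ^ ?d)"
 proof (rule cong_dvd_modulus)
  show "[q y = t] (mod m)" using y by (simp add: sols_def)
  show "P ^ ?d dvd m" by (rule P_power_dvd_m) (use c'(2) in simp)
 qed
 ultimately show td: "P ^ ?d dvd t" using cong_dvd_iff by blast
 have "[q ((y0 ?d J g)(J := P ^ v * z)) = t] (mod m)" unfolding yy[symmetric] using y by (simp add: sols_def)
 then have "[z\<^sup>2 = rad ?d J g] (mod P ^ (k - ?d))" unfolding solution_iff[OF J c'(1,2) td] .
 then show "EX z. y J = P ^ v * z & ~ P dvd z & 0 <= z & z < P ^ (k - v) & [z\<^sup>2 = rad ?d J g] (mod P ^ (k - ?d))"
  using z nz z0 zk by blast
qed

lemma sol_feas: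
 assumes y: "y \<in> sols" and c: "in_class J v y" and Jn: "J <= n"
 shows "feas J v"
proof -
 let ?d = "lev J v"
 define g where "g = (%j. if j < n then (if j = J then 0 else y j div P ^ lbd ?d J j) else undefined)"
 note S = sol_decompose[OF y c Jn, folded g_def]
 have pr: "prim --> (EX i<n. ~ P dvd y i)" using y by (simp add: sols_def)
 have "EX j<n. lbd ?d J j = 0" if pm: prim
 proof -
  obtain i where i: "i < n" "~ P dvd y i" using pr pm by blast
  then have v0: "val (y i) = 0" using le_val_iff[of 1 "y i"] k_pos by simp
  have "lbd ?d J i = 0"
  proof (cases "i = J")
   case True
   then have "v = 0" "l <= 0" using c i v0 by (auto simp: in_class_def)
   then have "lbd ?d J i <= 0" unfolding lbd_le_iff True using True i by (simp add: lev_def)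
   then show ?thesis by simp
  next
   case False
   then show ?thesis using c i v0 by (auto simp: in_class_def)
  qed
  then show ?thesis using i by blast
 qed
 moreover have "l <= v & ?d < k & P ^ ?d dvd t & feas_sq J ?d" if J: "J < n"
 proof -
  have c': "l <= v" "?d < k" using c J by (auto simp: in_class_def)
  obtain z where z: "~ P dvd z" "[z\<^sup>2 = rad ?d J g] (mod P ^ (k - ?d))" using S(4)[OF J] by blast
  have "P dvd P ^ (k - ?d)" using c' by (intro dvd_power) auto
  then have "[z\<^sup>2 = rad ?d J g] (mod P)" using z(2) cong_dvd_modulus by blast
  then have "nzsq (rad ?d J g)" using nzsq_square[OF z(1)] nzsq_cong by blast
  then have "feas_sq J ?d"
   using feas_sq_necessary[OF J S(3)[OF J]] nzsq_rad[OF J c' S(3)[OF J]] by blast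
  then show ?thesis using c' S(3)[OF J] by blast
 qed
 moreover have "v = 0 & t = 0" if J: "~ J < n"
 proof -
  have Jn': "J = n" and v0: "v = 0" using J Jn c by (auto simp: in_class_def)
  have "y0 (lev n 0) n g j = y j" for j
  proof (cases "j = n")
   case True
   then show ?thesis using y by (simp add: y0_def sols_def vecs_def)
  next
   case False
   then show ?thesis using S(2)[of j] Jn' v0 by simp
  qed
  then have "y0 (lev n 0) n g = y" by blast
  then have "[q y = 0] (mod m)" using q_y0_zero[of g] by simp
  moreover have "[q y = t] (mod m)" using y by (simp add: sols_def)
  ultimately have "[t = 0] (mod m)" by (simp add: cong_def)
  then have "t = 0" using t by (simp add: cong_def)
  then show ?thesis using v0 by simp
 qed
 ultimately show ?thesis by (simp add: feas_def)
qed

text \<open>The solution determines the digits, and then R for each a that yields a root. The number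
  of these a is the same for every nonzero square r, so the count does not depend on the
  solution.\<close>

lemma card_preimages:
 assumes y: "y \<in> sols" and c: "in_class J v y" and Jn: "J <= n"
 shows "card {(g, R, a). g \<in> digits J v & R \<in> {0..<mult J v} & a \<in> {0..<m} & success J v g R a & out J v g R a = y} = p ^ (k - 1) * gm"
  (is "card ?S = _")
proof -
 let ?d = "lev J v"
 define g where "g = (%j. if j < n then (if j = J then 0 else y j div P ^ lbd ?d J j) else undefined)"
 note S = sol_decompose[OF y c Jn, folded g_def]
 let ?r = "rad ?d J g"
 have v: "valid J v" using c Jn by (rule in_class_valid)
 have pr: "prim --> (EX i<n. ~ P dvd y i)" using y by (simp add: sols_def)
 have nz: "nzsq ?r"
 proof (cases "J < n")
  case True
  have f: "feas J v" using sol_feas[OF y c Jn] .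
  obtain z where z: "~ P dvd z" "[z\<^sup>2 = ?r] (mod P ^ (k - ?d))" using S(4)[OF True] by blast
  have "P dvd P ^ (k - ?d)" using v True by (intro dvd_power) (auto simp: valid_def)
  then have "[z\<^sup>2 = ?r] (mod P)" using z(2) cong_dvd_modulus by blast
  then show ?thesis using nzsq_square[OF z(1)] nzsq_cong by blast
 next
  case False
  then show ?thesis using nzsq_square[of 1] by (simp add: rad_def)
 qed
 have P_pow_nz: "P ^ i ~= 0" for i by simp
 have g_unique: "g' = g" if g': "g' \<in> digits J v" and o: "out J v g' R a = y" for g' R a
 proof
  fix j
  show "g' j = g j"
  proof (cases "j < n")
   case True
   show ?thesis
   proof (cases "j = J")
    case True
    have "g' j \<in> {0..<radix ?d J j}" using \<open>j < n\<close> by (intro PiE_mem[OF g'[unfolded digits_def]]) simp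
    then have "g' j = 0" using True by (simp add: radix_def)
    then show ?thesis using True \<open>j < n\<close> by (simp add: g_def)
   next
    case False
    then have "P ^ lbd ?d J j * g' j = y j" using o out_other[OF False, of v g' R a] True by (simp add: y0_def)
    then have "g' j = y j div P ^ lbd ?d J j" by (metis nonzero_mult_div_cancel_left P_pow_nz)
    then show ?thesis using True False by (simp add: g_def)
   qed
  next
   case False
   then have "j ~: {..<n}" by simp
   then show ?thesis using False PiE_arb[OF g'[unfolded digits_def], of j] by (simp add: g_def)
  qed
 qed
 \<comment> \<open>R is forced once a is given, but it depends on a, which decides which of the two
   roots belongs to an even R.\<close>
 have "EX Rf. \<forall>a\<in>{a \<in> {0..<m}. nonsq (a\<^sup>2 - ?r)}. ALL R. (R \<in> {0..<mult J v} & success J v g R a & out J v g R a = y) \<longleftrightarrow> R = Rf a"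
 proof (rule bchoice, rule ballI)
  fix a assume a: "a \<in> {a \<in> {0..<m}. nonsq (a\<^sup>2 - ?r)}"
  have ok: "root_ok ?r a" using nz a by (simp add: root_ok_iff)
  have suc: "out J v g R a = y ==> success J v g R a" for R
   using ok pr by (simp add: success_def)
  show "EX R0. ALL R. (R \<in> {0..<mult J v} & success J v g R a & out J v g R a = y) \<longleftrightarrow> R = R0"
  proof (cases "J < n")
   case False
   have "out J v g R a j = y j" for R j
    using S(2)[of j] y False by (cases "j = J") (auto simp: out_n y0_def sols_def vecs_def)
   then have "out J v g R a = y" for R by blast
   then have "(R \<in> {0..<mult J v} & success J v g R a & out J v g R a = y) \<longleftrightarrow> R = 0" for R
    using suc False by (auto simp: mult_def)
   then show ?thesis by blast
  next
   case J: True
   let ?K = "P ^ (k - ?d)"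
   obtain z where z: "y J = P ^ v * z" "~ P dvd z" "0 <= z" "z < P ^ (k - v)" "[z\<^sup>2 = ?r] (mod ?K)" using S(4)[OF J] by blast
   have kd: "1 <= k - ?d" "k - ?d <= k" using v J by (auto simp: valid_def)
   obtain b where b: "[root ?r a b = z] (mod ?K)" and bu: "!!b'. [root ?r a b' = z] (mod ?K) ==> b' = b"
    using root_choice[OF ok kd z(5)] by blast
   define R0 where "R0 = 2 * (z div ?K) + (if b then 1 else 0)"
   have iff: "out J v g R a = y \<longleftrightarrow> root ?r a (R mod 2 = 1) mod ?K + R div 2 * ?K = z" for R
   proof -
    have "out J v g R a = y \<longleftrightarrow> out J v g R a J = y J"
    proof
     assume e: "out J v g R a J = y J"
     show "out J v g R a = y"
     proof
      fix i
      show "out J v g R a i = y i"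
       using e S(2)[of i] out_other[of i J v g R a] by (cases "i = J") simp_all
     qed
    qed simp
    also have "... \<longleftrightarrow> root ?r a (R mod 2 = 1) mod ?K + R div 2 * ?K = z"
     unfolding out_J[OF J] z(1) by simp
    finally show ?thesis .
   qed
   have K0: "?K > 0" by simp
   have eqv: "root ?r a (R mod 2 = 1) mod ?K + R div 2 * ?K = z \<longleftrightarrow> R = R0" for R
   proof
    assume e: "root ?r a (R mod 2 = 1) mod ?K + R div 2 * ?K = z"
    have "z mod ?K = root ?r a (R mod 2 = 1) mod ?K" unfolding e[symmetric] by simp
    then have "(R mod 2 = 1) = b" by (intro bu) (simp add: cong_def)
    moreover have "z div ?K = R div 2" unfolding e[symmetric] by simp
    moreover have "R = 2 * (R div 2) + R mod 2" by simp
    moreover have "R mod 2 = 0 | R mod 2 = 1" by presburger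
    ultimately show "R = R0" unfolding R0_def by (cases b) auto
   next
    assume e: "R = R0"
    have R2: "R mod 2 = (if b then 1 else 0)" "R div 2 = z div ?K" unfolding e R0_def by auto
    have Rb: "(R mod 2 = 1) = b" unfolding R2(1) by simp
    have rz: "root ?r a b mod ?K = z mod ?K" using b by (simp add: cong_def)
    show "root ?r a (R mod 2 = 1) mod ?K + R div 2 * ?K = z" unfolding Rb rz R2(2) by (rule mod_div_mult_eq)
   qed
   have R0: "R0 \<in> {0..<mult J v}"
   proof -
    have zd: "0 <= z div ?K" using z(3) K0 by (simp add: pos_imp_zdiv_nonneg_iff)
    have "z div ?K * ?K <= z" using div_mult_mod_eq[of z ?K] pos_mod_sign[OF K0, of z] by linarith
    also have "z < P ^ (?d - v) * ?K"
     using z(4) v_le_lev[OF J, of v] kd by (simp add: power_add[symmetric])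
    finally have "z div ?K < P ^ (?d - v)" by (simp only: mult_less_cancel_right_pos K0)
    then show ?thesis using zd J by (auto simp: R0_def mult_def)
   qed
   have "(R \<in> {0..<mult J v} & success J v g R a & out J v g R a = y) \<longleftrightarrow> R = R0" for R
    using suc R0 unfolding iff eqv by blast
   then show ?thesis by blast
  qed
 qed
 then obtain Rf where Rf: "!!a R. a \<in> {0..<m} ==> nonsq (a\<^sup>2 - ?r) ==>
   (R \<in> {0..<mult J v} & success J v g R a & out J v g R a = y) \<longleftrightarrow> R = Rf a" by blast
 have ns: "nonsq (a\<^sup>2 - ?r)" if "success J v g R a" for R a
  using that success_iff[OF v] by blast
 have "?S = (%a. (g, Rf a, a)) ` {a \<in> {0..<m}. nonsq (a\<^sup>2 - ?r)}"
 proof (intro equalityI subsetI)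
  fix w assume "w \<in> ?S"
  then obtain g' R a where w: "w = (g', R, a)" "g' \<in> digits J v" "R \<in> {0..<mult J v}" "a \<in> {0..<m}"
   "success J v g' R a" "out J v g' R a = y" by blast
  have "g' = g" using g_unique w by blast
  then have "nonsq (a\<^sup>2 - ?r)" "R = Rf a" using ns Rf w by blast+
  then show "w \<in> (%a. (g, Rf a, a)) ` {a \<in> {0..<m}. nonsq (a\<^sup>2 - ?r)}" using w \<open>g' = g\<close> by blast
 next
  fix w assume "w \<in> (%a. (g, Rf a, a)) ` {a \<in> {0..<m}. nonsq (a\<^sup>2 - ?r)}"
  then obtain a where a: "w = (g, Rf a, a)" "a \<in> {0..<m}" "nonsq (a\<^sup>2 - ?r)" by blast
  then have "Rf a \<in> {0..<mult J v} & success J v g (Rf a) a & out J v g (Rf a) a = y" using Rf by blast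
  then show "w \<in> ?S" using a S(1) by blast
 qed
 moreover have "inj_on (%a. (g, Rf a, a)) {a \<in> {0..<m}. nonsq (a\<^sup>2 - ?r)}" by (rule inj_onI) simp
 ultimately have "card ?S = card {a \<in> {0..<m}. nonsq (a\<^sup>2 - ?r)}" by (simp only: card_image)
 then show ?thesis using card_nonsq_shift_power[OF k_pos nz] by simp
qed

definition good :: "nat => nat => (nat => int) => bool" where
 "good J v g \<longleftrightarrow> nzsq (rad (lev J v) J g) &
   (prim --> J < n & v = 0 | (EX i<n. i ~= J & ~ P dvd y0 (lev J v) J g i))"

lemma finite_digits [simp]: "finite (digits J v)"
 unfolding digits_def by (intro finite_PiE) auto

lemma card_triple: "card {((x, y), w) \<in> (A \<times> A) \<times> A. R x y & S w} = card {(x, y) \<in> A \<times> A. R x y} * card {w \<in> A. S w}"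
proof -
 have "{((x, y), w) \<in> (A \<times> A) \<times> A. R x y & S w} = {(x, y) \<in> A \<times> A. R x y} \<times> {w \<in> A. S w}" by auto
 then show ?thesis by (simp only: card_cartesian_product)
qed

lemma card_unit_shift: "2 * p <= 3 * card {w \<in> F. ~ P dvd c + w}"
proof -
 have "{w \<in> F. P dvd c + w} \<subseteq> {(- c) mod P}"
 proof
  fix w assume w: "w \<in> {w \<in> F. P dvd c + w}"
  then have "[w = - c] (mod P)" by (simp add: cong_iff_dvd_diff add.commute)
  with w show "w \<in> {(- c) mod P}" by (simp add: cong_def)
 qed
 then have "card {w \<in> F. P dvd c + w} <= 1" using card_mono[of "{(- c) mod P}"] by simp
 moreover have "card {w \<in> F. ~ P dvd c + w} = card F - card {w \<in> F. P dvd c + w}"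
  by (subst card_Diff_subset[symmetric]) (auto intro: arg_cong[where f = card])
 ultimately show ?thesis using p_ge_3 by simp
qed

definition shift :: "nat => nat => (nat => int) => (nat => int) => nat => int" where
 "shift J v dl g = (\<lambda>i\<in>{..<n}. (g i + dl i) mod radix (lev J v) J i)"

lemma bij_shift: "bij_betw (shift J v dl) (digits J v) (digits J v)"
proof -
 have sub: "shift J v dl ` digits J v \<subseteq> digits J v"
  by (rule image_subsetI) (simp add: shift_def digits_def restrict_PiE_iff)
 have "inj_on (shift J v dl) (digits J v)"
 proof (rule inj_onI)
  fix g g' assume g: "g \<in> digits J v" "g' \<in> digits J v" and e: "shift J v dl g = shift J v dl g'"
  show "g = g'"
  proof
   fix i
   show "g i = g' i"
   proof (cases "i < n")
    case True
    let ?N = "radix (lev J v) J i"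
    have "(g i + dl i) mod ?N = (g' i + dl i) mod ?N" using fun_cong[OF e, of i] True by (simp add: shift_def)
    then have "[g i + dl i = g' i + dl i] (mod ?N)" by (simp add: cong_def)
    then have "[g i = g' i] (mod ?N)" by (simp only: cong_add_rcancel)
    then have c: "g i mod ?N = g' i mod ?N" by (simp only: cong_def)
    have i: "i \<in> {..<n}" using True by simp
    have "g i \<in> {0..<?N}" by (rule PiE_mem[OF g(1)[unfolded digits_def] i])
    moreover have "g' i \<in> {0..<?N}" by (rule PiE_mem[OF g(2)[unfolded digits_def] i])
    ultimately have "g i mod ?N = g i" "g' i mod ?N = g' i" by (simp_all only: atLeastLessThan_iff mod_pos_pos_trivial)
    with c show ?thesis by (simp only:)
   next
    case False
    then have i: "i ~: {..<n}" by simp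
    show ?thesis unfolding PiE_arb[OF g(1)[unfolded digits_def] i] PiE_arb[OF g(2)[unfolded digits_def] i] ..
   qed
  qed
 qed
 then show ?thesis using endo_inj_surj[OF finite_digits sub] by (simp add: bij_betw_def)
qed

text \<open>Averaging over shifts of up to three coordinates: j1 and j2 in the block make r a
  nonzero square for at least 1/9 of the shifts, and j3 produces a coordinate prime to p for at
  least 2/3 of them. As j3 lies outside the block, the shares multiply to 2/27. The index n again
  stands for no coordinate.\<close>

lemma card_good:
 assumes f: "feas J v" "J <= n"
 shows "2 * card (digits J v) <= 27 * card {g \<in> digits J v. good J v g}"
proof -
 let ?d = "lev J v"
 have v: "valid J v" using f by (rule feas_valid)
 have fp: "prim --> (EX j<n. lbd ?d J j = 0)" using f by (simp add: feas_def)
 obtain j1 j2 where j12: "J < n & j1 \<in> blk J | j1 = n" "J < n & j2 \<in> blk J | j2 = n" and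
  cnt: "!!g. J < n ==> p\<^sup>2 <= 9 * card {(x, y) \<in> F \<times> F. nzsq (un J * (tau ?d - (\<Sum>j\<in>blk J. un j * (g j + (if j = j1 then x else if j = j2 then y else 0))\<^sup>2)))}"
 proof (cases "J < n")
  case True
  then have "P ^ ?d dvd t" "feas_sq J ?d" using f by (auto simp: feas_def)
  from feas_sq_count[OF True this] obtain j1 j2 where "j1 \<in> blk J | j1 = n" "j2 \<in> blk J | j2 = n"
   "ALL g. p\<^sup>2 <= 9 * card {(x, y) \<in> F \<times> F. nzsq (un J * (tau ?d - (\<Sum>j\<in>blk J. un j * (g j + (if j = j1 then x else if j = j2 then y else 0))\<^sup>2)))}"
   by (elim exE conjE)
  then show ?thesis using True by (intro that[of j1 j2]) simp_all
 next
  case False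
  then show ?thesis by (intro that[of n n]) simp_all
 qed
 define easy where "easy \<longleftrightarrow> ~ prim | J < n & v = 0"
 obtain j3 where j3: "J < n ==> j3 ~: blk J" and pr: "~ easy ==> j3 < n & j3 ~= J & lbd ?d J j3 = 0"
 proof (cases easy)
  case False
  then obtain j where j: "j < n" "lbd ?d J j = 0" using fp by (auto simp: easy_def)
  have v0: "v ~= 0" if "J < n" using False that by (auto simp: easy_def)
  have "j ~= J"
  proof
   assume e: "j = J"
   then have "ex J + 2 * v <= ex J" using j lbd_ge(2)[of ?d J j] by (simp add: lev_def)
   then show False using v0 j e by simp
  qed
  \<comment> \<open>A block index with lower bound 0 would have exponent ex J + 2 v > ex J, against
    the order of the exponents. So shifting j3 does not disturb the square condition.\<close>
  moreover have "j ~: blk J" if J: "J < n"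
  proof
   assume b: "j \<in> blk J"
   have "l <= v" using v J by (simp add: valid_def)
   from lbd_blk[OF J this b] have "ex j = lev J v" unfolding j(2) by simp
   then have "ex j = ex J + 2 * v" by (simp add: lev_def J)
   moreover have "ex j <= ex J" using b J ex_mono[of j J] by (simp add: blk_def)
   ultimately show False using v0[OF J] by simp
  qed
  ultimately show ?thesis using j by (intro that[of j]) simp_all
 next
  case True
  have "n ~: blk J" using f by (simp add: blk_def)
  then show ?thesis using True by (intro that[of n]) simp_all
 qed
 define dl where "dl = (%((x, y), w) i. if i = j1 then x else if i = j2 then y else if i = j3 then w else (0::int))"
 show ?thesis
 proof (rule card_pred_averaging[where T = "(F \<times> F) \<times> F" and ph = "%ta. shift J v (dl ta)"])
  show "finite (digits J v)" "finite ((F \<times> F) \<times> F)" by simp_all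
  show "(F \<times> F) \<times> F ~= {}" using p_ge_3 by auto
  show "bij_betw (shift J v (dl ta)) (digits J v) (digits J v)" for ta by (rule bij_shift)
  fix g assume g: "g \<in> digits J v"
  define A where "A = (%x y. J < n --> nzsq (un J * (tau ?d - (\<Sum>j\<in>blk J. un j * (g j + (if j = j1 then x else if j = j2 then y else 0))\<^sup>2))))"
  define B where "B = (%w. easy | ~ P dvd g j3 + w)"
  have imp: "good J v (shift J v (dl ((x, y), w)) g)" if a: "A x y" and b: "B w" for x y w
  proof -
   let ?g = "shift J v (dl ((x, y), w)) g"
   have sg: "[?g i = g i + dl ((x, y), w) i] (mod P)" if "i < n" "P dvd radix ?d J i" for i
    using that by (simp add: shift_def cong_def mod_mod_cancel)
   have "nzsq (rad ?d J ?g)"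
   proof (cases "J < n")
    case False
    then show ?thesis using nzsq_square[of 1] by (simp add: rad_def)
   next
    case J: True
    have c: "l <= v" "?d < k" "P ^ ?d dvd t" using f J by (auto simp: feas_def)
    have "[(\<Sum>j\<in>blk J. un j * (?g j)\<^sup>2) = (\<Sum>j\<in>blk J. un j * (g j + (if j = j1 then x else if j = j2 then y else 0))\<^sup>2)] (mod P)"
    proof (intro cong_sum cong_scalar_left cong_pow)
     fix j assume j: "j \<in> blk J"
     have jn: "j < n" "j ~= J" using j J by (auto simp: blk_def)
     have "ex j + 2 * lbd ?d J j = ?d" by (rule lbd_blk[OF J c(1) j])
     then have "P dvd radix ?d J j" using jn c(2) by (auto simp: radix_def intro!: dvd_power)
     then have c: "[?g j = g j + dl ((x, y), w) j] (mod P)" by (rule sg[OF jn(1)])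
     have "j ~= j3" using j3[OF J] j by blast
     then have "dl ((x, y), w) j = (if j = j1 then x else if j = j2 then y else 0)" by (simp only: dl_def prod.case if_False)
     with c show "[?g j = g j + (if j = j1 then x else if j = j2 then y else 0)] (mod P)" by (simp only:)
    qed
    then have "[un J * (tau ?d - (\<Sum>j\<in>blk J. un j * (?g j)\<^sup>2)) =
      un J * (tau ?d - (\<Sum>j\<in>blk J. un j * (g j + (if j = j1 then x else if j = j2 then y else 0))\<^sup>2))] (mod P)"
     by (intro cong_scalar_left cong_diff cong_refl)
    from nzsq_cong[OF this] show ?thesis using a J unfolding nzsq_rad[OF J c] A_def by simp
   qed
   moreover have "EX i<n. i ~= J & ~ P dvd y0 ?d J ?g i" if ne: "~ easy"
   proof -
    note j = pr[OF ne]
    have "P dvd radix ?d J j3" using j k_pos by (auto simp: radix_def intro!: dvd_power)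
    then have "[?g j3 = g j3 + dl ((x, y), w) j3] (mod P)" using sg j by blast
    moreover have "dl ((x, y), w) j3 = w" using j12 j3 j by (auto simp: dl_def)
    ultimately have "~ P dvd ?g j3" using b ne cong_dvd_iff by (fastforce simp: B_def)
    then have "~ P dvd y0 ?d J ?g j3" using j by (simp add: y0_def)
    then show ?thesis using j by blast
   qed
   ultimately show ?thesis unfolding good_def easy_def by blast
  qed
  have "{((x, y), w) \<in> (F \<times> F) \<times> F. A x y & B w} \<subseteq> {ta \<in> (F \<times> F) \<times> F. good J v (shift J v (dl ta) g)}"
  proof
   fix ta assume "ta \<in> {((x, y), w) \<in> (F \<times> F) \<times> F. A x y & B w}"
   then obtain x y w where "ta = ((x, y), w)" "ta \<in> (F \<times> F) \<times> F" "A x y" "B w" by blast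
   then show "ta \<in> {ta \<in> (F \<times> F) \<times> F. good J v (shift J v (dl ta) g)}" using imp by blast
  qed
  then have le: "card {((x, y), w) \<in> (F \<times> F) \<times> F. A x y & B w} <= card {ta \<in> (F \<times> F) \<times> F. good J v (shift J v (dl ta) g)}"
   by (rule card_mono[rotated]) (rule finite_subset[of _ "(F \<times> F) \<times> F"], auto)
  have cA: "p\<^sup>2 <= 9 * card {(x, y) \<in> F \<times> F. A x y}"
  proof (cases "J < n")
   case True
   show ?thesis unfolding A_def using cnt[OF True, of g] True by simp
  next
   case False
   then have "{(x, y) \<in> F \<times> F. A x y} = F \<times> F" by (auto simp: A_def)
   then have "card {(x, y) \<in> F \<times> F. A x y} = p\<^sup>2" by (simp only: card_F2)
   then show ?thesis by simp
  qed
  have cB: "2 * p <= 3 * card {w \<in> F. B w}"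
  proof (cases easy)
   case True
   then have "{w \<in> F. B w} = F" by (auto simp: B_def)
   then have "card {w \<in> F. B w} = p" by simp
   then show ?thesis by simp
  next
   case False
   then show ?thesis using card_unit_shift[of "g j3"] by (simp add: B_def)
  qed
  have "p\<^sup>2 * (2 * p) <= (9 * card {(x, y) \<in> F \<times> F. A x y}) * (3 * card {w \<in> F. B w})" by (rule mult_le_mono[OF cA cB])
  also have "... = 27 * card {((x, y), w) \<in> (F \<times> F) \<times> F. A x y & B w}" by (simp only: card_triple)
  also have "... <= 27 * card {ta \<in> (F \<times> F) \<times> F. good J v (shift J v (dl ta) g)}" using le by simp
  finally have fin: "p\<^sup>2 * (2 * p) <= 27 * card {ta \<in> (F \<times> F) \<times> F. good J v (shift J v (dl ta) g)}" .
  have cT: "card ((F \<times> F) \<times> F) = p\<^sup>2 * p" unfolding card_cartesian_product[of "F \<times> F"] card_F2 by simp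
  show "2 * card ((F \<times> F) \<times> F) <= 27 * card {ta \<in> (F \<times> F) \<times> F. good J v (shift J v (dl ta) g)}"
   using fin by (simp only: cT mult.assoc mult.commute[of 2] mult.left_commute[of 2])
 qed
qed

text \<open>The factor 135 is 27 * 5: the share 2/27 of good digits and the share 1/5 of values a
  from \<open>gm_ge\<close>.\<close>

lemma card_success:
 assumes f: "feas J v" "J <= n"
 shows "2 * (card (digits J v) * nat (mult J v) * p ^ k) <=
  135 * card {(g, R, a). g \<in> digits J v & R \<in> {0..<mult J v} & a \<in> {0..<m} & success J v g R a}"
proof -
 let ?d = "lev J v"
 have v: "valid J v" using f by (rule feas_valid)
 let ?G = "{g \<in> digits J v. good J v g}" and ?A = "%g. {0..<mult J v} \<times> {a \<in> {0..<m}. nonsq (a\<^sup>2 - rad ?d J g)}"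
 have "{(g, R, a). g \<in> digits J v & R \<in> {0..<mult J v} & a \<in> {0..<m} & success J v g R a} = (SIGMA g:?G. ?A g)"
  unfolding success_iff[OF v] good_def by blast
 then have "card {(g, R, a). g \<in> digits J v & R \<in> {0..<mult J v} & a \<in> {0..<m} & success J v g R a} = card (SIGMA g:?G. ?A g)"
  by simp
 also have "... = (\<Sum>g\<in>?G. card (?A g))" 
 proof (rule card_SigmaI)
  show "finite ?G" by simp
  show "\<forall>g\<in>?G. finite (?A g)"
   by (intro ballI finite_cartesian_product finite_subset[of "{a \<in> {0..<m}. _ a}" "{0..<m}"]) auto
 qed
 also have "... = (\<Sum>g\<in>?G. nat (mult J v) * (p ^ (k - 1) * gm))"
 proof (rule sum.cong[OF refl])
  fix g assume "g \<in> ?G"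
  then have "nzsq (rad ?d J g)" by (simp add: good_def)
  then show "card (?A g) = nat (mult J v) * (p ^ (k - 1) * gm)"
   by (simp only: card_cartesian_product card_nonsq_shift_power[OF k_pos]) simp
 qed
 also have "... = card ?G * (nat (mult J v) * (p ^ (k - 1) * gm))" by simp
 finally have c: "card {(g, R, a). g \<in> digits J v & R \<in> {0..<mult J v} & a \<in> {0..<m} & success J v g R a} =
   card ?G * (nat (mult J v) * (p ^ (k - 1) * gm))" .
 have "p ^ k = p ^ (k - 1) * p" using k_pos power_minus_mult[of k p] by simp
 also have "... <= p ^ (k - 1) * (5 * gm)" by (rule mult_le_mono2[OF gm_ge])
 finally have g: "nat (mult J v) * p ^ k <= nat (mult J v) * (p ^ (k - 1) * (5 * gm))" by (rule mult_le_mono2)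
 have "(2 * card (digits J v)) * (nat (mult J v) * p ^ k) <= (27 * card ?G) * (nat (mult J v) * (p ^ (k - 1) * (5 * gm)))"
  by (rule mult_le_mono[OF card_good[OF f] g])
 then show ?thesis unfolding c by (simp add: ac_simps)
qed

end

section \<open>Counting by quotients, remainders, rows and columns\<close>

lemma card_div_mod:
 fixes A B :: int
 assumes A: "A > 0"
 shows "card {z \<in> {0..<A * B}. R (z mod A) (z div A)} = card {(x, y). x \<in> {0..<A} & y \<in> {0..<B} & R x y}"
proof -
 have "bij_betw (%z. (z mod A, z div A)) {z \<in> {0..<A * B}. R (z mod A) (z div A)} {(x, y). x \<in> {0..<A} & y \<in> {0..<B} & R x y}"
 proof (rule bij_betw_byWitness[where f' = "%(x, y). x + A * y"])
  show "\<forall>z\<in>{z \<in> {0..<A * B}. R (z mod A) (z div A)}. (case (z mod A, z div A) of (x, y) => x + A * y) = z"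
   by simp
  show "\<forall>z\<in>{(x, y). x \<in> {0..<A} & y \<in> {0..<B} & R x y}. (%z. (z mod A, z div A)) (case z of (x, y) => x + A * y) = z"
   by (auto simp: mod_pos_pos_trivial div_pos_pos_trivial)
  show "(%z. (z mod A, z div A)) ` {z \<in> {0..<A * B}. R (z mod A) (z div A)} \<subseteq> {(x, y). x \<in> {0..<A} & y \<in> {0..<B} & R x y}"
  proof (rule image_subsetI)
   fix z assume z: "z \<in> {z \<in> {0..<A * B}. R (z mod A) (z div A)}"
   have "A * (z div A) <= z" using mult_div_mod_eq[of A z] pos_mod_sign[OF A, of z] by linarith
   then have "A * (z div A) < A * B" using z by simp
   then have "z div A < B" using A by (simp only: mult_less_cancel_left_pos)
   then show "(z mod A, z div A) \<in> {(x, y). x \<in> {0..<A} & y \<in> {0..<B} & R x y}"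
    using z A by (simp add: pos_imp_zdiv_nonneg_iff)
  qed
  show "(%(x, y). x + A * y) ` {(x, y). x \<in> {0..<A} & y \<in> {0..<B} & R x y} \<subseteq> {z \<in> {0..<A * B}. R (z mod A) (z div A)}"
  proof (rule image_subsetI, clarify)
   fix x y assume *: "x \<in> {0..<A}" "y \<in> {0..<B}" "R x y"
   have "A * (y + 1) <= A * B" using * A by (intro mult_left_mono) auto
   then have "x + A * y < A * B" using * by (simp add: algebra_simps)
   moreover have "(x + A * y) mod A = x" "(x + A * y) div A = y" using * by (auto simp: mod_pos_pos_trivial div_pos_pos_trivial)
   ultimately show "x + A * y \<in> {0..<A * B} & R ((x + A * y) mod A) ((x + A * y) div A)" using * A by simp
  qed
 qed
 then show ?thesis by (rule bij_betw_same_card)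
qed

lemma card_pairs_rows:
 assumes "finite A" "finite B"
 shows "card {(x, y). x \<in> A & y \<in> B & R x y} = (\<Sum>x\<in>A. card {y \<in> B. R x y})"
proof -
 have e: "{(x, y). x \<in> A & y \<in> B & R x y} = (SIGMA x:A. {y \<in> B. R x y})" by blast
 show ?thesis unfolding e using assms by (subst card_SigmaI) simp_all
qed

lemma card_pairs_columns:
 assumes "finite A" "finite B"
 shows "card {(x, y). x \<in> A & y \<in> B & R x y} = (\<Sum>y\<in>B. card {x \<in> A. R x y})"
proof -
 have "bij_betw prod.swap {(x, y). x \<in> A & y \<in> B & R x y} {(y, x). y \<in> B & x \<in> A & R x y}"
  by (rule bij_betw_byWitness[where f' = prod.swap]) auto
 then have "card {(x, y). x \<in> A & y \<in> B & R x y} = card {(y, x). y \<in> B & x \<in> A & R x y}" by (rule bij_betw_same_card)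
 then show ?thesis using card_pairs_rows[OF assms(2,1), of "%y x. R x y"] by simp
qed

lemma card_mod_periodic:
 fixes G D :: int
 assumes "G > 0"
 shows "card {w \<in> {0..<G * D}. Y (w mod G)} = nat D * card {x \<in> {0..<G}. Y x}"
proof -
 have "card {w \<in> {0..<G * D}. Y (w mod G)} = card {(x, y). x \<in> {0..<G} & y \<in> {0..<D} & Y x}"
  by (rule card_div_mod[OF assms, where R = "%x y. Y x"])
 also have "... = (\<Sum>y\<in>{0..<D}. card {x \<in> {0..<G}. Y x})" by (rule card_pairs_columns) simp_all
 finally show ?thesis by simp
qed

lemma sum_two_cases:
 fixes x w :: nat
 assumes "finite S" "!!z. ~ (A z & B z)"
 shows "(\<Sum>z\<in>S. if A z then x else if B z then w else 0) = card {z \<in> S. A z} * x + card {z \<in> S. B z} * w"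
proof -
 have "(\<Sum>z\<in>S. if A z then x else if B z then w else 0) = (\<Sum>z\<in>S. (if A z then x else 0) + (if B z then w else 0))"
  using assms(2) by (intro sum.cong) auto
 also have "... = card {z \<in> S. A z} * x + card {z \<in> S. B z} * w"
  using assms(1) by (simp add: sum.distrib sum.If_cases Int_def)
 finally show ?thesis .
qed

section \<open>Choosing a class by weight, and repeated attempts\<close>

context sampling
begin

text \<open>The code c stands for (J, v) = (c div k, c mod k), which is possible because v < k in
  every valid class. A nonzero weight is the number of pairs of digits and R, so one uniform number
  below the total selects class, digits and R together.\<close>

definition wt :: "nat => int" where
 "wt c = (if feas (c div k) (c mod k)
   then (\<Prod>j<n. radix (lev (c div k) (c mod k)) (c div k) j) * mult (c div k) (c mod k) else 0)"

definition tot :: "nat => int" where "tot N = (\<Sum>c<N. wt c)"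

abbreviation cl :: nat where "cl == (n + 1) * k"

definition catt :: "nat => int => int => (nat => int) option" where
 "catt c rh a = (let J = c div k; v = c mod k; N = radix (lev J v) J; g = (\<lambda>j\<in>{..<n}. digit N j rh); R = rest N n rh in
   if success J v g R a then Some (out J v g R a) else None)"

definition sel :: "int => nat" where "sel rh = (LEAST c. rh < tot (Suc c))"

definition attempt :: "int => int => (nat => int) option" where
 "attempt rh a = catt (sel rh) (rh - tot (sel rh)) a"

lemma mult_pos: "mult J v > 0"
 by (simp add: mult_def)

lemma prod_radix_pos: "(\<Prod>j<n. radix d J j) > 0"
 by (intro prod_pos) simp

lemma wt_nonneg: "wt c \<ge> 0"
 using mult_pos[of "c div k" "c mod k"] prod_radix_pos[of "lev (c div k) (c mod k)" "c div k"]
 unfolding wt_def by simp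

lemma wt_pos: "feas (c div k) (c mod k) ==> wt c > 0"
 using mult_pos[of "c div k" "c mod k"] prod_radix_pos[of "lev (c div k) (c mod k)" "c div k"]
 unfolding wt_def by simp

lemma tot_Suc: "tot (Suc N) = tot N + wt N"
 by (simp add: tot_def)

lemma tot_mono: "N <= N' ==> tot N <= tot N'"
 unfolding tot_def using wt_nonneg by (intro sum_mono2) auto

lemma tot_nonneg: "0 <= tot N"
 unfolding tot_def by (intro sum_nonneg wt_nonneg)

lemma sel_eq: "tot c <= rh ==> rh < tot (Suc c) ==> sel rh = c"
 unfolding sel_def
proof (rule Least_equality)
 fix y assume "tot c <= rh" "rh < tot (Suc y)"
 then show "c <= y" using tot_mono[of "Suc y" c] by linarith
qed

lemma sel_exists: "0 <= rh ==> rh < tot N ==> EX c<N. tot c <= rh & rh < tot (Suc c)"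
proof (induction N)
 case (Suc N)
 show ?case
 proof (cases "rh < tot N")
  case True
  then show ?thesis using Suc.IH Suc.prems less_SucI by blast
 next
  case False
  then show ?thesis using Suc.prems by (intro exI[of _ N]) simp
 qed
qed (simp add: tot_def)

lemma J_le: "c < cl ==> c div k <= n"
 using less_mult_imp_div_less[of c "n + 1" k] by simp

lemma card_catt:
 assumes "feas (c div k) (c mod k)"
 shows "card {(rh, a). rh \<in> {0..<wt c} & a \<in> {0..<m} & X (catt c rh a)} =
  card {(g, R, a). g \<in> digits (c div k) (c mod k) & R \<in> {0..<mult (c div k) (c mod k)} & a \<in> {0..<m} &
    X (if success (c div k) (c mod k) g R a then Some (out (c div k) (c mod k) g R a) else None)}"
  (is "card ?S = card ?T")
proof -
 let ?J = "c div k" let ?v = "c mod k" let ?N = "radix (lev ?J ?v) ?J"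
 define f where "f = (%x. (\<lambda>j\<in>{..<n}. digit ?N j x, rest ?N n x))"
 have W: "wt c = (\<Prod>j<n. ?N j) * mult ?J ?v" using assms by (simp only: wt_def if_True)
 have b: "bij_betw f {0..<wt c} (digits ?J ?v \<times> {0..<mult ?J ?v})"
  unfolding f_def W digits_def by (rule mixed_radix_bij) (use mult_pos[of ?J ?v] in simp_all)
 have ca: "catt c rh a = (if success ?J ?v (fst (f rh)) (snd (f rh)) a then Some (out ?J ?v (fst (f rh)) (snd (f rh)) a) else None)" for rh a
  by (simp only: catt_def Let_def f_def fst_conv snd_conv)
 have "bij_betw (%(rh, a). (fst (f rh), snd (f rh), a)) ?S ?T"
  unfolding bij_betw_def
 proof
  show "inj_on (%(rh, a). (fst (f rh), snd (f rh), a)) ?S"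
  proof (rule inj_onI)
   fix x y assume x: "x \<in> ?S" and y: "y \<in> ?S" and e: "(%(rh, a). (fst (f rh), snd (f rh), a)) x = (%(rh, a). (fst (f rh), snd (f rh), a)) y"
   obtain rh a rh' a' where xy: "x = (rh, a)" "y = (rh', a')" by (cases x, cases y)
   have "fst (f rh) = fst (f rh') & snd (f rh) = snd (f rh') & a = a'" using e unfolding xy by simp
   then have "f rh = f rh'" "a = a'" by (auto intro: prod_eqI)
   moreover have "rh \<in> {0..<wt c}" "rh' \<in> {0..<wt c}" using x y unfolding xy by simp_all
   ultimately show "x = y" unfolding xy using bij_betw_imp_inj_on[OF b] by (simp add: inj_onD)
  qed
  show "(%(rh, a). (fst (f rh), snd (f rh), a)) ` ?S = ?T"
  proof (intro equalityI subsetI)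
   fix w assume "w \<in> (%(rh, a). (fst (f rh), snd (f rh), a)) ` ?S"
   then obtain rh a where w: "w = (fst (f rh), snd (f rh), a)" and S: "rh \<in> {0..<wt c}" "a \<in> {0..<m}" "X (catt c rh a)" by auto
   have "f rh \<in> digits ?J ?v \<times> {0..<mult ?J ?v}" using bij_betw_apply[OF b S(1)] .
   then show "w \<in> ?T" using S(2,3) unfolding w ca by (simp add: mem_Times_iff)
  next
   fix w assume w: "w \<in> ?T"
   obtain g R a where e: "w = (g, R, a)" by (cases w)
   have T: "g \<in> digits ?J ?v" "R \<in> {0..<mult ?J ?v}" "a \<in> {0..<m}"
    "X (if success ?J ?v g R a then Some (out ?J ?v g R a) else None)" using w unfolding e by simp_all
   have "(g, R) \<in> f ` {0..<wt c}" unfolding bij_betw_imp_surj_on[OF b] using T(1,2) by (rule SigmaI)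
   then obtain rh where r: "rh \<in> {0..<wt c}" "f rh = (g, R)" by (metis imageE)
   have "X (catt c rh a)" unfolding ca r(2) fst_conv snd_conv by (rule T(4))
   then have "(rh, a) \<in> ?S" using r(1) T(3) by simp
   then show "w \<in> (%(rh, a). (fst (f rh), snd (f rh), a)) ` ?S" unfolding e using r(2) by (intro image_eqI[of _ _ "(rh, a)"]) simp_all
  qed
 qed
 then show ?thesis by (rule bij_betw_same_card)
qed

lemma digits_of_code:
 assumes "feas (c div k) (c mod k)" "0 <= rh" "rh < wt c"
 defines "N == radix (lev (c div k) (c mod k)) (c div k)"
 shows "(\<lambda>j\<in>{..<n}. digit N j rh) \<in> digits (c div k) (c mod k)" "0 <= rest N n rh" "rest N n rh < mult (c div k) (c mod k)"
proof -
 have W: "wt c = (\<Prod>j<n. N j) * mult (c div k) (c mod k)" using assms(1) by (simp only: wt_def if_True N_def)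
 show "0 <= rest N n rh" "rest N n rh < mult (c div k) (c mod k)"
  using rest_bounds[of n N rh "mult (c div k) (c mod k)"] assms(2,3) W by (simp_all add: N_def)
 show "(\<lambda>j\<in>{..<n}. digit N j rh) \<in> digits (c div k) (c mod k)"
  by (simp add: digits_def digit_def restrict_PiE_iff N_def)
qed

lemma catt_sound:
 assumes "c < cl" "0 <= rh" "rh < wt c" "catt c rh a = Some y"
 shows "y \<in> sols" "in_class (c div k) (c mod k) y"
proof -
 have f: "feas (c div k) (c mod k)" using assms(2,3) by (auto simp: wt_def split: if_splits)
 let ?N = "radix (lev (c div k) (c mod k)) (c div k)"
 note D = digits_of_code[OF f assms(2,3)]
 have s: "success (c div k) (c mod k) (\<lambda>j\<in>{..<n}. digit ?N j rh) (rest ?N n rh) a"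
  and y: "y = out (c div k) (c mod k) (\<lambda>j\<in>{..<n}. digit ?N j rh) (rest ?N n rh) a"
  using assms(4) unfolding catt_def Let_def by (simp_all split: if_splits)
 show "y \<in> sols" "in_class (c div k) (c mod k) y"
  unfolding y by (rule out_sound[OF f J_le[OF assms(1)] D s])+
qed

lemma card_catt_sol:
 assumes c: "c < cl" and y: "y \<in> sols"
 shows "card {(rh, a). rh \<in> {0..<wt c} & a \<in> {0..<m} & catt c rh a = Some y} =
  (if in_class (c div k) (c mod k) y then p ^ (k - 1) * gm else 0)"
proof (cases "in_class (c div k) (c mod k) y")
 case True
 let ?J = "c div k" let ?v = "c mod k"
 have f: "feas ?J ?v" by (rule sol_feas[OF y True J_le[OF c]])
 have "card {(rh, a). rh \<in> {0..<wt c} & a \<in> {0..<m} & catt c rh a = Some y} =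
  card {(g, R, a). g \<in> digits ?J ?v & R \<in> {0..<mult ?J ?v} & a \<in> {0..<m} &
    (if success ?J ?v g R a then Some (out ?J ?v g R a) else None) = Some y}"
  by (rule card_catt[OF f, where X = "%w. w = Some y"])
 moreover have "{(g, R, a). g \<in> digits ?J ?v & R \<in> {0..<mult ?J ?v} & a \<in> {0..<m} &
    (if success ?J ?v g R a then Some (out ?J ?v g R a) else None) = Some y} =
   {(g, R, a). g \<in> digits ?J ?v & R \<in> {0..<mult ?J ?v} & a \<in> {0..<m} & success ?J ?v g R a & out ?J ?v g R a = y}"
  by (auto split: if_splits)
 ultimately show ?thesis using card_preimages[OF y True J_le[OF c]] True by (simp only: if_True)
next
 case False
 have e: "{(rh, a). rh \<in> {0..<wt c} & a \<in> {0..<m} & catt c rh a = Some y} = {}"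
  using catt_sound(2)[OF c] False by (auto simp del: split_paired_All)
 show ?thesis unfolding e using False by simp
qed

lemma card_catt_success:
 assumes c: "c < cl"
 shows "2 * (nat (wt c) * p ^ k) <= 135 * card {(rh, a). rh \<in> {0..<wt c} & a \<in> {0..<m} & catt c rh a ~= None}"
proof (cases "feas (c div k) (c mod k)")
 case True
 let ?J = "c div k" let ?v = "c mod k"
 have "int (card (digits ?J ?v)) = (\<Prod>j<n. radix (lev ?J ?v) ?J j)"
  unfolding digits_def by (subst card_PiE) (auto simp: less_imp_le)
 then have W: "nat (wt c) = card (digits ?J ?v) * nat (mult ?J ?v)"
  using True by (simp only: wt_def if_True) (metis nat_int nat_mult_distrib of_nat_0_le_iff)
 have "card {(rh, a). rh \<in> {0..<wt c} & a \<in> {0..<m} & catt c rh a ~= None} =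
  card {(g, R, a). g \<in> digits ?J ?v & R \<in> {0..<mult ?J ?v} & a \<in> {0..<m} &
    (if success ?J ?v g R a then Some (out ?J ?v g R a) else None) ~= None}"
  by (rule card_catt[OF True, where X = "%w. w ~= None"])
 moreover have "{(g, R, a). g \<in> digits ?J ?v & R \<in> {0..<mult ?J ?v} & a \<in> {0..<m} &
    (if success ?J ?v g R a then Some (out ?J ?v g R a) else None) ~= None} =
   {(g, R, a). g \<in> digits ?J ?v & R \<in> {0..<mult ?J ?v} & a \<in> {0..<m} & success ?J ?v g R a}"
  by (auto split: if_splits)
 ultimately show ?thesis using card_success[OF True J_le[OF c]] unfolding W by (simp only:)
next
 case False
 then show ?thesis by (simp add: wt_def)
qed

lemma card_attempt:
 "card {(rh, a). rh \<in> {0..<tot N} & a \<in> {0..<m} & X (attempt rh a)} =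
  (\<Sum>c<N. card {(rh, a). rh \<in> {0..<wt c} & a \<in> {0..<m} & X (catt c rh a)})"
proof (induction N)
 case 0
 show ?case by (simp add: tot_def)
next
 case (Suc N)
 let ?S = "%N. {(rh, a). rh \<in> {0..<tot N} & a \<in> {0..<m} & X (attempt rh a)}"
 let ?T = "{(rh, a). rh \<in> {0..<wt N} & a \<in> {0..<m} & X (catt N rh a)}"
 let ?f = "%(rh, a::int). (rh + tot N, a)"
 have at: "attempt (rh + tot N) a = catt N rh a" if "0 <= rh" "rh < wt N" for rh a
  unfolding attempt_def using sel_eq[of N "rh + tot N"] that by (simp add: tot_Suc)
 have fin: "finite (?S N)" "finite ?T"
  by (rule finite_subset[of _ "{0..<tot N} \<times> {0..<m}"], auto)
   (rule finite_subset[of _ "{0..<wt N} \<times> {0..<m}"], auto)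
 have "?S (Suc N) = ?S N \<union> ?f ` ?T"
 proof (intro equalityI subsetI)
  fix w assume w: "w \<in> ?S (Suc N)"
  obtain rh a where e: "w = (rh, a)" by (cases w)
  have S: "0 <= rh" "rh < tot N + wt N" "a \<in> {0..<m}" "X (attempt rh a)" using w unfolding e by (simp_all add: tot_Suc)
  show "w \<in> ?S N \<union> ?f ` ?T"
  proof (cases "rh < tot N")
   case True
   then show ?thesis unfolding e using S by simp
  next
   case False
   have "(rh - tot N, a) \<in> ?T" using S False at[of "rh - tot N" a] by simp
   then have "?f (rh - tot N, a) \<in> ?f ` ?T" by (rule imageI)
   then show ?thesis unfolding e by simp
  qed
 next
  fix w assume "w \<in> ?S N \<union> ?f ` ?T"
  then show "w \<in> ?S (Suc N)"
  proof
   assume "w \<in> ?S N"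
   then show ?thesis using wt_nonneg[of N] by (auto simp: tot_Suc)
  next
   assume "w \<in> ?f ` ?T"
   then obtain rh a where e: "w = (rh + tot N, a)" and T: "0 <= rh" "rh < wt N" "a \<in> {0..<m}" "X (catt N rh a)" by auto
   then show ?thesis unfolding e using at[OF T(1,2)] tot_nonneg[of N] by (simp add: tot_Suc)
  qed
 qed
 moreover have "?S N \<inter> ?f ` ?T = {}" by auto
 moreover have "inj_on ?f ?T" by (auto simp: inj_on_def)
 ultimately have "card (?S (Suc N)) = card (?S N) + card ?T" using fin by (simp only: card_Un_disjoint finite_imageI card_image)
 then show ?case unfolding Suc.IH by simp
qed

lemma class_of_sol:
 assumes y: "y \<in> sols"
 shows "EX c<cl. ALL c'<cl. in_class (c' div k) (c' mod k) y \<longleftrightarrow> c' = c"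
proof -
 have lv: "P ^ l dvd y i" if "i < n" for i using y that by (simp add: sols_def)
 have "EX J v. J <= n & in_class J v y" by (rule in_class_exists) (rule lv)
 then obtain J v where J: "J <= n" and c: "in_class J v y" by blast
 have vk: "v < k" using in_class_valid[OF c J] v_le_lev[of J v] k_pos by (auto simp: valid_def split: if_splits)
 then have dm: "(J * k + v) div k = J" "(J * k + v) mod k = v" by auto
 have "J * k + v < J * k + k" using vk by simp
 also have "J * k + k = (J + 1) * k" by simp
 also have "... <= cl" using J by (intro mult_le_mono1) simp
 finally have lt: "J * k + v < cl" .
 have "in_class (c' div k) (c' mod k) y \<longleftrightarrow> c' = J * k + v" if c': "c' < cl" for c'
 proof
  assume "in_class (c' div k) (c' mod k) y"
  from in_class_unique[OF this c J_le[OF c'] J] show "c' = J * k + v" by (metis div_mult_mod_eq)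
 next
  assume "c' = J * k + v"
  then show "in_class (c' div k) (c' mod k) y" using c dm by simp
 qed
 then show ?thesis using lt by blast
qed

text \<open>Every solution lies in exactly one class, and the contribution of that class is the same
  number for all solutions.\<close>

lemma card_attempt_sol:
 assumes y: "y \<in> sols"
 shows "card {(rh, a). rh \<in> {0..<tot cl} & a \<in> {0..<m} & attempt rh a = Some y} = p ^ (k - 1) * gm"
proof -
 obtain c where c: "c < cl" "!!c'. c' < cl ==> in_class (c' div k) (c' mod k) y \<longleftrightarrow> c' = c"
  using class_of_sol[OF y] by blast
 have "card {(rh, a). rh \<in> {0..<tot cl} & a \<in> {0..<m} & attempt rh a = Some y} =
  (\<Sum>c'<cl. card {(rh, a). rh \<in> {0..<wt c'} & a \<in> {0..<m} & catt c' rh a = Some y})"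
  by (rule card_attempt[where X = "%w. w = Some y"])
 also have "... = (\<Sum>c'<cl. if c' = c then p ^ (k - 1) * gm else 0)"
  by (rule sum.cong[OF refl]) (use card_catt_sol[OF _ y] c(2) in simp)
 also have "... = p ^ (k - 1) * gm" using c(1) by (simp del: mult_Suc add_mult_distrib)
 finally show ?thesis .
qed

lemma card_attempt_success:
 "2 * (nat (tot cl) * p ^ k) <= 135 * card {(rh, a). rh \<in> {0..<tot cl} & a \<in> {0..<m} & attempt rh a ~= None}"
proof -
 have n: "nat (tot N) = (\<Sum>c<N. nat (wt c))" for N
  by (induction N) (simp_all add: tot_Suc nat_add_distrib tot_nonneg wt_nonneg, simp add: tot_def)
 have "2 * (nat (tot cl) * p ^ k) = (\<Sum>c<cl. 2 * (nat (wt c) * p ^ k))"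
  unfolding n by (simp only: sum_distrib_left sum_distrib_right)
 also have "... <= (\<Sum>c<cl. 135 * card {(rh, a). rh \<in> {0..<wt c} & a \<in> {0..<m} & catt c rh a ~= None})"
  by (rule sum_mono, rule card_catt_success) simp
 also have "... = 135 * card {(rh, a). rh \<in> {0..<tot cl} & a \<in> {0..<m} & attempt rh a ~= None}"
  by (simp only: card_attempt[where X = "%w. w ~= None"] sum_distrib_left)
 finally show ?thesis .
qed

lemma attempt_sound:
 assumes "0 <= rh" "rh < tot cl" "attempt rh a = Some y"
 shows "y \<in> sols"
proof -
 obtain c where c: "c < cl" "tot c <= rh" "rh < tot (Suc c)" using sel_exists[OF assms(1,2)] by blast
 have "catt c (rh - tot c) a = Some y" using assms(3) unfolding attempt_def sel_eq[OF c(2,3)] .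
 then show ?thesis by (rule catt_sound(1)[OF c(1), rotated 2]) (use c(2,3) in \<open>simp_all add: tot_Suc\<close>)
qed

text \<open>Because feasibility is decided exactly, the total weight settles existence, and the
  absence of representations is reported with certainty.\<close>

lemma tot_pos_iff: "tot cl > 0 \<longleftrightarrow> sols ~= {}"
proof
 assume g: "tot cl > 0"
 have "card {(rh, a). rh \<in> {0..<tot cl} & a \<in> {0..<m} & attempt rh a ~= None} ~= 0"
  using card_attempt_success g by (intro notI) simp
 then have "{(rh, a). rh \<in> {0..<tot cl} & a \<in> {0..<m} & attempt rh a ~= None} ~= {}" by (metis card.empty)
 then obtain rh a y where "0 <= rh" "rh < tot cl" "attempt rh a = Some y" by auto
 then show "sols ~= {}" using attempt_sound by blast
next
 assume "sols ~= {}"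
 then obtain y where y: "y \<in> sols" by blast
 obtain c where c: "c < cl" "in_class (c div k) (c mod k) y" using class_of_sol[OF y] by blast
 have "wt c > 0" by (rule wt_pos[OF sol_feas[OF y c(2) J_le[OF c(1)]]])
 then have "tot (Suc c) > 0" using tot_nonneg[of c] by (simp add: tot_Suc)
 then show "tot cl > 0" using tot_mono[of "Suc c" cl] c(1) by simp
qed

text \<open>The quotient z div m is rejected above the largest multiple of the total weight that is
  at most M; below it, the remainder modulo the total weight is exactly uniform.\<close>

definition one :: "int => int => (nat => int) option" where
 "one M z = (if z div m < M div tot cl * tot cl then attempt (z div m mod tot cl) (z mod m) else None)"

primrec multi :: "int => nat => int => (nat => int) option" where
 "multi M 0 Z = None"
| "multi M (Suc T) Z = (case one M (Z mod (m * M)) of Some y => Some y | None => multi M T (Z div (m * M)))"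

context
 fixes M :: int
 assumes G: "tot cl > 0" and M: "M \<ge> tot cl"
begin

lemma card_one:
 assumes X: "~ X None"
 shows "card {z \<in> {0..<m * M}. X (one M z)} =
  nat (M div tot cl) * card {(rh, a). rh \<in> {0..<tot cl} & a \<in> {0..<m} & X (attempt rh a)}"
proof -
 let ?G = "tot cl" let ?D = "M div ?G"
 have DM: "?G * ?D <= M" using mult_div_mod_eq[of ?G M] pos_mod_sign[OF G, of M] by linarith
 have "card {z \<in> {0..<m * M}. X (one M z)} =
   card {z \<in> {0..<m * M}. (%a w. w < ?D * ?G & X (attempt (w mod ?G) a)) (z mod m) (z div m)}"
  by (rule arg_cong[where f = card], rule Collect_cong) (simp add: one_def X)
 also have "... = card {(a, w). a \<in> {0..<m} & w \<in> {0..<M} & w < ?D * ?G & X (attempt (w mod ?G) a)}"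
  by (rule card_div_mod) simp
 also have "... = (\<Sum>a\<in>{0..<m}. card {w \<in> {0..<M}. w < ?D * ?G & X (attempt (w mod ?G) a)})"
  by (rule card_pairs_rows) simp_all
 also have "... = (\<Sum>a\<in>{0..<m}. nat ?D * card {rh \<in> {0..<?G}. X (attempt rh a)})"
 proof (rule sum.cong[OF refl])
  fix a
  have "{w \<in> {0..<M}. w < ?D * ?G & X (attempt (w mod ?G) a)} = {w \<in> {0..<?G * ?D}. X (attempt (w mod ?G) a)}"
   using DM by (auto simp: mult.commute)
  then show "card {w \<in> {0..<M}. w < ?D * ?G & X (attempt (w mod ?G) a)} = nat ?D * card {rh \<in> {0..<?G}. X (attempt rh a)}"
   using card_mod_periodic[OF G, of ?D "%rh. X (attempt rh a)"] by (simp only:)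
 qed
 also have "... = nat ?D * (\<Sum>a\<in>{0..<m}. card {rh \<in> {0..<?G}. X (attempt rh a)})" by (simp only: sum_distrib_left)
 also have "(\<Sum>a\<in>{0..<m}. card {rh \<in> {0..<?G}. X (attempt rh a)}) =
   card {(rh, a). rh \<in> {0..<tot cl} & a \<in> {0..<m} & X (attempt rh a)}"
  by (rule card_pairs_columns[symmetric]) simp_all
 finally show ?thesis .
qed

lemma card_one_sol: "y \<in> sols ==> card {z \<in> {0..<m * M}. one M z = Some y} = nat (M div tot cl) * (p ^ (k - 1) * gm)"
 using card_one[of "%w. w = Some y"] by (simp only: card_attempt_sol) simp

text \<open>At least half of [0, M) is kept since M is not below the total weight, and of this a
  share of 2/135 succeeds; 1/135 remains.\<close>

lemma card_one_fail: "135 * card {z \<in> {0..<m * M}. one M z = None} <= 134 * nat (m * M)"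
proof -
 let ?G = "tot cl" let ?D = "M div ?G"
 let ?A = "{z \<in> {0..<m * M}. one M z = None}" let ?B = "{z \<in> {0..<m * M}. one M z ~= None}"
 have s: "card ?A + card ?B = nat (m * M)"
 proof -
  have "?A \<union> ?B = {0..<m * M}" "?A \<inter> ?B = {}" by auto
  moreover have "finite ?A" "finite ?B" by (rule finite_subset[of _ "{0..<m * M}"], auto)+
  ultimately have "card ?A + card ?B = card {0..<m * M}" using card_Un_disjoint[of ?A ?B] by (simp only:)
  then show ?thesis by simp
 qed
 have "?D \<ge> 1" using M G by (simp add: pos_imp_zdiv_pos_iff int_one_le_iff_zero_less)
 then have "?G * 1 <= ?G * ?D" using G by (intro mult_left_mono) simp_all
 moreover have "M < ?G * ?D + ?G" using mult_div_mod_eq[of ?G M] pos_mod_bound[OF G, of M] by linarith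
 ultimately have "M <= 2 * (?D * ?G)" by (simp add: mult.commute)
 then have "nat M <= nat (2 * (?D * ?G))" by (rule nat_mono)
 also have "nat (2 * (?D * ?G)) = 2 * (nat ?D * nat ?G)" using \<open>?D \<ge> 1\<close> G by (simp add: nat_mult_distrib)
 finally have "nat M * p ^ k <= 2 * (nat ?D * nat ?G) * p ^ k" by (rule mult_le_mono1)
 moreover have "nat (m * M) = nat M * p ^ k"
  using nat_mult_distrib[of m M] by (simp add: nat_power_eq mult.commute)
 moreover have "2 * (nat ?D * nat ?G) * p ^ k = nat ?D * (2 * (nat ?G * p ^ k))" by (simp add: ac_simps)
 moreover have "nat ?D * (2 * (nat ?G * p ^ k)) <= nat ?D * (135 * card {(rh, a). rh \<in> {0..<tot cl} & a \<in> {0..<m} & attempt rh a ~= None})"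
  by (rule mult_le_mono2[OF card_attempt_success])
 moreover have "card ?B = nat ?D * card {(rh, a). rh \<in> {0..<tot cl} & a \<in> {0..<m} & attempt rh a ~= None}"
  by (rule card_one) simp
 ultimately have "nat (m * M) <= 135 * card ?B" by (simp only: mult.left_commute)
 then show ?thesis using s by linarith
qed

lemma M_pos: "M > 0" using G M by simp

lemma card_multi_Suc:
 "card {Z \<in> {0..<(m * M) ^ Suc T}. multi M (Suc T) Z = Some y} =
   card {z \<in> {0..<m * M}. one M z = Some y} * nat ((m * M) ^ T) +
   card {z \<in> {0..<m * M}. one M z = None} * card {Z \<in> {0..<(m * M) ^ T}. multi M T Z = Some y}"
 "card {Z \<in> {0..<(m * M) ^ Suc T}. multi M (Suc T) Z = None} =
   card {z \<in> {0..<m * M}. one M z = None} * card {Z \<in> {0..<(m * M) ^ T}. multi M T Z = None}"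
proof -
 have pos: "m * M > 0" using M_pos by simp
 have gen: "card {Z \<in> {0..<(m * M) ^ Suc T}. multi M (Suc T) Z = w} =
  (\<Sum>z\<in>{0..<m * M}. card {W \<in> {0..<(m * M) ^ T}. (case one M z of Some y => Some y | None => multi M T W) = w})" for w
  unfolding power_Suc multi.simps
  by (subst card_div_mod[OF pos, where R = "%z W. (case one M z of Some y => Some y | None => multi M T W) = w"],
    rule card_pairs_rows) simp_all
 show "card {Z \<in> {0..<(m * M) ^ Suc T}. multi M (Suc T) Z = Some y} =
   card {z \<in> {0..<m * M}. one M z = Some y} * nat ((m * M) ^ T) +
   card {z \<in> {0..<m * M}. one M z = None} * card {Z \<in> {0..<(m * M) ^ T}. multi M T Z = Some y}"
  unfolding gen
 proof (subst sum_two_cases[symmetric], simp, simp, rule sum.cong[OF refl])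
  fix z
  have "card {W \<in> {0..<(m * M) ^ T}. True} = card {0..<(m * M) ^ T}" by (rule arg_cong[where f = card]) auto
  then show "card {W \<in> {0..<(m * M) ^ T}. (case one M z of Some y => Some y | None => multi M T W) = Some y} =
   (if one M z = Some y then nat ((m * M) ^ T) else if one M z = None then card {Z \<in> {0..<(m * M) ^ T}. multi M T Z = Some y} else 0)"
   by (cases "one M z") auto
 qed
 have "card {Z \<in> {0..<(m * M) ^ Suc T}. multi M (Suc T) Z = None} =
   card {z \<in> {0..<m * M}. False} * 0 + card {z \<in> {0..<m * M}. one M z = None} * card {Z \<in> {0..<(m * M) ^ T}. multi M T Z = None}"
  unfolding gen by (subst sum_two_cases[symmetric], simp, simp, rule sum.cong[OF refl]) (auto split: option.split)
 then show "card {Z \<in> {0..<(m * M) ^ Suc T}. multi M (Suc T) Z = None} =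
   card {z \<in> {0..<m * M}. one M z = None} * card {Z \<in> {0..<(m * M) ^ T}. multi M T Z = None}" by simp
qed

lemma card_multi_sol: "EX C. \<forall>y\<in>sols. card {Z \<in> {0..<(m * M) ^ T}. multi M T Z = Some y} = C"
proof (induction T)
 case (Suc T)
 then obtain C where C: "!!y. y \<in> sols ==> card {Z \<in> {0..<(m * M) ^ T}. multi M T Z = Some y} = C" by blast
 show ?case unfolding card_multi_Suc(1) using C card_one_sol by (intro exI ballI) (simp only:)
qed simp

lemma multi_sound: "multi M T Z = Some y ==> 0 <= Z ==> y \<in> sols"
proof (induction T arbitrary: Z)
 case (Suc T)
 have pos: "m * M > 0" using M_pos by simp
 show ?case
 proof (cases "one M (Z mod (m * M))")
  case None
  then show ?thesis using Suc pos by (simp add: pos_imp_zdiv_nonneg_iff)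
 next
  case (Some y')
  let ?w = "Z mod (m * M) div m"
  have "attempt (?w mod tot cl) (Z mod (m * M) mod m) = Some y" using Some Suc.prems(1) by (simp add: one_def split: if_splits)
  then show ?thesis by (rule attempt_sound[OF pos_mod_sign[OF G] pos_mod_bound[OF G]])
 qed
qed simp

lemma card_multi_fail: "135 ^ T * card {Z \<in> {0..<(m * M) ^ T}. multi M T Z = None} <= 134 ^ T * nat ((m * M) ^ T)"
proof (induction T)
 case 0
 have "card {Z \<in> {0..<(m * M) ^ 0}. multi M 0 Z = None} <= card {0..<1::int}" by (rule card_mono) auto
 then show ?case by simp
next
 case (Suc T)
 have pos: "m * M \<ge> 0" using M_pos by simp
 have "135 ^ Suc T * card {Z \<in> {0..<(m * M) ^ Suc T}. multi M (Suc T) Z = None} =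
   (135 * card {z \<in> {0..<m * M}. one M z = None}) * (135 ^ T * card {Z \<in> {0..<(m * M) ^ T}. multi M T Z = None})"
  unfolding card_multi_Suc(2) by (simp only: power_Suc ac_simps)
 also have "... <= (134 * nat (m * M)) * (134 ^ T * nat ((m * M) ^ T))" by (rule mult_le_mono[OF card_one_fail Suc.IH])
 also have "... = 134 ^ Suc T * (nat (m * M) * nat ((m * M) ^ T))" by (simp only: power_Suc ac_simps)
 also have "nat (m * M) * nat ((m * M) ^ T) = nat ((m * M) ^ Suc T)" unfolding power_Suc by (rule nat_mult_distrib[OF pos, symmetric])
 finally show ?case .
qed

text \<open>(134/135)^200 is about 0.23.\<close>

lemma card_multi_fail_200: "3 * card {Z \<in> {0..<(m * M) ^ 200}. multi M 200 Z = None} <= nat ((m * M) ^ 200)"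
proof -
 let ?c = "card {Z \<in> {0..<(m * M) ^ 200}. multi M 200 Z = None}"
 have "135 ^ 200 * (3 * ?c) <= (3 * 134 ^ 200) * nat ((m * M) ^ 200)" using card_multi_fail[of 200] by linarith
 also have "... <= 135 ^ 200 * nat ((m * M) ^ 200)" by (rule mult_le_mono1) simp
 finally have "135 ^ 200 * (3 * ?c) <= 135 ^ 200 * nat ((m * M) ^ 200)" .
 then show ?thesis by (rule mult_left_le_imp_le) (rule zero_less_power, simp)
qed

end

text \<open>A weight is at most m^n * 2m, and there are (n + 1) k classes, where n + 1 <= m^n and k
  <= m; together with 2 <= m this gives exponent n + 1 + n + 2. One more factor m for the number a
  makes m^(2n+4) the range of an attempt.\<close>

lemma tot_le: "tot cl <= m ^ (2 * n + 3)"
proof -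
 have m2: "m \<ge> 2"
 proof -
  have "P ^ 1 <= m" using p_ge_3 k_pos by (intro power_increasing) simp_all
  then have "P <= m" by (simp only: power_one_right)
  then show ?thesis using p_ge_3 by linarith
 qed
 have w: "wt c <= m ^ n * (2 * m)" for c
 proof -
  have "radix d J j <= m" for d J j unfolding radix_def using m2 p_ge_3 by (auto intro: power_increasing)
  then have "(\<Prod>j<n. radix d J j) <= (\<Prod>j<n. m)" for d J by (intro prod_mono) (simp add: less_imp_le)
  then have r: "(\<Prod>j<n. radix d J j) <= m ^ n" for d J by simp
  show ?thesis
  proof (cases "feas (c div k) (c mod k)")
   case True
   have "mult (c div k) (c mod k) <= 2 * m"
    unfolding mult_def using True m2 p_ge_3 by (auto simp: feas_def intro!: power_increasing)
   then have "(\<Prod>j<n. radix (lev (c div k) (c mod k)) (c div k) j) * mult (c div k) (c mod k) <= m ^ n * (2 * m)"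
    using r mult_pos[of "c div k" "c mod k"] by (intro mult_mono) simp_all
   then show ?thesis using True by (simp only: wt_def if_True)
  next
   case False
   then show ?thesis using m2 by (simp add: wt_def)
  qed
 qed
 have "tot cl <= of_nat (card {..<cl}) * (m ^ n * (2 * m))" unfolding tot_def by (rule sum_bounded_above) (rule w)
 then have 1: "tot cl <= int (n + 1) * int k * (m ^ n * (2 * m))" by (simp only: card_lessThan of_nat_mult)
 have "n + 1 <= 2 ^ n" by (induction n) simp_all
 then have "int (n + 1) <= 2 ^ n" by (metis of_nat_le_iff of_nat_numeral of_nat_power)
 also have "... <= m ^ n" using m2 by (intro power_mono) simp_all
 finally have 2: "int (n + 1) <= m ^ n" .
 have "int k < 2 ^ k" by (metis of_nat_less_two_power)
 also have "(2::int) ^ k <= m" using p_ge_3 by (intro power_mono) simp_all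
 finally have 3: "int k <= m" by simp
 have "int (n + 1) * int k * (m ^ n * (2 * m)) <= m ^ n * m * (m ^ n * (m * m))"
  using 2 3 m2 by (intro mult_mono mult_nonneg_nonneg) simp_all
 also have "... = m ^ (n + 1 + (n + 2))" by (simp only: power_add power_one_right power2_eq_square)
 also have "n + 1 + (n + 2) = 2 * n + 3" by simp
 finally show ?thesis using 1 by simp
qed

end

section \<open>The sampling program\<close>

definition tau_c :: pcom where
 "tau_c = (''tau'' <-- V ''t'' ;;
   PFor ''i'' ''k'' (PIf (eq_e (V ''t'' mod. elem ''pw'' ''i'') (Lit 0)) (''tau'' <-- V ''t'' div. elem ''pw'' ''i'') PSkip))"

definition pow_step_c :: pcom where
 "pow_step_c = (PIf (V ''ee'' mod. Lit 2)
    (''tu'' <-- V ''pu'' *. V ''bu'' +: V ''r'' *. (V ''pv'' *. V ''bv'') ;;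
    ''pv'' <-- V ''pu'' *. V ''bv'' +: V ''pv'' *. V ''bu'' ;; ''pu'' <-- V ''tu'') PSkip ;;
   ''tu'' <-- V ''bu'' *. V ''bu'' +: V ''r'' *. (V ''bv'' *. V ''bv'') ;;
   ''bv'' <-- Lit 2 *: (V ''bu'' *. V ''bv'') ;; ''bu'' <-- V ''tu'' ;; ''ee'' <-- V ''ee'' div. Lit 2)"

definition pow_c :: pcom where
 "pow_c = (''pu'' <-- Lit 1 ;; ''pv'' <-- Lit 0 ;; ''ee'' <-- V ''p'' div. Lit 2 ;; PFor ''hh'' ''lg'' pow_step_c)"

definition legendre_c :: pcom where
 "legendre_c = (''r'' <-- Lit 0 ;; ''bv'' <-- Lit 0 ;; pow_c ;; ''g'' <-- eq_e (V ''pu'' mod. V ''p'') (Lit 1))"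

text \<open>\<open>c\<close> is the size of the block capped at 2, which is all that
  \<open>feas_sq\<close> distinguishes, and \<open>i1\<close> its last member; the cell is 0 if the
  block is empty.\<close>

definition block_c :: pcom where
 "block_c = (''c'' <-- Lit 0 ;; ''i1'' <-- Lit 0 ;;
   PFor ''j'' ''n'' (PIf ((V ''j'' <. V ''i'') *. eq_e ((elem ''ex'' ''j'' +. elem ''ex'' ''i'') mod. Lit 2) (Lit 0))
    (PIf (V ''c'') (''c'' <-- Lit 2) (''c'' <-- Lit 1) ;; ''i1'' <-- V ''j'') PSkip))"

text \<open>Three exponentiations per index, hence O(n log p) for all of them. For an empty block
  the characters taken at \<open>i1\<close> have no meaning; the test for \<open>c = 1\<close> masks
  them.\<close>

definition feas_step_c :: pcom where
 "feas_step_c = (block_c ;;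
   ''bu'' <-- (Lit 0 -. elem ''un'' ''i1'') *: elem ''un'' ''i'' ;; legendre_c ;;
   PAsg ''f0'' (V ''i'') (or_e (Lit 1 <. V ''c'') (eq_e (V ''c'') (Lit 1) *. V ''g'')) ;;
   ''bu'' <-- V ''tau'' *: elem ''un'' ''i'' ;; legendre_c ;;
   PAsg ''f1'' (V ''i'') (or_e (Lit 1 <. V ''c'') (V ''g'')) ;;
   ''bu'' <-- (V ''tau'' -. elem ''un'' ''i1'') *: elem ''un'' ''i'' ;; legendre_c ;;
   PAsg ''f1'' (V ''i'') (or_e (elem ''f1'' ''i'') (eq_e (V ''c'') (Lit 1) *. or_e (V ''g'') (Lit 3 <. V ''p''))))"

definition feas_c :: pcom where "feas_c = PFor ''i'' ''n'' feas_step_c"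

definition lb_c :: "nat => pcom" where
 "lb_c l = (PIf (elem ''ex'' ''j'' <. V ''d'' +. (V ''J'' <. V ''j''))
    (''lb'' <-- big_e (V ''d'' +. (V ''J'' <. V ''j'') +. Lit 1 -. elem ''ex'' ''j'') div. Lit 2) (''lb'' <-- Lit 0) ;;
   PIf (V ''lb'' <. Lit (int l)) (''lb'' <-- Lit (int l)) PSkip)"

definition class_c :: pcom where
 "class_c = (''J'' <-- V ''q'' div. V ''k'' ;; ''v'' <-- V ''q'' mod. V ''k'')"

definition level_c :: pcom where
 "level_c = PIf (V ''J'' <. V ''n'') (''d'' <-- big_e (elem ''ex'' ''J'' +. Lit 2 *. V ''v'')) (''d'' <-- V ''k'')"

definition product_step_c :: "nat => pcom" where
 "product_step_c l = (lb_c l ;; PIf (eq_e (V ''lb'') (Lit 0)) (''pr'' <-- Lit 1) PSkip ;;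
   PIf (eq_e (V ''j'') (V ''J'')) PSkip (''w'' <-- big_e (V ''w'' *. Cell ''pw'' (V ''k'' -. V ''lb''))))"

definition feasible_c :: "nat => bool => pcom" where
 "feasible_c l prim =
   (PIf (V ''J'' <. V ''n'')
    (PIf ((V ''d'' <. V ''k'') *. not_e (V ''v'' <. Lit (int l)) *. eq_e (V ''t'' mod. elem ''pw'' ''d'') (Lit 0))
      (PIf (eq_e (V ''t'' mod. Cell ''pw'' (V ''d'' +. Lit 1)) (Lit 0)) (''ok'' <-- elem ''f0'' ''J'') (''ok'' <-- elem ''f1'' ''J''))
      (''ok'' <-- Lit 0))
    (''ok'' <-- (Lit 0 <. eq_e (V ''v'') (Lit 0) *. eq_e (V ''t'') (Lit 0))) ;;
   (if prim then PIf (V ''pr'') PSkip (''ok'' <-- Lit 0) else PSkip))"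

definition weight_step_c :: "nat => bool => pcom" where
 "weight_step_c l prim = (class_c ;; level_c ;;
   PIf (V ''J'' <. V ''n'') (''w'' <-- big_e (Lit 2 *. Cell ''pw'' (V ''d'' -. V ''v''))) (''w'' <-- big_e (Lit 1)) ;;
   ''pr'' <-- Lit 0 ;; PFor ''j'' ''n'' (product_step_c l) ;; feasible_c l prim ;;
   PIf (V ''ok'') PSkip (''w'' <-- Lit 0) ;;
   PAsg ''pre'' (V ''q'' +. Lit 1) (big_e (elem ''pre'' ''q'' +. V ''w'')))"

definition weights_c :: "nat => bool => pcom" where
 "weights_c l prim = (PAsg ''pre'' (Lit 0) (Lit 0) ;; PFor ''q'' ''cl'' (weight_step_c l prim))"

definition range_c :: pcom where
 "range_c = (''M'' <-- Lit 1 ;; PFor ''i'' ''l1'' (''M'' <-- big_e (V ''M'' *. V ''m'')) ;; ''N1'' <-- big_e (V ''M'' *. V ''m'') ;;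
   ''G'' <-- elem ''pre'' ''cl'')"

definition select_c :: pcom where
 "select_c = PFor ''q'' ''cl'' (PIf (not_e (V ''R'' <. elem ''pre'' ''q'') *. (V ''R'' <. Cell ''pre'' (V ''q'' +. Lit 1)))
   (class_c ;; ''rr'' <-- big_e (V ''R'' -. elem ''pre'' ''q'')) PSkip)"

definition digit_c :: "nat => pcom" where
 "digit_c l = PIf (eq_e (V ''j'') (V ''J'')) (PAsg ''y'' (V ''j'') (Lit 0))
   (lb_c l ;; PAsg ''y'' (V ''j'') (big_e (elem ''pw'' ''lb'' *. (V ''rr'' mod. Cell ''pw'' (V ''k'' -. V ''lb'')))) ;;
   ''rr'' <-- V ''rr'' div. Cell ''pw'' (V ''k'' -. V ''lb'') ;;
   ''acc'' <-- V ''acc'' +: (Lit 0 -. Cell ''pw'' (elem ''ex'' ''j'') *. elem ''un'' ''j'' *. (elem ''y'' ''j'' *. elem ''y'' ''j'')))"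

definition decode_c :: "nat => pcom" where
 "decode_c l = (''acc'' <-- V ''t'' +: Lit 0 ;; PFor ''j'' ''n'' (digit_c l))"

definition root_c :: pcom where
 "root_c = (PIf (V ''J'' <. V ''n'') (''r'' <-- (V ''acc'' div. elem ''pw'' ''d'') *: RInv (elem ''un'' ''J'')) (''r'' <-- Lit 1) ;;
   ''bu'' <-- V ''av'' ;; ''bv'' <-- Lit 1 ;; pow_c ;;
   ''ok'' <-- (Lit 0 <. eq_e (V ''pu'' mod. V ''p'') (Lit 0) *. eq_e ((V ''pv'' *. V ''pv'' *. V ''r'') mod. V ''p'') (Lit 1)) ;;
   ''z'' <-- RInv (V ''pv'') ;;
   PIf (V ''rr'' mod. Lit 2) (''z'' <-- (Lit 0 -. Lit 1) *: V ''z'') (''z'' <-- Lit 1 *: V ''z'') ;;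
   PFor ''j'' ''k'' (''z'' <-- V ''z'' +: (V ''r'' -. V ''z'' *. V ''z'') *. RInv (Lit 2 *. V ''z'')))"

definition pivot_coord_c :: pcom where
 "pivot_coord_c = PIf (V ''J'' <. V ''n'')
   (PAsg ''y'' (V ''J'') (big_e (elem ''pw'' ''v'' *. (V ''z'' mod. Cell ''pw'' (V ''k'' -. V ''d'') +. (V ''rr'' div. Lit 2) *. Cell ''pw'' (V ''k'' -. V ''d''))))) PSkip"

definition primitive_c :: pcom where
 "primitive_c = (''pr'' <-- Lit 0 ;; PFor ''j'' ''n'' (PIf (elem ''y'' ''j'' mod. V ''p'') (''pr'' <-- Lit 1) PSkip))"

definition apply_c :: pcom where
 "apply_c = PFor ''i'' ''n'' (PAsg ''x'' (V ''i'') (Lit 0) ;;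
   PFor ''j'' ''n'' (PAsg ''x'' (V ''i'') (elem ''x'' ''i'' +: Cell ''U'' (entry (V ''i'') (V ''j'')) *. elem ''y'' ''j'')))"

definition try_c :: "nat => bool => pcom" where
 "try_c l prim = (select_c ;; level_c ;; decode_c l ;; root_c ;; pivot_coord_c ;; primitive_c ;;
   (if prim then PIf (V ''pr'') PSkip (''ok'' <-- Lit 0) else PSkip) ;;
   PIf (V ''ok'') (''status'' <-- Lit 1 ;; apply_c) PSkip)"

definition attempt_c :: "nat => bool => pcom" where
 "attempt_c l prim = (''zz'' <-- V ''Z'' mod. V ''N1'' ;; ''Z'' <-- V ''Z'' div. V ''N1'' ;;
   ''av'' <-- V ''zz'' mod. V ''m'' ;; ''R'' <-- V ''zz'' div. V ''m'' ;;
   PIf (V ''R'' <. (V ''M'' div. V ''G'') *. V ''G'') (''R'' <-- V ''R'' mod. V ''G'' ;; try_c l prim) PSkip)"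

definition sample_c :: "nat => bool => pcom" where
 "sample_c l prim = (tau_c ;; feas_c ;; weights_c l prim ;; range_c ;; ''status'' <-- Lit 0 ;;
   PIf (V ''G'') (PFor ''at'' ''T'' (PIf (V ''status'') PSkip (attempt_c l prim))) (''status'' <-- Lit 2))"

lemmas sample_defs = tau_c_def pow_step_c_def pow_c_def legendre_c_def block_c_def feas_step_c_def feas_c_def lb_c_def class_c_def
 level_c_def product_step_c_def feasible_c_def weight_step_c_def weights_c_def range_c_def select_c_def digit_c_def decode_c_def
 root_c_def pivot_coord_c_def primitive_c_def apply_c_def try_c_def attempt_c_def sample_c_def

lemma wf_sample:
 assumes "l <= 1"
 shows "wf tau_c" "wf pow_step_c" "wf pow_c" "wf legendre_c" "wf block_c" "wf feas_step_c" "wf feas_c" "wf (lb_c l)" "wf class_c"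
  "wf level_c" "wf (product_step_c l)" "wf (feasible_c l prim)" "wf (weight_step_c l prim)" "wf (weights_c l prim)" "wf range_c"
  "wf select_c" "wf (digit_c l)" "wf (decode_c l)" "wf root_c" "wf pivot_coord_c" "wf primitive_c" "wf apply_c" "wf (try_c l prim)"
  "wf (attempt_c l prim)" "wf (sample_c l prim)"
 using assms by (simp_all add: sample_defs expr_defs read_only_def)

lemma mods_sample [simp]:
 "mods tau_c = {''tau'', ''i''}" "mods pow_step_c = {''tu'', ''pv'', ''pu'', ''bv'', ''bu'', ''ee''}"
 "mods pow_c = {''tu'', ''pv'', ''pu'', ''bv'', ''bu'', ''ee'', ''hh''}"
 "mods legendre_c = {''tu'', ''pv'', ''pu'', ''bv'', ''bu'', ''ee'', ''hh'', ''r'', ''g''}"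
 "mods block_c = {''c'', ''i1'', ''j''}"
 "mods feas_step_c = {''tu'', ''pv'', ''pu'', ''bv'', ''bu'', ''ee'', ''hh'', ''r'', ''g'', ''c'', ''i1'', ''j'', ''f0'', ''f1''}"
 "mods feas_c = {''tu'', ''pv'', ''pu'', ''bv'', ''bu'', ''ee'', ''hh'', ''r'', ''g'', ''c'', ''i1'', ''j'', ''f0'', ''f1'', ''i''}"
 "mods (lb_c l) = {''lb''}" "mods class_c = {''J'', ''v''}" "mods level_c = {''d''}" "mods (product_step_c l) = {''lb'', ''pr'', ''w''}"
 "mods (feasible_c l prim) = {''ok''}" "mods (weight_step_c l prim) = {''J'', ''v'', ''d'', ''w'', ''pr'', ''j'', ''lb'', ''ok'', ''pre''}"
 "mods (weights_c l prim) = {''J'', ''v'', ''d'', ''w'', ''pr'', ''j'', ''lb'', ''ok'', ''pre'', ''q''}"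
 "mods range_c = {''M'', ''i'', ''N1'', ''G''}" "mods select_c = {''q'', ''J'', ''v'', ''rr''}"
 "mods (digit_c l) = {''y'', ''lb'', ''rr'', ''acc''}" "mods (decode_c l) = {''y'', ''lb'', ''rr'', ''acc'', ''j''}"
 "mods root_c = {''r'', ''tu'', ''pv'', ''pu'', ''bv'', ''bu'', ''ee'', ''hh'', ''ok'', ''z'', ''j''}"
 "mods pivot_coord_c = {''y''}" "mods primitive_c = {''pr'', ''j''}" "mods apply_c = {''x'', ''i'', ''j''}"
 "mods (try_c l prim) = {''q'', ''J'', ''v'', ''rr'', ''d'', ''y'', ''lb'', ''acc'', ''j'', ''r'', ''tu'', ''pv'', ''pu'', ''bv'', ''bu'', ''ee'', ''hh'', ''ok'', ''z'', ''pr'', ''status'', ''x'', ''i''}"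
 "mods (attempt_c l prim) = {''zz'', ''Z'', ''av'', ''R'', ''q'', ''J'', ''v'', ''rr'', ''d'', ''y'', ''lb'', ''acc'', ''j'', ''r'', ''tu'', ''pv'', ''pu'', ''bv'', ''bu'', ''ee'', ''hh'', ''ok'', ''z'', ''pr'', ''status'', ''x'', ''i''}"
 by (simp_all add: sample_defs insert_commute)

section \<open>Correctness of the sampling program\<close>

locale sampler = machine p n k lg l1 t B + smp?: sampling p n k l lg prim t ex un
 for p n k lg l1 t B l prim ex un +
 assumes B_big: "(P ^ k) ^ (2 * n + 4) < B" "3 * int k + 5 < B" and l1: "l1 = 2 * n + 3"
begin

lemmas wf_sampler [simp] = wf_sample[OF l_le]

definition rdy :: "store => bool" where
 "rdy s \<longleftrightarrow> pows s & (ALL i<n. s ''ex'' (int i) = int (ex i) & s ''un'' (int i) = un i)"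

lemma rdy_upd [simp]: "x ~: read_only ==> x ~: {''pw'', ''ex'', ''un''} ==> rdy (upd x i v s) \<longleftrightarrow> rdy s"
 by (auto simp: rdy_def upd_other)

lemma rdy_run [simp]: "wf c ==> {''pw'', ''ex'', ''un''} \<inter> mods c = {} ==> rdy (run m' c s) \<longleftrightarrow> rdy s"
 by (simp add: rdy_def run_frame)

lemma rdyD: "rdy s ==> base s" "rdy s ==> pows s" "rdy s ==> i < n ==> s ''ex'' (int i) = int (ex i)"
  "rdy s ==> i < n ==> s ''un'' (int i) = un i" "rdy s ==> i <= k ==> s ''pw'' (int i) = P ^ i"
 by (auto simp: rdy_def powsD)

lemmas bD = rdyD(1)[THEN baseD(1)] rdyD(1)[THEN baseD(2)] rdyD(1)[THEN baseD(3)] rdyD(1)[THEN baseD(4)] rdyD(1)[THEN baseD(5)]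
 rdyD(1)[THEN baseD(6)] rdyD(1)[THEN baseD(7)] rdyD(1)[THEN baseD(8)] rdyD(1)[THEN baseD(9)] rdyD(1)[THEN baseD(10)] rdyD(1)[THEN baseD(11)]

lemma rloop:
 assumes s: "rdy s" and N: "s N 0 = int M" and w: "wf (PFor i N b)" and mo: "{''pw'', ''ex'', ''un''} \<inter> mods (PFor i N b) = {}"
  and 0: "I 0 (upd i 0 0 s)"
  and step: "!!j u. j < M ==> I j u ==> u i 0 = int j ==> rdy u ==> (!!x. x ~: mods b ==> x ~= i ==> u x = s x) ==>
   I (Suc j) (upd i 0 (int j + 1) (run m b u))"
 shows "I M (run m (PFor i N b) s)"
proof (rule loop[where I = I, OF rdyD(1)[OF s] N w 0])
 fix j u assume *: "j < M" "I j u" "u i 0 = int j" "base u" "!!x. x ~: mods b ==> x ~= i ==> u x = s x"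
 have "u ''pw'' = s ''pw''" "u ''ex'' = s ''ex''" "u ''un'' = s ''un''" using mo by (auto intro!: *(5))
 then have "rdy u" using s *(4) by (simp add: rdy_def pows_def)
 then show "I (Suc j) (upd i 0 (int j + 1) (run m b u))" using step[OF *(1-3)] *(5) by blast
qed

text \<open>Later hits of the loop overwrite earlier ones, so the largest i < k for which p^i
  divides t wins.\<close>

lemma run_tau:
 assumes s: "rdy s" and d: "d < k" "P ^ d dvd t" "~ P ^ Suc d dvd t"
 shows "run m tau_c s ''tau'' 0 = tau d"
proof -
 let ?b = "PIf (eq_e (V ''t'' mod. elem ''pw'' ''i'') (Lit 0)) (''tau'' <-- V ''t'' div. elem ''pw'' ''i'') PSkip"
 let ?s = "upd ''tau'' 0 t s"
 define I where "I = (%j (u::store). d < j --> u ''tau'' 0 = tau d)"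
 have "I k (run m (PFor ''i'' ''k'' ?b) ?s)"
 proof (rule rloop[where I = I])
  show "rdy ?s" using s by (simp add: read_only_def)
  then show "?s ''k'' 0 = int k" by (rule bD)
  show "wf (PFor ''i'' ''k'' ?b)" by (simp add: expr_defs read_only_def)
  show "I 0 (upd ''i'' 0 0 ?s)" by (simp add: I_def)
  fix j u assume j: "j < k" "I j u" "u ''i'' 0 = int j" and u: "rdy u"
  have pj: "u ''pw'' (int j) = P ^ j" using rdyD(5)[OF u] j(1) by simp
  have "~ P ^ j dvd t" if "d < j" using d(3) that by (meson Suc_leI dvd_trans le_imp_power_dvd)
  then show "I (Suc j) (upd ''i'' 0 (int j + 1) (run m ?b u))"
   using j d(2) u by (auto simp: I_def upd_simps pj bD dvd_eq_mod_eq_0 tau_def less_Suc_eq)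
 qed simp
 then show ?thesis using d(1) s by (simp add: tau_c_def I_def bD)
qed

lemma h_eq: "P div 2 = int h"
proof -
 have "odd p" using odd_prime_axioms unfolding odd_prime_def by blast
 then obtain c where "p = 2 * c + 1" by (rule oddE)
 then show ?thesis by simp
qed

lemma run_pow:
 assumes s: "rdy s"
 shows "(run m pow_c s ''pu'' 0, run m pow_c s ''pv'' 0) = qpow m (s ''r'' 0) lg (s ''bu'' 0) (s ''bv'' 0) (int h)"
proof -
 let ?s = "upd ''ee'' 0 (int h) (upd ''pv'' 0 0 (upd ''pu'' 0 1 s))"
 define st where "st = (%u::store. (u ''pu'' 0, u ''pv'' 0, u ''bu'' 0, u ''bv'' 0, u ''ee'' 0))"
 have "st (run m (PFor ''hh'' ''lg'' pow_step_c) ?s) = (qstep m (s ''r'' 0) ^^ lg) (1, 0, s ''bu'' 0, s ''bv'' 0, int h)"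
 proof (rule rloop[where I = "%j u. st u = (qstep m (s ''r'' 0) ^^ j) (1, 0, s ''bu'' 0, s ''bv'' 0, int h)"])
  show "rdy ?s" using s by (simp add: read_only_def)
  then show "?s ''lg'' 0 = int lg" by (rule bD)
  show "wf (PFor ''hh'' ''lg'' pow_step_c)" by (simp add: read_only_def)
  show "st (upd ''hh'' 0 0 ?s) = (qstep m (s ''r'' 0) ^^ 0) (1, 0, s ''bu'' 0, s ''bv'' 0, int h)" by (simp add: st_def upd_simps)
  fix j u assume st: "st u = (qstep m (s ''r'' 0) ^^ j) (1, 0, s ''bu'' 0, s ''bv'' 0, int h)"
   and fr: "!!x. x ~: mods pow_step_c ==> x ~= ''hh'' ==> u x = ?s x"
  have r: "u ''r'' 0 = s ''r'' 0" using fr[of "''r''"] by (simp add: upd_simps)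
  have "st (upd ''hh'' 0 (int j + 1) (run m pow_step_c u)) = qstep m (s ''r'' 0) (st u)"
   unfolding pow_step_c_def by (cases "u ''ee'' 0 mod 2 = 1") (simp_all add: st_def qstep_def upd_simps r)
  then show "st (upd ''hh'' 0 (int j + 1) (run m pow_step_c u)) = (qstep m (s ''r'' 0) ^^ Suc j) (1, 0, s ''bu'' 0, s ''bv'' 0, int h)"
   unfolding st by simp
 qed simp
 moreover have "run m pow_c s = run m (PFor ''hh'' ''lg'' pow_step_c) ?s"
  unfolding h_eq[symmetric] using s by (simp add: pow_c_def bD upd_simps del: run.simps(5))
 ultimately have e: "(qstep m (s ''r'' 0) ^^ lg) (1, 0, s ''bu'' 0, s ''bv'' 0, int h) = st (run m pow_c s)" by (simp only:)
 show ?thesis unfolding qpow_def e st_def by (simp only: prod.case)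
qed

lemma run_legendre:
 assumes s: "rdy s"
 shows "run m legendre_c s ''g'' 0 = (if nzsq (s ''bu'' 0) then 1 else 0)"
proof -
 let ?s = "upd ''bv'' 0 0 (upd ''r'' 0 0 s)"
 have r: "rdy ?s" using s by (simp add: read_only_def)
 let ?u = "run m pow_c ?s"
 have "rdy ?u" using r by simp
 then have p: "?u ''p'' 0 = P" by (rule bD)
 have "qpow m 0 lg (s ''bu'' 0) 0 (int h) = (?u ''pu'' 0, ?u ''pv'' 0)" using run_pow[OF r] by (simp add: upd_simps)
 from qpow_nzsq[OF P_dvd_m lg this] show ?thesis by (simp add: legendre_c_def upd_simps p)
qed

lemma run_block:
 assumes s: "rdy s" and J: "J < n" "s ''i'' 0 = int J"
 defines "u == run m block_c s"
 shows "(u ''c'' 0 = 0 & blk J = {}) | (u ''c'' 0 = 1 & (EX a<n. u ''i1'' 0 = int a & blk J = {a})) |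
  (u ''c'' 0 = 2 & two_blk J & (EX a<n. u ''i1'' 0 = int a))"
proof -
 let ?b = "PIf ((V ''j'' <. V ''i'') *. eq_e ((elem ''ex'' ''j'' +. elem ''ex'' ''i'') mod. Lit 2) (Lit 0))
    (PIf (V ''c'') (''c'' <-- Lit 2) (''c'' <-- Lit 1) ;; ''i1'' <-- V ''j'') PSkip"
 let ?s = "upd ''i1'' 0 0 (upd ''c'' 0 0 s)"
 define S where "S = (%j. {i \<in> blk J. i < j})"
 define I where "I = (%j (u::store). (u ''c'' 0 = 0 & S j = {}) | (u ''c'' 0 = 1 & (EX a<n. u ''i1'' 0 = int a & S j = {a})) |
  (u ''c'' 0 = 2 & two_blk J & (EX a<n. u ''i1'' 0 = int a)))"
 have "I n (run m (PFor ''j'' ''n'' ?b) ?s)"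
 proof (rule rloop[where I = I])
  show "rdy ?s" using s by (simp add: read_only_def)
  then show "?s ''n'' 0 = int n" by (rule bD)
  show "wf (PFor ''j'' ''n'' ?b)" by (simp add: expr_defs read_only_def)
  show "I 0 (upd ''j'' 0 0 ?s)" by (simp add: I_def S_def upd_simps)
  fix j u assume j: "j < n" "I j u" "u ''j'' 0 = int j" and u: "rdy u"
   and fr: "!!x. x ~: mods ?b ==> x ~= ''j'' ==> u x = ?s x"
  have i: "u ''i'' 0 = int J" using fr[of "''i''"] J by (simp add: upd_simps)
  have e: "u ''ex'' (int j) = int (ex j)" "u ''ex'' (int J) = int (ex J)" using rdyD(3)[OF u] j J by auto
  have cnd: "Defs.eval m u ((V ''j'' <. V ''i'') *. eq_e ((elem ''ex'' ''j'' +. elem ''ex'' ''i'') mod. Lit 2) (Lit 0)) ~= 0 \<longleftrightarrow> j \<in> blk J"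
  proof -
   have "(int (ex j) + int (ex J)) mod 2 = 0 \<longleftrightarrow> (ex j + ex J) mod 2 = 0" by presburger
   then show ?thesis using i j e by (simp add: blk_def)
  qed
  show "I (Suc j) (upd ''j'' 0 (int j + 1) (run m ?b u))"
  proof (cases "j \<in> blk J")
   case False
   then have SS: "S (Suc j) = S j" by (auto simp: S_def less_Suc_eq)
   have rr: "run m ?b u = u" using False cnd by (simp only: run.simps if_False not_not)
   show ?thesis unfolding rr using j(2) unfolding I_def SS by (simp add: upd_simps)
  next
   case True
   then have SS: "S (Suc j) = insert j (S j)" by (auto simp: S_def less_Suc_eq)
   have rr: "run m ?b u = upd ''i1'' 0 (int j) (upd ''c'' 0 (if u ''c'' 0 = 0 then 1 else 2) u)"
    using True cnd j(3) by (simp only: run.simps if_True) (simp add: upd_simps)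
   have tw: "two_blk J" if "a \<in> S j" for a
   proof -
    have "a \<in> blk J" "a ~= j" using that by (auto simp: S_def)
    then show ?thesis unfolding two_blk_def using True by blast
   qed
   let ?v = "upd ''j'' 0 (int j + 1) (run m ?b u)"
   have v: "?v ''c'' 0 = (if u ''c'' 0 = 0 then 1 else 2)" "?v ''i1'' 0 = int j" unfolding rr by (simp_all add: upd_simps)
   have ?thesis if "u ''c'' 0 = 0" "S j = {}" unfolding I_def v SS using that j(1) by simp
   moreover have ?thesis if "u ''c'' 0 ~= 0" "two_blk J" unfolding I_def v SS using that j(1) by simp
   moreover have "two_blk J" if "S j = {a}" for a by (rule tw[of a]) (simp add: that)
   moreover have "(u ''c'' 0 = 0 & S j = {}) | (u ''c'' 0 ~= 0 & (EX a. S j = {a})) | (u ''c'' 0 ~= 0 & two_blk J)"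
    using j(2) unfolding I_def by (elim disjE conjE exE) simp_all
   ultimately show ?thesis by blast
  qed
 qed simp
 moreover have "S n = blk J" using J by (auto simp: S_def blk_def)
 ultimately show ?thesis by (simp only: u_def block_c_def run.simps eval.simps I_def)
qed

text \<open>\<open>flag0\<close> and \<open>flag1\<close> are the two branches of
  \<open>feas_sq\<close>. Neither mentions v, so one evaluation per J serves all classes with this
  J.\<close>

definition flag0 :: "nat => bool" where
 "flag0 J \<longleftrightarrow> two_blk J | (EX i. blk J = {i} & nzsq (- un i * un J))"

definition flag1 :: "int => nat => bool" where
 "flag1 T J \<longleftrightarrow> two_blk J | nzsq (T * un J) | (EX i. blk J = {i} & (nzsq ((T - un i) * un J) | p > 3))"

lemma nzsq_mod: "nzsq (x mod m) = nzsq x"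
proof (rule nzsq_cong)
 have "[x mod m = x] (mod m)" by (simp add: cong_def)
 then show "[x mod m = x] (mod P)" by (rule cong_dvd_modulus[OF _ P_dvd_m])
qed

lemma run_feas_step:
 assumes s: "rdy s" and J: "J < n" "s ''i'' 0 = int J"
 defines "u == run m feas_step_c s"
 shows "u ''f0'' = (s ''f0'')(int J := if flag0 J then 1 else 0)" "u ''f1'' = (s ''f1'')(int J := if flag1 (s ''tau'' 0) J then 1 else 0)"
proof -
 let ?T = "s ''tau'' 0"
 define s1 where "s1 = run m block_c s"
 have B: "(s1 ''c'' 0 = 0 & blk J = {}) | (s1 ''c'' 0 = 1 & (EX a<n. s1 ''i1'' 0 = int a & blk J = {a})) |
  (s1 ''c'' 0 = 2 & two_blk J & (EX a<n. s1 ''i1'' 0 = int a))"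
  unfolding s1_def by (rule run_block[OF s J])
 have r1: "rdy s1" unfolding s1_def using s by simp
 have i1: "s1 ''i'' 0 = int J" "s1 ''tau'' 0 = ?T" "s1 ''f0'' = s ''f0''" "s1 ''f1'' = s ''f1''" using J by (simp_all add: s1_def run_frame)
 define w where "w = s1 ''un'' (s1 ''i1'' 0)"
 have u1: "s1 ''un'' (int J) = un J" using rdyD(4)[OF r1 J(1)] .
 have leg: "run m legendre_c v ''g'' 0 = (if nzsq (v ''bu'' 0) then 1 else 0)" if "rdy v" for v by (rule run_legendre[OF that])
 have fr: "run m legendre_c v x = v x" if "x ~: mods legendre_c" for v x by (rule run_frame[OF that])
 define s2 where "s2 = run m legendre_c (upd ''bu'' 0 (((0 - w) * un J) mod m) s1)"
 have r2: "rdy s2" unfolding s2_def using r1 by (simp add: read_only_def)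
 have g2: "s2 ''g'' 0 = (if nzsq (- w * un J) then 1 else 0)" unfolding s2_def using r1 by (subst leg) (simp_all add: read_only_def upd_simps nzsq_mod del: mult_minus_left)
 define s3 where "s3 = upd ''f0'' (int J) (if s1 ''c'' 0 > 1 | s1 ''c'' 0 = 1 & nzsq (- w * un J) then 1 else 0) s2"
 define s4 where "s4 = run m legendre_c (upd ''bu'' 0 ((?T * un J) mod m) s3)"
 have r4: "rdy s4" "rdy s3" unfolding s4_def s3_def using r2 by (simp_all add: read_only_def)
 have g4: "s4 ''g'' 0 = (if nzsq (?T * un J) then 1 else 0)" unfolding s4_def using r4(2) by (subst leg) (simp_all add: read_only_def upd_simps nzsq_mod)
 define s5 where "s5 = upd ''f1'' (int J) (if s1 ''c'' 0 > 1 | nzsq (?T * un J) then 1 else 0) s4"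
 define s6 where "s6 = run m legendre_c (upd ''bu'' 0 (((?T - w) * un J) mod m) s5)"
 have r6: "rdy s6" "rdy s5" unfolding s6_def s5_def using r4 by (simp_all add: read_only_def)
 have g6: "s6 ''g'' 0 = (if nzsq ((?T - w) * un J) then 1 else 0)" unfolding s6_def using r6(2) by (subst leg) (simp_all add: read_only_def upd_simps nzsq_mod)
 have c: "s2 ''c'' = s1 ''c''" "s4 ''c'' = s1 ''c''" "s6 ''c'' = s1 ''c''" "s2 ''i'' = s1 ''i''" "s4 ''i'' = s1 ''i''" "s6 ''i'' = s1 ''i''"
  "s2 ''tau'' = s1 ''tau''" "s4 ''tau'' = s1 ''tau''" "s2 ''i1'' = s1 ''i1''" "s4 ''i1'' = s1 ''i1''" "s2 ''un'' = s1 ''un''" "s4 ''un'' = s1 ''un''"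
  "s6 ''f0'' = (s ''f0'')(int J := s3 ''f0'' (int J))" "s6 ''f1'' = (s ''f1'')(int J := s5 ''f1'' (int J))"
  by (simp_all add: s2_def s4_def s6_def s3_def s5_def fr upd_simps i1 fun_eq_iff)
 have e2: "run m (''bu'' <-- (Lit 0 -. elem ''un'' ''i1'') *: elem ''un'' ''i'' ;; legendre_c) s1 = s2"
  by (simp add: s2_def i1 u1 w_def)
 have e3: "run m (PAsg ''f0'' (V ''i'') (or_e (Lit 1 <. V ''c'') (eq_e (V ''c'') (Lit 1) *. V ''g''))) s2 = s3"
  unfolding s3_def by (simp add: c i1 g2)
 have e4: "run m (''bu'' <-- V ''tau'' *: elem ''un'' ''i'' ;; legendre_c) s3 = s4"
  unfolding s4_def by (simp add: s3_def upd_simps c i1 u1)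
 have e5: "run m (PAsg ''f1'' (V ''i'') (or_e (Lit 1 <. V ''c'') (V ''g''))) s4 = s5"
  unfolding s5_def by (simp add: c i1 g4)
 have e6: "run m (''bu'' <-- (V ''tau'' -. elem ''un'' ''i1'') *: elem ''un'' ''i'' ;; legendre_c) s5 = s6"
  unfolding s6_def by (simp add: s5_def upd_simps c i1 u1 w_def)
 have uu: "u = run m (PAsg ''f1'' (V ''i'') (or_e (elem ''f1'' ''i'') (eq_e (V ''c'') (Lit 1) *. or_e (V ''g'') (Lit 3 <. V ''p'')))) s6"
  unfolding u_def feas_step_c_def e2[symmetric] e3[symmetric] e4[symmetric] e5[symmetric] e6[symmetric] s1_def by (simp only: run.simps)
 have p3: "3 < P \<longleftrightarrow> p > 3" by simp
 have ff: "u ''f0'' = s6 ''f0''" "u ''f1'' = (s6 ''f1'')(int J := if s5 ''f1'' (int J) > 0 | s1 ''c'' 0 = 1 & (nzsq ((?T - w) * un J) | p > 3) then 1 else 0)"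
  unfolding uu by (simp_all add: upd_simps c i1 g6 bD[OF r6(1)] fun_eq_iff s5_def)
 have w: "w = un a" if "a < n" "s1 ''i1'' 0 = int a" for a unfolding w_def that(2) by (rule rdyD(4)[OF r1 that(1)])
 have fl: "(s1 ''c'' 0 > 1 | s1 ''c'' 0 = 1 & nzsq (- w * un J)) = flag0 J"
  "((s1 ''c'' 0 > 1 | nzsq (?T * un J)) | s1 ''c'' 0 = 1 & (nzsq ((?T - w) * un J) | p > 3)) = flag1 ?T J"
 proof -
  have nt: "~ two_blk J" if "blk J = {}" using that by (simp add: two_blk_def)
  have nt': "~ two_blk J" if "blk J = {a}" for a using that by (simp add: two_blk_def)
  from B have "(s1 ''c'' 0 > 1 | s1 ''c'' 0 = 1 & nzsq (- w * un J)) = flag0 J &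
   ((s1 ''c'' 0 > 1 | nzsq (?T * un J)) | s1 ''c'' 0 = 1 & (nzsq ((?T - w) * un J) | p > 3)) = flag1 ?T J"
  proof (elim disjE conjE exE)
   assume "s1 ''c'' 0 = 0" "blk J = {}"
   then show ?thesis using nt unfolding flag0_def flag1_def by simp
  next
   fix a assume a: "s1 ''c'' 0 = 1" "a < n" "s1 ''i1'' 0 = int a" "blk J = {a}"
   show ?thesis using nt'[OF a(4)] unfolding flag0_def flag1_def w[OF a(2,3)] a(1,4) by (simp del: mult_minus_left) (fastforce)?
  next
   assume "s1 ''c'' 0 = 2" "two_blk J"
   then show ?thesis unfolding flag0_def flag1_def by simp
  qed
  then show "(s1 ''c'' 0 > 1 | s1 ''c'' 0 = 1 & nzsq (- w * un J)) = flag0 J"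
   "((s1 ''c'' 0 > 1 | nzsq (?T * un J)) | s1 ''c'' 0 = 1 & (nzsq ((?T - w) * un J) | p > 3)) = flag1 ?T J" by blast+
 qed
 show "u ''f0'' = (s ''f0'')(int J := if flag0 J then 1 else 0)"
  unfolding ff(1) c fl(1)[symmetric] s3_def by (simp add: upd_simps)
 show "u ''f1'' = (s ''f1'')(int J := if flag1 ?T J then 1 else 0)"
  unfolding ff(2) c fl(2)[symmetric] s5_def by (auto simp: upd_simps)
qed

lemma run_feas:
 assumes s: "rdy s"
 defines "u == run m feas_c s"
 shows "ALL J<n. u ''f0'' (int J) = (if flag0 J then 1 else 0) & u ''f1'' (int J) = (if flag1 (s ''tau'' 0) J then 1 else 0)"
 unfolding u_def feas_c_def
proof (rule rloop[where I = "%j u. ALL J<j. u ''f0'' (int J) = (if flag0 J then 1 else 0) & u ''f1'' (int J) = (if flag1 (s ''tau'' 0) J then 1 else 0)"])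
 show "rdy s" by (rule s)
 then show "s ''n'' 0 = int n" by (rule bD)
 show "wf (PFor ''i'' ''n'' feas_step_c)" by (simp add: read_only_def)
 fix j u assume j: "j < n" "u ''i'' 0 = int j" "rdy u" and I: "ALL J<j. u ''f0'' (int J) = (if flag0 J then 1 else 0) & u ''f1'' (int J) = (if flag1 (s ''tau'' 0) J then 1 else 0)"
  and fr: "!!x. x ~: mods feas_step_c ==> x ~= ''i'' ==> u x = s x"
 have "u ''tau'' 0 = s ''tau'' 0" using fr[of "''tau''"] by simp
 then show "ALL J<Suc j. upd ''i'' 0 (int j + 1) (run m feas_step_c u) ''f0'' (int J) = (if flag0 J then 1 else 0) &
   upd ''i'' 0 (int j + 1) (run m feas_step_c u) ''f1'' (int J) = (if flag1 (s ''tau'' 0) J then 1 else 0)"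
  using I run_feas_step[OF j(3,1,2)] by (simp add: upd_simps less_Suc_eq)
qed simp_all

text \<open>The test ahead of the subtraction imitates truncated subtraction of naturals. With d at
  most 3k the reduced value stays below B, so the reduction modulo \<open>BIG\<close> is
  harmless.\<close>

lemma run_lb:
 assumes s: "rdy s" and c: "s ''J'' 0 = int J" "s ''j'' 0 = int j" "s ''d'' 0 = int d" "j < n" "d <= 3 * k"
 shows "run m (lb_c l) s ''lb'' 0 = int (lbd d J j)"
proof -
 let ?b = "if J < j then 1 else (0::nat)"
 have e: "s ''ex'' (int j) = int (ex j)" by (rule rdyD(3)[OF s c(4)])
 have b: "(if int J < int j then 1 else 0) = int ?b" by simp
 define w where "w = (d + ?b + 1 - ex j) div 2"
 have "(if int (ex j) < int d + int ?b then ((int d + int ?b + 1 - int (ex j)) mod B) div 2 else 0) = int w"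
 proof (cases "ex j < d + ?b")
  case True
  have "(int d + int ?b + 1 - int (ex j)) mod B = int d + int ?b + 1 - int (ex j)"
   using True B_big(2) c(5) by (intro mod_pos_pos_trivial) (auto split: if_splits)
  also have "... = int (d + ?b + 1 - ex j)" using True by (subst of_nat_diff) auto
  finally show ?thesis using True unfolding w_def by (simp add: zdiv_int)
 next
  case False
  then have "d + ?b + 1 - ex j <= 1" by (simp split: if_splits)
  then have "w = 0" unfolding w_def by simp
  then show ?thesis using False by simp
 qed
 then have "run m (PIf (elem ''ex'' ''j'' <. V ''d'' +. (V ''J'' <. V ''j''))
    (''lb'' <-- big_e (V ''d'' +. (V ''J'' <. V ''j'') +. Lit 1 -. elem ''ex'' ''j'') div. Lit 2) (''lb'' <-- Lit 0)) s = upd ''lb'' 0 (int w) s"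
  by (simp add: c e bD[OF s] b split: if_splits)
 then have "run m (lb_c l) s = run m (PIf (V ''lb'' <. Lit (int l)) (''lb'' <-- Lit (int l)) PSkip) (upd ''lb'' 0 (int w) s)"
  by (simp only: lb_c_def run.simps)
 then show ?thesis by (simp add: upd_simps lbd_def w_def max_def)
qed

end

lemma upd_upd [simp]: "upd a i v (upd a i w s) = upd a i v s"
 by (simp add: upd_def)

context sampler
begin

definition flags :: "store => bool" where
 "flags s \<longleftrightarrow> (ALL J<n. s ''f0'' (int J) = (if flag0 J then 1 else 0) &
   (ALL d<k. P ^ d dvd t --> ~ P ^ Suc d dvd t --> s ''f1'' (int J) = (if flag1 (tau d) J then 1 else 0)))"

lemma feas_sq_flags: "feas_sq J d \<longleftrightarrow> (if P ^ Suc d dvd t then flag0 J else flag1 (tau d) J)"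
 unfolding feas_sq_def flag0_def flag1_def by (rule refl)

lemma pw_diff: "rdy s ==> i <= j ==> j <= k ==> s ''pw'' (int j - int i) = P ^ (j - i)"
 using rdyD(5)[of s "j - i"] by (simp add: of_nat_diff)

lemma run_class:
 assumes "rdy s" "s ''q'' 0 = int c"
 shows "run m class_c s = upd ''v'' 0 (int (c mod k)) (upd ''J'' 0 (int (c div k)) s)"
 using assms by (simp add: class_c_def upd_simps bD zdiv_int zmod_int)

lemma run_level:
 assumes s: "rdy s" and c: "s ''J'' 0 = int J" "s ''v'' 0 = int v" "v < k"
 shows "run m level_c s = upd ''d'' 0 (int (lev J v)) s" "lev J v <= 3 * k"
proof -
 show l: "lev J v <= 3 * k" using ex_le[of J] c(3) by (auto simp: lev_def)
 have "int (ex J + 2 * v) mod B = int (ex J + 2 * v)" if "J < n"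
  using l that B_big(2) by (intro mod_pos_pos_trivial) (auto simp: lev_def)
 then show "run m level_c s = upd ''d'' 0 (int (lev J v)) s"
  using rdyD(3)[OF s, of J] by (simp add: level_c_def c bD[OF s] lev_def)
qed

lemma run_feasible:
 assumes s: "rdy s" and f: "flags s" and c: "s ''J'' 0 = int J" "s ''v'' 0 = int v" "s ''d'' 0 = int (lev J v)"
  and pr: "s ''pr'' 0 = (if EX j<n. lbd (lev J v) J j = 0 then 1 else 0)"
 shows "run m (feasible_c l prim) s = upd ''ok'' 0 (if feas J v then 1 else 0) s"
proof -
 let ?d = "lev J v"
 define X :: bool where "X \<longleftrightarrow> (if J < n then l <= v & ?d < k & P ^ ?d dvd t & feas_sq J ?d else v = 0 & t = 0)"
 let ?c1 = "PIf (V ''J'' <. V ''n'')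
    (PIf ((V ''d'' <. V ''k'') *. not_e (V ''v'' <. Lit (int l)) *. eq_e (V ''t'' mod. elem ''pw'' ''d'') (Lit 0))
      (PIf (eq_e (V ''t'' mod. Cell ''pw'' (V ''d'' +. Lit 1)) (Lit 0)) (''ok'' <-- elem ''f0'' ''J'') (''ok'' <-- elem ''f1'' ''J''))
      (''ok'' <-- Lit 0))
    (''ok'' <-- (Lit 0 <. eq_e (V ''v'') (Lit 0) *. eq_e (V ''t'') (Lit 0)))"
 have 1: "run m ?c1 s = upd ''ok'' 0 (if X then 1 else 0) s"
 proof (cases "J < n")
  case False
  then show ?thesis unfolding X_def by (simp add: c bD[OF s])
 next
  case J: True
  show ?thesis
  proof (cases "l <= v & ?d < k & P ^ ?d dvd t")
   case False
   then have "~ X" unfolding X_def using J by auto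
   moreover have "~ (l <= v & ?d < k & t mod s ''pw'' (int ?d) = 0)"
    using False rdyD(5)[OF s, of ?d] by (auto simp: dvd_eq_mod_eq_0)
   ultimately show ?thesis using J by (simp add: c bD[OF s]) (auto)?
  next
   case True
   have p: "s ''pw'' (int ?d) = P ^ ?d" "s ''pw'' (int ?d + 1) = P ^ Suc ?d"
    using rdyD(5)[OF s, of ?d] pows_Suc[OF rdyD(2)[OF s], of ?d] True by simp_all
   have m0: "t mod P ^ ?d = 0" using True by (simp add: dvd_eq_mod_eq_0)
   have f': "s ''f0'' (int J) = (if flag0 J then 1 else 0)"
    "~ P ^ Suc ?d dvd t ==> s ''f1'' (int J) = (if flag1 (tau ?d) J then 1 else 0)"
    using f J True unfolding flags_def by blast+
   have XX: "X \<longleftrightarrow> (if P ^ Suc ?d dvd t then flag0 J else flag1 (tau ?d) J)"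
    unfolding X_def feas_sq_flags using J True by simp
   have "run m ?c1 s = run m (PIf (eq_e (V ''t'' mod. Cell ''pw'' (V ''d'' +. Lit 1)) (Lit 0)) (''ok'' <-- elem ''f0'' ''J'') (''ok'' <-- elem ''f1'' ''J'')) s"
    using J True by (simp add: c bD[OF s] p m0 del: power_Suc)
   also have "... = upd ''ok'' 0 (if X then 1 else 0) s"
    unfolding XX using f' by (simp add: c bD[OF s] p dvd_eq_mod_eq_0 del: power_Suc)
   finally show ?thesis .
  qed
 qed
 have gen: "run m (if prim then PIf (V ''pr'') PSkip (''ok'' <-- Lit 0) else PSkip) (upd ''ok'' 0 (if X then 1 else 0) s) =
   upd ''ok'' 0 (if X & (prim --> E) then 1 else 0) s" if "s ''pr'' 0 = (if E then 1 else 0)" for E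
  using that by (cases prim; cases X; cases E) (simp_all add: upd_apply)
 have "run m (feasible_c l prim) s = run m (if prim then PIf (V ''pr'') PSkip (''ok'' <-- Lit 0) else PSkip) (run m ?c1 s)"
  by (simp only: feasible_c_def run.simps)
 also have "... = upd ''ok'' 0 (if X & (prim --> (EX j<n. lbd ?d J j = 0)) then 1 else 0) s"
  unfolding 1 by (rule gen[OF pr])
 also have "X & (prim --> (EX j<n. lbd ?d J j = 0)) \<longleftrightarrow> feas J v" unfolding feas_def X_def by blast
 finally show ?thesis .
qed

lemma run_weight_step:
 assumes s: "rdy s" and f: "flags s" and q: "s ''q'' 0 = int c" "c < cl"
 defines "u == run m (weight_step_c l prim) s"
 shows "u ''pre'' = (s ''pre'')(int c + 1 := (s ''pre'' (int c) + wt c) mod B)"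
proof -
 define J where "J = c div k" define v where "v = c mod k" define d where "d = lev J v"
 have vk: "v < k" using k_pos by (simp add: v_def)
 have Jn: "J <= n" using J_le[OF q(2)] by (simp add: J_def)
 define s1 where "s1 = upd ''v'' 0 (int v) (upd ''J'' 0 (int J) s)"
 have e1: "run m class_c s = s1" unfolding s1_def J_def v_def by (rule run_class[OF s q(1)])
 have r1: "rdy s1" "s1 ''J'' 0 = int J" "s1 ''v'' 0 = int v" using s by (simp_all add: s1_def read_only_def upd_simps)
 define s2 where "s2 = upd ''d'' 0 (int d) s1"
 have e2: "run m level_c s1 = s2" and d3: "d <= 3 * k" unfolding s2_def d_def by (rule run_level[OF r1 vk])+
 have r2: "rdy s2" "s2 ''J'' 0 = int J" "s2 ''v'' 0 = int v" "s2 ''d'' 0 = int d" using r1 by (simp_all add: s2_def read_only_def upd_simps)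
 define W0 where "W0 = (if J < n then 2 * s ''pw'' (int d - int v) else 1)"
 define s3 where "s3 = upd ''pr'' 0 0 (upd ''w'' 0 (W0 mod B) s2)"
 have pwe: "s2 ''pw'' = s ''pw''" by (simp add: s2_def s1_def upd_simps)
 have e3: "run m (PIf (V ''J'' <. V ''n'') (''w'' <-- big_e (Lit 2 *. Cell ''pw'' (V ''d'' -. V ''v''))) (''w'' <-- big_e (Lit 1)) ;; ''pr'' <-- Lit 0) s2 = s3"
  using r2 by (simp add: s3_def W0_def bD pwe)
 have r3: "rdy s3" "s3 ''J'' 0 = int J" "s3 ''v'' 0 = int v" "s3 ''d'' 0 = int d" using r2 by (simp_all add: s3_def read_only_def upd_simps)
 \<comment> \<open>The product is followed with whatever the program reads from \<open>pw\<close>.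
   In an infeasible class the lower bound may exceed k and a negative address is read; the outcome
   is discarded when the weight is reset to 0.\<close>
 define R where "R = (%i. if i = J then 1 else s ''pw'' (int k - int (lbd d J i)))"
 define s4 where "s4 = run m (PFor ''j'' ''n'' (product_step_c l)) s3"
 have I4: "s4 ''w'' 0 = (W0 * (\<Prod>i<n. R i)) mod B & s4 ''pr'' 0 = (if EX i<n. lbd d J i = 0 then 1 else 0)"
  unfolding s4_def
 proof (rule rloop[where I = "%j u. u ''w'' 0 = (W0 * (\<Prod>i<j. R i)) mod B & u ''pr'' 0 = (if EX i<j. lbd d J i = 0 then 1 else 0)"])
  show "rdy s3" by (rule r3)
  then show "s3 ''n'' 0 = int n" by (rule bD)
  show "wf (PFor ''j'' ''n'' (product_step_c l))" by (simp add: read_only_def)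
  show "upd ''j'' 0 0 s3 ''w'' 0 = (W0 * (\<Prod>i<0. R i)) mod B & upd ''j'' 0 0 s3 ''pr'' 0 = (if EX i<0. lbd d J i = 0 then 1 else 0)"
   by (simp add: s3_def upd_simps)
  fix j u assume j: "j < n" "u ''j'' 0 = int j" and u: "rdy u"
   and I: "u ''w'' 0 = (W0 * (\<Prod>i<j. R i)) mod B & u ''pr'' 0 = (if EX i<j. lbd d J i = 0 then 1 else 0)"
   and fr: "!!x. x ~: mods (product_step_c l) ==> x ~= ''j'' ==> u x = s3 x"
  have c: "u ''J'' 0 = int J" "u ''d'' 0 = int d" using fr[of "''J''"] fr[of "''d''"] r3 by simp_all
  define a where "a = run m (lb_c l) u"
  have lb: "a ''lb'' 0 = int (lbd d J j)" unfolding a_def by (rule run_lb[OF u c(1) j(2) c(2) j(1) d3])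
  have ra: "rdy a" using u by (simp add: a_def)
  have ca: "a ''J'' 0 = int J" "a ''j'' 0 = int j" "a ''w'' 0 = u ''w'' 0" "a ''pr'' 0 = u ''pr'' 0" "a ''pw'' = s ''pw''"
   using c j fr[of "''pw''"] pwe by (simp_all add: a_def run_frame s3_def upd_simps)
  have rr: "run m (product_step_c l) u = run m (PIf (eq_e (V ''lb'') (Lit 0)) (''pr'' <-- Lit 1) PSkip ;;
   PIf (eq_e (V ''j'') (V ''J'')) PSkip (''w'' <-- big_e (V ''w'' *. Cell ''pw'' (V ''k'' -. V ''lb'')))) a"
   by (simp only: product_step_c_def run.simps a_def)
  have Rj: "R j = (if j = J then 1 else s ''pw'' (int k - int (lbd d J j)))" by (simp add: R_def)
  have w: "(W0 * (\<Prod>i<j. R i)) mod B * x mod B = (W0 * ((\<Prod>i<j. R i) * x)) mod B" for x by (simp add: mod_mult_left_eq mult.assoc)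
  have "run m (product_step_c l) u ''w'' 0 = (W0 * (\<Prod>i<Suc j. R i)) mod B"
   unfolding rr using I by (simp add: upd_simps lb ca bD[OF ra] Rj w)
  moreover have "run m (product_step_c l) u ''pr'' 0 = (if EX i<Suc j. lbd d J i = 0 then 1 else 0)"
   unfolding rr using I by (auto simp add: upd_simps lb ca less_Suc_eq)
  ultimately show "upd ''j'' 0 (int j + 1) (run m (product_step_c l) u) ''w'' 0 = (W0 * (\<Prod>i<Suc j. R i)) mod B &
   upd ''j'' 0 (int j + 1) (run m (product_step_c l) u) ''pr'' 0 = (if EX i<Suc j. lbd d J i = 0 then 1 else 0)"
   by (simp add: upd_simps del: prod.lessThan_Suc)
 qed simp
 have wfl: "wf (PFor ''j'' ''n'' (product_step_c l))" by (simp add: read_only_def)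
 have fr4: "s4 x = s3 x" if "x ~: {''j'', ''lb'', ''pr'', ''w''}" for x unfolding s4_def using that by (intro run_frame) auto
 have r4: "rdy s4" unfolding s4_def using r3(1) wfl by (subst rdy_run) simp_all
 have c4: "s4 ''J'' 0 = int J" "s4 ''v'' 0 = int v" "s4 ''d'' 0 = int (lev J v)" "s4 ''f0'' = s ''f0''" "s4 ''f1'' = s ''f1''" "s4 ''pre'' = s ''pre''" "s4 ''q'' = s ''q''"
  using r3 by (simp_all add: fr4 d_def) (simp_all add: s3_def s2_def s1_def upd_simps)
 have f4: "flags s4" using f unfolding flags_def c4 .
 define s5 where "s5 = upd ''ok'' 0 (if feas J v then 1 else 0) s4"
 have e5: "run m (feasible_c l prim) s4 = s5"
  unfolding s5_def by (rule run_feasible[OF r4 f4 c4(1-3)]) (use I4 in \<open>simp add: d_def\<close>)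
 have wt: "wt c mod B = (if feas J v then s4 ''w'' 0 else 0)"
 proof (cases "feas J v")
  case True
  have v: "valid J v" by (rule feas_valid[OF True Jn])
  have "R i = radix d J i" if "i < n" for i
   using pw_diff[OF s lbd_valid[OF v that] order_refl] by (simp add: R_def radix_def d_def)
  then have "(\<Prod>i<n. R i) = (\<Prod>i<n. radix d J i)" by (intro prod.cong) auto
  moreover have "W0 = mult J v"
   using v pw_diff[OF s v_le_lev[of J v], of ] by (auto simp: W0_def mult_def d_def valid_def)
  ultimately show ?thesis using I4 True by (simp add: wt_def J_def v_def d_def mult.commute)
 next
  case False
  then show ?thesis by (simp add: wt_def J_def v_def)
 qed
 have "u = run m (PIf (V ''ok'') PSkip (''w'' <-- Lit 0) ;;
   PAsg ''pre'' (V ''q'' +. Lit 1) (big_e (elem ''pre'' ''q'' +. V ''w''))) s5"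
  unfolding u_def weight_step_c_def e5[symmetric] s4_def e3[symmetric] e2[symmetric] e1[symmetric] by (simp only: run.simps)
 then have "u ''pre'' = (s ''pre'')(int c + 1 := (s ''pre'' (int c) + wt c mod B) mod B)"
  unfolding wt using bD[OF r4] q(1) by (auto simp: s5_def upd_simps c4 fun_eq_iff)
 then show ?thesis by (simp only: mod_add_right_eq)
qed

text \<open>Makes the reductions modulo \<open>BIG\<close> act as the identity on the partial sums
  of weights, on \<open>M\<close> and on \<open>N1\<close>.\<close>

lemma m_power_less_B: "i <= 2 * n + 4 ==> m ^ i < B"
proof -
 assume "i <= 2 * n + 4"
 then have "m ^ i <= m ^ (2 * n + 4)" using p_ge_3 by (intro power_increasing) (auto simp: one_le_power)
 then show ?thesis using B_big(1) by simp
qed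

lemma tot_less_B: "c <= cl ==> tot c < B"
 using tot_mono[of c cl] tot_le m_power_less_B[of "2 * n + 3"] by simp

definition totals :: "store => bool" where
 "totals s \<longleftrightarrow> (\<forall>c\<le>cl. s ''pre'' (int c) = tot c)"

lemma run_weights:
 assumes s: "rdy s" and f: "flags s"
 shows "totals (run m (weights_c l prim) s)"
proof -
 let ?s = "upd ''pre'' 0 0 s"
 have "\<forall>c\<le>cl. run m (PFor ''q'' ''cl'' (weight_step_c l prim)) ?s ''pre'' (int c) = tot c"
 proof (rule rloop[where I = "%j u. \<forall>c\<le>j. u ''pre'' (int c) = tot c"])
  show r: "rdy ?s" using s by (simp add: read_only_def)
  show "?s ''cl'' 0 = int cl" by (rule bD[OF r])
  show "wf (PFor ''q'' ''cl'' (weight_step_c l prim))" by (simp add: read_only_def)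
  show "\<forall>c\<le>0. upd ''q'' 0 0 ?s ''pre'' (int c) = tot c" by (simp add: upd_simps tot_def)
  fix j u assume j: "j < cl" "\<forall>c\<le>j. u ''pre'' (int c) = tot c" "u ''q'' 0 = int j" "rdy u"
   and fr: "!!x. x ~: mods (weight_step_c l prim) ==> x ~= ''q'' ==> u x = ?s x"
  have "u ''f0'' = s ''f0''" "u ''f1'' = s ''f1''" using fr[of "''f0''"] fr[of "''f1''"] by (simp_all add: upd_simps)
  then have f': "flags u" using f unfolding flags_def by simp
  have "(tot j + wt j) mod B = tot (Suc j)"
   using tot_less_B[of "Suc j"] tot_nonneg[of "Suc j"] j(1) by (simp add: tot_Suc mod_pos_pos_trivial)
  then have "run m (weight_step_c l prim) u ''pre'' = (u ''pre'')(int j + 1 := tot (Suc j))"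
   using run_weight_step[OF j(4) f' j(3,1)] j(2) by simp
  moreover have "int c = int j + 1 \<longleftrightarrow> c = Suc j" for c by linarith
  ultimately show "\<forall>c\<le>Suc j. upd ''q'' 0 (int j + 1) (run m (weight_step_c l prim) u) ''pre'' (int c) = tot c"
   using j(2) by (auto simp: upd_simps le_Suc_eq)
 qed simp
 then show ?thesis unfolding totals_def by (simp add: weights_c_def)
qed

lemma run_range:
 assumes s: "rdy s" and p: "totals s"
 defines "u == run m range_c s"
 shows "u ''M'' 0 = m ^ (2 * n + 3)" "u ''N1'' 0 = m ^ (2 * n + 4)" "u ''G'' 0 = tot cl"
proof -
 let ?b = "''M'' <-- big_e (V ''M'' *. V ''m'')"
 let ?s = "upd ''M'' 0 1 s"
 define v where "v = run m (PFor ''i'' ''l1'' ?b) ?s"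
 have M: "v ''M'' 0 = m ^ l1 mod B"
  unfolding v_def
 proof (rule rloop[where I = "%j u. u ''M'' 0 = m ^ j mod B"])
  show r: "rdy ?s" using s by (simp add: read_only_def)
  show "?s ''l1'' 0 = int l1" by (rule bD[OF r])
  show "wf (PFor ''i'' ''l1'' ?b)" by (simp add: expr_defs read_only_def)
  show "upd ''i'' 0 0 ?s ''M'' 0 = m ^ 0 mod B" using m_power_less_B[of 0] by (simp add: upd_simps)
  fix j u assume j: "u ''M'' 0 = m ^ j mod B" "rdy u"
  have "m ^ j mod B * m mod B = m ^ Suc j mod B" by (simp only: mod_mult_left_eq power_Suc2)
  then show "upd ''i'' 0 (int j + 1) (run m ?b u) ''M'' 0 = m ^ Suc j mod B" using j(1) by (simp add: upd_simps bD[OF j(2)] del: power_Suc)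
 qed simp
 have rv: "rdy v" unfolding v_def using s by (subst rdy_run) (simp_all add: expr_defs read_only_def)
 have "m ^ l1 mod B = m ^ (2 * n + 3)" unfolding l1 using m_power_less_B[of "2 * n + 3"] by (intro mod_pos_pos_trivial) simp_all
 then have M': "v ''M'' 0 = m ^ (2 * n + 3)" using M by simp
 have e: "2 * n + 4 = Suc (2 * n + 3)" by simp
 have N: "m ^ (2 * n + 3) * m mod B = m ^ (2 * n + 4)"
  using m_power_less_B[of "2 * n + 4"] unfolding e power_Suc2[symmetric] by (intro mod_pos_pos_trivial) simp_all
 have pre: "v ''pre'' = s ''pre''" unfolding v_def by (subst run_frame, simp, simp add: upd_simps)
 have uu: "u = run m (''N1'' <-- big_e (V ''M'' *. V ''m'') ;; ''G'' <-- elem ''pre'' ''cl'') v"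
  unfolding u_def v_def range_c_def by (simp only: run.simps eval.simps)
 have g: "s ''pre'' (int cl) = tot cl" using p by (simp only: totals_def order_refl)
 show "u ''M'' 0 = m ^ (2 * n + 3)" "u ''N1'' 0 = m ^ (2 * n + 4)"
  unfolding uu by (simp_all only: run.simps eval.simps eval_e apply_op.simps upd_apply bD[OF rv] M' N) simp_all
 show "u ''G'' 0 = tot cl"
  unfolding uu using g by (simp add: upd_simps pre bD[OF rv])
qed

lemma run_select:
 assumes s: "rdy s" and p: "totals s" and c: "c < cl" "tot c <= s ''R'' 0" "s ''R'' 0 < tot (Suc c)"
 defines "u == run m select_c s"
 shows "u ''J'' 0 = int (c div k)" "u ''v'' 0 = int (c mod k)" "u ''rr'' 0 = s ''R'' 0 - tot c"
proof -
 let ?b = "PIf (not_e (V ''R'' <. elem ''pre'' ''q'') *. (V ''R'' <. Cell ''pre'' (V ''q'' +. Lit 1)))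
   (class_c ;; ''rr'' <-- big_e (V ''R'' -. elem ''pre'' ''q'')) PSkip"
 have "c < cl --> u ''J'' 0 = int (c div k) & u ''v'' 0 = int (c mod k) & u ''rr'' 0 = s ''R'' 0 - tot c"
  unfolding u_def select_c_def
 proof (rule rloop[where I = "%j u. c < j --> u ''J'' 0 = int (c div k) & u ''v'' 0 = int (c mod k) & u ''rr'' 0 = s ''R'' 0 - tot c"])
  show "rdy s" by (rule s)
  show "s ''cl'' 0 = int cl" by (rule bD[OF s])
  show "wf (PFor ''q'' ''cl'' ?b)" by (simp add: expr_defs read_only_def)
  fix j u assume j: "j < cl" "u ''q'' 0 = int j" "rdy u" and I: "c < j --> u ''J'' 0 = int (c div k) & u ''v'' 0 = int (c mod k) & u ''rr'' 0 = s ''R'' 0 - tot c"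
   and fr: "!!x. x ~: mods ?b ==> x ~= ''q'' ==> u x = s x"
  have e: "u ''R'' = s ''R''" "u ''pre'' = s ''pre''" using fr[of "''R''"] fr[of "''pre''"] by simp_all
  have pj: "s ''pre'' (int j) = tot j" "s ''pre'' (int j + 1) = tot (Suc j)"
   using p[unfolded totals_def, rule_format, of j] p[unfolded totals_def, rule_format, of "Suc j"] j(1) by (simp_all add: add.commute)
  have cnd: "Defs.eval m u (not_e (V ''R'' <. elem ''pre'' ''q'') *. (V ''R'' <. Cell ''pre'' (V ''q'' +. Lit 1))) ~= 0 \<longleftrightarrow> j = c"
  proof -
   have "tot j <= s ''R'' 0 & s ''R'' 0 < tot (Suc j) \<longleftrightarrow> j = c"
    using c sel_eq[of j "s ''R'' 0"] sel_eq[of c "s ''R'' 0"] by auto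
   then show ?thesis by (auto simp: e j(2) pj)
  qed
  show "c < Suc j --> upd ''q'' 0 (int j + 1) (run m ?b u) ''J'' 0 = int (c div k) &
    upd ''q'' 0 (int j + 1) (run m ?b u) ''v'' 0 = int (c mod k) & upd ''q'' 0 (int j + 1) (run m ?b u) ''rr'' 0 = s ''R'' 0 - tot c"
  proof (cases "j = c")
   case False
   then have "run m ?b u = u" using cnd by (simp only: run.simps if_False not_not)
   then show ?thesis using I False by (simp add: upd_simps del: run.simps)
  next
   case True
   have b: "(s ''R'' 0 - tot c) mod B = s ''R'' 0 - tot c"
    using c tot_less_B[of "Suc c"] tot_nonneg[of c] by (intro mod_pos_pos_trivial) simp_all
   have "run m ?b u = run m (''rr'' <-- big_e (V ''R'' -. elem ''pre'' ''q'')) (run m class_c u)"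
    using iffD2[OF cnd True] by (simp only: run.simps if_True not_False_eq_True)
   also have "... = upd ''rr'' 0 (s ''R'' 0 - tot c) (upd ''v'' 0 (int (c mod k)) (upd ''J'' 0 (int (c div k)) u))"
    unfolding run_class[OF j(3,2)] True[symmetric] using b True pj by (simp add: upd_simps e j(2) bD[OF j(3)])
   finally show ?thesis by (simp add: upd_simps del: run.simps)
  qed
 qed simp_all
 then show "u ''J'' 0 = int (c div k)" "u ''v'' 0 = int (c mod k)" "u ''rr'' 0 = s ''R'' 0 - tot c" using c(1) by blast+
qed

lemma run_decode:
 assumes s: "rdy s" and c: "s ''J'' 0 = int J" "s ''d'' 0 = int (lev J v)" "valid J v"
 defines "u == run m (decode_c l) s" and "N == radix (lev J v) J"
 defines "g == \<lambda>j\<in>{..<n}. digit N j (s ''rr'' 0)"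
 shows "ALL i<n. u ''y'' (int i) = y0 (lev J v) J g i" "u ''rr'' 0 = rest N n (s ''rr'' 0)" "u ''acc'' 0 = acc (lev J v) J g"
proof -
 let ?d = "lev J v"
 have dk: "?d <= k" using c(3) by (auto simp: valid_def lev_def split: if_splits)
 let ?s = "upd ''acc'' 0 (t mod m) s"
 define T where "T = (%i. P ^ ex i * un i * (y0 ?d J g i)\<^sup>2)"
 define I where "I = (%j (u::store). (ALL i<j. u ''y'' (int i) = y0 ?d J g i) & u ''rr'' 0 = rest N j (s ''rr'' 0) & u ''acc'' 0 = (t - (\<Sum>i<j. T i)) mod m)"
 have "I n (run m (PFor ''j'' ''n'' (digit_c l)) ?s)"
 proof (rule rloop[where I = I])
  show r: "rdy ?s" using s by (simp add: read_only_def)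
  show "?s ''n'' 0 = int n" by (rule bD[OF r])
  show "wf (PFor ''j'' ''n'' (digit_c l))" by (simp add: read_only_def)
  show "I 0 (upd ''j'' 0 0 ?s)" by (simp add: I_def upd_simps)
  fix j u assume j: "j < n" "u ''j'' 0 = int j" "rdy u" and I: "I j u"
   and fr: "!!x. x ~: mods (digit_c l) ==> x ~= ''j'' ==> u x = ?s x"
  have cu: "u ''J'' 0 = int J" "u ''d'' 0 = int ?d" using fr[of "''J''"] fr[of "''d''"] c by (simp_all add: upd_simps)
  show "I (Suc j) (upd ''j'' 0 (int j + 1) (run m (digit_c l) u))"
  proof (cases "j = J")
   case True
   then have y: "y0 ?d J g j = 0" by (simp add: y0_def)
   then have "T j = 0" by (simp add: T_def)
   moreover have "N j = 1" using True by (simp add: N_def radix_def)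
   moreover have "run m (digit_c l) u = upd ''y'' (int j) 0 u" using True j cu by (simp add: digit_c_def)
   ultimately show ?thesis using I y unfolding I_def by (auto simp: upd_simps less_Suc_eq)
  next
   case False
   define a where "a = run m (lb_c l) u"
   let ?b = "lbd ?d J j"
   have bk: "?b <= k" by (rule lbd_valid[OF c(3) j(1)])
   have lb: "a ''lb'' 0 = int ?b" unfolding a_def by (rule run_lb[OF j(3) cu(1) j(2) cu(2) j(1)]) (use dk in simp)
   have ra: "rdy a" using j(3) by (simp add: a_def)
   have fa: "a x = u x" if "x ~= ''lb''" for x unfolding a_def using that by (simp add: run_frame)
   have pwa: "a ''pw'' (int ?b) = P ^ ?b" "a ''pw'' (int k - int ?b) = N j"
    using rdyD(5)[OF ra bk] pw_diff[OF ra bk] False by (simp_all add: N_def radix_def)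
   let ?x = "rest N j (s ''rr'' 0)"
   have gj: "g j = ?x mod N j" using j(1) by (simp add: g_def digit_def)
   have Np: "N j = P ^ (k - ?b)" using False by (simp add: N_def radix_def)
   have yv: "y0 ?d J g j = P ^ ?b * (?x mod N j)" using j(1) False by (simp add: y0_def gj)
   have yB: "P ^ ?b * (?x mod N j) mod B = P ^ ?b * (?x mod N j)"
   proof (rule mod_pos_pos_trivial)
    have N0: "N j > 0" unfolding Np by simp
    then show "0 <= P ^ ?b * (?x mod N j)" by simp
    have "P ^ ?b * (?x mod N j) <= P ^ ?b * N j" using N0 by (intro mult_left_mono) (simp_all add: less_imp_le)
    also have "... = m" unfolding Np using bk by (simp add: power_add[symmetric])
    also have "m < B" by (rule B_large)
    finally show "P ^ ?b * (?x mod N j) < B" .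
   qed
   have yB': "y0 ?d J g j mod B = y0 ?d J g j" unfolding yv by (rule yB)
   have eu: "a ''ex'' (int j) = int (ex j)" "a ''un'' (int j) = un j" using rdyD(3,4)[OF ra j(1)] .
   have pe: "a ''pw'' (int (ex j)) = P ^ ex j" using rdyD(5)[OF ra ex_le[OF j(1)]] .
   have aj: "a ''j'' 0 = int j" "a ''rr'' 0 = ?x" "a ''acc'' 0 = (t - (\<Sum>i<j. T i)) mod m" "a ''y'' = u ''y''"
    using j(2) I by (simp_all add: fa I_def)
   have rr: "run m (digit_c l) u = run m (PAsg ''y'' (V ''j'') (big_e (elem ''pw'' ''lb'' *. (V ''rr'' mod. Cell ''pw'' (V ''k'' -. V ''lb'')))) ;;
   ''rr'' <-- V ''rr'' div. Cell ''pw'' (V ''k'' -. V ''lb'') ;;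
   ''acc'' <-- V ''acc'' +: (Lit 0 -. Cell ''pw'' (elem ''ex'' ''j'') *. elem ''un'' ''j'' *. (elem ''y'' ''j'' *. elem ''y'' ''j''))) a"
    using False j(2) cu by (simp add: digit_c_def a_def)
   have ac: "((t - (\<Sum>i<j. T i)) mod m + (0 - P ^ ex j * un j * (y0 ?d J g j * y0 ?d J g j))) mod m = (t - (\<Sum>i<Suc j. T i)) mod m"
    by (simp only: mod_add_left_eq T_def sum.lessThan_Suc power2_eq_square) (simp add: algebra_simps)
   have "run m (digit_c l) u = upd ''acc'' 0 ((t - (\<Sum>i<Suc j. T i)) mod m) (upd ''rr'' 0 (?x div N j) (upd ''y'' (int j) (y0 ?d J g j) a))"
    unfolding rr using ac by (simp add: upd_simps aj lb pwa bD[OF ra] yB' yv[symmetric] eu pe del: sum.lessThan_Suc)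
   then show ?thesis using I aj unfolding I_def by (auto simp: upd_simps less_Suc_eq simp del: sum.lessThan_Suc)
  qed
 qed simp
 moreover have "u = run m (PFor ''j'' ''n'' (digit_c l)) ?s"
  unfolding u_def decode_c_def using bD[OF s] by (simp del: run.simps(5))
 ultimately have "I n u" by simp
 then show "ALL i<n. u ''y'' (int i) = y0 ?d J g i" "u ''rr'' 0 = rest N n (s ''rr'' 0)" "u ''acc'' 0 = acc ?d J g"
  by (simp_all add: I_def acc_def q_def T_def)
qed

lemma run_root:
 assumes s: "rdy s" and c: "s ''J'' 0 = int J" "s ''d'' 0 = int d" "d <= k" and ac: "s ''acc'' 0 = acc d J g"
 defines "u == run m root_c s" and "a == s ''av'' 0"
 shows "u ''ok'' 0 = (if root_ok (rad d J g) a then 1 else 0)" "u ''z'' 0 = root (rad d J g) a (s ''rr'' 0 mod 2 = 1)"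
proof -
 let ?r = "rad d J g"
 let ?s = "upd ''bv'' 0 1 (upd ''bu'' 0 a (upd ''r'' 0 ?r s))"
 have pd: "s ''pw'' (int d) = P ^ d" by (rule rdyD(5)[OF s c(3)])
 have e1: "run m (PIf (V ''J'' <. V ''n'') (''r'' <-- (V ''acc'' div. elem ''pw'' ''d'') *: RInv (elem ''un'' ''J'')) (''r'' <-- Lit 1) ;;
   ''bu'' <-- V ''av'' ;; ''bv'' <-- Lit 1) s = ?s"
  using rdyD(4)[OF s, of J] by (simp add: c ac bD[OF s] pd rad_def a_def upd_simps)
 define s2 where "s2 = run m pow_c ?s"
 have r1: "rdy ?s" using s by (simp add: read_only_def)
 have r2: "rdy s2" using r1 by (simp add: s2_def)
 have qp: "qpow m ?r lg a 1 (int h) = (s2 ''pu'' 0, s2 ''pv'' 0)" using run_pow[OF r1] by (simp add: s2_def upd_simps)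
 have c2: "s2 ''r'' 0 = ?r" "s2 ''rr'' 0 = s ''rr'' 0" by (simp_all add: s2_def run_frame upd_simps)
 have ok: "root_ok ?r a \<longleftrightarrow> s2 ''pu'' 0 mod P = 0 & (s2 ''pv'' 0 * s2 ''pv'' 0 * ?r) mod P = 1"
 proof -
  have "1 mod P = 1" using p_ge_3 by simp
  then show ?thesis unfolding root_ok_def qp by (simp add: cong_def dvd_eq_mod_eq_0)
 qed
 define z0 where "z0 = (if s ''rr'' 0 mod 2 = 1 then - 1 else 1) * modular_inverse m (s2 ''pv'' 0) mod m"
 define s3 where "s3 = upd ''z'' 0 z0 (upd ''ok'' 0 (if root_ok ?r a then 1 else 0) s2)"
 have e3: "run m (''ok'' <-- (Lit 0 <. eq_e (V ''pu'' mod. V ''p'') (Lit 0) *. eq_e ((V ''pv'' *. V ''pv'' *. V ''r'') mod. V ''p'') (Lit 1)) ;;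
   ''z'' <-- RInv (V ''pv'') ;;
   PIf (V ''rr'' mod. Lit 2) (''z'' <-- (Lit 0 -. Lit 1) *: V ''z'') (''z'' <-- Lit 1 *: V ''z'')) s2 = s3"
  unfolding s3_def z0_def ok by (cases "s ''rr'' 0 mod 2 = 1") (simp_all add: c2 bD[OF r2] upd_simps)
 have r3: "rdy s3" using r2 by (simp add: s3_def read_only_def)
 let ?b = "''z'' <-- V ''z'' +: (V ''r'' -. V ''z'' *. V ''z'') *. RInv (Lit 2 *. V ''z'')"
 have "run m (PFor ''j'' ''k'' ?b) s3 ''z'' 0 = (newton m ?r ^^ k) z0"
 proof (rule rloop[where I = "%j u. u ''z'' 0 = (newton m ?r ^^ j) z0", OF r3])
  show "s3 ''k'' 0 = int k" by (rule bD[OF r3])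
  show "wf (PFor ''j'' ''k'' ?b)" by (simp add: read_only_def)
  show "upd ''j'' 0 0 s3 ''z'' 0 = (newton m ?r ^^ 0) z0" by (simp add: upd_simps s3_def)
  fix j u assume I: "u ''z'' 0 = (newton m ?r ^^ j) z0" and fr: "!!x. x ~: mods ?b ==> x ~= ''j'' ==> u x = s3 x"
  have "u ''r'' 0 = ?r" using fr[of "''r''"] by (simp add: s3_def upd_simps c2)
  then show "upd ''j'' 0 (int j + 1) (run m ?b u) ''z'' 0 = (newton m ?r ^^ Suc j) z0"
   by (simp add: upd_simps newton_def I)
 qed simp
 moreover have uu: "u = run m (PFor ''j'' ''k'' ?b) s3"
  unfolding u_def root_c_def e3[symmetric] s2_def e1[symmetric] by (simp only: run.simps(3))
 ultimately show "u ''z'' 0 = root ?r a (s ''rr'' 0 mod 2 = 1)"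
  unfolding root_def qp z0_def snd_conv by (simp only:)
 show "u ''ok'' 0 = (if root_ok ?r a then 1 else 0)" unfolding uu by (subst run_frame) (simp_all add: s3_def upd_simps)
qed

lemma run_primitive:
 assumes s: "rdy s"
 shows "run m primitive_c s ''pr'' 0 = (if EX i<n. ~ P dvd s ''y'' (int i) then 1 else 0)"
proof -
 let ?b = "PIf (elem ''y'' ''j'' mod. V ''p'') (''pr'' <-- Lit 1) PSkip"
 let ?s = "upd ''pr'' 0 0 s"
 have "run m (PFor ''j'' ''n'' ?b) ?s ''pr'' 0 = (if EX i<n. ~ P dvd s ''y'' (int i) then 1 else 0)"
 proof (rule rloop[where I = "%j u. u ''pr'' 0 = (if EX i<j. ~ P dvd s ''y'' (int i) then 1 else 0)"])
  show r: "rdy ?s" using s by (simp add: read_only_def)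
  show "?s ''n'' 0 = int n" by (rule bD[OF r])
  show "wf (PFor ''j'' ''n'' ?b)" by (simp add: expr_defs read_only_def)
  fix j u assume I: "u ''pr'' 0 = (if EX i<j. ~ P dvd s ''y'' (int i) then 1 else 0)" "u ''j'' 0 = int j" "rdy u"
   and fr: "!!x. x ~: mods ?b ==> x ~= ''j'' ==> u x = ?s x"
  have "u ''y'' = s ''y''" using fr[of "''y''"] by (simp add: upd_simps)
  then show "upd ''j'' 0 (int j + 1) (run m ?b u) ''pr'' 0 = (if EX i<Suc j. ~ P dvd s ''y'' (int i) then 1 else 0)"
   using I(1,2) by (auto simp: upd_simps bD[OF I(3)] dvd_eq_mod_eq_0 less_Suc_eq)
 qed (simp_all add: upd_simps)
 then show ?thesis by (simp add: primitive_c_def)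
qed

lemma run_apply:
 assumes s: "rdy s" and y: "!!i. i < n ==> s ''y'' (int i) = y i"
 shows "ALL i<n. run m apply_c s ''x'' (int i) = app n (mt s ''U'') y i mod m"
proof -
 let ?c = "PAsg ''x'' (V ''i'') (elem ''x'' ''i'' +: Cell ''U'' (entry (V ''i'') (V ''j'')) *. elem ''y'' ''j'')"
 let ?in = "PFor ''j'' ''n'' ?c" let ?b = "PAsg ''x'' (V ''i'') (Lit 0) ;; ?in"
 show ?thesis unfolding apply_c_def
 proof (rule rloop[where I = "%i u. ALL i'<i. u ''x'' (int i') = app n (mt s ''U'') y i' mod m", OF s])
  show "s ''n'' 0 = int n" by (rule bD[OF s])
  show "wf (PFor ''i'' ''n'' ?b)" by (simp add: expr_defs read_only_def)
  fix i u assume i: "i < n" "ALL i'<i. u ''x'' (int i') = app n (mt s ''U'') y i' mod m" "u ''i'' 0 = int i" "rdy u"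
   and fr: "!!x. x ~: mods ?b ==> x ~= ''i'' ==> u x = s x"
  let ?u = "upd ''x'' (int i) 0 u"
  have ru: "rdy ?u" using i(4) by (simp add: read_only_def)
  have "(ALL i'<i. run m ?in ?u ''x'' (int i') = app n (mt s ''U'') y i' mod m) & run m ?in ?u ''x'' (int i) = (\<Sum>j<n. mt s ''U'' i j * y j) mod m"
  proof (rule rloop[where I = "%j w. (ALL i'<i. w ''x'' (int i') = app n (mt s ''U'') y i' mod m) & w ''x'' (int i) = (\<Sum>j<j. mt s ''U'' i j * y j) mod m", OF ru])
   show "?u ''n'' 0 = int n" by (rule bD[OF ru])
   show "wf ?in" by (simp add: expr_defs read_only_def)
   show "(ALL i'<i. upd ''j'' 0 0 ?u ''x'' (int i') = app n (mt s ''U'') y i' mod m) & upd ''j'' 0 0 ?u ''x'' (int i) = (\<Sum>j<0. mt s ''U'' i j * y j) mod m"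
    using i(2) by (simp add: upd_simps)
   fix j w assume j: "j < n" "w ''j'' 0 = int j" "rdy w"
    and I: "(ALL i'<i. w ''x'' (int i') = app n (mt s ''U'') y i' mod m) & w ''x'' (int i) = (\<Sum>j<j. mt s ''U'' i j * y j) mod m"
    and fr': "!!x. x ~: mods ?c ==> x ~= ''j'' ==> w x = ?u x"
   have e: "w ''i'' 0 = int i" "w ''U'' = s ''U''" "w ''y'' = s ''y''"
    using fr'[of "''i''"] fr'[of "''U''"] fr'[of "''y''"] fr[of "''U''"] fr[of "''y''"] i(3) by (simp_all add: upd_simps)
   have "run m ?c w = upd ''x'' (int i) ((\<Sum>j<Suc j. mt s ''U'' i j * y j) mod m) w"
    using I y[OF j(1)] by (simp add: e j(2) bD[OF j(3)] mt_def mod_add_left_eq)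
   then show "(ALL i'<i. upd ''j'' 0 (int j + 1) (run m ?c w) ''x'' (int i') = app n (mt s ''U'') y i' mod m) &
     upd ''j'' 0 (int j + 1) (run m ?c w) ''x'' (int i) = (\<Sum>j<Suc j. mt s ''U'' i j * y j) mod m"
    using I by (simp add: upd_simps del: sum.lessThan_Suc run.simps)
  qed simp
  then show "ALL i'<Suc i. upd ''i'' 0 (int i + 1) (run m ?b u) ''x'' (int i') = app n (mt s ''U'') y i' mod m"
   using i(3) by (simp add: upd_simps less_Suc_eq app_def del: run.simps(5))
 qed simp_all
qed

end

context sampler
begin

abbreviation result :: "store => store => (nat => int) option => bool" where
 "result s u w == (case w of None => u ''status'' 0 = 0
   | Some y => u ''status'' 0 = 1 & (ALL i<n. u ''x'' (int i) = app n (mt s ''U'') y i mod m))"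

lemma run_try:
 assumes s: "rdy s" and p: "totals s" and R: "0 <= s ''R'' 0" "s ''R'' 0 < tot cl" and st: "s ''status'' 0 = 0"
 shows "result s (run m (try_c l prim) s) (attempt (s ''R'' 0) (s ''av'' 0))"
proof -
 obtain c where c: "c < cl" "tot c <= s ''R'' 0" "s ''R'' 0 < tot (Suc c)" using sel_exists[OF R] by blast
 define J where "J = c div k" define v where "v = c mod k" define rh where "rh = s ''R'' 0 - tot c"
 have r0: "0 <= rh" "rh < wt c" using c by (simp_all add: rh_def tot_Suc)
 have f: "feas J v" using r0 by (auto simp: wt_def J_def v_def split: if_splits)
 have Jn: "J <= n" using J_le[OF c(1)] by (simp add: J_def)
 have vk: "v < k" using k_pos by (simp add: v_def)
 have va: "valid J v" by (rule feas_valid[OF f Jn])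
 let ?d = "lev J v"
 have dk: "?d <= k" using va by (auto simp: valid_def lev_def split: if_splits)
 define N where "N = radix ?d J" define g where "g = (\<lambda>j\<in>{..<n}. digit N j rh)" define W where "W = rest N n rh"
 have W: "0 <= W" "W < mult J v"
  using digits_of_code(2,3)[OF f[unfolded J_def v_def] r0] by (simp_all add: W_def N_def J_def v_def)
 let ?a = "s ''av'' 0"
 have at: "attempt (s ''R'' 0) ?a = (if success J v g W ?a then Some (out J v g W ?a) else None)"
  unfolding attempt_def sel_eq[OF c(2,3)] catt_def Let_def g_def W_def N_def J_def v_def rh_def by (rule refl)
 define s1 where "s1 = run m select_c s"
 have r1: "rdy s1" using s by (simp add: s1_def)
 have c1: "s1 ''J'' 0 = int J" "s1 ''v'' 0 = int v" "s1 ''rr'' 0 = rh"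
  unfolding s1_def J_def v_def rh_def by (rule run_select[OF s p c])+
 define s2 where "s2 = upd ''d'' 0 (int ?d) s1"
 have e2: "run m level_c s1 = s2" unfolding s2_def by (rule run_level(1)[OF r1 c1(1,2) vk])
 have r2: "rdy s2" using r1 by (simp add: s2_def read_only_def)
 have c2: "s2 ''J'' 0 = int J" "s2 ''d'' 0 = int ?d" "s2 ''rr'' 0 = rh" "s2 ''v'' 0 = int v" by (simp_all add: s2_def upd_simps c1)
 define s3 where "s3 = run m (decode_c l) s2"
 have r3: "rdy s3" using r2 by (simp add: s3_def)
 have D: "ALL i<n. s3 ''y'' (int i) = y0 ?d J g i" "s3 ''rr'' 0 = W" "s3 ''acc'' 0 = acc ?d J g"
  using run_decode[OF r2 c2(1,2) va] unfolding s3_def c2(3) g_def W_def N_def by blast+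
 have c3: "s3 ''J'' 0 = int J" "s3 ''d'' 0 = int ?d" "s3 ''v'' 0 = int v" "s3 ''av'' = s ''av''" "s3 ''status'' = s ''status''" "s3 ''U'' = s ''U''"
  by (simp_all add: s3_def run_frame c2) (simp_all add: s2_def s1_def run_frame upd_simps)
 define s4 where "s4 = run m root_c s3"
 have r4: "rdy s4" using r3 by (simp add: s4_def)
 let ?z = "root (rad ?d J g) ?a (W mod 2 = 1)"
 have o4: "s4 ''ok'' 0 = (if root_ok (rad ?d J g) ?a then 1 else 0)" "s4 ''z'' 0 = ?z"
  using run_root[OF r3 c3(1,2) dk D(3)] unfolding s4_def c3 D(2) by blast+
 have c4: "s4 ''J'' 0 = int J" "s4 ''d'' 0 = int ?d" "s4 ''v'' 0 = int v" "s4 ''y'' = s3 ''y''" "s4 ''rr'' 0 = W" "s4 ''status'' = s ''status''" "s4 ''U'' = s ''U''"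
  by (simp_all add: s4_def run_frame c3 D)
 define s5 where "s5 = run m pivot_coord_c s4"
 have y5: "s5 ''y'' (int i) = out J v g W ?a i" if i: "i < n" for i
 proof (cases "J < n")
  case False
  have "s5 = s4" using False by (simp add: s5_def pivot_coord_c_def c4 bD[OF r4])
  then show ?thesis using D(1) i by (simp add: c4 out_n[OF False])
 next
  case True
  let ?K = "P ^ (k - ?d)" let ?Y = "P ^ v * (?z mod ?K + W div 2 * ?K)"
  have b: "?Y mod B = ?Y"
  proof (rule mod_pos_pos_trivial)
   show "0 <= ?Y" using W by (intro mult_nonneg_nonneg add_nonneg_nonneg) (simp_all add: pos_imp_zdiv_nonneg_iff)
   have "?Y < m" by (rule root_part_bounds[OF va True W])
   then show "?Y < B" using B_large by simp
  qed
  have "s5 = upd ''y'' (int J) ?Y s4"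
   using True vk rdyD(5)[OF r4, of v] pw_diff[OF r4 dk] b by (simp add: s5_def pivot_coord_c_def c4 o4 bD[OF r4])
  then show ?thesis using D(1) i by (simp add: upd_simps c4 out_J[OF True])
 qed
 have r5: "rdy s5" using r4 by (simp add: s5_def)
 define s6 where "s6 = run m primitive_c s5"
 have r6: "rdy s6" using r5 by (simp add: s6_def)
 have pr: "s6 ''pr'' 0 = (if EX i<n. ~ P dvd out J v g W ?a i then 1 else 0)"
 proof -
  have "(EX i<n. ~ P dvd s5 ''y'' (int i)) \<longleftrightarrow> (EX i<n. ~ P dvd out J v g W ?a i)" using y5 by auto
  then show ?thesis unfolding s6_def run_primitive[OF r5] by (simp only:)
 qed
 have c6: "s6 ''ok'' 0 = (if root_ok (rad ?d J g) ?a then 1 else 0)" "s6 ''y'' = s5 ''y''" "s6 ''status'' = s ''status''" "s6 ''U'' = s ''U''"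
  by (simp_all add: s6_def s5_def run_frame o4 c4)
 have gen: "run m (if prim then PIf (V ''pr'') PSkip (''ok'' <-- Lit 0) else PSkip) s6 ''ok'' 0 =
   (if X & (prim --> E) then 1 else 0)" if "s6 ''pr'' 0 = (if E then 1 else 0)" "s6 ''ok'' 0 = (if X then 1 else 0)" for E X
  using that by (cases prim; cases X; cases E) (simp_all add: upd_apply)
 define s7 where "s7 = run m (if prim then PIf (V ''pr'') PSkip (''ok'' <-- Lit 0) else PSkip) s6"
 have ok7: "s7 ''ok'' 0 = (if success J v g W ?a then 1 else 0)"
  unfolding s7_def success_def by (rule gen[OF pr c6(1)])
 have fr7: "s7 x = s6 x" if "x ~= ''ok''" for x unfolding s7_def using that by (intro run_frame) (cases prim; simp)
 have r7: "rdy s7" unfolding s7_def using r6 by (cases prim) (simp_all add: read_only_def)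
 have u: "run m (try_c l prim) s = run m (PIf (V ''ok'') (''status'' <-- Lit 1 ;; apply_c) PSkip) s7"
  unfolding s7_def s6_def s5_def s4_def s3_def e2[symmetric] s1_def try_c_def by (simp only: run.simps(3))
 show ?thesis
 proof (cases "success J v g W ?a")
  case False
  then show ?thesis unfolding at u using ok7 st by (simp add: fr7 c6)
 next
  case True
  let ?s8 = "upd ''status'' 0 1 s7"
  have u': "run m (try_c l prim) s = run m apply_c ?s8" unfolding u using ok7 True by simp
  have r8: "rdy ?s8" using r7 by (simp add: read_only_def)
  have y8: "?s8 ''y'' (int i) = out J v g W ?a i" if "i < n" for i using y5[OF that] by (simp add: upd_simps fr7 c6)
  have "mt ?s8 ''U'' = mt s ''U''" by (simp add: mt_def fun_eq_iff upd_simps fr7 c6)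
  then have "ALL i<n. run m apply_c ?s8 ''x'' (int i) = app n (mt s ''U'') (out J v g W ?a) i mod m" using run_apply[OF r8 y8] by simp
  moreover have "run m apply_c ?s8 ''status'' 0 = 1" by (simp add: run_frame upd_simps)
  ultimately show ?thesis unfolding at u' using True by simp
 qed
qed

definition prepared :: "store => bool" where
 "prepared s \<longleftrightarrow> rdy s & totals s & s ''M'' 0 = m ^ (2 * n + 3) & s ''N1'' 0 = m * m ^ (2 * n + 3) & s ''G'' 0 = tot cl"

lemma run_attempt:
 assumes s: "prepared s" and G: "tot cl > 0" and st: "s ''status'' 0 = 0"
 defines "u == run m (attempt_c l prim) s" and "M == m ^ (2 * n + 3)"
 shows "result s u (one M (s ''Z'' 0 mod (m * M)))" "u ''Z'' 0 = s ''Z'' 0 div (m * M)"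
proof -
 let ?z = "s ''Z'' 0 mod (m * M)"
 have r: "rdy s" "totals s" "s ''M'' 0 = M" "s ''N1'' 0 = m * M" "s ''G'' 0 = tot cl" using s by (simp_all add: prepared_def M_def)
 define s1 where "s1 = upd ''R'' 0 (?z div m) (upd ''av'' 0 (?z mod m) (upd ''Z'' 0 (s ''Z'' 0 div (m * M)) (upd ''zz'' 0 ?z s)))"
 have e1: "run m (''zz'' <-- V ''Z'' mod. V ''N1'' ;; ''Z'' <-- V ''Z'' div. V ''N1'' ;;
   ''av'' <-- V ''zz'' mod. V ''m'' ;; ''R'' <-- V ''zz'' div. V ''m'') s = s1"
  unfolding s1_def by (simp add: upd_simps r(3-) bD[OF r(1)])
 have r1: "rdy s1" "s1 ''M'' 0 = M" "s1 ''G'' 0 = tot cl" "s1 ''R'' 0 = ?z div m" "s1 ''av'' 0 = ?z mod m" "s1 ''status'' 0 = 0" "mt s1 ''U'' = mt s ''U''"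
  "s1 ''Z'' 0 = s ''Z'' 0 div (m * M)"
  using r st by (simp_all add: s1_def read_only_def upd_simps)
 have t1: "totals s1" using r(2) by (simp add: totals_def s1_def upd_simps)
 have uu: "u = run m (PIf (V ''R'' <. (V ''M'' div. V ''G'') *. V ''G'') (''R'' <-- V ''R'' mod. V ''G'' ;; try_c l prim) PSkip) s1"
  unfolding u_def attempt_c_def e1[symmetric] by (simp only: run.simps(3))
 show "u ''Z'' 0 = s ''Z'' 0 div (m * M)" unfolding uu by (subst run_frame) (simp_all add: r1)
 show "result s u (one M ?z)"
 proof (cases "?z div m < M div tot cl * tot cl")
  case False
  then have "u = s1" unfolding uu by (simp add: r1)
  then show ?thesis using False r1 by (simp add: one_def)
 next
  case True
  let ?s2 = "upd ''R'' 0 (?z div m mod tot cl) s1"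
  have u2: "u = run m (try_c l prim) ?s2" unfolding uu using True by (simp add: r1)
  have r2: "rdy ?s2" "totals ?s2" using r1(1) t1 by (simp_all add: read_only_def totals_def upd_simps)
  have e: "?s2 ''R'' 0 = ?z div m mod tot cl" "?s2 ''av'' 0 = ?z mod m" "?s2 ''status'' 0 = 0" "mt ?s2 ''U'' = mt s ''U''"
   using r1 by (simp_all add: upd_simps)
  have o: "one M ?z = attempt (?s2 ''R'' 0) (?s2 ''av'' 0)" unfolding one_def e using True by (simp only: if_True)
  have R2: "0 <= ?s2 ''R'' 0" "?s2 ''R'' 0 < tot cl" unfolding e using G by simp_all
  show ?thesis unfolding u2 o using run_try[OF r2 R2 e(3)] unfolding e(4) .
 qed
qed

lemma run_sample:
 assumes s: "rdy s"
 defines "u == run m (sample_c l prim) s" and "M == m ^ (2 * n + 3)"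
 shows "if sols = {} then u ''status'' 0 = 2 else result s u (multi M 200 (s ''Z'' 0))"
proof -
 define s1 where "s1 = run m tau_c s"
 define s2 where "s2 = run m feas_c s1"
 define s3 where "s3 = run m (weights_c l prim) s2"
 define s4 where "s4 = run m range_c s3"
 define s5 where "s5 = upd ''status'' 0 0 s4"
 have r: "rdy s1" "rdy s2" "rdy s3" "rdy s4" "rdy s5"
  unfolding s1_def s2_def s3_def s4_def s5_def using s by (simp_all add: read_only_def)
 have f2: "flags s2"
  using run_feas[OF r(1)] run_tau[OF s] unfolding flags_def s2_def s1_def by metis
 have t3: "totals s3" unfolding s3_def by (rule run_weights[OF r(2) f2])
 have g: "s4 ''M'' 0 = M" "s4 ''N1'' 0 = m ^ (2 * n + 4)" "s4 ''G'' 0 = tot cl"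
  unfolding s4_def M_def by (rule run_range[OF r(3) t3])+
 have N: "m ^ (2 * n + 4) = m * M" unfolding M_def power_Suc[symmetric] by (rule arg_cong[where f = "%i. m ^ i"]) simp
 have e: "s4 ''pre'' = s3 ''pre''" by (simp add: s4_def run_frame)
 have eU: "s5 ''U'' = s ''U''" "s5 ''Z'' = s ''Z''" by (simp_all add: s5_def s4_def s3_def s2_def s1_def upd_simps run_frame)
 have p5: "prepared s5" using r(5) t3 g N by (simp add: prepared_def totals_def s5_def upd_simps e M_def)
 let ?b = "PIf (V ''status'') PSkip (attempt_c l prim)"
 have uu: "u = run m (PIf (V ''G'') (PFor ''at'' ''T'' ?b) (''status'' <-- Lit 2)) s5"
  unfolding u_def sample_c_def s5_def s4_def s3_def s2_def s1_def by (simp only: run.simps(2,3) eval.simps)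
 have G5: "s5 ''G'' 0 = tot cl" using p5 by (simp add: prepared_def)
 show ?thesis
 proof (cases "sols = {}")
  case True
  then have "tot cl = 0" using tot_pos_iff tot_nonneg[of cl] by linarith
  then show ?thesis using True unfolding uu by (simp add: G5 upd_simps)
 next
  case False
  then have G: "tot cl > 0" using tot_pos_iff by blast
  have mtU: "mt w ''U'' = mt s ''U''" if "w ''U'' = s5 ''U''" for w using that eU by (simp add: mt_def fun_eq_iff)
  \<comment> \<open>Either nothing has succeeded yet and the unread part of Z yields the same as all
    of it, or the output is fixed and later iterations skip. The term \<open>200 - 200\<close> is
    the invariant at j = 200.\<close>
  have "(%w. (w ''status'' 0 = 0 & multi M 200 (s ''Z'' 0) = multi M (200 - 200) (w ''Z'' 0)) |
    (EX y. multi M 200 (s ''Z'' 0) = Some y & result s w (Some y))) (run m (PFor ''at'' ''T'' ?b) s5)"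
  proof (rule rloop[where I = "%j w. (w ''status'' 0 = 0 & multi M 200 (s ''Z'' 0) = multi M (200 - j) (w ''Z'' 0)) |
    (EX y. multi M 200 (s ''Z'' 0) = Some y & result s w (Some y))", OF r(5)])
   show "s5 ''T'' 0 = int 200" using bD[OF r(5)] by simp
   show "wf (PFor ''at'' ''T'' ?b)" by (simp add: read_only_def)
   have "upd ''at'' 0 0 s5 ''status'' 0 = 0 & multi M 200 (s ''Z'' 0) = multi M (200 - 0) (upd ''at'' 0 0 s5 ''Z'' 0)"
    by (simp only: upd_apply eU(2) minus_nat.diff_0) (simp add: s5_def upd_simps)
   then show "(upd ''at'' 0 0 s5 ''status'' 0 = 0 & multi M 200 (s ''Z'' 0) = multi M (200 - 0) (upd ''at'' 0 0 s5 ''Z'' 0)) |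
    (EX y. multi M 200 (s ''Z'' 0) = Some y & result s (upd ''at'' 0 0 s5) (Some y))" by (rule disjI1)
   fix j w assume j: "j < 200" and rw: "rdy w" and fr: "!!x. x ~: mods ?b ==> x ~= ''at'' ==> w x = s5 x"
    and I: "(w ''status'' 0 = 0 & multi M 200 (s ''Z'' 0) = multi M (200 - j) (w ''Z'' 0)) |
    (EX y. multi M 200 (s ''Z'' 0) = Some y & result s w (Some y))"
   have pw: "prepared w" using p5 rw fr[of "''pre''"] fr[of "''M''"] fr[of "''N1''"] fr[of "''G''"]
    by (simp add: prepared_def totals_def)
   have mw: "mt w ''U'' = mt s ''U''" using fr[of "''U''"] by (intro mtU) simp
   define w' where "w' = run m ?b w"
   have "(w' ''status'' 0 = 0 & multi M 200 (s ''Z'' 0) = multi M (200 - Suc j) (w' ''Z'' 0)) |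
    (EX y. multi M 200 (s ''Z'' 0) = Some y & result s w' (Some y))"
   proof (cases "w ''status'' 0 = 0")
    case False
    then have "w' = w" by (simp add: w'_def)
    then show ?thesis using I False by simp
   next
    case True
    then have mu: "multi M 200 (s ''Z'' 0) = multi M (Suc (200 - Suc j)) (w ''Z'' 0)"
    proof -
     have "200 - j = Suc (200 - Suc j)" using j by arith
     then show ?thesis using I True by (auto simp del: multi.simps)
    qed
    have we: "w' = run m (attempt_c l prim) w" using True by (simp add: w'_def)
    note A = run_attempt[OF pw G True, folded M_def we]
    show ?thesis
    proof (cases "one M (w ''Z'' 0 mod (m * M))")
     case None
     then have "multi M 200 (s ''Z'' 0) = multi M (200 - Suc j) (w' ''Z'' 0)" unfolding mu A(2) by simp
     then show ?thesis using A(1) None by simp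
    next
     case (Some y)
     then have "multi M 200 (s ''Z'' 0) = Some y" unfolding mu by simp
     then show ?thesis using A(1) Some mw by simp
    qed
   qed
   then show "(upd ''at'' 0 (int j + 1) (run m ?b w) ''status'' 0 = 0 &
     multi M 200 (s ''Z'' 0) = multi M (200 - Suc j) (upd ''at'' 0 (int j + 1) (run m ?b w) ''Z'' 0)) |
    (EX y. multi M 200 (s ''Z'' 0) = Some y & result s (upd ''at'' 0 (int j + 1) (run m ?b w)) (Some y))"
    unfolding w'_def[symmetric] by (simp only: upd_apply) simp
  qed simp
  moreover have "u = run m (PFor ''at'' ''T'' ?b) s5" unfolding uu using G G5 by simp
  ultimately show ?thesis using False by auto
 qed
qed

end

section \<open>Drawing one uniform integer digit by digit, and preparing the loop bounds\<close>

definition drawn :: "int => nat => state => nat => (int => state) => bool" where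
 "drawn m bt sg r f \<longleftrightarrow> (\<forall>w\<in>{0..<m ^ r}.
  mem (f w) ''Z'' 0 = mem sg ''Z'' 0 * m ^ r + w & mem (f w) ''BIG'' = (mem sg ''BIG'')(0 := mem sg ''BIG'' 0 * m ^ r) & bounded bt (mem (f w)) &
  (ALL a. a ~: {''tmp'', ''Z'', ''BIG'', ''cnt''} --> mem (f w) a = mem sg a) &
  time (f w) <= time sg + (3 + 40 * r) & bits (f w) <= bits sg + (3 + 40 * r) * (200 * bt))"

context
 fixes m :: int and bt :: nat
 assumes m: "0 < m" "m <= 2 ^ bt" and bt: "4 <= bt"
begin

lemma exec_to_Assign_BIG:
 assumes s: "bounded bt (mem sg)" and v: "0 < Defs.eval m (mem sg) e" "Defs.eval m (mem sg) e <= 2 ^ bt"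
  and e: "small_lits e" "1 + ops e <= 150"
 shows "exec_to m bt (Assign ''BIG'' (Lit 0) e) (ops e + 2) sg (upd ''BIG'' 0 (Defs.eval m (mem sg) e) (mem sg))"
 using bit_cost_150[OF m bt s, of "Lit 0"] bit_cost_150[OF m bt s e(1)] e(2) s v bt
 by (auto simp: exec_to_def algebra_simps bounded_def upd_simps)

lemma exec_to_While_done:
 assumes "bounded bt (mem sg)" "Defs.eval m (mem sg) e = 0" "small_lits e" "ops e <= 150"
 shows "exec_to m bt (While e b) (ops e + 1) sg (mem sg)"
 using bit_cost_150[OF m bt assms(1,3,4)] assms(1,2) bt
 by (simp add: exec_to_def while_loop_unfold)

lemma exec_to_While_step:
 assumes s: "bounded bt (mem sg)" and e: "Defs.eval m (mem sg) e ~= 0" "small_lits e" "ops e <= 150"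
  and b: "!!sg. mem sg = s0 ==> exec_to m bt b T1 sg s'" and s0: "mem sg = s0"
  and w: "!!sg. mem sg = s' ==> exec_to m bt (While e b) T2 sg s''"
 shows "exec_to m bt (While e b) (ops e + 1 + T1 + T2) sg s''"
proof -
 have mc: "mem (charge_test m e sg) = s0" using s0 by simp
 obtain sg1 where 1: "exec m b (charge_test m e sg) = return_spmf sg1" "mem sg1 = s'"
   "time sg1 <= time (charge_test m e sg) + T1" "bits sg1 <= bits (charge_test m e sg) + T1 * (200 * bt)"
  using b[OF mc] by (auto simp: exec_to_def)
 obtain sg2 where 2: "exec m (While e b) sg1 = return_spmf sg2" "mem sg2 = s''" "bounded bt s''"
   "time sg2 <= time sg1 + T2" "bits sg2 <= bits sg1 + T2 * (200 * bt)"
  using w[OF 1(2)] by (auto simp: exec_to_def)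
 have "exec m (While e b) sg = return_spmf sg2"
  using e(1) 1(1) 2(1) by (simp add: while_loop_unfold[of _ _ _ sg])
 moreover have "time sg2 <= time sg + (ops e + 1 + T1 + T2)" using 1(3) 2(4) by simp
 moreover have "bits sg2 <= bits sg + (ops e + 1 + T1 + T2) * (200 * bt)"
  using 1(4) 2(5) bit_cost_150[OF m bt s e(2,3)] bt by (simp add: algebra_simps)
 ultimately show ?thesis using 2 unfolding exec_to_def by blast
qed

definition halve_c :: com where
 "halve_c = Seq (Assign ''tmp'' (Lit 0) (Op Div (V ''tmp'') (Lit 2))) (Assign ''lg'' (Lit 0) (Op Add (V ''lg'') (Lit 1)))"

text \<open>Finds the bit length of p. The bound \<open>x < 2 ^ L\<close> gives the powering loops
  enough iterations, and \<open>2 ^ L <= 2 * x\<close> keeps L within 1 + log p. An unrestricted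
  \<open>While\<close> is used, as no cell holds the number of iterations beforehand.\<close>

lemma exec_halve_loop:
 assumes "bounded bt s" "s ''tmp'' 0 = int x" "0 <= s ''lg'' 0" "s ''lg'' 0 + 2 * int x <= 2 ^ bt"
 shows "EX L s'. x < 2 ^ L & (x = 0 --> L = 0) & (x > 0 --> 2 ^ L <= 2 * x) & s' ''lg'' 0 = s ''lg'' 0 + int L &
  (ALL a. a ~= ''tmp'' --> a ~= ''lg'' --> s' a = s a) &
  (ALL sg. mem sg = s --> exec_to m bt (While (V ''tmp'') halve_c) (3 + 20 * L) sg s')"
 using assms
proof (induction x arbitrary: s rule: less_induct)
 case (less x)
 show ?case
 proof (cases "x = 0")
  case True
  show ?thesis
  proof (intro exI[of _ 0] exI[of _ s] conjI allI impI)
   fix sg :: state assume "mem sg = s"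
   then show "exec_to m bt (While (V ''tmp'') halve_c) (3 + 20 * 0) sg s"
    using exec_to_While_done[of sg "V ''tmp''" halve_c] less.prems True by (simp add: numeral_eq_Suc)
  qed (use True in simp_all)
 next
  case False
  define s1 where "s1 = upd ''lg'' 0 (s ''lg'' 0 + 1) (upd ''tmp'' 0 (int (x div 2)) s)"
  have body: "exec_to m bt halve_c 12 sg s1" if "mem sg = s" for sg :: state
  proof -
   have 1: "exec_to m bt (Assign ''tmp'' (Lit 0) (Op Div (V ''tmp'') (Lit 2))) 6 sg (upd ''tmp'' 0 (int (x div 2)) s)"
   proof -
    have "int x div 2 <= 2 ^ bt" using less.prems by linarith
    then show ?thesis
     using exec_to_Assign[OF m bt, of sg "Op Div (V ''tmp'') (Lit 2)" "''tmp''" "Lit 0"] that less.prems by (simp add: zdiv_int numeral_eq_Suc)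
   qed
   have 2: "exec_to m bt (Assign ''lg'' (Lit 0) (Op Add (V ''lg'') (Lit 1))) 6 sg' s1" if "mem sg' = upd ''tmp'' 0 (int (x div 2)) s" for sg'
   proof -
    have b: "bounded bt (upd ''tmp'' 0 (int (x div 2)) s)" using 1 by (auto simp: exec_to_def)
    have "s ''lg'' 0 + 1 <= 2 ^ bt" using less.prems False by linarith
    then show ?thesis unfolding s1_def
     using exec_to_Assign[OF m bt, of sg' "Op Add (V ''lg'') (Lit 1)" "''lg''" "Lit 0"] that b less.prems by (simp add: upd_simps numeral_eq_Suc)
   qed
   have "exec_to m bt halve_c (6 + 6) sg s1" unfolding halve_c_def by (rule exec_to_Seq[OF 1 2])
   then show ?thesis by simp
  qed
  have b1: "bounded bt s1" using body[of "start s"] by (auto simp: exec_to_def start_def)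
  have l1: "s1 ''tmp'' 0 = int (x div 2)" "s1 ''lg'' 0 = s ''lg'' 0 + 1" by (simp_all add: s1_def upd_simps)
  have "s ''lg'' 0 + 1 + 2 * int (x div 2) <= 2 ^ bt"
  proof -
   have "2 * (x div 2) <= x" by simp
   then have "2 * int (x div 2) <= int x" by linarith
   then show ?thesis using less.prems(4) False by linarith
  qed
  then have "EX L s'. x div 2 < 2 ^ L & (x div 2 = 0 --> L = 0) & (x div 2 > 0 --> 2 ^ L <= 2 * (x div 2)) & s' ''lg'' 0 = s1 ''lg'' 0 + int L &
   (ALL a. a ~= ''tmp'' --> a ~= ''lg'' --> s' a = s1 a) &
   (ALL sg. mem sg = s1 --> exec_to m bt (While (V ''tmp'') halve_c) (3 + 20 * L) sg s')"
   using False less.prems(3) by (intro less.IH b1) (simp_all add: l1)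
  then obtain L s' where A: "x div 2 < 2 ^ L & (x div 2 = 0 --> L = 0) & (x div 2 > 0 --> 2 ^ L <= 2 * (x div 2)) & s' ''lg'' 0 = s1 ''lg'' 0 + int L &
   (ALL a. a ~= ''tmp'' --> a ~= ''lg'' --> s' a = s1 a) &
   (ALL sg. mem sg = s1 --> exec_to m bt (While (V ''tmp'') halve_c) (3 + 20 * L) sg s')" by (elim exE)
  note A2 = A[THEN conjunct2] note A3 = A2[THEN conjunct2] note A4 = A3[THEN conjunct2] note A5 = A4[THEN conjunct2]
  note L = A[THEN conjunct1] A2[THEN conjunct1] A3[THEN conjunct1]
  note s'1 = A4[THEN conjunct1] and s'2 = A5[THEN conjunct1] and ex' = A5[THEN conjunct2]
  note ex = ex'[rule_format] and s' = s'1 s'2[rule_format]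
  show ?thesis
  proof (intro exI[of _ "Suc L"] exI[of _ s'] conjI allI impI)
   show "x < 2 ^ Suc L" using L(1) by simp
   show "2 ^ Suc L <= 2 * x"
   proof (cases "x div 2 = 0")
    case True
    then show ?thesis using L(2) False by simp
   next
    case False
    then have "2 ^ L <= 2 * (x div 2)" using L(3) by simp
    also have "... <= x" by simp
    finally show ?thesis by simp
   qed
   show "s' ''lg'' 0 = s ''lg'' 0 + int (Suc L)" using s'(1) l1 by simp
   show "s' a = s a" if "a ~= ''tmp''" "a ~= ''lg''" for a using s'(2)[OF that] that by (simp add: s1_def upd_simps)
   fix sg :: state assume s: "mem sg = s"
   have "exec_to m bt (While (V ''tmp'') halve_c) (ops (V ''tmp'') + 1 + 12 + (3 + 20 * L)) sg s'"
    by (rule exec_to_While_step[where s' = s1, OF _ _ _ _ body s ex]) (use less.prems False s in simp_all)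
   then show "exec_to m bt (While (V ''tmp'') halve_c) (3 + 20 * Suc L) sg s'" by (rule exec_to_mono) simp
  qed (use False in simp)
 qed
qed

lemma bounded_upd: "bounded bt s ==> \<bar>v\<bar> <= 2 ^ bt ==> a ~= ''BIG'' ==> bounded bt (upd a i v s)"
 by (simp add: bounded_def upd_simps)

lemma exec_assign:
 assumes "bounded bt s" "Defs.eval m s e = v" "\<bar>v\<bar> <= 2 ^ bt" "a ~= ''BIG''" "small_lits e" "ops e <= 100" "mem sg = s"
 shows "exec_to m bt (Assign a (Lit 0) e) (ops e + 2) sg (upd a 0 v s)"
 using exec_to_Assign[OF m bt, of sg e a "Lit 0"] assms by simp

text \<open>\<open>BIG\<close> is multiplied along with Z, which keeps Z < \<open>BIG\<close>. After
  the last draw it equals m^K, large enough to serve as the cap of all later assignments.\<close>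

definition accumulate_c :: com where
 "accumulate_c = Seq (Assign ''Z'' (Lit 0) (Op Add (Op Mul (V ''Z'') (V ''m'')) (V ''tmp'')))
   (Seq (Assign ''BIG'' (Lit 0) (Op Mul (V ''BIG'') (V ''m''))) (Assign ''cnt'' (Lit 0) (Op Sub (V ''cnt'') (Lit 1))))"

definition draw_c :: com where
 "draw_c = While (V ''cnt'') (Seq (Sample ''tmp'' (Lit 0)) accumulate_c)"

lemma spmf_of_set_product:
 fixes A B :: int
 assumes A: "A > 0" and B: "B > 0"
 shows "bind_spmf (spmf_of_set {0..<A}) (%v. map_spmf (F v) (spmf_of_set {0..<B})) =
  map_spmf (%w. F (w div B) (w mod B)) (spmf_of_set {0..<A * B})"
proof -
 let ?g = "%w. (w div B, w mod B)"
 have inj: "inj_on ?g {0..<A * B}"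
  by (rule inj_onI) (metis div_mult_mod_eq prod.inject)
 have img: "?g ` {0..<A * B} = {0..<A} \<times> {0..<B}"
 proof (intro equalityI subsetI)
  fix z assume "z \<in> ?g ` {0..<A * B}"
  then obtain w where w: "z = ?g w" "0 <= w" "w < A * B" by auto
  have "w div B * B <= w" using div_mult_mod_eq[of w B] pos_mod_sign[OF B, of w] by linarith
  then have "w div B * B < A * B" using w by simp
  then have "w div B < A" using B by (simp only: mult_less_cancel_right_pos)
  then show "z \<in> {0..<A} \<times> {0..<B}" using w B by (simp add: pos_imp_zdiv_nonneg_iff)
 next
  fix z assume "z \<in> {0..<A} \<times> {0..<B}"
  then obtain x y where z: "z = (x, y)" "0 <= x" "x < A" "0 <= y" "y < B" by auto
  have "(x + 1) * B <= A * B" using z B by (intro mult_right_mono) auto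
  then have "x * B + y < A * B" using z by (simp add: algebra_simps)
  moreover have "(x * B + y) div B = x" "(x * B + y) mod B = y" using z by (simp_all add: div_pos_pos_trivial mod_pos_pos_trivial)
  ultimately show "z \<in> ?g ` {0..<A * B}" using z B by (intro image_eqI[of _ _ "x * B + y"]) simp_all
 qed
 have "pair_spmf (spmf_of_set {0..<A}) (spmf_of_set {0..<B}) = spmf_of_set ({0..<A} \<times> {0..<B})"
 proof (rule spmf_eqI)
  fix z :: "int \<times> int"
  show "spmf (pair_spmf (spmf_of_set {0..<A}) (spmf_of_set {0..<B})) z = spmf (spmf_of_set ({0..<A} \<times> {0..<B})) z"
   by (cases z) (simp add: spmf_of_set indicator_def)
 qed
 also have "... = map_spmf ?g (spmf_of_set {0..<A * B})" unfolding map_spmf_of_set_inj_on[OF inj] img ..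
 finally have p: "pair_spmf (spmf_of_set {0..<A}) (spmf_of_set {0..<B}) = map_spmf ?g (spmf_of_set {0..<A * B})" .
 have "bind_spmf (spmf_of_set {0..<A}) (%v. map_spmf (F v) (spmf_of_set {0..<B})) =
   map_spmf (%(x, y). F x y) (pair_spmf (spmf_of_set {0..<A}) (spmf_of_set {0..<B}))"
  by (simp add: pair_spmf_alt_def map_spmf_conv_bind_spmf)
 then show ?thesis unfolding p by (simp add: spmf.map_comp o_def)
qed

text \<open>The value sampled first becomes the leading digit w div m^r, and the remaining draws
  account for w mod m^r. Nested sampling thus collapses into one uniform w.\<close>

lemma exec_draw:
 assumes "bounded bt (mem sg)" "mem sg ''cnt'' 0 = int r" "mem sg ''m'' 0 = m" "0 <= mem sg ''Z'' 0" "mem sg ''Z'' 0 < mem sg ''BIG'' 0"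
  "mem sg ''BIG'' 0 * m ^ r <= 2 ^ bt" "int r <= 2 ^ bt"
 shows "EX f. exec m draw_c sg = map_spmf f (spmf_of_set {0..<m ^ r}) & drawn m bt sg r f"
 using assms
proof (induction r arbitrary: sg)
 case 0
 obtain sg' where s: "exec m draw_c sg = return_spmf sg'" "mem sg' = mem sg" "time sg' <= time sg + 3" "bits sg' <= bits sg + 3 * (200 * bt)"
  using exec_to_While_done[of sg "V ''cnt''" "Seq (Sample ''tmp'' (Lit 0)) accumulate_c"] 0
  by (auto simp: exec_to_def draw_c_def numeral_eq_Suc)
 have e: "{0..<m ^ 0} = {0}" by auto
 have "spmf_of_set {0::int} = return_spmf 0" by (simp add: spmf_of_set_def pmf_of_set_singleton)
 then show ?case unfolding e using s 0 by (intro exI[of _ "%_. sg'"]) (simp add: drawn_def)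
next
 case (Suc r)
 let ?s = "mem sg"
 define S where "S = (%v. charge (ops (Lit 0) + 1) (bit_cost m ?s (Lit 0) + bit_size m) (set_cell ''tmp'' 0 v (charge_test m (V ''cnt'') sg)))"
 define s1 where "s1 = (%v. upd ''cnt'' 0 (int r) (upd ''BIG'' 0 (?s ''BIG'' 0 * m) (upd ''Z'' 0 (?s ''Z'' 0 * m + v) (upd ''tmp'' 0 v ?s))))"
 have mr: "m ^ r \<ge> 1" using m by (simp add: one_le_power int_one_le_iff_zero_less)
 have B0: "?s ''BIG'' 0 > 0" using Suc.prems(1) by (simp add: bounded_def)
 have Bm: "?s ''BIG'' 0 * m <= 2 ^ bt"
 proof -
  have "?s ''BIG'' 0 * m * 1 <= ?s ''BIG'' 0 * m * m ^ r" using mr B0 m by (intro mult_left_mono) simp_all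
  then show ?thesis using Suc.prems(6) by (simp add: mult.assoc)
 qed
 have step: "exec_to m bt accumulate_c 25 (S v) (s1 v)" if v: "0 <= v" "v < m" for v
 proof -
  let ?t0 = "upd ''tmp'' 0 v ?s"
  let ?t1 = "upd ''Z'' 0 (?s ''Z'' 0 * m + v) ?t0"
  let ?t2 = "upd ''BIG'' 0 (?s ''BIG'' 0 * m) ?t1"
  have b0: "bounded bt ?t0" using Suc.prems(1) v m by (intro bounded_upd) simp_all
  have Zb: "\<bar>?s ''Z'' 0 * m + v\<bar> <= 2 ^ bt"
  proof -
   have "(?s ''Z'' 0 + 1) * m <= ?s ''BIG'' 0 * m" using Suc.prems(5) m by (intro mult_right_mono) simp_all
   then have "?s ''Z'' 0 * m + v <= 2 ^ bt" using v Bm by (simp add: algebra_simps)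
   moreover have "0 <= ?s ''Z'' 0 * m" using Suc.prems(4) m by simp
   ultimately show ?thesis using v by simp
  qed
  have b1: "bounded bt ?t1" by (rule bounded_upd[OF b0 Zb]) simp
  have "exec_to m bt (Assign ''Z'' (Lit 0) (Op Add (Op Mul (V ''Z'') (V ''m'')) (V ''tmp''))) (ops (Op Add (Op Mul (V ''Z'') (V ''m'')) (V ''tmp'')) + 2) (S v) ?t1"
   by (rule exec_assign[OF b0 _ Zb]) (simp_all add: S_def upd_simps Suc.prems)
  moreover have "exec_to m bt (Assign ''BIG'' (Lit 0) (Op Mul (V ''BIG'') (V ''m''))) (ops (Op Mul (V ''BIG'') (V ''m'')) + 2) sg' ?t2" if "mem sg' = ?t1" for sg'
   using exec_to_Assign_BIG[of sg' "Op Mul (V ''BIG'') (V ''m'')"] that b1 B0 m Bm by (simp add: upd_simps Suc.prems)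
  moreover have "exec_to m bt (Assign ''cnt'' (Lit 0) (Op Sub (V ''cnt'') (Lit 1))) (ops (Op Sub (V ''cnt'') (Lit 1)) + 2) sg' (s1 v)" if "mem sg' = ?t2" for sg'
  proof -
   have "bounded bt ?t2" using b1 B0 m Bm by (simp add: bounded_def upd_simps)
   moreover have "int r <= 2 ^ bt" using Suc.prems(7) by linarith
   ultimately show ?thesis unfolding s1_def using Suc.prems(2) that by (intro exec_assign) (simp_all add: upd_simps)
  qed
  ultimately have "exec_to m bt accumulate_c (ops (Op Add (Op Mul (V ''Z'') (V ''m'')) (V ''tmp'')) + 2 + (ops (Op Mul (V ''BIG'') (V ''m'')) + 2 + (ops (Op Sub (V ''cnt'') (Lit 1)) + 2))) (S v) (s1 v)"
   unfolding accumulate_c_def by (intro exec_to_Seq)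
  then show ?thesis by (rule exec_to_mono) simp
 qed
 define Q where "Q = (%v f. bind_spmf (exec m accumulate_c (S v)) (exec m draw_c) = map_spmf f (spmf_of_set {0..<m ^ r}) & (\<forall>w\<in>{0..<m ^ r}.
  mem (f w) ''Z'' 0 = (?s ''Z'' 0 * m + v) * m ^ r + w & mem (f w) ''BIG'' = (?s ''BIG'')(0 := ?s ''BIG'' 0 * m * m ^ r) & bounded bt (mem (f w)) &
  (ALL a. a ~: {''tmp'', ''Z'', ''BIG'', ''cnt''} --> mem (f w) a = ?s a) &
  time (f w) <= time sg + (3 + 40 * Suc r) & bits (f w) <= bits sg + (3 + 40 * Suc r) * (200 * bt)))"
 have ex: "\<forall>v\<in>{0..<m}. EX f. Q v f"
 proof
  fix v assume v: "v \<in> {0..<m}"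
  obtain sg1 where s1: "exec m accumulate_c (S v) = return_spmf sg1" "mem sg1 = s1 v" "bounded bt (s1 v)"
   "time sg1 <= time (S v) + 25" "bits sg1 <= bits (S v) + 25 * (200 * bt)"
   using step v by (auto simp: exec_to_def)
  have tS: "time (S v) = time sg + 5" "bits (S v) <= bits sg + 5 * (200 * bt)"
  proof -
   have "bit_size m <= bt + 2" using m by (intro bit_size_le) simp
   moreover have "bit_cost m ?s (V ''cnt'') <= 2 * (200 * bt)" using bit_cost_150[OF m bt Suc.prems(1), of "V ''cnt''"] by (simp add: numeral_eq_Suc)
   moreover have "bit_cost m ?s (Lit 0) <= 200 * bt" using bit_cost_150[OF m bt Suc.prems(1), of "Lit 0"] by simp
   ultimately show "bits (S v) <= bits sg + 5 * (200 * bt)" using bt by (simp add: S_def)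
   show "time (S v) = time sg + 5" by (simp add: S_def)
  qed
  have c: "s1 v ''cnt'' 0 = int r" "s1 v ''m'' 0 = m" "s1 v ''Z'' 0 = ?s ''Z'' 0 * m + v" "s1 v ''BIG'' 0 = ?s ''BIG'' 0 * m"
   using Suc.prems(3) by (simp_all add: s1_def upd_simps)
  have "(?s ''Z'' 0 + 1) * m <= ?s ''BIG'' 0 * m" using Suc.prems(5) m by (intro mult_right_mono) simp_all
  then have Zl: "?s ''Z'' 0 * m + v < ?s ''BIG'' 0 * m" using v by (simp add: algebra_simps)
  have "EX f. exec m draw_c sg1 = map_spmf f (spmf_of_set {0..<m ^ r}) & drawn m bt sg1 r f"
  proof (rule Suc.IH)
   show "bounded bt (mem sg1)" "mem sg1 ''cnt'' 0 = int r" "mem sg1 ''m'' 0 = m" using s1(2,3) c by simp_all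
   show "0 <= mem sg1 ''Z'' 0" using v m Suc.prems(4) by (simp add: s1(2) c)
   show "mem sg1 ''Z'' 0 < mem sg1 ''BIG'' 0" using Zl by (simp add: s1(2) c)
   show "mem sg1 ''BIG'' 0 * m ^ r <= 2 ^ bt" using Suc.prems(6) by (simp add: s1(2) c mult.assoc)
   show "int r <= 2 ^ bt" using Suc.prems(7) by linarith
  qed
  then obtain f where f: "exec m draw_c sg1 = map_spmf f (spmf_of_set {0..<m ^ r})" "drawn m bt sg1 r f"
   by (elim exE conjE)
  have fr: "s1 v a = ?s a" if "a ~: {''tmp'', ''Z'', ''BIG'', ''cnt''}" for a using that by (simp add: s1_def upd_simps)
  have tt: "time (f w) <= time sg + (3 + 40 * Suc r)" "bits (f w) <= bits sg + (3 + 40 * Suc r) * (200 * bt)" if "w \<in> {0..<m ^ r}" for w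
  proof -
   have "time (f w) <= time sg1 + (3 + 40 * r)" "bits (f w) <= bits sg1 + (3 + 40 * r) * (200 * bt)" using f(2)[unfolded drawn_def] that by blast+
   then show "time (f w) <= time sg + (3 + 40 * Suc r)" "bits (f w) <= bits sg + (3 + 40 * Suc r) * (200 * bt)"
    using s1(4,5) tS by (simp_all add: algebra_simps)
  qed
  show "EX f. Q v f" unfolding Q_def
  proof (intro exI[of _ f] conjI ballI)
   show "bind_spmf (exec m accumulate_c (S v)) (exec m draw_c) = map_spmf f (spmf_of_set {0..<m ^ r})" unfolding s1(1) by (simp add: f(1))
   fix w assume w: "w \<in> {0..<m ^ r}"
   note fw = f(2)[unfolded drawn_def, rule_format, OF w, unfolded s1(2) c]
   show "mem (f w) ''Z'' 0 = (?s ''Z'' 0 * m + v) * m ^ r + w" by (rule fw[THEN conjunct1])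
   have "s1 v ''BIG'' = (?s ''BIG'')(0 := ?s ''BIG'' 0 * m)" by (simp add: s1_def upd_def)
   then show "mem (f w) ''BIG'' = (?s ''BIG'')(0 := ?s ''BIG'' 0 * m * m ^ r)" using fw[THEN conjunct2, THEN conjunct1] by simp
   show "bounded bt (mem (f w))" by (rule fw[THEN conjunct2, THEN conjunct2, THEN conjunct1])
   show "ALL a. a ~: {''tmp'', ''Z'', ''BIG'', ''cnt''} --> mem (f w) a = ?s a"
   proof (intro allI impI)
    fix a assume a: "a ~: {''tmp'', ''Z'', ''BIG'', ''cnt''}"
    have "mem (f w) a = s1 v a" by (rule fw[THEN conjunct2, THEN conjunct2, THEN conjunct2, THEN conjunct1, rule_format, OF a])
    then show "mem (f w) a = ?s a" using fr[OF a] by (rule trans)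
   qed
   show "time (f w) <= time sg + (3 + 40 * Suc r)" "bits (f w) <= bits sg + (3 + 40 * Suc r) * (200 * bt)" by (rule tt[OF w])+
  qed
 qed
 obtain F where FQ: "\<forall>v\<in>{0..<m}. Q v (F v)" using bchoice[OF ex] by (rule exE)
 have F: "bind_spmf (exec m accumulate_c (S v)) (exec m draw_c) = map_spmf (F v) (spmf_of_set {0..<m ^ r})" if "v \<in> {0..<m}" for v
  using FQ[rule_format, OF that] unfolding Q_def by (rule conjunct1)
 have F2: "mem (F v w) ''Z'' 0 = (?s ''Z'' 0 * m + v) * m ^ r + w & mem (F v w) ''BIG'' = (?s ''BIG'')(0 := ?s ''BIG'' 0 * m * m ^ r) & bounded bt (mem (F v w)) &
   (ALL a. a ~: {''tmp'', ''Z'', ''BIG'', ''cnt''} --> mem (F v w) a = ?s a) &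
   time (F v w) <= time sg + (3 + 40 * Suc r) & bits (F v w) <= bits sg + (3 + 40 * Suc r) * (200 * bt)"
  if "v \<in> {0..<m}" "w \<in> {0..<m ^ r}" for v w
  using conjunct2[OF FQ[rule_format, OF that(1), unfolded Q_def]] that(2) by (rule bspec)
 have nz: "Defs.eval m ?s (V ''cnt'') ~= 0" using Suc.prems(2) by simp
 have ed: "exec m draw_c = while_loop m (V ''cnt'') (exec m (Seq (Sample ''tmp'' (Lit 0)) accumulate_c))"
  by (simp add: draw_c_def fun_eq_iff)
 have "exec m draw_c sg = bind_spmf (spmf_of_set {0..<m}) (%v. bind_spmf (exec m accumulate_c (S v)) (exec m draw_c))"
  unfolding ed using nz by (subst while_loop_unfold) (simp add: map_spmf_conv_bind_spmf S_def)
 also have "... = bind_spmf (spmf_of_set {0..<m}) (%v. map_spmf (F v) (spmf_of_set {0..<m ^ r}))"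
  using F by (intro bind_spmf_cong refl) simp
 also have "... = map_spmf (%w. F (w div m ^ r) (w mod m ^ r)) (spmf_of_set {0..<m * m ^ r})"
  using m mr by (intro spmf_of_set_product) simp_all
 finally have E: "exec m draw_c sg = map_spmf (%w. F (w div m ^ r) (w mod m ^ r)) (spmf_of_set {0..<m ^ Suc r})" by simp
 show ?case unfolding drawn_def
 proof (intro exI[of _ "%w. F (w div m ^ r) (w mod m ^ r)"] conjI E ballI)
  fix w assume w: "w \<in> {0..<m ^ Suc r}"
  have m0: "m ^ r > 0" using mr by linarith
  have "w div m ^ r * m ^ r <= w" using div_mult_mod_eq[of w "m ^ r"] pos_mod_sign[OF m0, of w] by linarith
  then have "w div m ^ r * m ^ r < m * m ^ r" using w by simp
  then have "w div m ^ r < m" using m0 by (simp only: mult_less_cancel_right_pos)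
  then have v: "w div m ^ r \<in> {0..<m}" using w m0 by (simp add: pos_imp_zdiv_nonneg_iff)
  have w': "w mod m ^ r \<in> {0..<m ^ r}" using m0 by simp
  note R = F2[OF v w']
  have "(?s ''Z'' 0 * m + w div m ^ r) * m ^ r + w mod m ^ r = ?s ''Z'' 0 * m ^ Suc r + w"
   using div_mult_mod_eq[of w "m ^ r"] by (simp add: algebra_simps)
  then show "mem (F (w div m ^ r) (w mod m ^ r)) ''Z'' 0 = ?s ''Z'' 0 * m ^ Suc r + w" using R by simp
  have "?s ''BIG'' 0 * m * m ^ r = ?s ''BIG'' 0 * m ^ Suc r" by simp
  then show "mem (F (w div m ^ r) (w mod m ^ r)) ''BIG'' = (?s ''BIG'')(0 := ?s ''BIG'' 0 * m ^ Suc r)" using R by (simp only:)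
  show "bounded bt (mem (F (w div m ^ r) (w mod m ^ r)))" using R by blast
  show "ALL a. a ~: {''tmp'', ''Z'', ''BIG'', ''cnt''} --> mem (F (w div m ^ r) (w mod m ^ r)) a = ?s a" using R by blast
  show "time (F (w div m ^ r) (w mod m ^ r)) <= time sg + (3 + 40 * Suc r)" using R by blast
  show "bits (F (w div m ^ r) (w mod m ^ r)) <= bits sg + (3 + 40 * Suc r) * (200 * bt)" using R by blast
 qed
qed

end

text \<open>The modulus is not an input cell; it is recovered through the ring addition as (-1 mod
  m) + 1. The number 200 is written as 5 * 5 * 8, because literals are limited to 9.\<close>

definition prepare_c :: com where
 "prepare_c = Seq (Assign ''BIG'' (Lit 0) (Lit 1)) (Seq (Assign ''tmp'' (Lit 0) (V ''p'')) (Seq (While (V ''tmp'') halve_c)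
   (Seq (Assign ''m'' (Lit 0) (Op Add (Op RAdd (Lit 0) (Op Sub (Lit 0) (Lit 1))) (Lit 1)))
   (Seq (Assign ''nk'' (Lit 0) (Op Add (V ''n'') (V ''k'')))
   (Seq (Assign ''cl'' (Lit 0) (Op Mul (Op Add (V ''n'') (Lit 1)) (V ''k'')))
   (Seq (Assign ''l1'' (Lit 0) (Op Add (Op Mul (Lit 2) (V ''n'')) (Lit 3)))
   (Seq (Assign ''T'' (Lit 0) (Op Mul (Op Mul (Lit 5) (Lit 5)) (Lit 8)))
    (Assign ''cnt'' (Lit 0) (Op Mul (V ''T'') (Op Add (V ''l1'') (Lit 1)))))))))))"

context
 fixes m :: int and bt :: nat
 assumes m: "0 < m" "m <= 2 ^ bt" and bt: "4 <= bt"
begin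

lemma exec_prepare:
 assumes s: "!!a i. \<bar>s a i\<bar> <= 2 ^ bt" "s ''n'' 0 = int n" "s ''k'' 0 = int k" "s ''p'' 0 = int p" "s ''lg'' 0 = 0" "p > 0"
  and b: "2 * int p <= 2 ^ bt" "int (400 * (n + 2) * (k + 1)) <= 2 ^ bt"
 shows "EX L s'. p < 2 ^ L & 2 ^ L <= 2 * p & exec_to m bt prepare_c (200 + 20 * L) (start s) s' & s' ''lg'' 0 = int L & s' ''m'' 0 = m &
  s' ''nk'' 0 = int (n + k) & s' ''cl'' 0 = int ((n + 1) * k) & s' ''l1'' 0 = int (2 * n + 3) & s' ''T'' 0 = 200 &
  s' ''cnt'' 0 = int (400 * (n + 2)) & s' ''BIG'' 0 = 1 &
  (ALL a. a ~: {''BIG'', ''tmp'', ''lg'', ''m'', ''nk'', ''cl'', ''l1'', ''T'', ''cnt''} --> s' a = s a)"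
proof -
 note EA = exec_assign[OF m bt]
 note BU = bounded_upd[OF m bt]
 have n: "int (n + k) <= 2 ^ bt" "int ((n + 1) * k) <= 2 ^ bt" "int (2 * n + 3) <= 2 ^ bt" "(200::int) <= 2 ^ bt" "int (400 * (n + 2)) <= 2 ^ bt"
 proof -
  have e: "400 * (n + 2) * (k + 1) = 400 * (n * k) + 800 * k + 400 * n + 800" by (simp add: algebra_simps)
  have "n + k <= 400 * (n + 2) * (k + 1)" "(n + 1) * k <= 400 * (n + 2) * (k + 1)" "2 * n + 3 <= 400 * (n + 2) * (k + 1)"
   "200 <= 400 * (n + 2) * (k + 1)" "400 * (n + 2) <= 400 * (n + 2) * (k + 1)" unfolding e by (simp_all add: algebra_simps)
  then show "int (n + k) <= 2 ^ bt" "int ((n + 1) * k) <= 2 ^ bt" "int (2 * n + 3) <= 2 ^ bt" "(200::int) <= 2 ^ bt" "int (400 * (n + 2)) <= 2 ^ bt"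
   using b(2) by linarith+
 qed
 define s1 where "s1 = upd ''BIG'' 0 1 s"
 have b1: "bounded bt s1" using s(1) by (simp add: bounded_def s1_def upd_simps)
 have E1: "exec_to m bt (Assign ''BIG'' (Lit 0) (Lit 1)) 3 (start s) s1"
 proof -
  have "bit_size 0 <= 6" "bit_size 1 <= 6" using bit_size_le[of 0 4] bit_size_le[of 1 4] by simp_all
  then show ?thesis using b1 bt by (simp add: exec_to_def start_def s1_def)
 qed
 define s2 where "s2 = upd ''tmp'' 0 (int p) s1"
 have pb: "\<bar>int p\<bar> <= 2 ^ bt" using b(1) by linarith
 have b2: "bounded bt s2" unfolding s2_def by (rule BU[OF b1 pb]) simp
 have E2: "exec_to m bt (Assign ''tmp'' (Lit 0) (V ''p'')) (ops (V ''p'') + 2) sg s2" if "mem sg = s1" for sg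
  unfolding s2_def by (rule EA[OF b1 _ pb]) (use that s in \<open>simp_all add: s1_def upd_simps\<close>)
 have "EX L s'. p < 2 ^ L & (p = 0 --> L = 0) & (p > 0 --> 2 ^ L <= 2 * p) & s' ''lg'' 0 = s2 ''lg'' 0 + int L &
  (ALL a. a ~= ''tmp'' --> a ~= ''lg'' --> s' a = s2 a) &
  (ALL sg. mem sg = s2 --> exec_to m bt (While (V ''tmp'') halve_c) (3 + 20 * L) sg s')"
  by (rule exec_halve_loop[OF m bt b2]) (use s b in \<open>simp_all add: s2_def s1_def upd_simps\<close>)
 then obtain L s3 where A: "p < 2 ^ L & (p = 0 --> L = 0) & (p > 0 --> 2 ^ L <= 2 * p) & s3 ''lg'' 0 = s2 ''lg'' 0 + int L &
  (ALL a. a ~= ''tmp'' --> a ~= ''lg'' --> s3 a = s2 a) &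
  (ALL sg. mem sg = s2 --> exec_to m bt (While (V ''tmp'') halve_c) (3 + 20 * L) sg s3)" by (elim exE)
 note A2 = A[THEN conjunct2] note A3 = A2[THEN conjunct2] note A4 = A3[THEN conjunct2] note A5 = A4[THEN conjunct2]
 note E3 = A5[THEN conjunct2, rule_format] and f3 = A5[THEN conjunct1, rule_format]
 have lg3: "s3 ''lg'' 0 = int L" using A4[THEN conjunct1] s(5) by (simp add: s2_def s1_def upd_simps)
 have b3: "bounded bt s3" using E3[of "start s2"] by (auto simp: exec_to_def start_def)
 have c3: "s3 ''n'' 0 = int n" "s3 ''k'' 0 = int k" using f3[of "''n''"] f3[of "''k''"] s by (simp_all add: s2_def s1_def upd_simps)
 define s4 where "s4 = upd ''m'' 0 m s3"
 have mb: "\<bar>m\<bar> <= 2 ^ bt" using m by simp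
 have mm: "(- 1) mod m + 1 = m" using zmod_minus1[OF m(1)] by simp
 have E4: "exec_to m bt (Assign ''m'' (Lit 0) (Op Add (Op RAdd (Lit 0) (Op Sub (Lit 0) (Lit 1))) (Lit 1))) (ops (Op Add (Op RAdd (Lit 0) (Op Sub (Lit 0) (Lit 1))) (Lit 1)) + 2) sg s4"
  if "mem sg = s3" for sg
  unfolding s4_def by (rule EA[OF b3 _ mb]) (use that mm in simp_all)
 have b4: "bounded bt s4" unfolding s4_def by (rule BU[OF b3 mb]) simp
 define s5 where "s5 = upd ''nk'' 0 (int (n + k)) s4"
 have v5: "\<bar>int (n + k)\<bar> <= 2 ^ bt" using n(1) by simp
 have E5: "exec_to m bt (Assign ''nk'' (Lit 0) (Op Add (V ''n'') (V ''k''))) (ops (Op Add (V ''n'') (V ''k'')) + 2) sg s5" if "mem sg = s4" for sg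
  unfolding s5_def by (rule EA[OF b4 _ v5]) (use that in \<open>simp_all add: s4_def upd_simps c3\<close>)
 have b5: "bounded bt s5" unfolding s5_def by (rule BU[OF b4 v5]) simp
 define s6 where "s6 = upd ''cl'' 0 (int ((n + 1) * k)) s5"
 have v6: "\<bar>int ((n + 1) * k)\<bar> <= 2 ^ bt" using n(2) by simp
 have E6: "exec_to m bt (Assign ''cl'' (Lit 0) (Op Mul (Op Add (V ''n'') (Lit 1)) (V ''k''))) (ops (Op Mul (Op Add (V ''n'') (Lit 1)) (V ''k'')) + 2) sg s6" if "mem sg = s5" for sg
  unfolding s6_def by (rule EA[OF b5 _ v6]) (use that in \<open>simp_all add: s5_def s4_def upd_simps c3 algebra_simps\<close>)
 have b6: "bounded bt s6" unfolding s6_def by (rule BU[OF b5 v6]) simp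
 define s7 where "s7 = upd ''l1'' 0 (int (2 * n + 3)) s6"
 have v7: "\<bar>int (2 * n + 3)\<bar> <= 2 ^ bt" using n(3) by simp
 have E7: "exec_to m bt (Assign ''l1'' (Lit 0) (Op Add (Op Mul (Lit 2) (V ''n'')) (Lit 3))) (ops (Op Add (Op Mul (Lit 2) (V ''n'')) (Lit 3)) + 2) sg s7" if "mem sg = s6" for sg
  unfolding s7_def by (rule EA[OF b6 _ v7]) (use that in \<open>simp_all add: s6_def s5_def s4_def upd_simps c3\<close>)
 have b7: "bounded bt s7" unfolding s7_def by (rule BU[OF b6 v7]) simp
 define s8 where "s8 = upd ''T'' 0 200 s7"
 have v8: "\<bar>200::int\<bar> <= 2 ^ bt" using n(4) by simp
 have E8: "exec_to m bt (Assign ''T'' (Lit 0) (Op Mul (Op Mul (Lit 5) (Lit 5)) (Lit 8))) (ops (Op Mul (Op Mul (Lit 5) (Lit 5)) (Lit 8)) + 2) sg s8" if "mem sg = s7" for sg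
  unfolding s8_def by (rule EA[OF b7 _ v8]) (use that in simp_all)
 have b8: "bounded bt s8" unfolding s8_def by (rule BU[OF b7 v8]) simp
 define s9 where "s9 = upd ''cnt'' 0 (int (400 * (n + 2))) s8"
 have v9: "\<bar>int (400 * (n + 2))\<bar> <= 2 ^ bt" using n(5) by simp
 have E9: "exec_to m bt (Assign ''cnt'' (Lit 0) (Op Mul (V ''T'') (Op Add (V ''l1'') (Lit 1)))) (ops (Op Mul (V ''T'') (Op Add (V ''l1'') (Lit 1))) + 2) sg s9" if "mem sg = s8" for sg
  unfolding s9_def by (rule EA[OF b8 _ v9]) (use that in \<open>simp_all add: s8_def s7_def upd_simps\<close>)
 note ES = exec_to_Seq[where m = m and bt = bt]
 note F8 = ES[OF E8 E9] note F7 = ES[OF E7 F8] note F6 = ES[OF E6 F7] note F5 = ES[OF E5 F6] note F4 = ES[OF E4 F5]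
 note F3 = ES[OF E3 F4] note F2 = ES[OF E2 F3] note F1 = ES[OF E1 F2]
 have E: "exec_to m bt prepare_c (200 + 20 * L) (start s) s9"
  unfolding prepare_c_def by (rule exec_to_mono[OF F1]) simp_all
 have "s9 a = s a" if "a ~: {''BIG'', ''tmp'', ''lg'', ''m'', ''nk'', ''cl'', ''l1'', ''T'', ''cnt''}" for a
  using that f3[of a] by (simp add: s9_def s8_def s7_def s6_def s5_def s4_def s2_def s1_def upd_simps)
 moreover have "s9 ''lg'' 0 = int L" "s9 ''m'' 0 = m" "s9 ''nk'' 0 = int (n + k)" "s9 ''cl'' 0 = int ((n + 1) * k)" "s9 ''l1'' 0 = int (2 * n + 3)" "s9 ''T'' 0 = 200"
  "s9 ''cnt'' 0 = int (400 * (n + 2))" "s9 ''BIG'' 0 = 1"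
  using lg3 f3[of "''BIG''"] by (simp_all add: s9_def s8_def s7_def s6_def s5_def s4_def s2_def s1_def upd_simps)
 moreover have "p < 2 ^ L" "2 ^ L <= 2 * p" using A[THEN conjunct1] A3[THEN conjunct1] s(6) by simp_all
 ultimately show ?thesis using E by (intro exI[of _ L] exI[of _ s9] conjI allI impI) assumption+
qed

end

section \<open>Independence of unread cells, and a counting criterion for Las Vegas
  algorithms\<close>

primrec evars :: "expr => vname set" where
 "evars (Lit c) = {}"
| "evars (Cell a e) = insert a (evars e)"
| "evars (Op f a b) = evars a \<union> evars b"
| "evars (RInv e) = evars e"

primrec pvars :: "pcom => vname set" where
 "pvars PSkip = {}"
| "pvars (PAsg a i e) = insert a (evars i \<union> evars e)"
| "pvars (c1 ;; c2) = pvars c1 \<union> pvars c2"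
| "pvars (PIf e c1 c2) = evars e \<union> pvars c1 \<union> pvars c2"
| "pvars (PFor i N b) = {i, N} \<union> pvars b"

definition agree :: "vname set => store => store => bool" where
 "agree X s s' \<longleftrightarrow> (ALL a. a ~: X --> s a = s' a)"

lemma agree_eval: "agree X s s' ==> evars e \<inter> X = {} ==> Defs.eval m s e = Defs.eval m s' e"
proof (induction e)
 case (Op f a b)
 then have "evars a \<inter> X = {}" "evars b \<inter> X = {}" by auto
 with Op show ?case by simp
qed (auto simp: agree_def)

lemma agree_upd: "agree X s s' ==> agree X (upd a i v s) (upd a i v s')"
 by (simp add: agree_def upd_def)

lemma agree_run: "agree X s s' ==> pvars c \<inter> X = {} ==> agree X (run m c s) (run m c s')"
proof (induction c arbitrary: s s')
 case (PAsg a i e)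
 have "Defs.eval m s i = Defs.eval m s' i" "Defs.eval m s e = Defs.eval m s' e"
  using PAsg.prems by (auto intro!: agree_eval[OF PAsg.prems(1)])
 then show ?case using agree_upd[OF PAsg.prems(1)] by simp
next
 case (PSeq c1 c2)
 have "agree X (run m c1 s) (run m c1 s')" by (rule PSeq.IH(1)[OF PSeq.prems(1)]) (use PSeq.prems(2) in auto)
 then have "agree X (run m c2 (run m c1 s)) (run m c2 (run m c1 s'))" by (rule PSeq.IH(2)) (use PSeq.prems(2) in auto)
 then show ?case by simp
next
 case (PIf e c1 c2)
 have "Defs.eval m s e = Defs.eval m s' e" by (rule agree_eval[OF PIf.prems(1)]) (use PIf.prems(2) in auto)
 moreover have "agree X (run m c1 s) (run m c1 s')" by (rule PIf.IH(1)[OF PIf.prems(1)]) (use PIf.prems(2) in auto)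
 moreover have "agree X (run m c2 s) (run m c2 s')" by (rule PIf.IH(2)[OF PIf.prems(1)]) (use PIf.prems(2) in auto)
 ultimately show ?case by simp
next
 case (PFor i N b)
 let ?f = "%s. upd i 0 (s i 0 + 1) (run m b s)"
 have i: "i ~: X" "N ~: X" "pvars b \<inter> X = {}" using PFor.prems(2) by auto
 have "agree X ((?f ^^ r) (upd i 0 0 s)) ((?f ^^ r) (upd i 0 0 s'))" for r
 proof (induction r)
  case 0
  show ?case using agree_upd[OF PFor.prems(1)] by simp
 next
  case (Suc r)
  have "((?f ^^ r) (upd i 0 0 s)) i = ((?f ^^ r) (upd i 0 0 s')) i" using Suc i(1) by (simp add: agree_def)
  then show ?case using agree_upd[OF PFor.IH[OF Suc i(3)]] by simp
 qed
 moreover have "s N = s' N" using PFor.prems(1) i(2) by (simp add: agree_def)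
 ultimately show ?case by simp
qed simp

lemma spmf_map_uniform:
 assumes "finite A" "A ~= {}"
 shows "spmf (map_spmf g (spmf_of_set A)) x = real (card {w \<in> A. g w = x}) / real (card A)"
proof -
 have "spmf (map_spmf g (spmf_of_set A)) x = measure (measure_pmf (pmf_of_set A)) (g -` {x})"
  using assms by (simp add: spmf_map measure_spmf_spmf_of_set)
 also have "... = real (card (A \<inter> g -` {x})) / real (card A)" by (rule measure_pmf_of_set[OF assms(2,1)])
 also have "A \<inter> g -` {x} = {w \<in> A. g w = x}" by auto
 finally show ?thesis .
qed

text \<open>The mass outside failure is |R| C / |A| and each representation has C / |A|, so
  conditioning leaves 1 / |R|.\<close>

lemma las_vegas_of_counts:
 assumes A: "finite A" "A ~= {}" and R: "finite R" "R ~= {}"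
  and cases: "!!w. w \<in> A ==> g w = Failure | (\<exists>x\<in>R. g w = Representation x)"
  and eq: "!!x. x \<in> R ==> card {w \<in> A. g w = Representation x} = C"
  and fail: "3 * card {w \<in> A. g w = Failure} <= card A"
 shows "las_vegas_uniform R (map_spmf g (spmf_of_set A))"
proof -
 let ?D = "map_spmf g (spmf_of_set A)" let ?f = "card {w \<in> A. g w = Failure}"
 have cA: "card A > 0" using A by (simp add: card_gt_0_iff)
 have ls: "lossless_spmf ?D" using A by simp
 have sp: "spmf ?D x = real (card {w \<in> A. g w = x}) / real (card A)" for x by (rule spmf_map_uniform[OF A])
 have f13: "spmf ?D Failure <= 1 / 3"
 proof -
  have "3 * real ?f <= real (card A)" using fail by linarith
  then show ?thesis unfolding sp using cA by (simp add: field_simps)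
 qed
 have "A = {w \<in> A. g w = Failure} \<union> (\<Union>x\<in>R. {w \<in> A. g w = Representation x})" using cases by auto
 then have "card A = card ({w \<in> A. g w = Failure} \<union> (\<Union>x\<in>R. {w \<in> A. g w = Representation x}))" by simp
 also have "... = ?f + card (\<Union>x\<in>R. {w \<in> A. g w = Representation x})" using A R by (intro card_Un_disjoint) auto
 also have "card (\<Union>x\<in>R. {w \<in> A. g w = Representation x}) = (\<Sum>x\<in>R. card {w \<in> A. g w = Representation x})"
  using A R by (intro card_UN_disjoint) auto
 also have "... = card R * C" using eq by simp
 finally have tot: "card A = ?f + card R * C" .
 \<comment> \<open>With C = 0 every draw would fail, against the bound of one third.\<close>
 have C0: "C > 0" using tot fail cA by (cases C) auto
 have meas: "measure (measure_spmf ?D) (- {Failure}) = real (card R * C) / real (card A)"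
 proof -
  have "measure (measure_spmf ?D) (- {Failure}) = measure (measure_spmf ?D) (space (measure_spmf ?D)) - measure (measure_spmf ?D) {Failure}"
   using measure_spmf.finite_measure_compl[of "{Failure}" ?D] unfolding Compl_eq_Diff_UNIV space_measure_spmf by simp
  also have "... = 1 - spmf ?D Failure"
   using ls by (simp add: lossless_spmf_def weight_spmf_def spmf_conv_measure_spmf)
  also have "... = (real (card A) - real ?f) / real (card A)" unfolding sp using cA by (simp add: diff_divide_distrib)
  also have "real (card A) - real ?f = real (card R * C)" using tot by simp
  finally show ?thesis .
 qed
 have "cond_spmf ?D (- {Failure}) = map_spmf Representation (spmf_of_set R)"
 proof (rule spmf_eqI)
  fix x
  have r: "spmf (map_spmf Representation (spmf_of_set R)) x = real (card {y \<in> R. Representation y = x}) / real (card R)"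
   by (rule spmf_map_uniform[OF R])
  show "spmf (cond_spmf ?D (- {Failure})) x = spmf (map_spmf Representation (spmf_of_set R)) x"
  proof (cases "\<exists>y\<in>R. x = Representation y")
   case True
   then obtain y where y: "y \<in> R" "x = Representation y" by blast
   have "{z \<in> R. Representation z = x} = {y}" using y by auto
   then have "spmf (map_spmf Representation (spmf_of_set R)) x = 1 / real (card R)" unfolding r by simp
   moreover have "spmf (cond_spmf ?D (- {Failure})) x = (real C / real (card A)) / (real (card R * C) / real (card A))"
    unfolding spmf_cond_spmf meas sp y(2) eq[OF y(1)] by simp
   moreover have "(real C / real (card A)) / (real (card R * C) / real (card A)) = 1 / real (card R)"
    using C0 cA by simp
   ultimately show ?thesis by simp
  next
   case False
   then have e: "{z \<in> R. Representation z = x} = {}" by auto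
   have "spmf (cond_spmf ?D (- {Failure})) x = 0"
   proof (cases "x = Failure")
    case False
    then have e': "{w \<in> A. g w = x} = {}" using cases \<open>~ (\<exists>y\<in>R. x = Representation y)\<close> by force
    show ?thesis unfolding spmf_cond_spmf sp e' by simp
   next
    case True
    show ?thesis unfolding spmf_cond_spmf True by simp
   qed
   then show ?thesis unfolding r e by simp
  qed
 qed
 then show ?thesis unfolding las_vegas_uniform_def using ls f13 R by simp
qed

section \<open>Assembling the program, its cost, and the return to the given form\<close>

definition main_c :: "nat => bool => pcom" where
 "main_c l prim = (powers_c ;; init_c ;; diag_c ;; sample_c l prim)"

definition sampler_c :: "nat => bool => com" where
 "sampler_c l prim = Seq prepare_c (Seq draw_c (compile (main_c l prim)))"

definition limits :: "nat => nat => nat => nat => vname => nat" where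
 "limits b n k L N = (if N = ''n'' then n else if N = ''k'' then k else if N = ''lg'' then L else if N = ''nk'' then n + k
   else if N = ''cl'' then (n + 1) * k else if N = ''l1'' then 2 * n + 3 else if N = ''T'' then 200 else b)"

definition volume :: "nat => nat => nat => nat" where
 "volume n k L = n ^ 3 + n * k ^ 3 + n * L"

text \<open>The mixed term k n^2 is at most n^3 if k <= n and at most n k^3 otherwise. It is the
  cost of scanning for pivots and of computing the weights.\<close>

lemma monomials_le:
 assumes "n \<ge> 1" "k \<ge> 1" "L \<ge> 1"
 shows "1 <= volume n k L" "n <= volume n k L" "k <= volume n k L" "L <= volume n k L" "n * n <= volume n k L" "n * k <= volume n k L"
  "n * (n * n) <= volume n k L" "k * (n * n) <= volume n k L" "n * L <= volume n k L"
proof -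
 have 1: "n * (n * n) <= volume n k L" "n * (k * (k * k)) <= volume n k L" "n * L <= volume n k L"
  by (simp_all add: volume_def power3_eq_cube)
 show "n * (n * n) <= volume n k L" "n * L <= volume n k L" using 1 by simp_all
 have "1 * (n * n) <= n * (n * n)" using assms by (intro mult_le_mono1) simp
 then have "n * n <= n * (n * n)" by (simp only: mult_1_left)
 then show nn: "n * n <= volume n k L" using 1(1) by (rule le_trans)
 show n: "n <= volume n k L" by (rule le_trans[OF le_square nn])
 then show "1 <= volume n k L" using assms(1) by (rule le_trans[rotated])
 have "1 * L <= n * L" using assms by (intro mult_le_mono1) simp
 then have "L <= n * L" by (simp only: mult_1_left)
 then show "L <= volume n k L" using 1(3) by (rule le_trans)
 have "k * 1 <= k * (k * k)" using assms by (intro mult_le_mono2) simp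
 then have "n * (k * 1) <= n * (k * (k * k))" by (rule mult_le_mono2)
 then have "n * k <= n * (k * (k * k))" by (simp only: mult_1_right)
 then show nk: "n * k <= volume n k L" using 1(2) by (rule le_trans)
 have "1 * k <= n * k" using assms by (intro mult_le_mono1) simp
 then have "k <= n * k" by (simp only: mult_1_left)
 then show "k <= volume n k L" using nk by (rule le_trans)
 show "k * (n * n) <= volume n k L"
 proof (cases "k <= n")
  case True
  then have "k * (n * n) <= n * (n * n)" by (rule mult_le_mono1)
  then show ?thesis using 1(1) by (rule le_trans)
 next
  case False
  then have "k * (n * n) <= k * (n * k)" by (intro mult_le_mono2) simp
  also have "... = n * (k * k)" by (simp add: ac_simps)
  also have "... <= n * (k * (k * k))" using assms by (intro mult_le_mono2) simp
  finally show ?thesis using 1(2) by (rule le_trans)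
 qed
qed

text \<open>Unfolded, the cost is a linear combination of the nine monomials just estimated, and the
  constant generously bounds the sum of the coefficients.\<close>

lemma cost_main_le:
 assumes "n \<ge> 1" "k \<ge> 1" "L \<ge> 1"
 shows "cost (limits b n k L) (main_c l prim) <= 1000000000 * volume n k L"
 using monomials_le[OF assms]
 by (cases prim) (simp_all add: main_c_def sample_defs diag_defs expr_defs limits_def algebra_simps del: numeral_eq_Suc)

lemma wf_main: "l <= 1 ==> wf (main_c l prim)"
 by (simp add: main_c_def wf_sample)

lemma main_vars: "pvars (powers_c ;; init_c ;; diag_c) \<inter> {''Z'', ''tmp'', ''cnt''} = {}"
 by (simp add: diag_defs expr_defs)

lemma (in machine) run_diagonalize:
 assumes s: "base s" and Q: "!!i j. i < n ==> j < n ==> mt s ''Q'' i j = Q0 i j"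
  and sym: "!!i j. i < n ==> j < n ==> Q0 i j = Q0 j i"
 defines "u == run m (powers_c ;; init_c ;; diag_c) s"
 shows "pows u" "EX ex. (ALL i<n. u ''ex'' (int i) = int (ex i)) & diagonal_form n k Q0 (mt u ''U'') ex (%i. u ''un'' (int i))"
proof -
 define s1 where "s1 = run m powers_c s"
 define s2 where "s2 = run m init_c s1"
 have p1: "pows s1" unfolding s1_def by (rule run_powers[OF s])
 have b1: "base s1" by (rule powsD(1)[OF p1])
 have p2: "pows s2" unfolding s2_def using p1 by (subst pows_run) simp_all
 have Q1: "mt s1 ''Q'' i j = Q0 i j" if "i < n" "j < n" for i j using Q[OF that] by (simp add: s1_def)
 have u: "u = run m diag_c s2" by (simp add: u_def s1_def s2_def)
 show "pows u" unfolding u using p2 by (subst pows_run) simp_all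
 show "EX ex. (ALL i<n. u ''ex'' (int i) = int (ex i)) & diagonal_form n k Q0 (mt u ''U'') ex (%i. u ''un'' (int i))"
  unfolding u by (rule run_diag[OF p2 _ _ _ sym]) (use run_init[OF b1] Q1 in \<open>simp_all add: s2_def\<close>)
qed

lemma app_dvd: "(!!j. j < n ==> d dvd y j) ==> d dvd app n A y i"
 unfolding app_def by (intro dvd_sum) (simp add: dvd_mult)

definition mode :: "nat => bool => nat => int Matrix.vec => bool" where
 "mode l prim p x \<longleftrightarrow> (l = 1 --> ~ primitive p x) & (prim --> primitive p x)"

lemma scalar_prod_bf:
 assumes "x \<in> carrier_vec n" "Q \<in> carrier_mat n n"
 shows "scalar_prod x (mult_mat_vec Q x) = bf n (%i j. index_mat Q (i, j)) (vec_index x) (vec_index x)"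
 using assms unfolding scalar_prod_def bf_def app_def
 by (auto simp: scalar_prod_def atLeast0LessThan intro!: sum.cong)

text \<open>The change of basis is invertible modulo m. Both it and its inverse preserve
  divisibility of all coordinates by p, so primitive vectors correspond to primitive ones.\<close>

lemma (in sampling) bij_solutions:
 assumes D: "diagonal_form n k (%i j. index_mat Q (i, j)) U ex un" and Q: "Q \<in> carrier_mat n n"
 defines "f == %y. Matrix.vec n (%i. app n U y i mod m)"
 shows "bij_betw f sols {x \<in> representations n Q p k t. mode l prim p x}"
proof -
 let ?Q = "%i j. index_mat Q (i, j)"
 obtain W where W: "inverse_mod m n U W" using D by (auto simp: diagonal_form_def)
 have UW: "[app n U (app n W y) i = y i] (mod m)" "[app n W (app n U y) i = y i] (mod m)" if "i < n" for y i
  using W that by (simp_all add: inverse_mod_def)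
 have form: "[bf n ?Q (app n U y) (app n U y) = q y] (mod m)" for y
  using D unfolding diagonal_form_def q_def by blast
 have mc: "[x mod m = x] (mod m)" for x by (simp add: cong_def)
 have fi: "vec_index (f y) i = app n U y i mod m" if "i < n" for y i using that by (simp add: f_def)
 have fc: "f y \<in> carrier_vec n" for y by (simp add: f_def)
 have prim_dvd: "primitive p x \<longleftrightarrow> (EX i<n. ~ P dvd vec_index x i)" if "x \<in> carrier_vec n" for x
 proof -
  have "gcd a P = 1 \<longleftrightarrow> ~ P dvd a" for a :: int
  proof
   assume "gcd a P = 1"
   then show "~ P dvd a" using p_ge_3 by (auto simp: gcd.commute elim!: dvdE)
  next
   assume "~ P dvd a"
   then have "coprime P a" using prime_P prime_imp_coprime by blast
   then show "gcd a P = 1" by (simp add: coprime_iff_gcd_eq_1 gcd.commute)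
  qed
  then show ?thesis using that by (simp add: primitive_def)
 qed
 have Pm: "P dvd x mod m \<longleftrightarrow> P dvd x" for x using dvd_mod_iff[OF P_dvd_m] .
 have prim_f: "primitive p (f y) \<longleftrightarrow> (EX i<n. ~ P dvd y i)" for y
 proof
  assume "primitive p (f y)"
  then obtain i where i: "i < n" "~ P dvd app n U y i" unfolding prim_dvd[OF fc] by (auto simp: fi Pm)
  then show "EX i<n. ~ P dvd y i" using app_dvd[of n P y U i] by blast
 next
  assume "EX i<n. ~ P dvd y i"
  then obtain i where i: "i < n" "~ P dvd y i" by blast
  have "[app n W (app n U y) i = y i] (mod P)" using UW(2)[OF i(1)] P_dvd_m by (rule cong_dvd_modulus)
  then have "~ P dvd app n W (app n U y) i" using i(2) cong_dvd_iff by blast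
  then have "EX j<n. ~ P dvd app n U y j" using app_dvd[of n P "app n U y" W i] by blast
  then show "primitive p (f y)" unfolding prim_dvd[OF fc] by (auto simp: fi Pm)
 qed
 have rep: "f y \<in> representations n Q p k t \<longleftrightarrow> [q y = t] (mod m)" for y
 proof -
  have "[bf n ?Q (vec_index (f y)) (vec_index (f y)) = bf n ?Q (app n U y) (app n U y)] (mod m)"
   by (rule bf_cong) (simp_all add: fi mc)
  then have "[bf n ?Q (vec_index (f y)) (vec_index (f y)) = q y] (mod m)" using form by (rule cong_trans)
  then have "[bf n ?Q (vec_index (f y)) (vec_index (f y)) = t] (mod m) \<longleftrightarrow> [q y = t] (mod m)" by (simp add: cong_def)
  then show ?thesis unfolding representations_def using fc scalar_prod_bf[OF fc Q] by (simp add: fi)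
 qed
 have md: "mode l prim p (f y) \<longleftrightarrow> (ALL i<n. P ^ l dvd y i) & (prim --> (EX i<n. ~ P dvd y i))" for y
 proof -
  have "l = 0 | l = 1" using l_le by linarith
  then show ?thesis unfolding mode_def prim_f by (elim disjE) simp_all
 qed
 have mem: "f y \<in> {x \<in> representations n Q p k t. mode l prim p x} \<longleftrightarrow> y \<in> sols" if "y \<in> vecs" for y
  using that rep md by (simp add: sols_def)
 have vecs: "y \<in> sols ==> y \<in> vecs" for y by (simp add: sols_def)
 show ?thesis unfolding bij_betw_def
 proof
  show "inj_on f sols"
  proof (rule inj_onI)
   fix y y' assume y: "y \<in> sols" "y' \<in> sols" and e: "f y = f y'"
   have eq: "[app n U y j = app n U y' j] (mod m)" if "j < n" for j
    using arg_cong[OF e, of "%x. vec_index x j"] that by (simp add: fi cong_def)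
   show "y = y'"
   proof
    fix i
    show "y i = y' i"
    proof (cases "i < n")
     case True
     have "[app n W (app n U y) i = app n W (app n U y') i] (mod m)" by (rule app_cong[OF eq])
     then have "[y i = y' i] (mod m)" using UW(2)[OF True] by (meson cong_sym cong_trans)
     moreover have "0 <= y i" "y i < m" "0 <= y' i" "y' i < m" using vecs[OF y(1)] vecs[OF y(2)] True by (simp_all add: vecs_def)
     ultimately show ?thesis by (simp add: cong_def)
    next
     case False
     then show ?thesis using vecs[OF y(1)] vecs[OF y(2)] by (simp add: vecs_def)
    qed
   qed
  qed
  show "f ` sols = {x \<in> representations n Q p k t. mode l prim p x}"
  proof (intro equalityI subsetI)
   fix x assume "x \<in> f ` sols"
   then show "x \<in> {x \<in> representations n Q p k t. mode l prim p x}" using mem vecs by blast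
  next
   fix x assume x: "x \<in> {x \<in> representations n Q p k t. mode l prim p x}"
   have xc: "x \<in> carrier_vec n" "!!i. i < n ==> 0 <= vec_index x i & vec_index x i < m" using x by (auto simp: representations_def)
   define y where "y = (%i. if i < n then app n W (vec_index x) i mod m else 0)"
   have yv: "y \<in> vecs" by (simp add: y_def vecs_def)
   have "vec_index (f y) i = vec_index x i" if i: "i < n" for i
   proof -
    have "[app n U y i = app n U (app n W (vec_index x)) i] (mod m)" by (rule app_cong) (simp add: y_def mc)
    then have "[app n U y i = vec_index x i] (mod m)" using UW(1)[OF i] by (rule cong_trans)
    then show ?thesis using xc(2)[OF i] by (simp add: fi[OF i] cong_def)
   qed
   then have "f y = x" using fc[of y] xc(1) by (intro eq_vecI) auto
   then show "x \<in> f ` sols" using mem[OF yv] x by auto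
  qed
 qed
qed

lemma abs_less_bit_size: "\<bar>x\<bar> < 2 ^ bit_size x"
proof (cases "x = 0")
 case False
 then have "\<bar>x\<bar> < 2 ^ nat (bitlen \<bar>x\<bar>)" using bitlen_bounds[of "\<bar>x\<bar>"] by simp
 also have "(2::int) ^ nat (bitlen \<bar>x\<bar>) <= 2 ^ bit_size x" by (intro power_increasing) (simp_all add: bit_size_def)
 finally show ?thesis .
qed simp

section \<open>The algorithm on one input\<close>

locale problem = odd_prime p for p +
 fixes n k l :: nat and Q :: "int mat" and t :: int and prim :: bool
 assumes n1: "n \<ge> 1" and k1: "k \<ge> 1" and Q: "Q \<in> carrier_mat n n" "transpose_mat Q = Q" and t: "t \<in> {0..<P ^ k}" and l: "l <= 1"
begin

abbreviation m :: int where "m == P ^ k"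

text \<open>200 attempts, each reading 2n + 4 digits in base m.\<close>

abbreviation K :: nat where "K == 400 * (n + 2)"

abbreviation IS :: nat where "IS == input_size n Q p k t"

text \<open>Chosen to hold the largest number that occurs, m^K: m is at most 2^IS, and K = 400 (n +
  2) is at most 1200 IS.\<close>

definition bt :: nat where "bt = 1200 * (IS * IS)"

abbreviation s0 :: store where "s0 == sampler_input n Q p k t"

abbreviation reps :: "int Matrix.vec set" where "reps == {x \<in> representations n Q p k t. mode l prim p x}"

lemma bit_size_pos: "bit_size x \<ge> 1"
 by (simp add: bit_size_def)

lemma size_bounds: "n <= IS" "k <= IS" "k * bit_size P <= IS" "bit_size P <= IS" "bit_size t <= IS"
 "!!i j. i < n ==> j < n ==> bit_size (index_mat Q (i, j)) <= IS"
proof -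
 let ?S = "\<Sum>i<n. \<Sum>j<n. bit_size (index_mat Q (i, j))"
 have "(\<Sum>i<n. \<Sum>j<n. 1) <= ?S" by (intro sum_mono bit_size_pos)
 then have "n * n <= ?S" by simp
 then have "n <= ?S" by (rule le_trans[OF le_square])
 then show "n <= IS" by (simp add: input_size_def)
 show kb: "k * bit_size P <= IS" and "bit_size t <= IS" by (simp_all add: input_size_def)
 have "k * 1 <= k * bit_size P" by (intro mult_le_mono2 bit_size_pos)
 then have "k <= k * bit_size P" by (simp only: mult_1_right)
 then show "k <= IS" using kb by (rule le_trans)
 have "1 * bit_size P <= k * bit_size P" using k1 by (intro mult_le_mono1) simp
 then have "bit_size P <= k * bit_size P" by (simp only: mult_1_left)
 then show "bit_size P <= IS" using kb by (rule le_trans)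
 fix i j assume ij: "i < n" "j < n"
 have "bit_size (index_mat Q (i, j)) <= (\<Sum>j<n. bit_size (index_mat Q (i, j)))"
  using ij by (intro member_le_sum[of j "{..<n}" "%j. bit_size (index_mat Q (i, j))"]) auto
 also have "... <= ?S"
  using ij by (intro member_le_sum[of i "{..<n}" "%i. \<Sum>j<n. bit_size (index_mat Q (i, j))"]) auto
 also have "... <= IS" by (simp add: input_size_def)
 finally show "bit_size (index_mat Q (i, j)) <= IS" .
qed

lemma IS_pos: "IS \<ge> 1"
 using size_bounds(1) n1 by simp

lemma IS_le_bt: "1200 * IS <= bt" "4 <= bt" "1200 <= bt"
proof -
 have "IS * 1 <= IS * IS" using IS_pos by (intro mult_le_mono2)
 then show "1200 * IS <= bt" by (simp add: bt_def)
 then show "4 <= bt" "1200 <= bt" using IS_pos by simp_all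
qed

lemma le_pow_bt: "x <= 2 ^ IS ==> x <= (2::int) ^ bt"
proof -
 assume x: "x <= 2 ^ IS"
 have "(2::int) ^ IS <= 2 ^ bt" using IS_le_bt(1) by (intro power_increasing) simp_all
 with x show ?thesis by (rule order_trans)
qed

lemma bits_le: "bit_size x <= IS ==> \<bar>x\<bar> <= 2 ^ IS"
proof -
 assume "bit_size x <= IS"
 then have "(2::int) ^ bit_size x <= 2 ^ IS" by (intro power_increasing) simp_all
 then show ?thesis by (rule less_imp_le[OF less_le_trans[OF abs_less_bit_size]])
qed

lemma nat_le_pow: "x <= IS ==> int x <= 2 ^ IS"
 using of_nat_less_two_power[of IS, where ?'a = int] by linarith

lemma cells_le: "\<bar>s0 a i\<bar> <= 2 ^ bt"
proof (rule le_pow_bt)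
 have "\<bar>scalar_cells (int n) i\<bar> <= 2 ^ IS" "\<bar>scalar_cells P i\<bar> <= 2 ^ IS" "\<bar>scalar_cells (int k) i\<bar> <= 2 ^ IS" "\<bar>scalar_cells t i\<bar> <= 2 ^ IS"
  using nat_le_pow[OF size_bounds(1)] bits_le[OF size_bounds(4)] nat_le_pow[OF size_bounds(2)] bits_le[OF size_bounds(5)]
  by (simp_all add: scalar_cells_def)
 moreover have "\<bar>matrix_cells n Q i\<bar> <= 2 ^ IS"
 proof (cases "0 <= i & i < int (n * n)")
  case True
  then have "nat i < n * n" by linarith
  then have "nat i div n < n" using less_mult_imp_div_less by blast
  moreover have "nat i mod n < n" using n1 by simp
  ultimately show ?thesis using True bits_le[OF size_bounds(6)] by (simp add: matrix_cells_def)
 next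
  case False
  then show ?thesis by (auto simp: matrix_cells_def)
 qed
 ultimately show "\<bar>s0 a i\<bar> <= 2 ^ IS" by (simp add: sampler_input_def)
qed

lemma m_le: "m <= 2 ^ IS"
proof -
 have "P <= 2 ^ bit_size P" using abs_less_bit_size[of P] by simp
 then have "m <= (2 ^ bit_size P) ^ k" by (intro power_mono) simp_all
 also have "... = 2 ^ (k * bit_size P)" by (simp add: power_mult[symmetric] mult.commute)
 also have "... <= 2 ^ IS" using size_bounds(3) by (intro power_increasing) simp_all
 finally show ?thesis .
qed

lemma m_gt_1: "1 < m" "0 < m"
 using p_ge_3 k1 by (simp_all add: one_less_power)

lemma range_le: "m ^ K <= 2 ^ bt"
proof -
 have "m ^ K <= (2 ^ IS) ^ K" using m_le m_gt_1 by (intro power_mono) simp_all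
 also have "... = 2 ^ (IS * K)" by (simp add: power_mult)
 also have "... <= 2 ^ bt"
 proof (rule power_increasing)
  have "K <= 1200 * IS" using size_bounds(1) IS_pos by simp
  then have "IS * K <= IS * (1200 * IS)" by (rule mult_le_mono2)
  then show "IS * K <= bt" by (simp add: bt_def)
 qed simp
 finally show ?thesis .
qed

lemma range_large: "x <= k * K ==> int x < m ^ K"
proof -
 assume x: "x <= k * K"
 have "(2::int) ^ k <= m" using p_ge_3 by (intro power_mono) simp_all
 then have "((2::int) ^ k) ^ K <= m ^ K" by (rule power_mono) simp
 then have "(2::int) ^ (k * K) <= m ^ K" by (simp only: power_mult)
 moreover have "int (k * K) < 2 ^ (k * K)" by (rule of_nat_less_two_power)
 moreover have "int x <= int (k * K)" using x by (simp only: of_nat_le_iff)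
 ultimately show ?thesis by linarith
qed

lemma size_large: "int (400 * (n + 2) * (k + 1)) <= 2 ^ bt" "2 * P <= 2 ^ bt"
proof -
 have "400 * (n + 2) * (k + 1) <= 400 * (3 * IS) * (2 * IS)"
  using size_bounds(1,2) IS_pos by (intro mult_le_mono) simp_all
 also have "... = 2 * bt" by (simp add: bt_def)
 also have "2 * bt <= 2 ^ bt"
 proof -
  have "2 * (b::nat) <= 2 ^ b" if "b \<ge> 2" for b
   using that by (induction b rule: nat_induct_at_least) simp_all
  then show ?thesis using IS_le_bt(2) by simp
 qed
 finally have "int (400 * (n + 2) * (k + 1)) <= int (2 ^ bt)" by (simp only: of_nat_le_iff)
 then show "int (400 * (n + 2) * (k + 1)) <= 2 ^ bt" by (simp only: of_nat_power of_nat_numeral)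
 have "2 * P <= 2 ^ Suc IS" using bits_le[OF size_bounds(4)] by simp
 also have "... <= 2 ^ bt" using IS_le_bt(1) IS_pos by (intro power_increasing) simp_all
 finally show "2 * P <= 2 ^ bt" .
qed

lemma m_le_bt: "m <= 2 ^ bt"
 by (rule le_pow_bt[OF m_le])

lemma las_vegas_empty:
 assumes "!!w. w \<in> A ==> g w = No_Representation" "finite A" "A ~= {}"
 shows "las_vegas_uniform {} (map_spmf g (spmf_of_set A))"
proof -
 have "map_spmf g (spmf_of_set A) = map_spmf (%_. No_Representation) (spmf_of_set A)"
  using assms by (intro map_spmf_cong) simp_all
 also have "... = return_spmf No_Representation" using assms by (simp add: map_const_spmf_of_set)
 finally have e: "map_spmf g (spmf_of_set A) = return_spmf No_Representation" .
 have "cond_spmf (return_spmf No_Representation) (- {Failure}) = return_spmf No_Representation"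
  by (rule spmf_eqI) (simp add: measure_spmf_return_spmf measure_return indicator_def)
 then show ?thesis unfolding e las_vegas_uniform_def by simp
qed

lemma exec_sampler:
 "EX g L. exec m (sampler_c l prim) (start s0) = map_spmf g (spmf_of_set {0..<m ^ K}) & L \<ge> 1 & 2 ^ L <= 2 * p &
  (\<forall>w\<in>{0..<m ^ K}. time (g w) <= 2000000000 * volume n k L & bits (g w) <= 2000000000 * volume n k L * (200 * bt)) &
  las_vegas_uniform reps (map_spmf (%w. outcome n (g w)) (spmf_of_set {0..<m ^ K}))"
proof -
 note mb = m_gt_1(2) m_le_bt IS_le_bt(2)
 have c0: "s0 ''n'' 0 = int n" "s0 ''k'' 0 = int k" "s0 ''p'' 0 = int p" "s0 ''t'' 0 = t" "s0 ''lg'' 0 = 0" "s0 ''Z'' 0 = 0" "s0 ''Q'' = matrix_cells n Q"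
  by (simp_all add: sampler_input_def scalar_cells_def)
 have p0: "p > 0" using p_ge_3 by simp
 obtain L s' where A: "p < 2 ^ L & 2 ^ L <= 2 * p & exec_to m bt prepare_c (200 + 20 * L) (start s0) s' & s' ''lg'' 0 = int L & s' ''m'' 0 = m &
  s' ''nk'' 0 = int (n + k) & s' ''cl'' 0 = int ((n + 1) * k) & s' ''l1'' 0 = int (2 * n + 3) & s' ''T'' 0 = 200 &
  s' ''cnt'' 0 = int K & s' ''BIG'' 0 = 1 &
  (ALL a. a ~: {''BIG'', ''tmp'', ''lg'', ''m'', ''nk'', ''cl'', ''l1'', ''T'', ''cnt''} --> s' a = s0 a)"
  using exec_prepare[where s = s0 and n = n and k = k and p = p, OF mb cells_le c0(1-3,5) p0 size_large(2,1)] by (elim exE)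
 note A2 = A[THEN conjunct2] note A3 = A2[THEN conjunct2] note A4 = A3[THEN conjunct2] note A5 = A4[THEN conjunct2] note A6 = A5[THEN conjunct2]
 note A7 = A6[THEN conjunct2] note A8 = A7[THEN conjunct2] note A9 = A8[THEN conjunct2] note A10 = A9[THEN conjunct2] note A11 = A10[THEN conjunct2]
 note pL = A[THEN conjunct1] and L2 = A2[THEN conjunct1] and ex1 = A3[THEN conjunct1]
 note c1 = A4[THEN conjunct1] A5[THEN conjunct1] A6[THEN conjunct1] A7[THEN conjunct1] A8[THEN conjunct1] A9[THEN conjunct1] A10[THEN conjunct1] A11[THEN conjunct1]
 note fr1 = A11[THEN conjunct2, rule_format]
 have L1: "L \<ge> 1" using pL p_ge_3 by (cases L) simp_all
 obtain sg1 where s1: "exec m prepare_c (start s0) = return_spmf sg1" "mem sg1 = s'" "bounded bt s'"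
  "time sg1 <= time (start s0) + (200 + 20 * L)" "bits sg1 <= bits (start s0) + (200 + 20 * L) * (200 * bt)"
  using ex1 unfolding exec_to_def by (elim exE conjE)
 have Kb: "int K <= 2 ^ bt"
 proof -
  have "400 * (n + 2) * 1 <= 400 * (n + 2) * (k + 1)" by (intro mult_le_mono2) simp
  then show ?thesis using size_large(1) by linarith
 qed
 have Z1: "s' ''Z'' 0 = 0" using fr1[of "''Z''"] c0(6) by simp
 have "EX f. exec m draw_c sg1 = map_spmf f (spmf_of_set {0..<m ^ K}) & drawn m bt sg1 K f"
 proof (rule exec_draw[OF mb])
  show "bounded bt (mem sg1)" unfolding s1(2) by (rule s1(3))
  show "mem sg1 ''cnt'' 0 = int K" "mem sg1 ''m'' 0 = m" unfolding s1(2) by (rule c1)+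
  show "0 <= mem sg1 ''Z'' 0" "mem sg1 ''Z'' 0 < mem sg1 ''BIG'' 0" unfolding s1(2) Z1 c1 by simp_all
  show "mem sg1 ''BIG'' 0 * m ^ K <= 2 ^ bt" unfolding s1(2) c1 mult_1 by (rule range_le)
 qed (rule Kb)
 then obtain f where f: "exec m draw_c sg1 = map_spmf f (spmf_of_set {0..<m ^ K})" and fw: "drawn m bt sg1 K f" by (elim exE conjE)
 have fZ: "mem (f w) ''Z'' 0 = w" and fB: "mem (f w) ''BIG'' = (s' ''BIG'')(0 := m ^ K)" and fbd: "bounded bt (mem (f w))"
  and fo: "!!a. a ~: {''tmp'', ''Z'', ''BIG'', ''cnt''} ==> mem (f w) a = s' a"
  and ft: "time (f w) <= time sg1 + (3 + 40 * K)" "bits (f w) <= bits sg1 + (3 + 40 * K) * (200 * bt)" if w: "w \<in> {0..<m ^ K}" for w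
 proof -
  note R = fw[unfolded drawn_def, rule_format, OF w, unfolded s1(2) Z1 c1 mult_1 mult_zero_left add_0_left]
  show "mem (f w) ''Z'' 0 = w" by (rule R[THEN conjunct1])
  show "mem (f w) ''BIG'' = (s' ''BIG'')(0 := m ^ K)" by (rule R[THEN conjunct2, THEN conjunct1])
  show "bounded bt (mem (f w))" by (rule R[THEN conjunct2, THEN conjunct2, THEN conjunct1])
  show "!!a. a ~: {''tmp'', ''Z'', ''BIG'', ''cnt''} ==> mem (f w) a = s' a"
   using R[THEN conjunct2, THEN conjunct2, THEN conjunct2, THEN conjunct1] by (simp only: not_False_eq_True simp_thms)
  show "time (f w) <= time sg1 + (3 + 40 * K)" "bits (f w) <= bits sg1 + (3 + 40 * K) * (200 * bt)"
   using R[THEN conjunct2, THEN conjunct2, THEN conjunct2, THEN conjunct2] by (rule conjunct1, rule conjunct2)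
 qed
 have t0: "0 <= t" "t < m" using t by simp_all
 have kK: "k * K = 400 * (n * k) + 800 * k" by (simp add: algebra_simps)
 have nk: "n <= n * k" using k1 by simp
 have B5: "int n + int k + 5 < m ^ K" 
 proof -
  have "n + k + 5 <= k * K" unfolding kK using nk k1 by linarith
  from range_large[OF this] show ?thesis by (simp only: of_nat_add of_nat_numeral)
 qed
 have B3: "3 * int k + 5 < m ^ K" 
 proof -
  have "3 * k + 5 <= k * K" unfolding kK using k1 by linarith
  from range_large[OF this] show ?thesis by (simp only: of_nat_add of_nat_numeral of_nat_mult)
 qed
 have B1: "m < m ^ K" using m_gt_1 power_strict_increasing[of 1 K m] by simp
 have B4: "m ^ (2 * n + 4) < m ^ K" using m_gt_1 by (intro power_strict_increasing) simp_all
 have PL: "P < 2 ^ L" using pL by (metis of_nat_less_iff of_nat_numeral of_nat_power)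
 interpret M: machine p n k L "2 * n + 3" t "m ^ K" by unfold_locales (use k1 n1 PL t0 B1 B5 in simp_all)
 have base: "M.base (mem (f w))" if w: "w \<in> {0..<m ^ K}" for w
  unfolding M.base_def using c0 c1 by (simp add: fo[OF w] fr1 fB[OF w])
 let ?Q = "%i j. index_mat Q (i, j)"
 have Qf: "M.mt (mem (f w)) ''Q'' i j = ?Q i j" if w: "w \<in> {0..<m ^ K}" and ij: "i < n" "j < n" for w i j
 proof -
  have "i * n + j < (i + 1) * n" using ij by simp
  also have "... <= n * n" using ij by (intro mult_le_mono1) simp
  finally have "i * n + j < n * n" .
  then have "int (i * n + j) < int (n * n)" by (simp only: of_nat_less_iff)
  moreover have "(i * n + j) div n = i" "(i * n + j) mod n = j" using ij by auto
  ultimately have "matrix_cells n Q (int (i * n + j)) = ?Q i j" unfolding matrix_cells_def by (simp only: nat_int) simp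
  then show ?thesis using c0(7) fo[OF w, of "''Q''"] fr1[of "''Q''"] by (simp add: M.mt_def)
 qed
 have sym: "?Q i j = ?Q j i" if "i < n" "j < n" for i j
  using arg_cong[OF Q(2), of "%A. index_mat A (i, j)"] Q(1) that by simp
 let ?D = "powers_c ;; init_c ;; diag_c"
 define d where "d = (%w. run m ?D (mem (f w)))"
 have z0: "0 \<in> {0..<m ^ K}" using m_gt_1 by simp
 have pd: "M.pows (d w)" if "w \<in> {0..<m ^ K}" for w
  unfolding d_def by (rule M.run_diagonalize(1)[OF base[OF that] Qf[OF that] sym])
 \<comment> \<open>The form is extracted for the draw 0 alone, so that exponents, units and basis
   are fixed before the draw varies.\<close>
 have "EX ex. (ALL i<n. d 0 ''ex'' (int i) = int (ex i)) & diagonal_form n k ?Q (M.mt (d 0) ''U'') ex (%i. d 0 ''un'' (int i))"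
  unfolding d_def by (rule M.run_diagonalize(2)[OF base[OF z0] Qf[OF z0] sym])
 then obtain ex where ex: "ALL i<n. d 0 ''ex'' (int i) = int (ex i)" and df: "diagonal_form n k ?Q (M.mt (d 0) ''U'') ex (%i. d 0 ''un'' (int i))"
  by (elim exE conjE)
 define un where "un = (%i. d 0 ''un'' (int i))" define U where "U = M.mt (d 0) ''U''"
 have df': "diagonal_form n k ?Q U ex un" using df by (simp only: un_def U_def)
 note dd = df'[unfolded diagonal_form_def]
 interpret S: sampler p n k L "2 * n + 3" t "m ^ K" l prim ex un
  by unfold_locales (use k1 l PL t0 B4 B3 dd[THEN conjunct1] dd[THEN conjunct2, THEN conjunct1] in simp_all)
 \<comment> \<open>The diagonalization reads none of the cells in which the draws differ, so all of
   them reach the same diagonal form and share one bijection from solutions to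
   representations.\<close>
 have ag: "d w a = d 0 a" if w: "w \<in> {0..<m ^ K}" and a: "a ~: {''Z'', ''tmp'', ''cnt''}" for w a
 proof -
  have "agree {''Z'', ''tmp'', ''cnt''} (mem (f w)) (mem (f 0))"
   unfolding agree_def
  proof (intro allI impI)
   fix b assume "b ~: {''Z'', ''tmp'', ''cnt''}"
   then show "mem (f w) b = mem (f 0) b" using fo[OF w, of b] fo[OF z0, of b] fB[OF w] fB[OF z0] by (cases "b = ''BIG''") simp_all
  qed
  from agree_run[OF this main_vars] show ?thesis using a unfolding agree_def d_def by blast
 qed
 have rdy: "S.rdy (d w)" if w: "w \<in> {0..<m ^ K}" for w
  unfolding S.rdy_def using pd[OF w] ex by (simp add: ag[OF w] un_def)
 have dU: "M.mt (d w) ''U'' = U" if w: "w \<in> {0..<m ^ K}" for w unfolding U_def by (simp add: M.mt_def fun_eq_iff ag[OF w])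
 have dZ: "d w ''Z'' 0 = w" if w: "w \<in> {0..<m ^ K}" for w unfolding d_def using fZ[OF w] by (subst run_frame) simp_all
 define u where "u = (%w. run m (main_c l prim) (mem (f w)))"
 have ud: "u w = run m (sample_c l prim) (d w)" for w by (simp only: u_def d_def main_c_def run.simps(3))
 let ?M = "m ^ (2 * n + 3)"
 define F where "F = (%y. Matrix.vec n (%i. app n U y i mod m))"
 have res: "if S.sols = {} then u w ''status'' 0 = 2 else
   (case S.multi ?M 200 w of None => u w ''status'' 0 = 0 | Some y => u w ''status'' 0 = 1 & (ALL i<n. u w ''x'' (int i) = app n U y i mod m))"
  if w: "w \<in> {0..<m ^ K}" for w
  using S.run_sample[OF rdy[OF w]] unfolding ud dU[OF w] dZ[OF w] .
 define b where "b = nat (2 ^ bt)"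
 define T where "T = cost (limits b n k L) (main_c l prim)"
 have "\<forall>w\<in>{0..<m ^ K}. EX sg. exec m (compile (main_c l prim)) (f w) = return_spmf sg & mem sg = u w & time sg <= time (f w) + T & bits sg <= bits (f w) + T * (200 * bt)"
 proof
  fix w assume w: "w \<in> {0..<m ^ K}"
  have "exec_to m bt (compile (main_c l prim)) T (f w) (u w)"
   unfolding T_def u_def
  proof (rule exec_compile[OF mb wf_main[OF l] fbd[OF w]])
   fix N assume N: "N \<in> read_only"
   note bd = M.baseD[OF base[OF w]]
   have "\<bar>mem (f w) N 0\<bar> <= 2 ^ bt" using fbd[OF w] by (simp add: bounded_def)
   then have "nat (mem (f w) N 0) <= b" unfolding b_def by (intro nat_mono) simp
   moreover have "nat (mem (f w) ''n'' 0) = n" "nat (mem (f w) ''k'' 0) = k" "nat (mem (f w) ''lg'' 0) = L" "nat (mem (f w) ''nk'' 0) = n + k"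
    "nat (mem (f w) ''cl'' 0) = (n + 1) * k" "nat (mem (f w) ''l1'' 0) = 2 * n + 3" unfolding bd by (rule nat_int)+
   moreover have "nat (mem (f w) ''T'' 0) = 200" unfolding bd by simp
   ultimately show "nat (mem (f w) N 0) <= limits b n k L N"
    unfolding limits_def by (simp split: if_split)
  qed
  then show "EX sg. exec m (compile (main_c l prim)) (f w) = return_spmf sg & mem sg = u w & time sg <= time (f w) + T & bits sg <= bits (f w) + T * (200 * bt)"
   unfolding exec_to_def by (elim exE conjE) (intro exI conjI)
 qed
 from bchoice[OF this] obtain g where g: "\<forall>w\<in>{0..<m ^ K}. exec m (compile (main_c l prim)) (f w) = return_spmf (g w) & mem (g w) = u w &
   time (g w) <= time (f w) + T & bits (g w) <= bits (f w) + T * (200 * bt)" by (rule exE)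
 have fin: "finite {0..<m ^ K}" "{0..<m ^ K} ~= {}" using z0 by auto
 have E: "exec m (sampler_c l prim) (start s0) = map_spmf g (spmf_of_set {0..<m ^ K})"
 proof -
  have "exec m (sampler_c l prim) (start s0) = bind_spmf (spmf_of_set {0..<m ^ K}) (%w. exec m (compile (main_c l prim)) (f w))"
   by (simp add: sampler_c_def s1(1) f map_spmf_conv_bind_spmf)
  also have "... = bind_spmf (spmf_of_set {0..<m ^ K}) (%w. return_spmf (g w))"
   using g fin by (intro bind_spmf_cong refl) simp
  finally show ?thesis by (simp add: map_spmf_conv_bind_spmf)
 qed
 have tot: "200 + 20 * L + (3 + 40 * K) + T <= 2000000000 * volume n k L"
  using cost_main_le[OF n1 k1 L1, of b l prim] monomials_le(1,2,4)[OF n1 k1 L1] unfolding T_def by simp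
 have bounds: "time (g w) <= 2000000000 * volume n k L" "bits (g w) <= 2000000000 * volume n k L * (200 * bt)" if w: "w \<in> {0..<m ^ K}" for w
 proof -
  have gw: "time (g w) <= time (f w) + T" "bits (g w) <= bits (f w) + T * (200 * bt)" using g w by blast+
  show "time (g w) <= 2000000000 * volume n k L" using gw(1) ft(1)[OF w] s1(4) tot by (simp add: start_def)
  have "bits (g w) <= (200 + 20 * L + (3 + 40 * K) + T) * (200 * bt)"
   using gw(2) ft(2)[OF w] s1(5) by (simp add: start_def algebra_simps)
  also have "... <= 2000000000 * volume n k L * (200 * bt)" by (rule mult_le_mono1[OF tot])
  finally show "bits (g w) <= 2000000000 * volume n k L * (200 * bt)" .
 qed
 have bij: "bij_betw F S.sols reps" unfolding F_def by (rule S.bij_solutions[OF df' Q(1)])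
 have gm: "mem (g w) = u w" if "w \<in> {0..<m ^ K}" for w using g that by blast
 have "las_vegas_uniform reps (map_spmf (%w. outcome n (g w)) (spmf_of_set {0..<m ^ K}))"
 proof (cases "S.sols = {}")
  case True
  then have R: "reps = {}" using bij by (simp add: bij_betw_def)
  have "outcome n (g w) = No_Representation" if "w \<in> {0..<m ^ K}" for w
   using res[OF that] True gm[OF that] by (simp add: outcome_def)
  then show ?thesis unfolding R by (rule las_vegas_empty[OF _ fin])
 next
  case False
  have G: "S.tot ((n + 1) * k) > 0" using S.tot_pos_iff False by blast
  have MG: "?M \<ge> S.tot ((n + 1) * k)" by (rule S.tot_le)
  have pw: "(m * ?M) ^ 200 = m ^ K"
  proof -
   have "(m * ?M) ^ 200 = m ^ (Suc (2 * n + 3) * 200)" by (simp only: power_Suc power_mult)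
   then show ?thesis by (simp add: algebra_simps)
  qed
  have o: "outcome n (g w) = (case S.multi ?M 200 w of None => Failure | Some y => Representation (F y))" if w: "w \<in> {0..<m ^ K}" for w
  proof (cases "S.multi ?M 200 w")
   case None
   then show ?thesis using res[OF w] False gm[OF w] by (simp add: outcome_def)
  next
   case (Some y)
   then have "u w ''status'' 0 = 1" "ALL i<n. u w ''x'' (int i) = app n U y i mod m" using res[OF w] False by simp_all
   moreover from this have "Matrix.vec n (%i. u w ''x'' (int i)) = F y" unfolding F_def by (intro eq_vecI) simp_all
   ultimately show ?thesis using Some gm[OF w] by (simp add: outcome_def)
  qed
  have sound: "y \<in> S.sols" if "w \<in> {0..<m ^ K}" "S.multi ?M 200 w = Some y" for w y
   using S.multi_sound[OF G MG that(2)] that(1) by simp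
  have finR: "finite reps"
  proof -
   have "inj_on (%y. restrict y {..<n}) S.vecs"
   proof (rule inj_onI)
    fix y y' assume y: "y \<in> S.vecs" "y' \<in> S.vecs" and e: "restrict y {..<n} = restrict y' {..<n}"
    show "y = y'"
    proof
     fix i show "y i = y' i"
      using y fun_cong[OF e, of i] by (cases "i < n") (auto simp: S.vecs_def restrict_def)
    qed
   qed
   moreover have "(%y. restrict y {..<n}) ` S.vecs \<subseteq> (\<Pi>\<^sub>E i\<in>{..<n}. {0..<m})" by (rule image_subsetI) (simp add: S.vecs_def restrict_PiE_iff)
   moreover have "finite (\<Pi>\<^sub>E i\<in>{..<n}. {0..<m})" by (intro finite_PiE) simp_all
   ultimately have "finite S.vecs" by (rule inj_on_finite)
   then have "finite S.sols" by (rule rev_finite_subset) (auto simp: S.sols_def)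
   then show ?thesis using bij bij_betw_finite by blast
  qed
  obtain C where C: "\<forall>y\<in>S.sols. card {Z \<in> {0..<(m * ?M) ^ 200}. S.multi ?M 200 Z = Some y} = C" using S.card_multi_sol[OF G MG, of 200] by (rule exE)
  show ?thesis
  proof (rule las_vegas_of_counts[OF fin finR])
   show "reps ~= {}" using bij False by (auto simp: bij_betw_def)
   fix w assume w: "w \<in> {0..<m ^ K}"
   show "outcome n (g w) = Failure | (\<exists>x\<in>reps. outcome n (g w) = Representation x)"
   proof (cases "S.multi ?M 200 w")
    case (Some y)
    then show ?thesis using o[OF w] bij_betw_apply[OF bij sound[OF w Some]] by auto
   qed (use o[OF w] in simp)
  next
   fix x assume "x \<in> reps"
   then obtain y where y: "y \<in> S.sols" "x = F y" using bij unfolding bij_betw_def by blast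
   have "{w \<in> {0..<m ^ K}. outcome n (g w) = Representation x} = {w \<in> {0..<m ^ K}. S.multi ?M 200 w = Some y}"
   proof (intro Collect_cong conj_cong refl)
    fix w assume w: "w \<in> {0..<m ^ K}"
    show "outcome n (g w) = Representation x \<longleftrightarrow> S.multi ?M 200 w = Some y"
    proof (cases "S.multi ?M 200 w")
     case (Some y')
     then show ?thesis using o[OF w] y sound[OF w Some] bij_betw_imp_inj_on[OF bij] by (auto simp: inj_on_def)
    qed (use o[OF w] in simp)
   qed
   then show "card {w \<in> {0..<m ^ K}. outcome n (g w) = Representation x} = C" using C y(1) unfolding pw by simp
  next
   have "{w \<in> {0..<m ^ K}. outcome n (g w) = Failure} = {w \<in> {0..<m ^ K}. S.multi ?M 200 w = None}"
    by (intro Collect_cong conj_cong refl) (simp add: o split: option.splits)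
   then show "3 * card {w \<in> {0..<m ^ K}. outcome n (g w) = Failure} <= card {0..<m ^ K}"
    using S.card_multi_fail_200[OF G MG] unfolding pw by simp
  qed
 qed
 then show ?thesis using E L1 L2 bounds by (intro exI[of _ g] exI[of _ L] conjI ballI)
qed

text \<open>\<omega> at least 2 absorbs n^3 into n^(1 + \<omega>), and log (k + 1) is at least 1.
  The factor 2 comes from L <= 1 + log p <= 2 log p.\<close>

lemma volume_le_ring_op_bound:
 assumes "\<omega> \<ge> 2" "L \<ge> 1" "2 ^ L <= 2 * p"
 shows "real (volume n k L) <= 2 * ring_op_bound \<omega> n p k"
proof -
 have "log 2 (real k + 1) \<ge> log 2 2" using k1 by (subst log_le_cancel_iff) simp_all
 then have lk: "log 2 (real k + 1) \<ge> 1" by simp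
 have "real n ^ 3 = real n powr 3" using n1 by (simp add: powr_numeral)
 also have "... <= real n powr (1 + \<omega>)" using assms(1) n1 by (intro powr_mono) simp_all
 finally have n3: "real n ^ 3 <= real n powr (1 + \<omega>)" .
 have "real n powr (1 + \<omega>) * 1 <= real n powr (1 + \<omega>) * log 2 (real k + 1)" using lk by (intro mult_left_mono) simp_all
 then have a: "real n ^ 3 <= real n powr (1 + \<omega>) * log 2 (real k + 1)" using n3 by linarith
 have "real (2 ^ L) <= real (2 * p)" using assms(3) by (simp only: of_nat_le_iff)
 then have "2 powr real L <= 2 * real p" by (simp add: powr_realpow)
 then have "real L <= log 2 (2 * real p)" using p_ge_3 by (simp add: le_log_iff)
 also have "... = 1 + log 2 (real p)" using p_ge_3 by (simp add: log_mult)
 also have "1 <= log 2 (real p)" using p_ge_3 by (simp add: le_log_iff)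
 finally have "real L <= 2 * log 2 (real p)" by simp
 then have "real n * real L <= real n * (2 * log 2 (real p))" by (intro mult_left_mono) simp_all
 then have b: "real n * real L <= 2 * (real n * log 2 (real p))" by (simp only: mult.left_commute)
 have "0 <= real n * real k ^ 3" "0 <= real n ^ 3" by simp_all
 moreover have "real (volume n k L) = real n ^ 3 + real n * real k ^ 3 + real n * real L" by (simp add: volume_def)
 moreover have "v <= 2 * (x + y + z)" if "v = a + y + c" "a <= x" "c <= 2 * z" "0 <= y" "0 <= a" for v x y z a c :: real
 proof -
  have "a + y + c <= 2 * x + 2 * y + 2 * z" by (intro add_mono) (use that(2-5) in linarith)+
  then show ?thesis unfolding that(1) by (simp only: distrib_left)
 qed
 ultimately show ?thesis using a b unfolding ring_op_bound_def by blast
qed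

lemma volume_le_input_size:
 assumes "2 ^ L <= 2 * p"
 shows "volume n k L <= 3 * IS ^ 4"
proof -
 have "2 ^ L <= 2 * p" by (rule assms)
 have "int (2 ^ L) <= 2 * P" using assms by linarith
 also have "2 * P < 2 * 2 ^ bit_size P" using abs_less_bit_size[of P] by simp
 finally have "(2::int) ^ L < 2 ^ Suc (bit_size P)" by simp
 then have "L < Suc (bit_size P)" by (rule power_less_imp_less_exp[rotated]) simp
 then have L: "L <= IS" using size_bounds(4) by simp
 have i: "IS ^ i <= IS ^ 4" if "i <= 4" for i using that IS_pos by (intro power_increasing)
 have "n ^ 3 <= IS ^ 3" using size_bounds(1) by (intro power_mono) simp_all
 then have 1: "n ^ 3 <= IS ^ 4" using i[of 3] by linarith
 have "k ^ 3 <= IS ^ 3" using size_bounds(2) by (intro power_mono) simp_all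
 then have "n * k ^ 3 <= IS * IS ^ 3" using size_bounds(1) by (intro mult_le_mono)
 then have 2: "n * k ^ 3 <= IS ^ 4" by (simp add: numeral_eq_Suc)
 have "n * L <= IS * IS" using size_bounds(1) L by (intro mult_le_mono)
 then have 3: "n * L <= IS ^ 4" using i[of 2] by (simp add: power2_eq_square)
 show ?thesis unfolding volume_def using 1 2 3 by linarith
qed

end

lemma sampling_algorithm_sampler:
 assumes \<omega>: "\<omega> \<ge> 2" and l: "l <= 1"
  and reps: "!!n Q p k t. reps n Q p k t = {x \<in> representations n Q p k t. mode l prim p x}"
 shows "sampling_algorithm \<omega> reps (sampler_c l prim)"
 unfolding sampling_algorithm_def
\<comment> \<open>The time constant 2 * 10^9 is doubled by \<open>volume_le_ring_op_bound\<close>.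
  For the bits, 2 * 10^9 * 3 * 200 * 1200 = 1440000000000000, and degree 6 combines
  \<open>IS ^ 4\<close> from the time with \<open>IS * IS\<close> from \<open>bt\<close>.\<close>
proof (rule exI[of _ "4000000000 :: real"], rule exI[of _ "Polynomial.monom 1440000000000000 6"], intro allI impI)
 fix n :: nat and Q :: "int mat" and p k :: nat and t :: int
 assume a: "n \<ge> 1" "Q \<in> carrier_mat n n" "transpose_mat Q = Q" "prime p" "odd p" "k \<ge> 1" "t \<in> {0..<int p ^ k}"
 interpret problem p n k l Q t prim by unfold_locales (use a l in simp_all)
 obtain g L where g: "exec m (sampler_c l prim) (start s0) = map_spmf g (spmf_of_set {0..<m ^ K})" and L: "L \<ge> 1" "2 ^ L <= 2 * p"
  and b: "\<forall>w\<in>{0..<m ^ K}. time (g w) <= 2000000000 * volume n k L & bits (g w) <= 2000000000 * volume n k L * (200 * bt)"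
  and v: "las_vegas_uniform {x \<in> representations n Q p k t. mode l prim p x} (map_spmf (%w. outcome n (g w)) (spmf_of_set {0..<m ^ K}))"
  using exec_sampler by (elim exE conjE)
 have "real (time sg) <= 4000000000 * ring_op_bound \<omega> n p k & bits sg <= Polynomial.poly (Polynomial.monom 1440000000000000 6) IS"
  if st: "sg \<in> set_spmf (map_spmf g (spmf_of_set {0..<m ^ K}))" for sg
 proof -
  have "set_spmf (map_spmf g (spmf_of_set {0..<m ^ K})) = g ` {0..<m ^ K}" by (simp only: set_map_spmf set_spmf_of_set finite_atLeastLessThan_int if_True)
  then obtain w where w: "w \<in> {0..<m ^ K}" "sg = g w" using st by blast
  have t: "time sg <= 2000000000 * volume n k L" "bits sg <= 2000000000 * volume n k L * (200 * bt)" using b w by blast+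
  have "real (time sg) <= 2000000000 * real (volume n k L)" using t(1) by linarith
  then have 1: "real (time sg) <= 4000000000 * ring_op_bound \<omega> n p k" using volume_le_ring_op_bound[OF \<omega> L] by linarith
  have "2000000000 * volume n k L * (200 * bt) <= 2000000000 * (3 * IS ^ 4) * (200 * bt)"
   using volume_le_input_size[OF L(2)] by (intro mult_le_mono1 mult_le_mono2)
  also have "... = 1440000000000000 * (IS ^ 4 * (IS * IS))" by (simp add: bt_def)
  also have "IS ^ 4 * (IS * IS) = IS ^ (4 + 2)" by (simp only: power_add power2_eq_square)
  finally have "bits sg <= 1440000000000000 * IS ^ (4 + 2)" using t(2) by (rule le_trans[rotated])
  then show ?thesis using 1 by (simp add: poly_monom)
 qed
 then show "let D = exec (int p ^ k) (sampler_c l prim) (start (sampler_input n Q p k t)) in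
  (\<forall>sg\<in>set_spmf D. real (time sg) <= 4000000000 * ring_op_bound \<omega> n p k & bits sg <= Polynomial.poly (Polynomial.monom 1440000000000000 6) (input_size n Q p k t)) &
  las_vegas_uniform (reps n Q p k t) (map_spmf (outcome n) D)"
  unfolding Let_def g reps using v by (simp add: spmf.map_comp o_def)
qed

theorem theorem3:
  fixes \<omega> :: real
  assumes "matmul_exponent \<omega>"
  shows "(\<exists>c. sampling_algorithm \<omega> representations c) \<and>
         (\<exists>c. sampling_algorithm \<omega> primitive_representations c) \<and>
         (\<exists>c. sampling_algorithm \<omega> nonprimitive_representations c)"
proof -
 have \<omega>: "\<omega> \<ge> 2" by (rule matmul_exponent_ge_2[OF assms])
 have "sampling_algorithm \<omega> representations (sampler_c 0 False)"
  by (rule sampling_algorithm_sampler[OF \<omega>]) (simp_all add: mode_def)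
 moreover have "sampling_algorithm \<omega> primitive_representations (sampler_c 0 True)"
  by (rule sampling_algorithm_sampler[OF \<omega>]) (simp_all add: mode_def primitive_representations_def)
 moreover have "sampling_algorithm \<omega> nonprimitive_representations (sampler_c 1 False)"
  by (rule sampling_algorithm_sampler[OF \<omega>]) (simp_all add: mode_def nonprimitive_representations_def)
 ultimately show ?thesis by blast
qed

end
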